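(* Let $(H_N)_{N\in\mathbb{N}}$ be the Hamiltonians of a Gaussian spin glass, and for each $N$ let $Q^{\beta,N}=\{r(\sigma^i,\sigma^j)\}_{i,j\in\mathbb{N}}$ where $(\sigma^i)_{i\in\mathbb{N}}$ are sampled i.i.d. from the Gibbs measure $\mathcal{G}_{\beta,N}$. If $\lim_{N\to\infty}\frac1N E\log Z_N(\beta)$ exists and is differentiable (as a function of the inverse temperature) at $\beta>0$, then every limit point in the space of ROSt's of the sequence $(Q^{\beta,N})_N$ is stochastically stable, i.e. for every $\lambda>0$ its law is invariant under the cavity mapping $\Phi_{\lambda,l}$.
   Context: Gaussian spin glass: for each $N\in\mathbb{N}$, $H_N=(H_N(\sigma),\sigma\in\{-1,+1\}^N)$ is a centered Gaussian vector with covariance $E[H_N(\sigma)H_N(\sigma')]=N r(\sigma,\sigma')$, where $r=r_N$ is a positive definite (in the kernel sense, i.e. positive semidefinite) symmetric form on $\{-1,+1\}^N$ with $r(\sigma,\sigma)=1$; $Z_N(\beta)=\sum_\sigma e^{\beta H_N(\sigma)}$ and $\mathcal{G}_{\beta,N}(\sigma)=e^{\beta H_N(\sigma)}/Z_N(\beta)$. The randomness of $Q^{\beta,N}$ comes from both $H_N$ and the sampling. A Random Overlap Structure (ROSt) is a random symmetric positive semidefinite $\mathbb{N}\times\mathbb{N}$ matrix $Q=\{q_{ij}\}$ with $1$'s on the diagonal which is weakly exchangeable: $\tau Q\tau^{-1}$ has the same law as $Q$ for every permutation matrix $\tau$ that fixes all but finitely many elements. The space of ROSt's is the set of laws $\mathbb{P}$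 of ROSt's with the weak-$*$ topology (as Borel probability measures on the compact set of such matrices in $[-1,1]^{\mathbb{N}\times\mathbb{N}}$ with the product topology); it is compact. $\mathcal{H}$ is a fixed infinite-dimensional separable real Hilbert space with inner product $\cdot$ and norm $\|\cdot\|$, $\mathcal{B}$ is its closed unit ball, and $\mathcal{M}(\mathcal{B})$ is the set of Borel probability measures on $\mathcal{B}$. By the Dovbysh–Sudakov theorem, for every ROSt $Q$ there is a random element $\mu$ of $\mathcal{M}(\mathcal{B})$, called a sampling measure of $Q$, such that conditionally on $\mu$, $(q_{ij})_{i\neq j}$ has the law of $(v^i\cdot v^j)_{i\ne j}$ with $v^1,v^2,\dots$ i.i.d. of law $\mu$; conversely every random element of $\mathcal{M}(\mathcal{B})$ is a sampling measure of the ROSt so constructed (diagonal entries set to $1$). Cavity field: let $(l_i)_{i\in\mathbb{N}}$ be i.i.d. standard Gaussians independent of $\mathbb{P}$, with law $P_l$, let $(e_i)$ be a fixed orthonormal basis of $\mathcal{H}$, and $l(v)=\sum_i l_i\,(v\cdot e_i)$, so that $E_l[l(v)l(v')]=v\cdot v'$. The cavity mapping $\Phi_{\lambda,l}$ sends $\mathbb{P}$ to the law (under $\mathbb{P}\times P_l$) of the ROSt with sampling measure $$\Phi_{\lambda,l}\mu(dv)=\frac{e^{\lambda l(v)-\frac{\lambda^2}{2}\|v\|^2}\mu(dv)}{\int_{\mathcal{B}} e^{\lambda l(w)-\frac{\lambda^2}{2}\|w\|^2}\mu(dw)};$$ the image law does not depend on the choice of $\mu$. $\mathbb{P}$ is invariant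 if it equals its image. *)

theory Defs
  imports "HOL-Probability.Probability"
begin

section \<open>The space of random overlap structures\<close>

definition rost_matrices :: "(nat \<Rightarrow> nat \<Rightarrow> real) set" where
  "rost_matrices = {q. (\<forall>i j. q i j = q j i) \<and> (\<forall>i. q i i = 1) \<and>
     (\<forall>n (x :: nat \<Rightarrow> real). 0 \<le> (\<Sum>i<n. \<Sum>j<n. x i * x j * q i j))}"

text \<open>The topology on \<^typ>\<open>nat \<Rightarrow> nat \<Rightarrow> real\<close> is the product topology; the entries of a matrix in
  \<^const>\<open>rost_matrices\<close> lie in $[-1,1]$ by positive semidefiniteness.\<close>

definition rost_algebra :: "(nat \<Rightarrow> nat \<Rightarrow> real) measure" where
  "rost_algebra = restrict_space borel rost_matrices"

definition rost_laws :: "(nat \<Rightarrow> nat \<Rightarrow> real) measure set" where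
  "rost_laws = {P \<in> space (prob_algebra rost_algebra).
     \<forall>\<tau>. bij \<tau> \<and> finite {i. \<tau> i \<noteq> i} \<longrightarrow> distr P rost_algebra (\<lambda>q i j. q (\<tau> i) (\<tau> j)) = P}"

text \<open>The weak-* topology: the coarsest topology on \<^const>\<open>rost_laws\<close> that makes
  $P \mapsto \int f\,dP$ continuous for every continuous $f$ on the compact set
  \<^const>\<open>rost_matrices\<close>.\<close>

definition rost_topology :: "(nat \<Rightarrow> nat \<Rightarrow> real) measure topology" where
  "rost_topology =
     pullback_topology rost_laws
       (\<lambda>P. \<lambda>f\<in>{f. continuous_on rost_matrices f}. \<integral>q. f q \<partial>P)
       (product_topology (\<lambda>_. euclideanreal) {f. continuous_on rost_matrices f})"

definition rost_limit_point ::
  "(nat \<Rightarrow> (nat \<Rightarrow> nat \<Rightarrow> real) measure) \<Rightarrow> (nat \<Rightarrow> nat \<Rightarrow> real) measure \<Rightarrow> bool" where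
  "rost_limit_point Q P \<longleftrightarrow>
     (\<exists>s. strict_mono s \<and> limitin rost_topology (Q \<circ> s) P sequentially)"

section \<open>Sampling measures\<close>

text \<open>\<^term>\<open>prob_algebra unit_ball_algebra\<close> is the space of Borel probability measures on the closed
  unit ball. The random elements of it are represented by their laws \<^term>\<open>D\<close>.\<close>

definition unit_ball_algebra :: "'h :: {real_inner, polish_space} measure" where
  "unit_ball_algebra = restrict_space borel (cball 0 1)"

definition random_measure_laws :: "'h :: {real_inner, polish_space} measure measure set" where
  "random_measure_laws = space (prob_algebra (prob_algebra unit_ball_algebra))"

definition overlap_law ::
  "'h :: {real_inner, polish_space} measure \<Rightarrow> (nat \<Rightarrow> nat \<Rightarrow> real) measure" where
  "overlap_law m =
     distr (\<Pi>\<^sub>M i\<in>UNIV. m) rost_algebra (\<lambda>v i j. if i = j then 1 else v i \<bullet> v j)"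

definition sampled_rost_law ::
  "'h :: {real_inner, polish_space} measure measure \<Rightarrow> (nat \<Rightarrow> nat \<Rightarrow> real) measure" where
  "sampled_rost_law D = D \<bind> overlap_law"

definition is_sampling_law ::
  "'h :: {real_inner, polish_space} measure measure \<Rightarrow> (nat \<Rightarrow> nat \<Rightarrow> real) measure \<Rightarrow> bool" where
  "is_sampling_law D P \<longleftrightarrow> D \<in> random_measure_laws \<and> sampled_rost_law D = P"

section \<open>The cavity mapping\<close>

text \<open>The basis is indexed by the natural numbers, so a space that has one is
  infinite-dimensional.\<close>

definition orthonormal_basis :: "(nat \<Rightarrow> 'h :: {real_inner, polish_space}) \<Rightarrow> bool" where
  "orthonormal_basis e \<longleftrightarrow>
     (\<forall>i j. e i \<bullet> e j = (if i = j then 1 else 0)) \<and> closure (span (range e)) = UNIV"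

definition gaussian_sequence :: "(nat \<Rightarrow> real) measure" where
  "gaussian_sequence = (\<Pi>\<^sub>M i\<in>UNIV. std_normal_distribution)"

text \<open>For each \<^term>\<open>v\<close> the series converges for almost every \<^term>\<open>l\<close>.\<close>

definition cavity_field ::
  "(nat \<Rightarrow> 'h :: {real_inner, polish_space}) \<Rightarrow> (nat \<Rightarrow> real) \<Rightarrow> 'h \<Rightarrow> real" where
  "cavity_field e l v = (\<Sum>i. l i * (v \<bullet> e i))"

definition cavity_weight ::
  "real \<Rightarrow> (nat \<Rightarrow> 'h :: {real_inner, polish_space}) \<Rightarrow> (nat \<Rightarrow> real) \<Rightarrow> 'h \<Rightarrow> real" where
  "cavity_weight lam e l v = exp (lam * cavity_field e l v - lam\<^sup>2 / 2 * (norm v)\<^sup>2)"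

text \<open>The normalization is positive, and it is finite for almost every \<^term>\<open>l\<close> because its mean over
  \<^term>\<open>l\<close> is 1. The value on the exceptional null set is chosen so that the map always takes
  probability measures to probability measures.\<close>

definition cavity_measure ::
  "real \<Rightarrow> (nat \<Rightarrow> 'h :: {real_inner, polish_space}) \<Rightarrow> (nat \<Rightarrow> real) \<Rightarrow> 'h measure \<Rightarrow> 'h measure"
  where
  "cavity_measure lam e l m =
     (let Z = \<integral>\<^sup>+ w. ennreal (cavity_weight lam e l w) \<partial>m
      in if Z < \<infinity> then density m (\<lambda>v. ennreal (cavity_weight lam e l v) / Z) else m)"

definition cavity_sampling_law ::
  "real \<Rightarrow> (nat \<Rightarrow> 'h :: {real_inner, polish_space}) \<Rightarrow> 'h measure measure \<Rightarrow> 'h measure measure"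
  where
  "cavity_sampling_law lam e D =
     distr (D \<Otimes>\<^sub>M gaussian_sequence) (prob_algebra unit_ball_algebra)
       (\<lambda>(m, l). cavity_measure lam e l m)"

text \<open>Every ROSt law has a sampling measure by the Dovbysh--Sudakov theorem, and the image does not
  depend on which one is chosen.\<close>

definition cavity_map ::
  "real \<Rightarrow> (nat \<Rightarrow> 'h :: {real_inner, polish_space}) \<Rightarrow>
   (nat \<Rightarrow> nat \<Rightarrow> real) measure \<Rightarrow> (nat \<Rightarrow> nat \<Rightarrow> real) measure" where
  "cavity_map lam e P =
     sampled_rost_law (cavity_sampling_law lam e (SOME D. is_sampling_law D P))"

definition stochastically_stable ::
  "(nat \<Rightarrow> 'h :: {real_inner, polish_space}) \<Rightarrow> (nat \<Rightarrow> nat \<Rightarrow> real) measure \<Rightarrow> bool" where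
  "stochastically_stable e P \<longleftrightarrow> (\<forall>lam>0. cavity_map lam e P = P)"

section \<open>Gaussian spin glasses\<close>

definition spin_configs :: "nat \<Rightarrow> (nat \<Rightarrow> int) set" where
  "spin_configs N = (\<Pi>\<^sub>E i\<in>{..<N}. {-1, 1})"

text \<open>Degenerate linear combinations, with variance 0, are allowed.\<close>

definition centered_gaussian_vector ::
  "'w measure \<Rightarrow> 'i set \<Rightarrow> ('i \<Rightarrow> 'w \<Rightarrow> real) \<Rightarrow> bool" where
  "centered_gaussian_vector M I X \<longleftrightarrow>
     (\<forall>i\<in>I. X i \<in> borel_measurable M) \<and>
     (\<forall>a. \<exists>s\<ge>0. distr M borel (\<lambda>\<omega>. \<Sum>i\<in>I. a i * X i \<omega>) =
        (if s = 0 then return borel 0 else density lborel (normal_density 0 s)))"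

definition gaussian_spin_glass ::
  "(nat \<Rightarrow> 'w measure) \<Rightarrow> (nat \<Rightarrow> (nat \<Rightarrow> int) \<Rightarrow> (nat \<Rightarrow> int) \<Rightarrow> real) \<Rightarrow>
   (nat \<Rightarrow> (nat \<Rightarrow> int) \<Rightarrow> 'w \<Rightarrow> real) \<Rightarrow> bool" where
  "gaussian_spin_glass M r H \<longleftrightarrow> (\<forall>N\<ge>1.
     prob_space (M N) \<and>
     (\<forall>\<sigma>\<in>spin_configs N. \<forall>\<sigma>'\<in>spin_configs N. r N \<sigma> \<sigma>' = r N \<sigma>' \<sigma>) \<and>
     (\<forall>x :: (nat \<Rightarrow> int) \<Rightarrow> real.
        0 \<le> (\<Sum>\<sigma>\<in>spin_configs N. \<Sum>\<sigma>'\<in>spin_configs N. x \<sigma> * x \<sigma>' * r N \<sigma> \<sigma>')) \<and>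
     (\<forall>\<sigma>\<in>spin_configs N. r N \<sigma> \<sigma> = 1) \<and>
     centered_gaussian_vector (M N) (spin_configs N) (H N) \<and>
     (\<forall>\<sigma>\<in>spin_configs N. \<forall>\<sigma>'\<in>spin_configs N.
        (\<integral>\<omega>. H N \<sigma> \<omega> * H N \<sigma>' \<omega> \<partial>M N) = real N * r N \<sigma> \<sigma>'))"

definition partition_function ::
  "(nat \<Rightarrow> (nat \<Rightarrow> int) \<Rightarrow> 'w \<Rightarrow> real) \<Rightarrow> nat \<Rightarrow> real \<Rightarrow> 'w \<Rightarrow> real" where
  "partition_function H N \<beta> \<omega> = (\<Sum>\<sigma>\<in>spin_configs N. exp (\<beta> * H N \<sigma> \<omega>))"

definition free_energy ::
  "(nat \<Rightarrow> 'w measure) \<Rightarrow> (nat \<Rightarrow> (nat \<Rightarrow> int) \<Rightarrow> 'w \<Rightarrow> real) \<Rightarrow> nat \<Rightarrow> real \<Rightarrow> real" where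
  "free_energy M H N \<beta> = 1 / real N * (\<integral>\<omega>. ln (partition_function H N \<beta> \<omega>) \<partial>M N)"

definition gibbs_measure ::
  "(nat \<Rightarrow> (nat \<Rightarrow> int) \<Rightarrow> 'w \<Rightarrow> real) \<Rightarrow> nat \<Rightarrow> real \<Rightarrow> 'w \<Rightarrow> (nat \<Rightarrow> int) measure" where
  "gibbs_measure H N \<beta> \<omega> =
     point_measure (spin_configs N)
       (\<lambda>\<sigma>. ennreal (exp (\<beta> * H N \<sigma> \<omega>) / partition_function H N \<beta> \<omega>))"

definition spin_glass_rost_law ::
  "(nat \<Rightarrow> 'w measure) \<Rightarrow> (nat \<Rightarrow> (nat \<Rightarrow> int) \<Rightarrow> (nat \<Rightarrow> int) \<Rightarrow> real) \<Rightarrow>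
   (nat \<Rightarrow> (nat \<Rightarrow> int) \<Rightarrow> 'w \<Rightarrow> real) \<Rightarrow> real \<Rightarrow> nat \<Rightarrow> (nat \<Rightarrow> nat \<Rightarrow> real) measure" where
  "spin_glass_rost_law M r H \<beta> N =
     M N \<bind> (\<lambda>\<omega>. distr (\<Pi>\<^sub>M i\<in>UNIV. gibbs_measure H N \<beta> \<omega>) rost_algebra
                      (\<lambda>\<sigma> i j. r N (\<sigma> i) (\<sigma> j)))"

end

theory Submission imports Defs begin

text \<open>The cavity mapping of intensity \<open>lam\<close> acts on a Gibbs measure as the addition of an independent
  copy of the Hamiltonian scaled by \<open>lam / sqrt N\<close>. In law this is the change of the inverse temperature
  from \<open>\<beta>\<close> to \<open>sqrt (\<beta>\<^sup>2 + lam\<^sup>2 / N)\<close>, a shift of order \<open>1 / N\<close>. By Pinsker's inequality the mean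
  squared total variation distance of the two Gibbs measures is at most the shift times the increment of
  \<open>N\<close> times the derivative of the free energy; that derivative is monotone, and as the limit is
  differentiable at \<open>\<beta>\<close>, its increment over the shift tends to zero. Hence the cavity mapping
  asymptotically leaves the overlap laws of the spin glass unchanged.

  To pass to the limit, the mapping has to be continuous. The weight \<open>exp (lam x - lam\<^sup>2 / 2)\<close> is
  approximated in Gaussian mean by a nonnegative trigonometric polynomial, and the normalization by a
  polynomial in it; Gaussian averages of products of these are continuous functions of finitely many
  overlaps. The approximation error is uniform over all random measures, so only the overlaps matter,
  both on the ball and for the spin glass. The existence of a sampling measure of the limit
  (Dovbysh--Sudakov) comes from de Finetti's theorem applied to the projections of the even-indexed
  vectors onto the span of the odd-indexed ones.\<close>

section \<open>Laws on overlap matrices\<close>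

text \<open>The cavity mapping on the limit is defined through sampling measures on a Hilbert ball,
  which have no relation to the spin configurations; only the overlaps are common to both. Hence
  everything is phrased for an abstract field, \<open>cavity_model\<close>, with three instances:
  the cavity field on the ball, \<open>H / sqrt N\<close> on the configurations, and a combination
  of two independent copies of \<open>H\<close>. In each, the tilted averages are close to the same
  function \<open>cavity_test\<close> of the overlaps, with an error made of one-dimensional
  Gaussian integrals. The obstacle is the random normalization, which is not bounded away from zero:
  it is truncated at \<delta>, at a cost controlled by the mean of the inverse weight. The change of
  temperature is obtained in the same way, as two instances have the same
  \<open>cavity_test\<close>. Finally, only pointwise convergence of the free energies is given:
  monotonicity allows the shift of order \<open>1 / N\<close> to be enlarged to a fixed step
  \<open>t\<close>, over which increments of the derivative are bounded by finite differences of the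
  free energy; \<open>t\<close> is chosen before \<open>N\<close>.\<close>

definition block_test :: "nat \<Rightarrow> ((nat \<Rightarrow> nat \<Rightarrow> real) \<Rightarrow> real) \<Rightarrow> bool" where
  "block_test n F \<longleftrightarrow> continuous_on UNIV F \<and> (\<forall>q. 0 \<le> F q \<and> F q \<le> 1) \<and>
     (\<forall>q q'. (\<forall>i<n. \<forall>j<n. q i j = q' i j) \<longrightarrow> F q = F q')"

lemma block_test_borel: "block_test n F \<Longrightarrow> F \<in> borel_measurable borel"
  by (simp add: block_test_def borel_measurable_continuous_onI)

lemma block_test_rost_measurable: "block_test n F \<Longrightarrow> F \<in> borel_measurable rost_algebra"
  unfolding rost_algebra_def by (intro measurable_restrict_space1 block_test_borel)

lemma continuous_matrix_entry: "continuous_on S (\<lambda>q :: nat \<Rightarrow> nat \<Rightarrow> real. q i j)"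
proof -
  have "continuous_on S ((\<lambda>r :: nat \<Rightarrow> real. r j) \<circ> (\<lambda>q. q i))"
    by (intro continuous_on_compose continuous_on_product_coordinates[THEN continuous_on_subset]) auto
  then show ?thesis by (simp add: comp_def)
qed

section \<open>Lower orthants generate the product sigma-algebra\<close>

lemma seq_le_in_generator: "finite J \<Longrightarrow> {x. \<forall>a\<in>J. x a \<le> t a} \<in> {{x. \<forall>a\<in>J. x a \<le> t a} | J t. finite J}"
  by (rule CollectI, rule exI[of _ J], rule exI[of _ t]) simp

text \<open>The product algebra is generated by the coordinates, and rays generate each coordinate.
  Both uniqueness arguments of the development, for laws of overlap matrices and in de Finetti's
  theorem, compare two laws on these orthants.\<close>

lemma sets_sigma_seq_le:
  "sets (\<Pi>\<^sub>M i\<in>(UNIV :: 'i set). (borel :: real measure)) =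
     sigma_sets UNIV {{x. \<forall>a\<in>J. x a \<le> t a} | J t. finite J}" (is "?L = sigma_sets UNIV ?G")
proof
  let ?S = "sigma UNIV ?G"
  have "{x :: 'i \<Rightarrow> real. x a \<le> r} \<in> sets ?S" for a r
    using sigma_sets.Basic[OF seq_le_in_generator[of "{a}" "\<lambda>_. r"], of UNIV] by simp
  then have id: "(\<lambda>x. x) \<in> ?S \<rightarrow>\<^sub>M (\<Pi>\<^sub>M i\<in>UNIV. borel)"
    by (intro measurable_PiM_single') (simp_all add: space_PiM borel_measurable_iff_le)
  show "?L \<subseteq> sigma_sets UNIV ?G"
    using measurable_sets[OF id] by (intro subsetI) simp
  have "X \<in> ?L" if X: "X \<in> ?G" for X
  proof -
    obtain J t where J: "finite J" and X: "X = {x. \<forall>a\<in>J. x a \<le> t a}" using X by blast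
    have "{x\<in>space (\<Pi>\<^sub>M i\<in>(UNIV :: 'i set). (borel :: real measure)). \<forall>a\<in>J. x a \<le> t a} \<in> ?L"
      by (rule sets.sets_Collect_finite_All[OF _ J]) measurable
    then show ?thesis by (simp add: space_PiM X)
  qed
  then have "?G \<subseteq> ?L" by (rule subsetI)
  from sets.sigma_sets_subset[OF this] show "sigma_sets UNIV ?G \<subseteq> ?L"
    by (simp add: space_PiM)
qed

lemma Int_stable_seq_le:
  "Int_stable {{x :: 'i \<Rightarrow> real. \<forall>a\<in>J. x a \<le> t a} | J t. finite J}"
proof (rule Int_stableI, clarify)
  fix J J' :: "'i set" and t t' :: "'i \<Rightarrow> real"
  assume J: "finite J" "finite J'"
  let ?u = "\<lambda>a. if a \<in> J then if a \<in> J' then min (t a) (t' a) else t a else t' a"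
  have "{x. \<forall>a\<in>J. x a \<le> t a} \<inter> {x. \<forall>a\<in>J'. x a \<le> t' a} = {x. \<forall>a\<in>J \<union> J'. x a \<le> ?u a}"
    (is "?A = ?B")
  proof (intro equalityI subsetI)
    fix x assume "x \<in> ?B"
    then have *: "x a \<le> ?u a" if "a \<in> J \<union> J'" for a using that by blast
    have "x a \<le> t a" if "a \<in> J" for a using *[of a] that by (cases "a \<in> J'") auto
    moreover have "x a \<le> t' a" if "a \<in> J'" for a using *[of a] that by (cases "a \<in> J") auto
    ultimately show "x \<in> ?A" by blast
  qed auto
  then show "\<exists>J'' u. ?A = {x. \<forall>a\<in>J''. x a \<le> u a} \<and> finite J''"
    using J by (intro exI[of _ "J \<union> J'"] exI[of _ ?u]) simp
qed

lemma measurable_uncurry_matrix: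
  "(\<lambda>q. \<lambda>(i, j). q i j) \<in> borel \<rightarrow>\<^sub>M (\<Pi>\<^sub>M a\<in>(UNIV :: (nat \<times> nat) set). (borel :: real measure))"
  by (rule measurable_PiM_single')
     (auto simp: space_PiM split_beta intro!: borel_measurable_continuous_onI continuous_matrix_entry)

text \<open>Rows and matrices are countable products of second countable spaces, so the Borel
  algebra of the product topology is the product algebra; this is used once for the rows and once
  for the entries.\<close>

lemma measurable_curry_matrix:
  "(\<lambda>x i j. x (i, j)) \<in> (\<Pi>\<^sub>M a\<in>(UNIV :: (nat \<times> nat) set). (borel :: real measure)) \<rightarrow>\<^sub>M borel"
proof -
  have row: "(\<lambda>x j. x (i, j)) \<in> (\<Pi>\<^sub>M a\<in>(UNIV :: (nat \<times> nat) set). (borel :: real measure)) \<rightarrow>\<^sub>M borel" for i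
    by (subst measurable_cong_sets[OF refl sets_PiM_equal_borel[symmetric]], rule measurable_PiM_single')
       (auto simp: space_PiM)
  show ?thesis
    by (subst measurable_cong_sets[OF refl sets_PiM_equal_borel[symmetric]], rule measurable_PiM_single')
       (auto simp: space_PiM intro: row)
qed

lemma measurable_into_matrix:
  assumes "\<And>i j. (\<lambda>x. f x i j) \<in> borel_measurable M"
  shows "f \<in> M \<rightarrow>\<^sub>M (borel :: (nat \<Rightarrow> nat \<Rightarrow> real) measure)"
proof -
  have "(\<lambda>x. \<lambda>(i, j). f x i j) \<in> M \<rightarrow>\<^sub>M (\<Pi>\<^sub>M a\<in>(UNIV :: (nat \<times> nat) set). (borel :: real measure))"
    by (rule measurable_PiM_single') (auto simp: space_PiM split_beta assms)
  from measurable_compose[OF this measurable_curry_matrix] show ?thesis by simp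
qed

lemma space_rost_algebra: "space rost_algebra = rost_matrices"
  by (auto simp: rost_algebra_def space_restrict_space)

lemma measurable_into_rost:
  assumes "\<And>i j. (\<lambda>x. f x i j) \<in> borel_measurable M" "\<And>x. x \<in> space M \<Longrightarrow> f x \<in> rost_matrices"
  shows "f \<in> M \<rightarrow>\<^sub>M rost_algebra"
  unfolding rost_algebra_def using assms
  by (intro measurable_restrict_space2 measurable_into_matrix) auto

text \<open>Functions of this kind are what the rest can handle: their integrals pass to weak-*
  limits and they depend on finitely many replicas. They determine the law because indicators of
  orthants in finitely many entries are bounded limits of them.\<close>

lemma rost_law_eqI:
  assumes P: "P \<in> space (prob_algebra rost_algebra)" and Q: "Q \<in> space (prob_algebra rost_algebra)"
    and eq: "\<And>n F. block_test n F \<Longrightarrow> (\<integral>q. F q \<partial>P) = (\<integral>q. F q \<partial>Q)"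
  shows "P = Q"
proof -
  let ?B = "\<Pi>\<^sub>M a\<in>(UNIV :: (nat \<times> nat) set). (borel :: real measure)"
  define u :: "(nat \<Rightarrow> nat \<Rightarrow> real) \<Rightarrow> nat \<times> nat \<Rightarrow> real" where "u = (\<lambda>q. \<lambda>(i, j). q i j)"
  let ?G = "{{x :: nat \<times> nat \<Rightarrow> real. \<forall>a\<in>J. x a \<le> t a} | J t. finite J}"
  have sP: "sets P = sets rost_algebra" "sets Q = sets rost_algebra" "prob_space P" "prob_space Q"
    using P Q by (auto simp: space_prob_algebra)
  interpret P: prob_space P by fact
  interpret Q: prob_space Q by fact
  have um: "u \<in> R \<rightarrow>\<^sub>M ?B" if "sets R = sets rost_algebra" for R
    using measurable_restrict_space1[OF measurable_uncurry_matrix] that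
    by (simp add: rost_algebra_def u_def cong: measurable_cong_sets)
  have "distr P ?B u = distr Q ?B u"
  proof (rule measure_eqI_generator_eq[OF Int_stable_seq_le])
    fix X assume "X \<in> ?G"
    then obtain J t where J: "finite J" and X: "X = {x. \<forall>a\<in>J. x a \<le> t a}" by blast
    \<comment> \<open>A product of ramps: each factor is 1 up to \<open>t a\<close> and, for
      positive \<open>k\<close>, falls linearly to 0 at \<open>t a + 1 / k\<close>, so that the
      products tend to the indicator of the closed orthant.\<close>
    define F where "F k q = (\<Prod>a\<in>J. max 0 (min 1 (1 - real k * (u q a - t a))))"
      for k and q :: "nat \<Rightarrow> nat \<Rightarrow> real"
    \<comment> \<open>The block must contain the row and the column of every constrained entry. For
      empty \<open>J\<close> the maximum is unspecified, but then any block will do.\<close>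
    obtain n where n: "J \<subseteq> {..<n} \<times> {..<n}"
    proof -
      have "i < Suc (Max (fst ` J \<union> snd ` J))" "j < Suc (Max (fst ` J \<union> snd ` J))" if "(i, j) \<in> J" for i j
        using that J by (auto intro!: le_imp_less_Suc Max_ge rev_image_eqI)
      then show ?thesis by (intro that[of "Suc (Max (fst ` J \<union> snd ` J))"]) auto
    qed
    have bt: "block_test n (F k)" for k
      unfolding block_test_def
    proof (intro conjI allI impI)
      show "continuous_on UNIV (F k)" unfolding F_def u_def split_beta
        by (intro continuous_intros continuous_matrix_entry)
      show "0 \<le> F k q" "F k q \<le> 1" for q unfolding F_def by (auto intro!: prod_nonneg prod_le_1)
      show "F k q = F k q'" if "\<forall>i<n. \<forall>j<n. q i j = q' i j" for q q'
        unfolding F_def u_def using that n by (intro prod.cong) auto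
    qed
    have one: "(\<lambda>k. max 0 (min 1 (1 - real k * (x - s)))) \<longlonglongrightarrow> (if x \<le> s then 1 else 0)" for x s :: real
    proof (cases "x \<le> s")
      case True
      then have "max 0 (min 1 (1 - real k * (x - s))) = 1" for k
        by (auto simp: min_def max_def mult_nonneg_nonpos)
      then show ?thesis using True by simp
    next
      case False
      then obtain k0 :: nat where k0: "1 / (x - s) \<le> real k0" using real_arch_simple by blast
      have "max 0 (min 1 (1 - real k * (x - s))) = 0" if "k0 \<le> k" for k
      proof -
        have "1 \<le> real k0 * (x - s)" using k0 False by (simp add: field_simps)
        also have "\<dots> \<le> real k * (x - s)" using that False by (intro mult_right_mono) auto
        finally show ?thesis by auto
      qed
      then show ?thesis using False
        by (intro tendsto_eventually) (auto simp: eventually_sequentially)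
    qed
    have lim: "(\<lambda>k. F k q) \<longlonglongrightarrow> indicator X (u q)" for q
    proof -
      have "(\<lambda>k. F k q) \<longlonglongrightarrow> (\<Prod>a\<in>J. if u q a \<le> t a then 1 else 0)"
        unfolding F_def by (intro tendsto_prod one)
      also have "(\<Prod>a\<in>J. if u q a \<le> t a then 1 else 0) = (indicator X (u q) :: real)"
        using J by (auto simp: X indicator_def intro!: prod.neutral prod_zero)
      finally show ?thesis .
    qed
    have X_sets: "X \<in> sets ?B"
      unfolding sets_sigma_seq_le using \<open>X \<in> ?G\<close> by (rule sigma_sets.Basic)
    have conv: "(\<lambda>k. \<integral>q. F k q \<partial>R) \<longlonglongrightarrow> measure (distr R ?B u) X"
      if R: "prob_space R" "sets R = sets rost_algebra" for R
    proof -
      interpret R: prob_space R by fact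
      have m: "F k \<in> borel_measurable R" for k
        using block_test_rost_measurable[OF bt] R(2) by (simp cong: measurable_cong_sets)
      have mi: "(\<lambda>q. indicator X (u q) :: real) \<in> borel_measurable R"
        by (rule measurable_compose[OF um[OF R(2)] borel_measurable_indicator[OF X_sets]])
      have "(\<lambda>k. \<integral>q. F k q \<partial>R) \<longlonglongrightarrow> (\<integral>q. indicator X (u q) \<partial>R)"
      proof (rule integral_dominated_convergence[where w="\<lambda>_. 1", OF mi m])
        show "integrable R (\<lambda>_. 1 :: real)" by simp
        show "AE q in R. (\<lambda>k. F k q) \<longlonglongrightarrow> indicator X (u q)" by (rule AE_I2) (rule lim)
        show "AE q in R. norm (F k q) \<le> 1" for k
          using bt[of k] by (intro AE_I2) (auto simp: block_test_def)
      qed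
      also have "(\<integral>q. indicator X (u q) \<partial>R) = (\<integral>x. (indicator X x :: real) \<partial>distr R ?B u)"
        by (rule integral_distr[OF um[OF R(2)] borel_measurable_indicator[OF X_sets], symmetric])
      also have "\<dots> = measure (distr R ?B u) X"
        using sets.sets_into_space[OF X_sets] by (simp only: Bochner_Integration.integral_indicator space_distr Int_absorb2)
      finally show ?thesis .
    qed
    have "measure (distr P ?B u) X = measure (distr Q ?B u) X"
      using LIMSEQ_unique[OF conv[OF sP(3,1)]] conv[OF sP(4,2)] eq[OF bt] by simp
    then show "emeasure (distr P ?B u) X = emeasure (distr Q ?B u) X"
      using P.prob_space_distr[OF um[OF sP(1)]] Q.prob_space_distr[OF um[OF sP(2)]]
      by (simp add: prob_space_def finite_measure.emeasure_eq_measure)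
  next
    show "range (\<lambda>_::nat. UNIV) \<subseteq> ?G"
      using seq_le_in_generator[of "{} :: (nat \<times> nat) set"] by (simp add: image_subset_iff)
    show "emeasure (distr P ?B u) UNIV \<noteq> \<infinity>" for i :: nat
      using P.prob_space_distr[OF um[OF sP(1)]] by (simp add: prob_space_def finite_measure.emeasure_eq_measure)
  qed (use sets_sigma_seq_le in auto)
  then have d: "distr (distr P ?B u) borel (\<lambda>x i j. x (i, j)) = distr (distr Q ?B u) borel (\<lambda>x i j. x (i, j))"
    by simp
  have "distr P borel (\<lambda>q. q) = distr Q borel (\<lambda>q. q)"
    using d um[OF sP(1)] um[OF sP(2)]
    by (simp add: distr_distr[OF measurable_curry_matrix] comp_def u_def)
  then have e: "emeasure (distr P borel (\<lambda>q. q)) A = emeasure (distr Q borel (\<lambda>q. q)) A" for A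
    by simp
  have id: "(\<lambda>q. q) \<in> P \<rightarrow>\<^sub>M borel" "(\<lambda>q. q) \<in> Q \<rightarrow>\<^sub>M borel"
    using sP by (simp_all add: rost_algebra_def measurable_restrict_space1 cong: measurable_cong_sets)
  have spP: "space P = rost_matrices" "space Q = rost_matrices"
    using sets_eq_imp_space_eq[OF sP(1)] sets_eq_imp_space_eq[OF sP(2)] space_rost_algebra by auto
  \<comment> \<open>Events of either law are traces of Borel sets on \<open>rost_matrices\<close>,
    where both laws live, so agreement as Borel laws on all matrices is enough.\<close>
  show ?thesis
  proof (rule measure_eqI)
    fix A assume "A \<in> sets P"
    then obtain B where B: "B \<in> sets borel" "A = B \<inter> rost_matrices"
      by (auto simp: sP rost_algebra_def sets_restrict_space)
    show "emeasure P A = emeasure Q A"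
      using e[of B] B id spP by (simp add: emeasure_distr)
  qed (simp add: sP)
qed

section \<open>Kernels\<close>

text \<open>Measurability of a kernel need only be checked on a generating pi-system; on a cylinder
  the infinite product measure is a finite product of evaluations of \<open>m\<close>.\<close>

lemma measurable_PiM_kernel:
  "(\<lambda>m. \<Pi>\<^sub>M i\<in>I. m) \<in> prob_algebra N \<rightarrow>\<^sub>M prob_algebra (\<Pi>\<^sub>M i\<in>I. N)"
proof (rule measurable_prob_algebra_generated[OF sets_PiM Int_stable_prod_algebra prod_algebra_sets_into_space])
  fix m assume "m \<in> space (prob_algebra N)"
  then show "prob_space (\<Pi>\<^sub>M i\<in>I. m)" "sets (\<Pi>\<^sub>M i\<in>I. m) = sets (\<Pi>\<^sub>M i\<in>I. N)"
    by (auto simp: space_prob_algebra intro!: prob_space_PiM sets_PiM_cong)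
next
  fix A assume "A \<in> prod_algebra I (\<lambda>i. N)"
  then obtain J E where A: "A = prod_emb I (\<lambda>_. N) J (Pi\<^sub>E J E)"
    and J: "finite J" "J \<subseteq> I" and E: "E \<in> (\<Pi> j\<in>J. sets N)"
    by (auto simp: prod_algebra_def)
  have eq: "emeasure (\<Pi>\<^sub>M i\<in>I. m) A = (\<Prod>j\<in>J. emeasure m (E j))" if "m \<in> space (prob_algebra N)" for m
  proof -
    have m: "sets m = sets N" "prob_space m" using that by (auto simp: space_prob_algebra)
    have "A = prod_emb I (\<lambda>_. m) J (Pi\<^sub>E J E)"
      unfolding A prod_emb_def using sets_eq_imp_space_eq[OF m(1)] by simp
    then show ?thesis using m J E by (simp add: emeasure_PiM_emb Pi_iff)
  qed
  have meas: "(\<lambda>m. \<Prod>j\<in>J. emeasure m (E j)) \<in> borel_measurable (prob_algebra N)"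
    using E by (intro borel_measurable_prod_ennreal
        measurable_compose[OF measurable_prob_algebraD[OF measurable_ident[unfolded id_def]]
          measurable_emeasure_subprob_algebra]) auto
  show "(\<lambda>m. emeasure (\<Pi>\<^sub>M i\<in>I. m) A) \<in> borel_measurable (prob_algebra N)"
    by (rule measurable_cong[THEN iffD2, OF eq meas])
qed

text \<open>This is \<open>cavity_measure\<close> with an arbitrary weight on an arbitrary space,
  including its convention when the normalization is infinite. It serves the Hilbert ball and the
  spin configurations alike.\<close>

definition tilt :: "'a measure \<Rightarrow> ('a \<Rightarrow> real) \<Rightarrow> 'a measure" where
  "tilt m w = (let Z = \<integral>\<^sup>+ x. ennreal (w x) \<partial>m
     in if Z < \<infinity> then density m (\<lambda>x. ennreal (w x) / Z) else m)"

lemma sets_tilt [simp, measurable_cong]: "sets (tilt m w) = sets m"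
  by (simp add: tilt_def Let_def)

lemma nn_integral_pos_weight:
  assumes "prob_space m" "w \<in> borel_measurable m" "\<And>x. x \<in> space m \<Longrightarrow> 0 < w x"
  shows "(\<integral>\<^sup>+ x. ennreal (w x) \<partial>m) \<noteq> 0"
proof
  interpret prob_space m by fact
  assume "(\<integral>\<^sup>+ x. ennreal (w x) \<partial>m) = 0"
  then have "AE x in m. ennreal (w x) = 0" using assms by (simp add: nn_integral_0_iff_AE)
  then have "AE x in m. False" using AE_space by eventually_elim (use assms(3) in force)
  then show False by simp
qed

lemma prob_space_tilt:
  assumes "prob_space m" "w \<in> borel_measurable m" "\<And>x. x \<in> space m \<Longrightarrow> 0 < w x"
  shows "prob_space (tilt m w)"
proof (cases "(\<integral>\<^sup>+ x. ennreal (w x) \<partial>m) < \<infinity>")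
  case True
  note [measurable] = assms(2)
  let ?Z = "\<integral>\<^sup>+ x. ennreal (w x) \<partial>m"
  have "(\<integral>\<^sup>+ x. ennreal (w x) / ?Z \<partial>m) = 1"
    using True nn_integral_pos_weight[OF assms]
    by (simp add: nn_integral_divide ennreal_divide_self)
  then show ?thesis using True by (intro prob_spaceI) (simp add: tilt_def emeasure_density)
qed (simp add: tilt_def assms)

text \<open>The tilted mass of a fixed set is a quotient of two kernel integrals, each jointly
  measurable in \<open>m\<close> and \<open>l\<close>; where the normalization is infinite it falls
  back to the mass under \<open>m\<close>.\<close>

lemma measurable_tilt:
  assumes w [measurable]: "(\<lambda>(l, x). w l x) \<in> borel_measurable (L \<Otimes>\<^sub>M X)"
    and pos: "\<And>l x. l \<in> space L \<Longrightarrow> x \<in> space X \<Longrightarrow> 0 < w l x"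
  shows "(\<lambda>(m, l). tilt m (w l)) \<in> prob_algebra X \<Otimes>\<^sub>M L \<rightarrow>\<^sub>M prob_algebra X"
proof (rule measurable_prob_algebra_generated[OF sets.sigma_sets_eq[symmetric] sets.Int_stable sets.space_closed])
  fix ml assume ml: "ml \<in> space (prob_algebra X \<Otimes>\<^sub>M L)"
  obtain m l where [simp]: "ml = (m, l)" by (cases ml)
  have m: "prob_space m" "sets m = sets X" and l: "l \<in> space L"
    using ml by (auto simp: space_pair_measure space_prob_algebra)
  have "w l \<in> borel_measurable X" using l by measurable
  then have "w l \<in> borel_measurable m" by (simp add: m cong: measurable_cong_sets)
  then show "prob_space (case ml of (m, l) \<Rightarrow> tilt m (w l))"
    using m l pos sets_eq_imp_space_eq[OF m(2)] by (auto intro!: prob_space_tilt)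
  show "sets (case ml of (m, l) \<Rightarrow> tilt m (w l)) = sets X" by (simp add: m)
next
  fix A assume A [measurable]: "A \<in> sets X"
  let ?K = "prob_algebra X \<Otimes>\<^sub>M L"
  define Z where "Z ml = (\<integral>\<^sup>+ x. ennreal (w (snd ml) x) \<partial>fst ml)" for ml
  define V where "V ml = (\<integral>\<^sup>+ x. ennreal (w (snd ml) x) * indicator A x \<partial>fst ml)" for ml
  have [measurable]: "fst \<in> ?K \<rightarrow>\<^sub>M subprob_algebra X"
    by (rule measurable_prob_algebraD) measurable
  have [measurable]: "Z \<in> borel_measurable ?K"
    unfolding Z_def by (rule nn_integral_measurable_subprob_algebra2[where N = X]) measurable
  have [measurable]: "V \<in> borel_measurable ?K"
    unfolding V_def by (rule nn_integral_measurable_subprob_algebra2[where N = X]) measurable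
  have [measurable]: "(\<lambda>ml. emeasure (fst ml) A) \<in> borel_measurable ?K"
    by measurable
  have meas: "(\<lambda>ml. if Z ml < \<infinity> then V ml / Z ml
      else emeasure (fst ml) A) \<in> borel_measurable ?K"
    by measurable
  have eq: "emeasure (case ml of (m, l) \<Rightarrow> tilt m (w l)) A =
     (if Z ml < \<infinity> then V ml / Z ml
      else emeasure (fst ml) A)" if ml: "ml \<in> space ?K" for ml
  proof -
    obtain m l where [simp]: "ml = (m, l)" by (cases ml)
    have m: "sets m = sets X" and l: "l \<in> space L"
      using ml by (auto simp: space_pair_measure space_prob_algebra)
    have "w l \<in> borel_measurable X" using l by measurable
    then have [measurable]: "w l \<in> borel_measurable m" by (simp add: m cong: measurable_cong_sets)
    have [measurable]: "A \<in> sets m" by (simp add: m)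
    have "(\<integral>\<^sup>+ x. ennreal (w l x) / c * indicator A x \<partial>m) = (\<integral>\<^sup>+ x. ennreal (w l x) * indicator A x \<partial>m) / c" for c
      by (subst nn_integral_divide[symmetric]) (auto simp: divide_ennreal_def ac_simps)
    then show ?thesis by (simp add: tilt_def Let_def emeasure_density Z_def V_def)
  qed
  show "(\<lambda>ml. emeasure (case ml of (m, l) \<Rightarrow> tilt m (w l)) A) \<in> borel_measurable ?K"
    by (rule measurable_cong[THEN iffD2, OF eq meas])
qed

section \<open>Replicas of a tilted measure\<close>

lemma distr_PiM_Suc:
  assumes "prob_space m"
  shows "distr (m \<Otimes>\<^sub>M (\<Pi>\<^sub>M i\<in>{..<k}. m)) (\<Pi>\<^sub>M i\<in>{..<Suc k}. m) (\<lambda>(y, x). x(k := y)) = (\<Pi>\<^sub>M i\<in>{..<Suc k}. m)"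
proof -
  have "insert k {..<k} = {..<Suc k}" by auto
  then show ?thesis
    using distr_pair_PiM_eq_PiM[of "{..<k}" "\<lambda>_. m" k] assms by simp
qed

text \<open>Fubini for one more independent replica. The hypothesis \<open>dep\<close> makes
  \<open>G\<close> blind to coordinates from \<open>k\<close> on, so the same function can be read
  on the product over \<open>k\<close> and over \<open>k + 1\<close> coordinates.\<close>

lemma
  fixes G :: "(nat \<Rightarrow> 'a) \<Rightarrow> real" and h :: "'a \<Rightarrow> real"
  assumes m: "prob_space m"
    and dep: "\<And>x y. (\<And>i. i < k \<Longrightarrow> x i = y i) \<Longrightarrow> G x = G y"
    and G: "integrable (\<Pi>\<^sub>M i\<in>{..<k}. m) G" and h: "integrable m h"
  shows integrable_PiM_Suc: "integrable (\<Pi>\<^sub>M i\<in>{..<Suc k}. m) (\<lambda>x. G x * h (x k))" (is ?A)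
    and integral_PiM_Suc: "(\<integral>x. G x * h (x k) \<partial>(\<Pi>\<^sub>M i\<in>{..<Suc k}. m)) =
      (\<integral>x. G x \<partial>(\<Pi>\<^sub>M i\<in>{..<k}. m)) * (\<integral>x. h x \<partial>m)" (is ?B)
proof -
  interpret m: prob_space m by fact
  let ?P = "\<Pi>\<^sub>M i\<in>{..<k}. m" and ?S = "\<Pi>\<^sub>M i\<in>{..<Suc k}. m"
  interpret P: prob_space ?P using m by (intro prob_space_PiM)
  interpret pair_sigma_finite m ?P ..
  have ins: "{..<Suc k} = insert k {..<k}" by auto
  have t: "(\<lambda>(y, x). x(k := y)) \<in> m \<Otimes>\<^sub>M ?P \<rightarrow>\<^sub>M ?S"
    unfolding ins by measurable
  have restr: "(\<lambda>x. restrict x {..<k}) \<in> ?S \<rightarrow>\<^sub>M ?P"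
    by (rule measurable_restrict_subset) auto
  have Gm: "G \<in> borel_measurable ?P" using G by simp
  have "(\<lambda>x. G (restrict x {..<k})) \<in> borel_measurable ?S"
    by (rule measurable_compose[OF restr Gm])
  moreover have "G (restrict x {..<k}) = G x" for x by (rule dep) simp
  ultimately have GS: "G \<in> borel_measurable ?S" by simp
  have hS: "(\<lambda>x. h (x k)) \<in> borel_measurable ?S"
    by (rule measurable_compose[OF measurable_component_singleton]) (use h in auto)
  have prod: "(\<lambda>x. G x * h (x k)) \<in> borel_measurable ?S" using GS hS by measurable
  have Gk: "G (x(k := y)) = G x" for x y by (rule dep) simp
  have int: "integrable (m \<Otimes>\<^sub>M ?P) (\<lambda>(y, x). G x * h y)"
  proof (rule Fubini_integrable)
    show "(\<lambda>(y, x). G x * h y) \<in> borel_measurable (m \<Otimes>\<^sub>M ?P)"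
      using Gm h by measurable
    show "integrable m (\<lambda>y. \<integral>x. norm (case (y, x) of (y, x) \<Rightarrow> G x * h y) \<partial>?P)"
      using h G by (simp add: abs_mult)
    show "AE y in m. integrable ?P (\<lambda>x. case (y, x) of (y, x) \<Rightarrow> G x * h y)"
      using G by simp
  qed
  have "integrable (distr (m \<Otimes>\<^sub>M ?P) ?S (\<lambda>(y, x). x(k := y))) (\<lambda>x. G x * h (x k))"
    using int by (subst integrable_distr_eq[OF t prod]) (simp add: Gk split_beta')
  then show ?A by (simp add: distr_PiM_Suc[OF m])
  have "(\<integral>x. G x * h (x k) \<partial>?S) = (\<integral>x. G x * h (x k) \<partial>distr (m \<Otimes>\<^sub>M ?P) ?S (\<lambda>(y, x). x(k := y)))"
    by (simp add: distr_PiM_Suc[OF m])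
  also have "\<dots> = (\<integral>z. (case z of (y, x) \<Rightarrow> G x * h y) \<partial>(m \<Otimes>\<^sub>M ?P))"
    by (subst integral_distr[OF t prod]) (simp add: Gk split_beta')
  also have "\<dots> = (\<integral>y. \<integral>x. G x * h y \<partial>?P \<partial>m)"
    using integral_fst'[OF int] by simp
  also have "\<dots> = (\<integral>x. G x \<partial>?P) * (\<integral>x. h x \<partial>m)"
    by simp
  finally show ?B .
qed

lemma
  assumes m: "prob_space m" and h: "integrable m (h :: 'a \<Rightarrow> real)"
  shows integrable_PiM_prod: "integrable (\<Pi>\<^sub>M i\<in>{..<k}. m) (\<lambda>x. \<Prod>i<k. h (x i))"
    and integral_PiM_prod: "(\<integral>x. (\<Prod>i<k. h (x i)) \<partial>(\<Pi>\<^sub>M i\<in>{..<k}. m)) = (\<integral>x. h x \<partial>m) ^ k"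
proof -
  interpret product_sigma_finite "\<lambda>_ :: nat. m"
    using m by (simp add: product_sigma_finite_def prob_space_imp_sigma_finite)
  show "integrable (\<Pi>\<^sub>M i\<in>{..<k}. m) (\<lambda>x. \<Prod>i<k. h (x i))"
    using h by (intro product_integrable_prod) auto
  show "(\<integral>x. (\<Prod>i<k. h (x i)) \<partial>(\<Pi>\<^sub>M i\<in>{..<k}. m)) = (\<integral>x. h x \<partial>m) ^ k"
    using h by (subst product_integral_prod) auto
qed

text \<open>Exchanging one factor at a time: the untouched factors integrate to 1 each, so every
  exchange costs the L1 distance of \<open>a\<close> and \<open>b\<close>.\<close>

lemma integral_PiM_prod_diff_le:
  fixes a b :: "'a \<Rightarrow> real" and n :: nat
  assumes m: "prob_space m" and int: "integrable m a" "integrable m b"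
    and nonneg: "\<And>x. 0 \<le> a x" "\<And>x. 0 \<le> b x"
    and one: "(\<integral>x. a x \<partial>m) = 1" "(\<integral>x. b x \<partial>m) = 1"
  shows "(\<integral>x. \<bar>(\<Prod>i<n. a (x i)) - (\<Prod>i<n. b (x i))\<bar> \<partial>(\<Pi>\<^sub>M i\<in>{..<n}. m)) \<le> n * (\<integral>x. \<bar>a x - b x\<bar> \<partial>m)"
proof (induction n)
  case (Suc n)
  let ?P = "\<lambda>n::nat. \<Pi>\<^sub>M i\<in>{..<n}. m"
  let ?D = "\<lambda>n x. \<bar>(\<Prod>i<n. a (x i)) - (\<Prod>i<n. b (x i))\<bar>"
  have prodc: "(\<Prod>i<n. c (x i)) = (\<Prod>i<n. c (y i))" if "\<And>i. i < n \<Longrightarrow> x i = y i" for c :: "'a \<Rightarrow> real" and x y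
    using that by (intro prod.cong) auto
  have Dint: "integrable (?P k) (?D k)" for k
    by (intro integrable_abs Bochner_Integration.integrable_diff integrable_PiM_prod m int)
  have ab: "integrable m (\<lambda>x. \<bar>a x - b x\<bar>)" using int by auto
  note I1 = integrable_PiM_Suc[where G = "?D n", OF m _ Dint int(1)]
    integral_PiM_Suc[where G = "?D n", OF m _ Dint int(1)]
  have I2: "integrable (?P (Suc n)) (\<lambda>x. (\<Prod>i<n. b (x i)) * \<bar>a (x n) - b (x n)\<bar>)"
    "(\<integral>x. (\<Prod>i<n. b (x i)) * \<bar>a (x n) - b (x n)\<bar> \<partial>?P (Suc n)) =
      (\<integral>x. (\<Prod>i<n. b (x i)) \<partial>?P n) * (\<integral>x. \<bar>a x - b x\<bar> \<partial>m)"
    by (rule integrable_PiM_Suc[where G = "\<lambda>x. \<Prod>i<n. b (x i)", OF m _ integrable_PiM_prod[OF m int(2)] ab]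
        integral_PiM_Suc[where G = "\<lambda>x. \<Prod>i<n. b (x i)", OF m _ integrable_PiM_prod[OF m int(2)] ab],
        erule prodc)+
  have D1: "integrable (?P (Suc n)) (\<lambda>x. ?D n x * a (x n))"
     "(\<integral>x. ?D n x * a (x n) \<partial>?P (Suc n)) = (\<integral>x. ?D n x \<partial>?P n) * (\<integral>x. a x \<partial>m)"
    by (rule I1, metis prodc)+
  have "(\<integral>x. ?D (Suc n) x \<partial>?P (Suc n)) \<le>
      (\<integral>x. ?D n x * a (x n) + (\<Prod>i<n. b (x i)) * \<bar>a (x n) - b (x n)\<bar> \<partial>?P (Suc n))"
  proof (rule integral_mono[OF Dint])
    show "integrable (?P (Suc n)) (\<lambda>x. ?D n x * a (x n) + (\<Prod>i<n. b (x i)) * \<bar>a (x n) - b (x n)\<bar>)"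
      using D1(1) I2(1) by (intro Bochner_Integration.integrable_add)
    fix x
    have "(\<Prod>i<Suc n. a (x i)) - (\<Prod>i<Suc n. b (x i)) =
      ((\<Prod>i<n. a (x i)) - (\<Prod>i<n. b (x i))) * a (x n) + (\<Prod>i<n. b (x i)) * (a (x n) - b (x n))"
      by (simp add: algebra_simps)
    then have "?D (Suc n) x \<le> \<bar>((\<Prod>i<n. a (x i)) - (\<Prod>i<n. b (x i))) * a (x n)\<bar>
        + \<bar>(\<Prod>i<n. b (x i)) * (a (x n) - b (x n))\<bar>"
      by (simp only: abs_triangle_ineq)
    then show "?D (Suc n) x \<le> ?D n x * a (x n) + (\<Prod>i<n. b (x i)) * \<bar>a (x n) - b (x n)\<bar>"
      using nonneg by (simp add: abs_mult prod_nonneg)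
  qed
  also have "\<dots> = (\<integral>x. ?D n x * a (x n) \<partial>?P (Suc n)) +
      (\<integral>x. (\<Prod>i<n. b (x i)) * \<bar>a (x n) - b (x n)\<bar> \<partial>?P (Suc n))"
    using D1(1) I2(1) by (intro Bochner_Integration.integral_add)
  also have "\<dots> = (\<integral>x. ?D n x \<partial>?P n) + (\<integral>x. \<bar>a x - b x\<bar> \<partial>m)"
    using I2(2) D1(2) by (simp add: one integral_PiM_prod[OF m int(2)])
  also have "\<dots> \<le> n * (\<integral>x. \<bar>a x - b x\<bar> \<partial>m) + (\<integral>x. \<bar>a x - b x\<bar> \<partial>m)"
    using Suc by simp
  finally show ?case by (simp add: algebra_simps)
qed simp

lemma PiM_density_eq:
  fixes g :: "'a \<Rightarrow> real" and n :: nat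
  assumes m: "prob_space m" and g [measurable]: "g \<in> borel_measurable m"
    and nonneg: "\<And>x. 0 \<le> g x" and d: "prob_space (density m (\<lambda>x. ennreal (g x)))"
  shows "(\<Pi>\<^sub>M i\<in>{..<n}. density m (\<lambda>x. ennreal (g x))) =
    density (\<Pi>\<^sub>M i\<in>{..<n}. m) (\<lambda>x. ennreal (\<Prod>i<n. g (x i)))"
proof -
  let ?d = "density m (\<lambda>x. ennreal (g x))"
  interpret product_sigma_finite "\<lambda>_ :: nat. m"
    using m by (simp add: product_sigma_finite_def prob_space_imp_sigma_finite)
  interpret D: product_sigma_finite "\<lambda>_ :: nat. ?d"
    using d by (simp add: product_sigma_finite_def prob_space_imp_sigma_finite)
  have "density (\<Pi>\<^sub>M i\<in>{..<n}. m) (\<lambda>x. ennreal (\<Prod>i<n. g (x i))) = (\<Pi>\<^sub>M i\<in>{..<n}. ?d)"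
  proof (rule D.PiM_eqI)
    show "finite {..<n}" by simp
    show "sets (density (\<Pi>\<^sub>M i\<in>{..<n}. m) (\<lambda>x. ennreal (\<Prod>i<n. g (x i)))) = sets (\<Pi>\<^sub>M i\<in>{..<n}. ?d)"
      by (simp, rule sets_PiM_cong) auto
    fix A :: "nat \<Rightarrow> 'a set" assume "\<And>i. i \<in> {..<n} \<Longrightarrow> A i \<in> sets ?d"
    then have A [measurable]: "\<And>i. i \<in> {..<n} \<Longrightarrow> A i \<in> sets m" by simp
    have PA: "Pi\<^sub>E {..<n} A \<in> sets (\<Pi>\<^sub>M i\<in>{..<n}. m)" using A by (intro sets_PiM_I_finite) auto
    have "emeasure (density (\<Pi>\<^sub>M i\<in>{..<n}. m) (\<lambda>x. ennreal (\<Prod>i<n. g (x i)))) (Pi\<^sub>E {..<n} A) =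
        (\<integral>\<^sup>+ x. ennreal (\<Prod>i<n. g (x i)) * indicator (Pi\<^sub>E {..<n} A) x \<partial>(\<Pi>\<^sub>M i\<in>{..<n}. m))"
      using PA by (intro emeasure_density) measurable
    also have "\<dots> = (\<integral>\<^sup>+ x. (\<Prod>i<n. ennreal (g (x i)) * indicator (A i) (x i)) \<partial>(\<Pi>\<^sub>M i\<in>{..<n}. m))"
    proof (intro nn_integral_cong)
      fix x assume "x \<in> space (\<Pi>\<^sub>M i\<in>{..<n}. m)"
      then have "x \<in> extensional {..<n}" by (simp add: space_PiM PiE_def)
      then have "indicator (Pi\<^sub>E {..<n} A) x = (\<Prod>i<n. indicator (A i) (x i) :: ennreal)"
        by (auto simp: indicator_def PiE_iff prod_eq_1_iff intro!: prod.neutral[symmetric] prod_zero[symmetric])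
      then show "ennreal (\<Prod>i<n. g (x i)) * indicator (Pi\<^sub>E {..<n} A) x =
          (\<Prod>i<n. ennreal (g (x i)) * indicator (A i) (x i))"
        using nonneg by (simp add: prod.distrib prod_ennreal)
    qed
    also have "\<dots> = (\<Prod>i<n. \<integral>\<^sup>+ x. ennreal (g x) * indicator (A i) x \<partial>m)"
      by (rule product_nn_integral_prod) (auto intro!: borel_measurable_times_ennreal)
    also have "\<dots> = (\<Prod>i<n. emeasure ?d (A i))"
      by (intro prod.cong refl emeasure_density[symmetric]) auto
    finally show "emeasure (density (\<Pi>\<^sub>M i\<in>{..<n}. m) (\<lambda>x. ennreal (\<Prod>i<n. g (x i)))) (Pi\<^sub>E {..<n} A) =
        (\<Prod>i<n. emeasure ?d (A i))" .
  qed
  then show ?thesis by (rule sym)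
qed

lemma tilt_eq_density:
  assumes "integrable m w" "\<And>x. 0 \<le> w x" "0 < (\<integral>x. w x \<partial>m)"
  shows "tilt m w = density m (\<lambda>x. ennreal (w x / (\<integral>x. w x \<partial>m)))"
  using assms unfolding tilt_def
  by (simp add: nn_integral_eq_integral Let_def divide_ennreal)

lemma integral_weight_pos:
  assumes "prob_space m" "integrable m w" "\<And>x. 0 < (w x :: real)"
  shows "0 < (\<integral>x. w x \<partial>m)"
proof -
  have "(\<integral>\<^sup>+ x. ennreal (w x) \<partial>m) \<noteq> 0" using assms by (intro nn_integral_pos_weight) auto
  then show ?thesis
    using assms by (simp add: nn_integral_eq_integral less_imp_le less_le)
qed

lemma integral_PiM_tilt:
  fixes n :: nat
  assumes m: "prob_space m" and w: "integrable m w" "\<And>x. 0 < w x"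
    and F: "F \<in> borel_measurable (\<Pi>\<^sub>M i\<in>{..<n}. m)"
  shows "(\<integral>x. F x \<partial>(\<Pi>\<^sub>M i\<in>{..<n}. tilt m w)) =
    (\<integral>x. F x * (\<Prod>i<n. w (x i) / (\<integral>x. w x \<partial>m)) \<partial>(\<Pi>\<^sub>M i\<in>{..<n}. m))"
proof -
  let ?Z = "\<integral>x. w x \<partial>m"
  have Z: "0 < ?Z" by (rule integral_weight_pos[OF m w])
  have t: "tilt m w = density m (\<lambda>x. ennreal (w x / ?Z))"
    using w Z by (intro tilt_eq_density) (auto intro: less_imp_le)
  have "prob_space (tilt m w)" using w by (intro prob_space_tilt m) auto
  then have "(\<Pi>\<^sub>M i\<in>{..<n}. tilt m w) = density (\<Pi>\<^sub>M i\<in>{..<n}. m) (\<lambda>x. ennreal (\<Prod>i<n. w (x i) / ?Z))"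
    unfolding t using w Z by (intro PiM_density_eq m) (auto intro: less_imp_le)
  moreover have "(\<lambda>x. \<Prod>i<n. w (x i) / ?Z) \<in> borel_measurable (\<Pi>\<^sub>M i\<in>{..<n}. m)"
    using w by (intro borel_measurable_prod borel_measurable_divide measurable_compose[OF measurable_component_singleton]) auto
  ultimately show ?thesis
    using F Z w(2) by (simp add: integral_density mult.commute prod_nonneg less_imp_le)
qed

text \<open>The trouble is a small normalization \<open>Z\<close>. If \<open>Z < 2 * d\<close>, the
  trivial bound 2 is below \<open>4 * d / Z\<close>, and \<open>1 / Z\<close> is controlled by the
  mean of \<open>1 / w\<close>. If the mass of \<open>T\<close> is off by more than
  \<open>d\<close>, the bound 2 is below \<open>2 / d\<close> times the L1 error. Otherwise the
  truncation is inactive and the factors can be exchanged one by one.\<close>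

lemma tilt_replicas_truncated:
  fixes w T :: "'a \<Rightarrow> real" and F :: "(nat \<Rightarrow> 'a) \<Rightarrow> real"
  assumes m: "prob_space m" and w: "integrable m w" "\<And>x. 0 < w x" and iw: "integrable m (\<lambda>x. 1 / w x)"
    and T: "T \<in> borel_measurable m" "\<And>x. 0 \<le> T x" "\<And>x. T x \<le> B" and d: "0 < d"
    and F: "F \<in> borel_measurable (\<Pi>\<^sub>M i\<in>{..<n}. m)" "\<And>x. \<bar>F x\<bar> \<le> 1"
  shows "\<bar>(\<integral>x. F x \<partial>(\<Pi>\<^sub>M i\<in>{..<n}. tilt m w)) -
      (\<integral>x. F x * (\<Prod>i<n. T (x i)) \<partial>(\<Pi>\<^sub>M i\<in>{..<n}. m)) / max (\<integral>x. T x \<partial>m) d ^ n\<bar>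
    \<le> (2 * real n + 2) / d * (\<integral>x. \<bar>T x - w x\<bar> \<partial>m) + 4 * d * (\<integral>x. 1 / w x \<partial>m)"
proof -
  interpret m: prob_space m by fact
  let ?P = "\<Pi>\<^sub>M i\<in>{..<n}. m"
  interpret P: prob_space ?P using m by (intro prob_space_PiM)
  define Z where "Z = (\<integral>x. w x \<partial>m)"
  define Z' where "Z' = (\<integral>x. T x \<partial>m)"
  define E where "E = (\<integral>x. \<bar>T x - w x\<bar> \<partial>m)"
  define R where "R = (\<integral>x. F x \<partial>(\<Pi>\<^sub>M i\<in>{..<n}. tilt m w))"
  define R' where "R' = (\<integral>x. F x * (\<Prod>i<n. T (x i)) \<partial>?P) / max Z' d ^ n"
  have Ti: "integrable m T" using T by (intro m.integrable_const_bound[of _ B]) auto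
  have Z: "0 < Z" unfolding Z_def by (rule integral_weight_pos[OF m w])
  have Z': "0 \<le> Z'" unfolding Z'_def using T by simp
  have E: "0 \<le> E" unfolding E_def by simp
  have ZZ': "\<bar>Z' - Z\<bar> \<le> E"
    unfolding Z_def Z'_def E_def
    using integral_abs_bound[of m "\<lambda>x. T x - w x"] Ti w by simp
  \<comment> \<open>Jensen's inequality for the reciprocal, from its tangent line at
    \<open>Z\<close>.\<close>
  have iZ: "1 / Z \<le> (\<integral>x. 1 / w x \<partial>m)"
  proof -
    have "(\<integral>x. 2 / Z - w x / Z\<^sup>2 \<partial>m) \<le> (\<integral>x. 1 / w x \<partial>m)"
    proof (intro integral_mono iw)
      show "integrable m (\<lambda>x. 2 / Z - w x / Z\<^sup>2)" using w by simp
      fix x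
      have "0 \<le> (Z - w x)\<^sup>2 / (w x * Z\<^sup>2)" using w(2)[of x] by (simp add: less_imp_le)
      also have "\<dots> = 1 / w x - (2 / Z - w x / Z\<^sup>2)"
        using Z w(2)[of x] by (simp add: field_simps power2_eq_square)
      finally show "2 / Z - w x / Z\<^sup>2 \<le> 1 / w x" by simp
    qed
    moreover have "(\<integral>x. 2 / Z - w x / Z\<^sup>2 \<partial>m) = 1 / Z"
      using w Z by (simp add: m.prob_space flip: Z_def) (simp add: field_simps power2_eq_square)
    ultimately show ?thesis by simp
  qed
  then have iw0: "0 \<le> (\<integral>x. 1 / w x \<partial>m)" using Z by (meson order.trans zero_le_divide_1_iff less_imp_le)
  have pt: "prob_space (tilt m w)" using w by (intro prob_space_tilt m) auto
  have "\<bar>R\<bar> \<le> 1"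
  proof -
    interpret Q: prob_space "\<Pi>\<^sub>M i\<in>{..<n}. tilt m w" using pt by (intro prob_space_PiM)
    have "F \<in> borel_measurable (\<Pi>\<^sub>M i\<in>{..<n}. tilt m w)"
      using F(1) by (simp cong: measurable_cong_sets sets_PiM_cong)
    then have "integrable (\<Pi>\<^sub>M i\<in>{..<n}. tilt m w) F" using F(2) by (intro Q.integrable_const_bound[of _ 1]) auto
    then have "\<bar>R\<bar> \<le> (\<integral>x. 1 \<partial>(\<Pi>\<^sub>M i\<in>{..<n}. tilt m w))" unfolding R_def
      using F(2) by (intro order.trans[OF integral_abs_bound] integral_mono) auto
    then show ?thesis by (simp add: Q.prob_space)
  qed
  have FT: "\<bar>\<integral>x. F x * (\<Prod>i<n. T (x i)) \<partial>?P\<bar> \<le> Z' ^ n"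
  proof -
    have "\<bar>\<integral>x. F x * (\<Prod>i<n. T (x i)) \<partial>?P\<bar> \<le> (\<integral>x. \<bar>F x * (\<Prod>i<n. T (x i))\<bar> \<partial>?P)"
      by (rule integral_abs_bound)
    also have "\<dots> \<le> (\<integral>x. (\<Prod>i<n. T (x i)) \<partial>?P)"
    proof (rule integral_mono')
      show "\<bar>F x * (\<Prod>i<n. T (x i))\<bar> \<le> (\<Prod>i<n. T (x i))" for x
        using F(2)[of x] T(2) by (auto simp: abs_mult prod_nonneg intro!: mult_left_le_one_le)
    qed (auto intro!: integrable_PiM_prod m Ti prod_nonneg T(2))
    finally show ?thesis by (simp add: integral_PiM_prod[OF m Ti] Z'_def)
  qed
  have "\<bar>R'\<bar> \<le> 1"
  proof -
    have "Z' ^ n \<le> max Z' d ^ n" using Z' by (intro power_mono) auto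
    then show ?thesis unfolding R'_def using FT d by (simp add: abs_divide divide_le_eq)
  qed
  have main: "\<bar>R - R'\<bar> \<le> (2 * real n + 2) / d * E + 4 * d * (1 / Z)"
  proof -
    consider "Z < 2 * d" | "d < \<bar>Z' - Z\<bar>" | "2 * d \<le> Z" "\<bar>Z' - Z\<bar> \<le> d" by linarith
    then show ?thesis
    proof cases
      case 1
      have "\<bar>R - R'\<bar> \<le> 2" using \<open>\<bar>R\<bar> \<le> 1\<close> \<open>\<bar>R'\<bar> \<le> 1\<close> by linarith
      also have "2 \<le> 4 * d * (1 / Z)" using 1 Z by (simp add: field_simps)
      also have "\<dots> \<le> (2 * real n + 2) / d * E + 4 * d * (1 / Z)" using E d by simp
      finally show ?thesis .
    next
      case 2
      have "\<bar>R - R'\<bar> \<le> 2" using \<open>\<bar>R\<bar> \<le> 1\<close> \<open>\<bar>R'\<bar> \<le> 1\<close> by linarith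
      also have "2 \<le> 2 / d * E" using 2 ZZ' d by (simp add: field_simps)
      also have "\<dots> \<le> (2 * real n + 2) / d * E" using d E by (intro mult_right_mono divide_right_mono) auto
      also have "\<dots> \<le> (2 * real n + 2) / d * E + 4 * d * (1 / Z)" using d Z by simp
      finally show ?thesis .
    next
      case 3
      then have dZ': "d \<le> Z'" by linarith
      let ?a = "\<lambda>x. w x / Z" and ?b = "\<lambda>x. T x / Z'"
      have ab: "integrable m ?a" "integrable m ?b" using w Ti by auto
      have ab1: "(\<integral>x. ?a x \<partial>m) = 1" "(\<integral>x. ?b x \<partial>m) = 1"
        using Z dZ' d by (auto simp: Z_def[symmetric] Z'_def[symmetric])
      have Fp: "integrable ?P (\<lambda>x. F x * (\<Prod>i<n. c (x i)))" if "integrable m c" for c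
      proof (rule Bochner_Integration.integrable_bound[OF integrable_PiM_prod[OF m that, of n]])
        show "(\<lambda>x. F x * (\<Prod>i<n. c (x i))) \<in> borel_measurable ?P"
          using F(1) borel_measurable_integrable[OF integrable_PiM_prod[OF m that, of n]] by simp
      qed (use F(2) in \<open>auto simp: abs_mult intro!: mult_left_le_one_le\<close>)
      have "R' = (\<integral>x. F x * (\<Prod>i<n. ?b (x i)) \<partial>?P)"
        unfolding R'_def using dZ' by (simp add: max_def prod_dividef)
      moreover have "R = (\<integral>x. F x * (\<Prod>i<n. ?a (x i)) \<partial>?P)"
        unfolding R_def Z_def by (rule integral_PiM_tilt[OF m w F(1)])
      ultimately have "R - R' = (\<integral>x. F x * (\<Prod>i<n. ?a (x i)) - F x * (\<Prod>i<n. ?b (x i)) \<partial>?P)"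
        using Fp[OF ab(1)] Fp[OF ab(2)] by (simp only: Bochner_Integration.integral_diff)
      then have "\<bar>R - R'\<bar> \<le> (\<integral>x. \<bar>F x * (\<Prod>i<n. ?a (x i)) - F x * (\<Prod>i<n. ?b (x i))\<bar> \<partial>?P)"
        by (simp only: integral_abs_bound)
      also have "\<dots> \<le> (\<integral>x. \<bar>(\<Prod>i<n. ?a (x i)) - (\<Prod>i<n. ?b (x i))\<bar> \<partial>?P)"
      proof (rule integral_mono')
        show "\<bar>F x * (\<Prod>i<n. ?a (x i)) - F x * (\<Prod>i<n. ?b (x i))\<bar> \<le> \<bar>(\<Prod>i<n. ?a (x i)) - (\<Prod>i<n. ?b (x i))\<bar>" for x
          using F(2)[of x] by (simp only: right_diff_distrib[symmetric] abs_mult) (simp add: mult_left_le_one_le)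
      qed (auto intro!: integrable_PiM_prod m ab)
      also have "\<dots> \<le> n * (\<integral>x. \<bar>?a x - ?b x\<bar> \<partial>m)"
        by (rule integral_PiM_prod_diff_le[OF m ab _ _ ab1]) (use w(2) T(2) Z Z' in \<open>auto intro: less_imp_le\<close>)
      also have "(\<integral>x. \<bar>?a x - ?b x\<bar> \<partial>m) \<le> (\<integral>x. \<bar>T x - w x\<bar> / Z + T x * (\<bar>Z' - Z\<bar> / (Z * Z')) \<partial>m)"
      proof (rule integral_mono)
        show "integrable m (\<lambda>x. \<bar>?a x - ?b x\<bar>)" using ab by auto
        show "integrable m (\<lambda>x. \<bar>T x - w x\<bar> / Z + T x * (\<bar>Z' - Z\<bar> / (Z * Z')))" using w Ti by auto
        fix x
        \<comment> \<open>Error in the numerator plus error in the normalization; as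
          \<open>T\<close> has mass \<open>Z'\<close>, the second integrates to
          \<open>\<bar>Z' - Z\<bar> / Z\<close> in absolute value.\<close>
        have "?a x - ?b x = (w x - T x) / Z + T x * ((Z' - Z) / (Z * Z'))"
          using Z dZ' d by (simp add: field_simps)
        then have "\<bar>?a x - ?b x\<bar> \<le> \<bar>(w x - T x) / Z\<bar> + \<bar>T x * ((Z' - Z) / (Z * Z'))\<bar>"
          by (simp only: abs_triangle_ineq)
        then show "\<bar>?a x - ?b x\<bar> \<le> \<bar>T x - w x\<bar> / Z + T x * (\<bar>Z' - Z\<bar> / (Z * Z'))"
          using Z Z' T(2)[of x] by (simp add: abs_mult abs_divide abs_minus_commute)
      qed
      also have "\<dots> = E / Z + \<bar>Z' - Z\<bar> / Z"
        using w Ti dZ' d by (simp add: E_def flip: Z'_def)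
      also have "\<dots> \<le> E / Z + E / Z" using ZZ' Z by (intro add_left_mono divide_right_mono) auto
      also have "\<dots> \<le> E / d"
      proof -
        have "E / Z \<le> E / (2 * d)" using 3 d E by (intro divide_left_mono) auto
        then show ?thesis by simp
      qed
      finally have "\<bar>R - R'\<bar> \<le> n * (E / d)" by (simp add: mult_left_mono)
      also have "\<dots> \<le> (2 * real n + 2) * (E / d)" using E d by (intro mult_right_mono) auto
      also have "\<dots> \<le> (2 * real n + 2) / d * E + 4 * d * (1 / Z)" using d Z by simp
      finally show ?thesis .
    qed
  qed
  also have "\<dots> \<le> (2 * real n + 2) / d * E + 4 * d * (\<integral>x. 1 / w x \<partial>m)"
    using iZ d by (intro add_left_mono mult_left_mono) auto
  finally show ?thesis unfolding R_def R'_def E_def Z'_def .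
qed

text \<open>A power of the normalization is an integral over additional replicas, so a polynomial in
  place of the reciprocal turns the tilted average into a combination of integrals of products of
  \<open>T\<close> without denominators. Such products can be averaged over a Gaussian field
  explicitly. The factor \<open>B ^ n\<close> bounds the numerator that multiplies the error
  \<eta>.\<close>

lemma tilt_replicas_polynomial:
  fixes w T :: "'a \<Rightarrow> real" and F :: "(nat \<Rightarrow> 'a) \<Rightarrow> real"
  assumes m: "prob_space m" and w: "integrable m w" "\<And>x. 0 < w x" and iw: "integrable m (\<lambda>x. 1 / w x)"
    and T: "T \<in> borel_measurable m" "\<And>x. 0 \<le> T x" "\<And>x. T x \<le> B" and d: "0 < d"
    and F: "F \<in> borel_measurable (\<Pi>\<^sub>M i\<in>{..<n}. m)" "\<And>x. \<bar>F x\<bar> \<le> 1"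
    and dep: "\<And>x y. (\<And>i. i < n \<Longrightarrow> x i = y i) \<Longrightarrow> F x = F y"
    and p: "\<And>z. 0 \<le> z \<Longrightarrow> z \<le> B \<Longrightarrow> \<bar>(\<Sum>k\<le>D. p k * z ^ k) - 1 / max z d ^ n\<bar> \<le> \<eta>"
  shows "\<bar>(\<integral>x. F x \<partial>(\<Pi>\<^sub>M i\<in>{..<n}. tilt m w)) -
      (\<Sum>k\<le>D. p k * (\<integral>x. F x * (\<Prod>i<n + k. T (x i)) \<partial>(\<Pi>\<^sub>M i\<in>{..<n + k}. m)))\<bar>
    \<le> (2 * real n + 2) / d * (\<integral>x. \<bar>T x - w x\<bar> \<partial>m) + 4 * d * (\<integral>x. 1 / w x \<partial>m) + B ^ n * \<eta>"
proof -
  interpret m: prob_space m by fact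
  have Ti: "integrable m T" using T by (intro m.integrable_const_bound[of _ B]) auto
  define I where "I = (\<integral>x. F x * (\<Prod>i<n. T (x i)) \<partial>(\<Pi>\<^sub>M i\<in>{..<n}. m))"
  define Z where "Z = (\<integral>x. T x \<partial>m)"
  let ?P = "\<lambda>k::nat. \<Pi>\<^sub>M i\<in>{..<k}. m"
  have B: "0 \<le> B" using T(2,3) order.trans by blast
  have Z: "0 \<le> Z" "Z \<le> B" unfolding Z_def using T Ti m.integral_le_const[OF Ti, of B] by auto
  have step: "integrable (?P (n + k)) (\<lambda>x. F x * (\<Prod>i<n + k. T (x i))) \<and>
     (\<integral>x. F x * (\<Prod>i<n + k. T (x i)) \<partial>?P (n + k)) = I * Z ^ k" for k
  proof (induction k)
    case 0
    have "integrable (?P n) (\<lambda>x. F x * (\<Prod>i<n. T (x i)))"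
    proof (rule Bochner_Integration.integrable_bound[OF integrable_PiM_prod[OF m Ti, of n]])
      show "(\<lambda>x. F x * (\<Prod>i<n. T (x i))) \<in> borel_measurable (?P n)"
        using F(1) borel_measurable_integrable[OF integrable_PiM_prod[OF m Ti, of n]] by simp
    qed (use F(2) in \<open>auto simp: abs_mult intro!: mult_left_le_one_le\<close>)
    then show ?case by (simp add: I_def)
  next
    case (Suc k)
    have dep': "F x * (\<Prod>i<n + k. T (x i)) = F y * (\<Prod>i<n + k. T (y i))"
      if "\<And>i. i < n + k \<Longrightarrow> x i = y i" for x y
    proof -
      have "F x = F y" by (rule dep) (simp add: that)
      moreover have "(\<Prod>i<n + k. T (x i)) = (\<Prod>i<n + k. T (y i))" by (rule prod.cong) (auto simp: that)
      ultimately show ?thesis by simp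
    qed
    from integrable_PiM_Suc[OF m dep' conjunct1[OF Suc] Ti] integral_PiM_Suc[OF m dep' conjunct1[OF Suc] Ti]
    show ?case using Suc by (simp add: ac_simps Z_def)
  qed
  have Ile: "\<bar>I\<bar> \<le> B ^ n"
  proof -
    have "\<bar>I\<bar> \<le> (\<integral>x. \<bar>F x * (\<Prod>i<n. T (x i))\<bar> \<partial>?P n)" unfolding I_def by (rule integral_abs_bound)
    also have "\<dots> \<le> (\<integral>x. (\<Prod>i<n. T (x i)) \<partial>?P n)"
    proof (rule integral_mono')
      show "\<bar>F x * (\<Prod>i<n. T (x i))\<bar> \<le> (\<Prod>i<n. T (x i))" for x
        using F(2)[of x] T(2) by (auto simp: abs_mult prod_nonneg intro!: mult_left_le_one_le)
    qed (auto intro!: integrable_PiM_prod m Ti prod_nonneg T(2))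
    also have "\<dots> = Z ^ n" by (simp add: integral_PiM_prod[OF m Ti] Z_def)
    also have "\<dots> \<le> B ^ n" using Z by (intro power_mono) auto
    finally show ?thesis .
  qed
  have "(\<Sum>k\<le>D. p k * (\<integral>x. F x * (\<Prod>i<n + k. T (x i)) \<partial>?P (n + k))) = I * (\<Sum>k\<le>D. p k * Z ^ k)"
    using step by (simp add: sum_distrib_left ac_simps)
  then have "\<bar>I / max Z d ^ n - (\<Sum>k\<le>D. p k * (\<integral>x. F x * (\<Prod>i<n + k. T (x i)) \<partial>?P (n + k)))\<bar> =
      \<bar>I\<bar> * \<bar>(\<Sum>k\<le>D. p k * Z ^ k) - 1 / max Z d ^ n\<bar>"
    by (simp add: abs_mult[symmetric] right_diff_distrib abs_minus_commute)
  also have "\<dots> \<le> B ^ n * \<eta>"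
    using p[OF Z] Ile B by (intro mult_mono) auto
  finally show ?thesis
    using tilt_replicas_truncated[OF m w iw T d F] unfolding I_def Z_def by linarith
qed

section \<open>Trigonometric approximation of the exponential weight\<close>

interpretation std_normal: real_distribution std_normal_distribution
  by (rule real_dist_normal_dist)

lemma
  shows integrable_std_normal_exp: "integrable std_normal_distribution (\<lambda>x. exp (a * x))"
    and integral_std_normal_exp: "(\<integral>x. exp (a * x) \<partial>std_normal_distribution) = exp (a\<^sup>2 / 2)"
proof -
  have *: "std_normal_density x * exp (a * x) = exp (a\<^sup>2 / 2) * normal_density a 1 x" for x
  proof -
    have "- x\<^sup>2 / 2 + a * x = a\<^sup>2 / 2 + - (x - a)\<^sup>2 / 2" by (simp add: power2_eq_square algebra_simps add_divide_distrib diff_divide_distrib)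
    then have "exp (- x\<^sup>2 / 2) * exp (a * x) = exp (a\<^sup>2 / 2) * exp (- (x - a)\<^sup>2 / 2)"
      by (simp only: exp_add[symmetric])
    then show ?thesis by (simp add: normal_density_def)
  qed
  show "integrable std_normal_distribution (\<lambda>x. exp (a * x))"
    by (subst integrable_density) (simp_all add: * normal_density_nonneg)
  show "(\<integral>x. exp (a * x) \<partial>std_normal_distribution) = exp (a\<^sup>2 / 2)"
    by (subst integral_density) (simp_all add: * normal_density_nonneg)
qed

text \<open>The density of the normal law with mean \<open>lam\<close> and variance 1 relative to
  the standard one, so its standard Gaussian mean is 1.\<close>

definition gauss_weight :: "real \<Rightarrow> real \<Rightarrow> real" where
  "gauss_weight lam x = exp (lam * x - lam\<^sup>2 / 2)"

lemma gauss_weight_alt: "gauss_weight lam x = exp (- lam\<^sup>2 / 2) * exp (lam * x)"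
  by (simp add: gauss_weight_def exp_add[symmetric] algebra_simps)

lemma gauss_weight_measurable [measurable]: "gauss_weight lam \<in> borel_measurable borel"
  unfolding gauss_weight_def by measurable

lemma integrable_gauss_weight: "integrable std_normal_distribution (gauss_weight lam)"
  unfolding gauss_weight_alt[abs_def] by (intro integrable_mult_right integrable_std_normal_exp)

definition trig_poly :: "nat \<Rightarrow> (nat \<Rightarrow> complex) \<Rightarrow> (nat \<Rightarrow> real) \<Rightarrow> real \<Rightarrow> complex" where
  "trig_poly d c t x = (\<Sum>j<d. c j * cis (t j * x))"

text \<open>Terms are kept in a list, so that sums and products are again of this form by
  concatenating and mapping; the indexed form \<open>trig_poly\<close> is recovered at the
  end.\<close>

definition is_trig :: "(real \<Rightarrow> complex) \<Rightarrow> bool" where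
  "is_trig f \<longleftrightarrow> (\<exists>zs. \<forall>x. f x = (\<Sum>(c, t)\<leftarrow>zs. c * cis (t * x)))"

lemma is_trig_add: "is_trig f \<Longrightarrow> is_trig g \<Longrightarrow> is_trig (\<lambda>x. f x + g x)"
  unfolding is_trig_def
proof (elim exE)
  fix zs ys assume "\<forall>x. f x = (\<Sum>(c, t)\<leftarrow>zs. c * cis (t * x))" "\<forall>x. g x = (\<Sum>(c, t)\<leftarrow>ys. c * cis (t * x))"
  then show "\<exists>zs. \<forall>x. f x + g x = (\<Sum>(c, t)\<leftarrow>zs. c * cis (t * x))"
    by (intro exI[of _ "zs @ ys"]) simp
qed

lemma is_trig_cis: "is_trig (\<lambda>x. c * cis (t * x))"
  unfolding is_trig_def by (intro exI[of _ "[(c, t)]"]) simp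

lemma is_trig_const: "is_trig (\<lambda>x. c)"
  using is_trig_cis[of c 0] by simp

lemma is_trig_cis_mult: "is_trig f \<Longrightarrow> is_trig (\<lambda>x. c * cis (t * x) * f x)"
  unfolding is_trig_def
proof (elim exE)
  fix zs assume f: "\<forall>x. f x = (\<Sum>(c, t)\<leftarrow>zs. c * cis (t * x))"
  have "c * cis (t * x) * (\<Sum>(c, t)\<leftarrow>zs. c * cis (t * x)) = (\<Sum>(c', t')\<leftarrow>map (\<lambda>(a, s). (c * a, t + s)) zs. c' * cis (t' * x))" for x
    by (induction zs) (auto simp: algebra_simps cis_mult[symmetric])
  then show "\<exists>zs. \<forall>x. c * cis (t * x) * f x = (\<Sum>(c, t)\<leftarrow>zs. c * cis (t * x))"
    using f by metis
qed

lemma is_trig_mult: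
  assumes f: "is_trig f" and g: "is_trig g" shows "is_trig (\<lambda>x. f x * g x)"
proof -
  obtain zs where zs: "\<And>x. f x = (\<Sum>(c, t)\<leftarrow>zs. c * cis (t * x))" using f unfolding is_trig_def by blast
  have "is_trig (\<lambda>x. (\<Sum>(c, t)\<leftarrow>zs. c * cis (t * x)) * g x)"
  proof (induction zs)
    case Nil then show ?case using is_trig_const[of 0] by simp
  next
    case (Cons z zs)
    then show ?case using is_trig_add[OF is_trig_cis_mult[OF g, of "fst z" "snd z"]]
      by (simp add: distrib_right split_beta)
  qed
  then show ?thesis by (simp add: zs)
qed

lemma is_trig_power: "is_trig f \<Longrightarrow> is_trig (\<lambda>x. f x ^ n)"
  by (induction n) (auto intro: is_trig_mult is_trig_const)

lemma is_trig_sum: "(\<And>i. i \<in> I \<Longrightarrow> is_trig (f i)) \<Longrightarrow> is_trig (\<lambda>x. \<Sum>i\<in>I. f i x)"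
  by (induction I rule: infinite_finite_induct) (auto intro: is_trig_add is_trig_const)

lemma is_trig_sin: "is_trig (\<lambda>x. complex_of_real (sin (a * x)))"
proof -
  have "complex_of_real (sin y) = (- \<i> / 2) * cis y + (\<i> / 2) * cis (- y)" for y
    by (simp add: complex_eq_iff)
  then have "(\<lambda>x. complex_of_real (sin (a * x))) = (\<lambda>x. (- \<i> / 2) * cis (a * x) + (\<i> / 2) * cis (- a * x))"
    by simp
  then show ?thesis by (simp only:) (intro is_trig_add is_trig_cis)
qed

lemma is_trig_trig_poly:
  assumes "is_trig f" shows "\<exists>d c t. f = trig_poly d c t"
proof -
  obtain zs where zs: "\<And>x. f x = (\<Sum>(c, t)\<leftarrow>zs. c * cis (t * x))" using assms unfolding is_trig_def by blast
  have "f = trig_poly (length zs) (\<lambda>j. fst (zs ! j)) (\<lambda>j. snd (zs ! j))"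
    by (auto simp: zs trig_poly_def sum_list_sum_nth split_beta atLeast0LessThan)
  then show ?thesis by blast
qed

lemma abs_arcsin_sin_le: "\<bar>arcsin (sin x)\<bar> \<le> \<bar>x\<bar>"
proof (cases "\<bar>x\<bar> \<le> pi / 2")
  case True then show ?thesis by (subst arcsin_sin) auto
next
  case False
  have "- (pi / 2) \<le> arcsin (sin x)" "arcsin (sin x) \<le> pi / 2" using arcsin_bounded[of "sin x"] by auto
  then show ?thesis using False by linarith
qed

text \<open>Folding the line by \<open>arcsin \<circ> sin\<close> keeps the folded weight below \<open>exp (\<bar>lam\<bar> \<bar>x\<bar>)\<close>, and on
  the folded line Weierstrass' theorem gives a polynomial in the sine.\<close>

lemma trig_approx_gauss_weight:
  assumes e: "0 < e"
  shows "\<exists>d c t B. (\<forall>x. Im (trig_poly d c t x) = 0 \<and> 0 \<le> Re (trig_poly d c t x) \<and> Re (trig_poly d c t x) \<le> B) \<and>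
     (\<integral>x. \<bar>Re (trig_poly d c t x) - gauss_weight lam x\<bar> \<partial>std_normal_distribution) \<le> e"
proof -
  let ?N = std_normal_distribution
  \<comment> \<open>As a function of \<open>x\<close>, \<open>h k\<close> agrees with the weight
    where \<open>\<bar>x\<bar> \<le> Suc k * pi / 2\<close>, and it is a continuous function of
    \<open>sin (x / Suc k)\<close>.\<close>
  define f where "f k s = gauss_weight lam (real (Suc k) * arcsin s)" for k s
  define h where "h k x = f k (sin (x / real (Suc k)))" for k x
  have fold: "\<bar>real (Suc k) * arcsin (sin (x / real (Suc k)))\<bar> \<le> \<bar>x\<bar>" for k x
  proof -
    have "\<bar>real (Suc k) * arcsin (sin (x / real (Suc k)))\<bar> = real (Suc k) * \<bar>arcsin (sin (x / real (Suc k)))\<bar>"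
      by (simp add: abs_mult)
    also have "\<dots> \<le> real (Suc k) * \<bar>x / real (Suc k)\<bar>" by (intro mult_left_mono abs_arcsin_sin_le) auto
    also have "\<dots> = \<bar>x\<bar>" by (simp add: abs_divide)
    finally show ?thesis .
  qed
  \<comment> \<open>Folding may change the sign of the argument, so the dominating function contains
    both exponentials.\<close>
  have dom: "gauss_weight lam y \<le> exp (lam * x) + exp (- lam * x)" if "\<bar>y\<bar> \<le> \<bar>x\<bar>" for x y
  proof -
    have "\<bar>lam * y\<bar> \<le> \<bar>lam * x\<bar>" using that by (simp add: abs_mult mult_left_mono)
    then have "lam * y \<le> lam * x \<or> lam * y \<le> - lam * x" by linarith
    then have "exp (lam * y) \<le> exp (lam * x) \<or> exp (lam * y) \<le> exp (- lam * x)" by simp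
    then have "exp (lam * y) \<le> exp (lam * x) + exp (- lam * x)"
      using exp_gt_zero[of "lam * x"] exp_gt_zero[of "- lam * x"] by linarith
    moreover have "gauss_weight lam y \<le> exp (lam * y)" by (simp add: gauss_weight_def)
    ultimately show ?thesis by linarith
  qed
  have hm [measurable]: "h k \<in> borel_measurable borel" for k
    unfolding h_def f_def gauss_weight_def by (intro borel_measurable_continuous_onI continuous_intros) auto
  have lim: "(\<lambda>k. \<integral>x. \<bar>h k x - gauss_weight lam x\<bar> \<partial>?N) \<longlonglongrightarrow> (\<integral>x. 0 \<partial>?N)"
  proof (rule integral_dominated_convergence[where w = "\<lambda>x. exp (lam * x) + exp (- lam * x)"])
    show "AE x in ?N. (\<lambda>k. \<bar>h k x - gauss_weight lam x\<bar>) \<longlonglongrightarrow> 0"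
    proof (rule AE_I2, rule tendsto_eventually)
      fix x
      obtain k0 :: nat where k0: "\<bar>x\<bar> \<le> real k0" using real_arch_simple by blast
      have "\<bar>h k x - gauss_weight lam x\<bar> = 0" if "k0 \<le> k" for k
      proof -
        have "\<bar>x / real (Suc k)\<bar> \<le> 1" using k0 that by (simp add: abs_divide)
        then have "- (pi / 2) \<le> x / real (Suc k)" "x / real (Suc k) \<le> pi / 2"
          using pi_gt3 by linarith+
        then have "arcsin (sin (x / real (Suc k))) = x / real (Suc k)" by (intro arcsin_sin)
        then show ?thesis by (simp add: h_def f_def)
      qed
      then show "\<forall>\<^sub>F k in sequentially. \<bar>h k x - gauss_weight lam x\<bar> = 0"
        by (auto simp: eventually_sequentially)
    qed
    show "AE x in ?N. norm \<bar>h k x - gauss_weight lam x\<bar> \<le> exp (lam * x) + exp (- lam * x)" for k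
    proof (rule AE_I2)
      fix x
      have "h k x \<le> exp (lam * x) + exp (- lam * x)"
        unfolding h_def f_def by (rule dom[OF fold])
      moreover have "gauss_weight lam x \<le> exp (lam * x) + exp (- lam * x)" by (rule dom) simp
      moreover have "0 \<le> h k x" "0 \<le> gauss_weight lam x" by (auto simp: h_def f_def gauss_weight_def)
      ultimately show "norm \<bar>h k x - gauss_weight lam x\<bar> \<le> exp (lam * x) + exp (- lam * x)" by simp
    qed
    show "integrable ?N (\<lambda>x. exp (lam * x) + exp (- lam * x))"
      by (intro Bochner_Integration.integrable_add integrable_std_normal_exp)
  qed auto
  then have "\<forall>\<^sub>F k in sequentially. (\<integral>x. \<bar>h k x - gauss_weight lam x\<bar> \<partial>?N) < e / 2"
    using e by (intro order_tendstoD) auto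
  then obtain k where k: "(\<integral>x. \<bar>h k x - gauss_weight lam x\<bar> \<partial>?N) < e / 2"
    by (auto simp: eventually_sequentially)
  \<comment> \<open>Raising the function by \<open>e / 4\<close> before approximating it within
    \<open>e / 4\<close> keeps the polynomial nonnegative; the total deviation stays below
    \<open>e / 2\<close>.\<close>
  have "continuous_on {-1..1} (\<lambda>s. f k s + e / 4)"
    unfolding f_def gauss_weight_def by (intro continuous_intros) auto
  then obtain g where g: "real_polynomial_function g" "\<And>s. s \<in> {-1..1} \<Longrightarrow> \<bar>f k s + e / 4 - g s\<bar> < e / 4"
    using Stone_Weierstrass_real_polynomial_function[of "{-1..1::real}" "\<lambda>s. f k s + e / 4" "e / 4"] e
    by (auto simp: less_imp_le)
  obtain a m where am: "g = (\<lambda>s. \<Sum>i\<le>m. a i * s ^ i)"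
    using g(1) unfolding real_polynomial_function_iff_sum by blast
  define T where "T x = g (sin (x / real (Suc k)))" for x
  have "is_trig (\<lambda>x. \<Sum>i\<le>m. complex_of_real (a i) * complex_of_real (sin (1 / real (Suc k) * x)) ^ i)"
    by (intro is_trig_sum is_trig_mult is_trig_const is_trig_power is_trig_sin)
  also have "(\<lambda>x. \<Sum>i\<le>m. complex_of_real (a i) * complex_of_real (sin (1 / real (Suc k) * x)) ^ i) =
      (\<lambda>x. complex_of_real (T x))"
    by (auto simp: T_def am)
  finally obtain d c t where dct: "(\<lambda>x. complex_of_real (T x)) = trig_poly d c t"
    using is_trig_trig_poly by blast
  have ReT: "Re (trig_poly d c t x) = T x" "Im (trig_poly d c t x) = 0" for x
    using fun_cong[OF dct, of x, symmetric] by simp_all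
  have near: "\<bar>h k x + e / 4 - T x\<bar> < e / 4" for x
    unfolding h_def T_def by (rule g) auto
  have h0: "0 \<le> h k x" for x by (auto simp: h_def f_def gauss_weight_def)
  have hB: "h k x \<le> exp (\<bar>lam\<bar> * (real (Suc k) * (pi / 2)))" for x
  proof -
    let ?y = "real (Suc k) * arcsin (sin (x / real (Suc k)))"
    have "\<bar>arcsin (sin (x / real (Suc k)))\<bar> \<le> pi / 2"
      using arcsin_bounded[of "sin (x / real (Suc k))"] by auto
    then have "\<bar>?y\<bar> \<le> real (Suc k) * (pi / 2)" by (simp add: abs_mult mult_left_mono)
    then have "\<bar>lam * ?y\<bar> \<le> \<bar>lam\<bar> * (real (Suc k) * (pi / 2))" unfolding abs_mult by (rule mult_left_mono) simp
    then have "lam * ?y - lam\<^sup>2 / 2 \<le> \<bar>lam\<bar> * (real (Suc k) * (pi / 2))"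
      using zero_le_power2[of lam] by linarith
    then show ?thesis by (simp only: h_def f_def gauss_weight_def exp_le_cancel_iff)
  qed
  have Tm: "T \<in> borel_measurable borel" unfolding T_def am by measurable
  have T0: "0 \<le> T x" for x using near[of x] h0[of x] unfolding abs_less_iff by linarith
  have TB: "T x \<le> exp (\<bar>lam\<bar> * (real (Suc k) * (pi / 2))) + e" for x
    using near[of x] hB[of x] unfolding abs_less_iff by linarith
  have hi: "integrable ?N (h k)"
    by (rule Bochner_Integration.integrable_bound[where f = "\<lambda>_. exp (\<bar>lam\<bar> * (real (Suc k) * (pi / 2)))"])
       (use hB h0 in auto)
  have Ti: "integrable ?N T"
    by (rule std_normal.integrable_const_bound[where B = "exp (\<bar>lam\<bar> * (real (Suc k) * (pi / 2))) + e"])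
       (use TB T0 Tm in auto)
  have "(\<integral>x. \<bar>T x - gauss_weight lam x\<bar> \<partial>?N) \<le> (\<integral>x. \<bar>h k x - gauss_weight lam x\<bar> + e / 2 \<partial>?N)"
  proof (rule integral_mono)
    show "integrable ?N (\<lambda>x. \<bar>T x - gauss_weight lam x\<bar>)"
      using Ti integrable_gauss_weight by auto
    show "integrable ?N (\<lambda>x. \<bar>h k x - gauss_weight lam x\<bar> + e / 2)"
      using hi integrable_gauss_weight[of lam] std_normal.prob_space
      by (intro Bochner_Integration.integrable_add integrable_abs Bochner_Integration.integrable_diff) auto
    show "\<bar>T x - gauss_weight lam x\<bar> \<le> \<bar>h k x - gauss_weight lam x\<bar> + e / 2" for x
      using near[of x] by linarith
  qed
  also have "\<dots> = (\<integral>x. \<bar>h k x - gauss_weight lam x\<bar> \<partial>?N) + e / 2"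
    using hi integrable_gauss_weight[of lam] std_normal.prob_space by (subst Bochner_Integration.integral_add) auto
  also have "\<dots> \<le> e" using k by simp
  finally show ?thesis using T0 TB ReT by (intro exI[of _ d] exI[of _ c] exI[of _ t]) auto
qed

text \<open>The order of the choices matters: \<delta> depends only on \<open>e\<close> and
  \<open>C\<close>, then the trigonometric polynomial is fitted to an accuracy proportional to
  \<delta>, this fixes its bound \<open>B\<close>, and only then are \<eta> and the polynomial for
  the truncated reciprocal chosen on \<open>{0..B}\<close>. Each of the three error terms gets a
  third of \<open>e\<close>.\<close>

lemma cavity_parameters:
  fixes n :: nat
  assumes e: "0 < e" and C: "0 < C"
  obtains d c t B D p \<delta> \<eta> where
    "\<And>x. Im (trig_poly d c t x) = 0" "\<And>x. 0 \<le> Re (trig_poly d c t x)" "\<And>x. Re (trig_poly d c t x) \<le> B"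
    "0 < \<delta>" "\<And>z. 0 \<le> z \<Longrightarrow> z \<le> B \<Longrightarrow> \<bar>(\<Sum>k\<le>D. p k * z ^ k) - 1 / max z \<delta> ^ n\<bar> \<le> \<eta>"
    "(2 * real n + 2) / \<delta> * (\<integral>x. \<bar>Re (trig_poly d c t x) - gauss_weight lam x\<bar> \<partial>std_normal_distribution)
       + 4 * \<delta> * C + B ^ n * \<eta> \<le> e"
proof -
  define \<delta> where "\<delta> = e / (12 * C)"
  have d: "0 < \<delta>" using e C by (simp add: \<delta>_def)
  obtain d c t B where T: "\<And>x. Im (trig_poly d c t x) = 0 \<and> 0 \<le> Re (trig_poly d c t x) \<and> Re (trig_poly d c t x) \<le> B"
    and I: "(\<integral>x. \<bar>Re (trig_poly d c t x) - gauss_weight lam x\<bar> \<partial>std_normal_distribution) \<le> e * \<delta> / (3 * (2 * real n + 2))"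
    using trig_approx_gauss_weight[of "e * \<delta> / (3 * (2 * real n + 2))" lam] e d by auto
  have B: "0 \<le> B" using T by (meson order.trans)
  define \<eta> where "\<eta> = e / (3 * (B ^ n + 1))"
  have eta: "0 < \<eta>" using e B by (simp add: \<eta>_def add_nonneg_pos)
  have "continuous_on {0..B} (\<lambda>z. 1 / max z \<delta> ^ n)"
    using d by (intro continuous_intros) (auto simp: max_def)
  then obtain g where g: "real_polynomial_function g" "\<And>z. z \<in> {0..B} \<Longrightarrow> \<bar>1 / max z \<delta> ^ n - g z\<bar> < \<eta>"
    using Stone_Weierstrass_real_polynomial_function[of "{0..B}" "\<lambda>z. 1 / max z \<delta> ^ n" "\<eta>"] eta by auto
  obtain p D where p: "g = (\<lambda>s. \<Sum>i\<le>D. p i * s ^ i)"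
    using g(1) unfolding real_polynomial_function_iff_sum by blast
  have "\<bar>(\<Sum>k\<le>D. p k * z ^ k) - 1 / max z \<delta> ^ n\<bar> \<le> \<eta>" if "0 \<le> z" "z \<le> B" for z
    using g(2)[of z] that by (simp add: p abs_minus_commute)
  moreover have "(2 * real n + 2) / \<delta> * (\<integral>x. \<bar>Re (trig_poly d c t x) - gauss_weight lam x\<bar> \<partial>std_normal_distribution)
       + 4 * \<delta> * C + B ^ n * \<eta> \<le> e"
  proof -
    have "(2 * real n + 2) / \<delta> * (\<integral>x. \<bar>Re (trig_poly d c t x) - gauss_weight lam x\<bar> \<partial>std_normal_distribution) \<le>
      (2 * real n + 2) / \<delta> * (e * \<delta> / (3 * (2 * real n + 2)))" using I d by (intro mult_left_mono) auto
    also have "\<dots> = e / 3"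
    proof -
      have "a / \<delta> * (e * \<delta> / (3 * a)) = e / 3" if "0 < a" for a using that d by simp
      from this[of "2 * real n + 2"] show ?thesis by (simp only:)
    qed
    finally have 1: "(2 * real n + 2) / \<delta> * (\<integral>x. \<bar>Re (trig_poly d c t x) - gauss_weight lam x\<bar> \<partial>std_normal_distribution) \<le> e / 3" .
    have 2: "4 * \<delta> * C = e / 3" using C by (simp add: \<delta>_def)
    have "B ^ n * \<eta> \<le> (B ^ n + 1) * \<eta>" using eta by (intro mult_right_mono) auto
    also have "\<dots> = e / 3"
    proof -
      have cancel: "a * (e / (3 * a)) = e / 3" if "a \<noteq> 0" for a using that by simp
      have "B ^ n + 1 \<noteq> 0" using zero_le_power[OF B, of n] by linarith
      then show ?thesis unfolding \<eta>_def by (rule cancel)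
    qed
    finally show ?thesis using 1 2 by linarith
  qed
  ultimately show ?thesis using T d by (intro that[where d = d and c = c and t = t and B = B and D = D and p = p and \<delta> = \<delta> and \<eta> = \<eta>]) auto
qed

section \<open>The finite-dimensional test functions\<close>

text \<open>For a real trigonometric polynomial with these data and a centered Gaussian vector with
  covariance \<open>q\<close>, this is the mean of the product of the polynomial over the first
  \<open>k\<close> coordinates: expanding the product leaves characteristic functions. In this form
  it makes sense for every matrix and is continuous in it.\<close>

definition overlap_char :: "nat \<Rightarrow> (nat \<Rightarrow> complex) \<Rightarrow> (nat \<Rightarrow> real) \<Rightarrow> nat \<Rightarrow> (nat \<Rightarrow> nat \<Rightarrow> real) \<Rightarrow> real" where
  "overlap_char d c t k q = Re (\<Sum>\<phi>\<in>PiE {..<k} (\<lambda>_. {..<d}). (\<Prod>i<k. c (\<phi> i)) *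
     complex_of_real (exp (- (\<Sum>i<k. \<Sum>j<k. t (\<phi> i) * t (\<phi> j) * q i j) / 2)))"

text \<open>The factors \<open>g\<close> are dampings of the frequencies. They compensate for a
  field \<kappa> whose variances are below those of \<open>q\<close>: the hypothesis on
  \<open>v\<close> says that damping and characteristic function together yield the quadratic form
  of \<open>q\<close>. For a field with the full variances, \<open>g\<close> is 1.\<close>

lemma integral_prod_trig:
  assumes L: "prob_space L" and \<kappa> [measurable]: "\<And>i. \<kappa> i \<in> borel_measurable L"
    and char: "\<And>s :: nat \<Rightarrow> real. (\<integral>l. cis (\<Sum>i<k. s i * \<kappa> i l) \<partial>L) = complex_of_real (exp (- v s / 2))"
    and v: "\<And>\<phi>. (\<Prod>i<k. g i (\<phi> i)) * exp (- v (\<lambda>i. t (\<phi> i)) / 2) = exp (- (\<Sum>i<k. \<Sum>j<k. t (\<phi> i) * t (\<phi> j) * q i j) / 2)"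
    and real: "\<And>i l. i < k \<Longrightarrow> l \<in> space L \<Longrightarrow> complex_of_real (T i l) = (\<Sum>j<d. c j * complex_of_real (g i j) * cis (t j * \<kappa> i l))"
  shows "(\<integral>l. (\<Prod>i<k. T i l) \<partial>L) = overlap_char d c t k q"
proof -
  interpret L: prob_space L by fact
  let ?\<Phi> = "PiE {..<k} (\<lambda>_. {..<d})"
  have fin: "finite ?\<Phi>" by (intro finite_PiE) auto
  have prod_cis: "(\<Prod>i<k. cis (s i)) = cis (\<Sum>i<k. s i)" for s :: "nat \<Rightarrow> real"
    by (induction k) (auto simp: cis_mult)
  have int: "integrable L (\<lambda>l. cis (\<Sum>i<k. t (\<phi> i) * \<kappa> i l))" for \<phi>
    by (rule L.integrable_const_bound[of _ 1]) (auto simp: cis_conv_exp)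
  have "complex_of_real (\<integral>l. (\<Prod>i<k. T i l) \<partial>L) = (\<integral>l. (\<Prod>i<k. complex_of_real (T i l)) \<partial>L)"
    by (simp add: integral_complex_of_real flip: of_real_prod)
  also have "\<dots> = (\<integral>l. (\<Sum>\<phi>\<in>?\<Phi>. (\<Prod>i<k. c (\<phi> i) * complex_of_real (g i (\<phi> i))) * cis (\<Sum>i<k. t (\<phi> i) * \<kappa> i l)) \<partial>L)"
  proof (intro Bochner_Integration.integral_cong refl)
    fix l assume "l \<in> space L"
    then have "(\<Prod>i<k. complex_of_real (T i l)) =
        (\<Prod>i<k. \<Sum>j<d. c j * complex_of_real (g i j) * cis (t j * \<kappa> i l))"
      by (intro prod.cong refl real) auto
    also have "\<dots> = (\<Sum>\<phi>\<in>?\<Phi>. \<Prod>i<k. c (\<phi> i) * complex_of_real (g i (\<phi> i)) * cis (t (\<phi> i) * \<kappa> i l))"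
      by (rule prod_sum_PiE) auto
    also have "\<dots> = (\<Sum>\<phi>\<in>?\<Phi>. (\<Prod>i<k. c (\<phi> i) * complex_of_real (g i (\<phi> i))) * cis (\<Sum>i<k. t (\<phi> i) * \<kappa> i l))"
      by (simp add: prod.distrib prod_cis)
    finally show "(\<Prod>i<k. complex_of_real (T i l)) =
      (\<Sum>\<phi>\<in>?\<Phi>. (\<Prod>i<k. c (\<phi> i) * complex_of_real (g i (\<phi> i))) * cis (\<Sum>i<k. t (\<phi> i) * \<kappa> i l))" .
  qed
  also have "\<dots> = (\<Sum>\<phi>\<in>?\<Phi>. (\<Prod>i<k. c (\<phi> i) * complex_of_real (g i (\<phi> i))) * complex_of_real (exp (- v (\<lambda>i. t (\<phi> i)) / 2)))"
    using int by (simp add: char)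
  also have "\<dots> = (\<Sum>\<phi>\<in>?\<Phi>. (\<Prod>i<k. c (\<phi> i)) * complex_of_real (exp (- (\<Sum>i<k. \<Sum>j<k. t (\<phi> i) * t (\<phi> j) * q i j) / 2)))"
    proof (intro sum.cong refl)
    fix \<phi>
    have "(\<Prod>i<k. c (\<phi> i) * complex_of_real (g i (\<phi> i))) * complex_of_real (exp (- v (\<lambda>i. t (\<phi> i)) / 2)) =
        (\<Prod>i<k. c (\<phi> i)) * complex_of_real ((\<Prod>i<k. g i (\<phi> i)) * exp (- v (\<lambda>i. t (\<phi> i)) / 2))"
      by (simp add: prod.distrib)
    then show "(\<Prod>i<k. c (\<phi> i) * complex_of_real (g i (\<phi> i))) * complex_of_real (exp (- v (\<lambda>i. t (\<phi> i)) / 2)) =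
        (\<Prod>i<k. c (\<phi> i)) * complex_of_real (exp (- (\<Sum>i<k. \<Sum>j<k. t (\<phi> i) * t (\<phi> j) * q i j) / 2))"
      by (simp only: v)
  qed
  finally show ?thesis
    unfolding overlap_char_def by (metis Re_complex_of_real)
qed

lemma continuous_overlap_char: "continuous_on S (overlap_char d c t k)"
  unfolding overlap_char_def by (intro continuous_intros continuous_matrix_entry) auto

lemma overlap_char_cong:
  "(\<And>i j. i < k \<Longrightarrow> j < k \<Longrightarrow> q i j = q' i j) \<Longrightarrow> overlap_char d c t k q = overlap_char d c t k q'"
  unfolding overlap_char_def by (intro arg_cong[of _ _ Re] sum.cong refl) simp

text \<open>Positive semidefiniteness keeps every exponential at most 1, so the coefficients alone
  give a bound.\<close>

lemma overlap_char_bounded: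
  "\<exists>K. \<forall>q\<in>rost_matrices. \<bar>overlap_char d c t k q\<bar> \<le> K"
proof (intro exI ballI)
  fix q assume q: "q \<in> rost_matrices"
  let ?\<Phi> = "PiE {..<k} (\<lambda>_. {..<d})"
  have "\<bar>overlap_char d c t k q\<bar> \<le> cmod (\<Sum>\<phi>\<in>?\<Phi>. (\<Prod>i<k. c (\<phi> i)) *
     complex_of_real (exp (- (\<Sum>i<k. \<Sum>j<k. t (\<phi> i) * t (\<phi> j) * q i j) / 2)))"
    unfolding overlap_char_def by (rule abs_Re_le_cmod)
  also have "\<dots> \<le> (\<Sum>\<phi>\<in>?\<Phi>. cmod (\<Prod>i<k. c (\<phi> i)))"
  proof (intro order.trans[OF norm_sum] sum_mono)
    fix \<phi>
    have "0 \<le> (\<Sum>i<k. \<Sum>j<k. t (\<phi> i) * t (\<phi> j) * q i j)"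
      using q unfolding rost_matrices_def by (auto dest!: spec[of _ k] spec[of _ "\<lambda>i. t (\<phi> i)"])
    then show "cmod ((\<Prod>i<k. c (\<phi> i)) * complex_of_real (exp (- (\<Sum>i<k. \<Sum>j<k. t (\<phi> i) * t (\<phi> j) * q i j) / 2)))
        \<le> cmod (\<Prod>i<k. c (\<phi> i))"
      by (simp add: norm_mult mult_left_le)
  qed
  finally show "\<bar>overlap_char d c t k q\<bar> \<le> (\<Sum>\<phi>\<in>?\<Phi>. cmod (\<Prod>i<k. c (\<phi> i)))" .
qed

text \<open>The field average of the polynomial expression in
  \<open>tilt_replicas_polynomial\<close>, written as a function of the overlaps alone. It is
  continuous for a block test \<open>F\<close>, so its integral passes to weak-* limits.\<close>

definition cavity_test :: "((nat \<Rightarrow> nat \<Rightarrow> real) \<Rightarrow> real) \<Rightarrow> nat \<Rightarrow> nat \<Rightarrow> (nat \<Rightarrow> real) \<Rightarrow>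
    nat \<Rightarrow> (nat \<Rightarrow> complex) \<Rightarrow> (nat \<Rightarrow> real) \<Rightarrow> (nat \<Rightarrow> nat \<Rightarrow> real) \<Rightarrow> real" where
  "cavity_test F n D p d c t q = (\<Sum>k\<le>D. p k * (F q * overlap_char d c t (n + k) q))"

lemma continuous_cavity_test:
  "block_test n F \<Longrightarrow> continuous_on S (cavity_test F n D p d c t)"
  unfolding cavity_test_def block_test_def
  by (intro continuous_intros continuous_overlap_char) (auto intro: continuous_on_subset)

section \<open>Random tilts of random measures\<close>

text \<open>The diagonal is set to 1 even where \<open>Q x x\<close> is smaller, as on the ball; two
  replicas that happen to coincide at a point \<open>x\<close> still have the overlap
  \<open>Q x x\<close>.\<close>

definition replica_overlap :: "('a \<Rightarrow> 'a \<Rightarrow> real) \<Rightarrow> (nat \<Rightarrow> 'a) \<Rightarrow> nat \<Rightarrow> nat \<Rightarrow> real" where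
  "replica_overlap Q v i j = (if i = j then 1 else Q (v i) (v j))"

lemma integral_PiM_UNIV_restrict:
  fixes G :: "(nat \<Rightarrow> 'a) \<Rightarrow> 'b::{banach, second_countable_topology}"
  assumes m: "prob_space m" and G: "G \<in> borel_measurable (\<Pi>\<^sub>M i\<in>{..<k}. m)"
    and dep: "\<And>x y. (\<And>i. i < k \<Longrightarrow> x i = y i) \<Longrightarrow> G x = G y"
  shows "(\<integral>x. G x \<partial>(\<Pi>\<^sub>M i\<in>UNIV. m)) = (\<integral>x. G x \<partial>(\<Pi>\<^sub>M i\<in>{..<k}. m))"
proof -
  interpret product_prob_space "\<lambda>_ :: nat. m" UNIV
    using m by (intro product_prob_spaceI)
  have "(\<integral>x. G x \<partial>(\<Pi>\<^sub>M i\<in>{..<k}. m)) = (\<integral>x. G x \<partial>distr (\<Pi>\<^sub>M i\<in>UNIV. m) (\<Pi>\<^sub>M i\<in>{..<k}. m) (\<lambda>x. restrict x {..<k}))"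
    by (subst distr_PiM_restrict_finite) auto
  also have "\<dots> = (\<integral>x. G (restrict x {..<k}) \<partial>(\<Pi>\<^sub>M i\<in>UNIV. m))"
    by (rule integral_distr[OF measurable_restrict_subset G]) simp
  also have "\<dots> = (\<integral>x. G x \<partial>(\<Pi>\<^sub>M i\<in>UNIV. m))"
    by (intro Bochner_Integration.integral_cong refl dep) simp
  finally show ?thesis by simp
qed

text \<open>This is the source of uniformity in the random measure: bounds that hold at every point
  pass to every \<open>m\<close> with the same constant, and Tonelli yields integrability in
  \<open>x\<close> for almost every \<open>l\<close>.\<close>

lemma fubini_nonneg_bound:
  fixes g :: "'l \<Rightarrow> 'a \<Rightarrow> real"
  assumes L: "prob_space L" and m: "prob_space m"
    and g [measurable]: "(\<lambda>(l, x). g l x) \<in> borel_measurable (L \<Otimes>\<^sub>M m)" and nonneg: "\<And>l x. 0 \<le> g l x"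
    and int: "\<And>x. x \<in> space m \<Longrightarrow> integrable L (\<lambda>l. g l x)"
    and le: "\<And>x. x \<in> space m \<Longrightarrow> (\<integral>l. g l x \<partial>L) \<le> K"
  shows "AE l in L. integrable m (g l)" "integrable L (\<lambda>l. \<integral>x. g l x \<partial>m)" "(\<integral>l. \<integral>x. g l x \<partial>m \<partial>L) \<le> K"
proof -
  interpret L: prob_space L by fact
  interpret m: prob_space m by fact
  interpret pair_prob_space L m ..
  have "(\<integral>\<^sup>+ z. ennreal (norm (case z of (l, x) \<Rightarrow> g l x)) \<partial>(L \<Otimes>\<^sub>M m)) = (\<integral>\<^sup>+ x. \<integral>\<^sup>+ l. ennreal (g l x) \<partial>L \<partial>m)"
    using nonneg by (subst nn_integral_snd[symmetric]) auto
  also have "\<dots> \<le> (\<integral>\<^sup>+ x. ennreal K \<partial>m)"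
    using int le nonneg by (intro nn_integral_mono) (simp add: nn_integral_eq_integral ennreal_leI)
  finally have fin: "(\<integral>\<^sup>+ z. ennreal (norm (case z of (l, x) \<Rightarrow> g l x)) \<partial>(L \<Otimes>\<^sub>M m)) < \<infinity>"
    by (simp add: m.emeasure_space_1 order.strict_trans1)
  have pair: "integrable (L \<Otimes>\<^sub>M m) (\<lambda>(l, x). g l x)"
    using g fin by (rule integrableI_bounded)
  show "AE l in L. integrable m (g l)" "integrable L (\<lambda>l. \<integral>x. g l x \<partial>m)"
    using AE_integrable_fst[OF pair] integrable_fst[OF pair] by auto
  have "(\<integral>l. \<integral>x. g l x \<partial>m \<partial>L) = (\<integral>x. \<integral>l. g l x \<partial>L \<partial>m)"
    using integral_fst[OF pair] integral_snd[OF pair] by simp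
  also have "\<dots> \<le> K"
    using integrable_snd[OF pair] le by (intro m.integral_le_const AE_I2)
  finally show "(\<integral>l. \<integral>x. g l x \<partial>m \<partial>L) \<le> K" .
qed

text \<open>\<open>L\<close> carries the randomness of the field, \<open>w\<close> is the exact
  weight and \<open>T\<close> its bounded substitute. The field meets the overlaps in
  \<open>integral_prod_T\<close>; the constants \<open>C\<close> and \<open>E\<close> are uniform
  over the points of \<open>X\<close>. The ball and the finite configuration spaces both fit
  in.\<close>

locale cavity_model = prob_space L
  for L :: "'l measure" +
  fixes X :: "'a measure" and Q :: "'a \<Rightarrow> 'a \<Rightarrow> real" and w T :: "'l \<Rightarrow> 'a \<Rightarrow> real"
    and d :: nat and c :: "nat \<Rightarrow> complex" and t :: "nat \<Rightarrow> real" and B C E :: real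
  assumes w_measurable [measurable]: "(\<lambda>(l, x). w l x) \<in> borel_measurable (L \<Otimes>\<^sub>M X)"
    and T_measurable [measurable]: "(\<lambda>(l, x). T l x) \<in> borel_measurable (L \<Otimes>\<^sub>M X)"
    and Q_measurable [measurable]: "(\<lambda>(x, y). Q x y) \<in> borel_measurable (X \<Otimes>\<^sub>M X)"
    and w_pos: "\<And>l x. 0 < w l x" and T_nonneg: "\<And>l x. 0 \<le> T l x" and T_le: "\<And>l x. T l x \<le> B"
    and integrable_w: "\<And>x. x \<in> space X \<Longrightarrow> integrable L (\<lambda>l. w l x)"
    and integral_w: "\<And>x. x \<in> space X \<Longrightarrow> (\<integral>l. w l x \<partial>L) \<le> C"
    and integrable_inverse_w: "\<And>x. x \<in> space X \<Longrightarrow> integrable L (\<lambda>l. 1 / w l x)"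
    and integral_inverse_w: "\<And>x. x \<in> space X \<Longrightarrow> (\<integral>l. 1 / w l x \<partial>L) \<le> C"
    and integral_T_w: "\<And>x. x \<in> space X \<Longrightarrow> (\<integral>l. \<bar>T l x - w l x\<bar> \<partial>L) \<le> E"
    and overlap_rost: "\<And>v. (\<And>i. v i \<in> space X) \<Longrightarrow> replica_overlap Q v \<in> rost_matrices"
    and integral_prod_T: "\<And>k v. (\<And>i. i < k \<Longrightarrow> v i \<in> space X) \<Longrightarrow>
       (\<integral>l. (\<Prod>i<k. T l (v i)) \<partial>L) = overlap_char d c t k (replica_overlap Q v)"
begin

lemma measurable_replica_overlap: "replica_overlap Q \<in> (\<Pi>\<^sub>M i\<in>UNIV. X) \<rightarrow>\<^sub>M rost_algebra"
proof (rule measurable_into_rost)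
  fix i j :: nat
  have "(\<lambda>v. (v i, v j)) \<in> (\<Pi>\<^sub>M i\<in>UNIV. X) \<rightarrow>\<^sub>M X \<Otimes>\<^sub>M X" by measurable
  from measurable_compose[OF this Q_measurable]
  show "(\<lambda>v. replica_overlap Q v i j) \<in> borel_measurable (\<Pi>\<^sub>M i\<in>UNIV. X)"
    by (simp add: replica_overlap_def)
qed (auto intro!: overlap_rost simp: space_PiM)

text \<open>Points of the finite product carry replicas only in the first \<open>k\<close>
  coordinates; the remaining entries are set to 0 so that the matrix is measurable there.\<close>

lemma measurable_finite_overlap:
  "(\<lambda>v i j. if i < k \<and> j < k then replica_overlap Q v i j else 0) \<in> (\<Pi>\<^sub>M i\<in>{..<k}. X) \<rightarrow>\<^sub>M borel"
proof (rule measurable_into_matrix)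
  fix i j :: nat
  show "(\<lambda>v. if i < k \<and> j < k then replica_overlap Q v i j else 0) \<in> borel_measurable (\<Pi>\<^sub>M i\<in>{..<k}. X)"
  proof (cases "i < k \<and> j < k")
    case True
    then have "(\<lambda>v. (v i, v j)) \<in> (\<Pi>\<^sub>M i\<in>{..<k}. X) \<rightarrow>\<^sub>M X \<Otimes>\<^sub>M X"
      by (intro measurable_Pair measurable_component_singleton) auto
    from measurable_compose[OF this Q_measurable] True show ?thesis
      by (simp add: replica_overlap_def)
  next
    case False
    then have "(\<lambda>v. if i < k \<and> j < k then replica_overlap Q v i j else 0) = (\<lambda>_. 0)" by auto
    then show ?thesis by simp
  qed
qed

lemma measurable_block_overlap:
  assumes G: "continuous_on UNIV G" and dep: "\<And>q q'. (\<And>i j. i < k \<Longrightarrow> j < k \<Longrightarrow> q i j = q' i j) \<Longrightarrow> G q = (G q' :: real)"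
    and kN: "k \<le> N"
  shows "(\<lambda>v. G (replica_overlap Q v)) \<in> borel_measurable (\<Pi>\<^sub>M i\<in>{..<N}. X)"
proof -
  have "(\<lambda>v. G (\<lambda>i j. if i < N \<and> j < N then replica_overlap Q v i j else 0)) \<in> borel_measurable (\<Pi>\<^sub>M i\<in>{..<N}. X)"
    by (rule measurable_compose[OF measurable_finite_overlap borel_measurable_continuous_onI[OF G]])
  also have "(\<lambda>v. G (\<lambda>i j. if i < N \<and> j < N then replica_overlap Q v i j else 0)) = (\<lambda>v. G (replica_overlap Q v))"
    using kN by (intro ext dep) auto
  finally show ?thesis .
qed

lemma replica_overlap_dep:
  assumes "\<And>i. i < k \<Longrightarrow> v i = v' i" "\<And>q q'. (\<And>i j. i < k \<Longrightarrow> j < k \<Longrightarrow> q i j = q' i j) \<Longrightarrow> G q = G q'"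
  shows "G (replica_overlap Q v) = G (replica_overlap Q v')"
  using assms(1) by (intro assms(2)) (simp add: replica_overlap_def)

context
  fixes n :: nat and F D p \<delta> \<eta>
  assumes F: "block_test n F" and \<delta>: "0 < \<delta>"
    and p: "\<And>z. 0 \<le> z \<Longrightarrow> z \<le> B \<Longrightarrow> \<bar>(\<Sum>k\<le>D. p k * z ^ k) - 1 / max z \<delta> ^ n\<bar> \<le> \<eta>"
begin

lemma F_dep: "(\<And>i j. i < n \<Longrightarrow> j < n \<Longrightarrow> q i j = q' i j) \<Longrightarrow> F q = F q'"
  using F by (auto simp: block_test_def)

lemma F_bound: "\<bar>F q\<bar> \<le> 1"
  using F by (auto simp: block_test_def)

text \<open>For fixed replicas the mean over the field is \<open>overlap_char\<close>, so Fubini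
  gives an integral over \<open>n + k\<close> replicas; since the integrand depends on this block
  only, it may be read on the infinite product, which is the same for all \<open>k\<close>.\<close>

lemma integral_cavity_test:
  assumes m: "m \<in> space (prob_algebra X)"
  shows "(\<integral>l. (\<Sum>k\<le>D. p k * (\<integral>v. F (replica_overlap Q v) * (\<Prod>i<n + k. T l (v i)) \<partial>(\<Pi>\<^sub>M i\<in>{..<n + k}. m))) \<partial>L)
     = (\<integral>v. cavity_test F n D p d c t (replica_overlap Q v) \<partial>(\<Pi>\<^sub>M i\<in>UNIV. m))"
    and "integrable L (\<lambda>l. \<Sum>k\<le>D. p k * (\<integral>v. F (replica_overlap Q v) * (\<Prod>i<n + k. T l (v i)) \<partial>(\<Pi>\<^sub>M i\<in>{..<n + k}. m)))"
proof -
  have pm: "prob_space m" and sm [measurable_cong]: "sets m = sets X" using m by (auto simp: space_prob_algebra)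
  have spm: "space m = space X" using sets_eq_imp_space_eq[OF sm] .
  interpret m: prob_space m by fact
  have "0 \<le> B" using T_nonneg T_le by (rule order.trans)
  let ?P = "\<lambda>k. \<Pi>\<^sub>M i\<in>{..<n + k}. m"
  let ?f = "\<lambda>k l v. F (replica_overlap Q v) * (\<Prod>i<n + k. T l (v i))"
  have Fm [measurable]: "(\<lambda>v. F (replica_overlap Q v)) \<in> borel_measurable (?P k)" for k
  proof -
    have "(\<lambda>v. F (replica_overlap Q v)) \<in> borel_measurable (\<Pi>\<^sub>M i\<in>{..<n + k}. X)"
      using F by (intro measurable_block_overlap[where k = n] F_dep) (auto simp: block_test_def)
    then show ?thesis by (simp cong: measurable_cong_sets sets_PiM_cong add: sm)
  qed
  have Tm: "(\<lambda>z. T (fst z) (snd z i)) \<in> borel_measurable (L \<Otimes>\<^sub>M ?P k)" if "i < n + k" for i k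
  proof -
    have "(\<lambda>z. (fst z, snd z i)) \<in> L \<Otimes>\<^sub>M ?P k \<rightarrow>\<^sub>M L \<Otimes>\<^sub>M m"
      using that by (intro measurable_Pair measurable_fst measurable_compose[OF measurable_snd measurable_component_singleton]) auto
    then have "(\<lambda>z. (fst z, snd z i)) \<in> L \<Otimes>\<^sub>M ?P k \<rightarrow>\<^sub>M L \<Otimes>\<^sub>M X"
      by (simp cong: measurable_cong_sets sets_pair_measure_cong add: sm)
    from measurable_compose[OF this T_measurable] show ?thesis by simp
  qed
  have bound: "\<bar>?f k l v\<bar> \<le> B ^ (n + k)" for k l v
  proof -
    have "\<bar>?f k l v\<bar> = \<bar>F (replica_overlap Q v)\<bar> * (\<Prod>i<n + k. T l (v i))"
      by (simp add: abs_mult prod_nonneg T_nonneg)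
    also have "\<dots> \<le> 1 * (\<Prod>i<n + k. B)"
      using T_nonneg T_le by (intro mult_mono prod_mono F_bound prod_nonneg) auto
    finally show ?thesis by simp
  qed
  have Pk: "prob_space (?P k)" for k using pm by (intro prob_space_PiM)
  have pair: "integrable (L \<Otimes>\<^sub>M ?P k) (\<lambda>(l, v). ?f k l v)" for k
  proof -
    interpret P: prob_space "?P k" by (rule Pk)
    interpret LP: pair_prob_space L "?P k" ..
    show ?thesis
    proof (rule LP.integrable_const_bound[of _ "B ^ (n + k)"])
      show "AE z in L \<Otimes>\<^sub>M ?P k. norm (case z of (l, v) \<Rightarrow> ?f k l v) \<le> B ^ (n + k)"
        using bound by (intro AE_I2) (simp add: split_beta)
      have "(\<lambda>z. F (replica_overlap Q (snd z)) * (\<Prod>i<n + k. T (fst z) (snd z i))) \<in> borel_measurable (L \<Otimes>\<^sub>M ?P k)"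
        by (intro borel_measurable_times borel_measurable_prod Tm measurable_compose[OF measurable_snd Fm]) auto
      then show "(\<lambda>(l, v). ?f k l v) \<in> borel_measurable (L \<Otimes>\<^sub>M ?P k)" by (simp add: split_beta)
    qed
  qed
  have swap: "integrable L (\<lambda>l. \<integral>v. ?f k l v \<partial>?P k)"
      "(\<integral>l. \<integral>v. ?f k l v \<partial>?P k \<partial>L) = (\<integral>v. F (replica_overlap Q v) * overlap_char d c t (n + k) (replica_overlap Q v) \<partial>?P k)" for k
  proof -
    interpret P: prob_space "?P k" by (rule Pk)
    interpret LP: pair_prob_space L "?P k" ..
    show "integrable L (\<lambda>l. \<integral>v. ?f k l v \<partial>?P k)" using LP.integrable_fst[OF pair] .
    have "(\<integral>l. \<integral>v. ?f k l v \<partial>?P k \<partial>L) = (\<integral>v. \<integral>l. ?f k l v \<partial>L \<partial>?P k)"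
      using LP.integral_fst[OF pair] LP.integral_snd[OF pair] by simp
    also have "\<dots> = (\<integral>v. F (replica_overlap Q v) * overlap_char d c t (n + k) (replica_overlap Q v) \<partial>?P k)"
    proof (intro Bochner_Integration.integral_cong refl)
      fix v assume "v \<in> space (?P k)"
      then have "i < n + k \<Longrightarrow> v i \<in> space X" for i by (auto simp: space_PiM spm)
      then show "(\<integral>l. ?f k l v \<partial>L) = F (replica_overlap Q v) * overlap_char d c t (n + k) (replica_overlap Q v)"
        using integral_prod_T[of "n + k" v] by simp
    qed
    finally show "(\<integral>l. \<integral>v. ?f k l v \<partial>?P k \<partial>L) = (\<integral>v. F (replica_overlap Q v) * overlap_char d c t (n + k) (replica_overlap Q v) \<partial>?P k)" .
  qed
  show "integrable L (\<lambda>l. \<Sum>k\<le>D. p k * (\<integral>v. ?f k l v \<partial>?P k))"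
    using swap(1) by auto
  let ?U = "\<Pi>\<^sub>M i\<in>(UNIV :: nat set). m"
  interpret U: prob_space ?U using pm by (intro prob_space_PiM)
  define g where "g k q = F q * overlap_char d c t (n + k) q" for k q
  have g_cont: "continuous_on UNIV (g k)" for k
    unfolding g_def using F by (intro continuous_intros continuous_overlap_char) (auto simp: block_test_def)
  have g_dep: "g k q = g k q'" if "\<And>i j. i < n + k \<Longrightarrow> j < n + k \<Longrightarrow> q i j = q' i j" for k q q'
  proof -
    have "F q = F q'" by (rule F_dep) (simp add: that)
    moreover have "overlap_char d c t (n + k) q = overlap_char d c t (n + k) q'" by (rule overlap_char_cong) (simp add: that)
    ultimately show ?thesis by (simp add: g_def)
  qed
  have gU: "(\<integral>v. g k (replica_overlap Q v) \<partial>?U) = (\<integral>v. g k (replica_overlap Q v) \<partial>?P k)" for k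
  proof (rule integral_PiM_UNIV_restrict[OF pm])
    have "(\<lambda>v. g k (replica_overlap Q v)) \<in> borel_measurable (\<Pi>\<^sub>M i\<in>{..<n + k}. X)"
      by (rule measurable_block_overlap[where k = "n + k", OF g_cont g_dep]) auto
    then show "(\<lambda>v. g k (replica_overlap Q v)) \<in> borel_measurable (?P k)"
      by (simp cong: measurable_cong_sets sets_PiM_cong add: sm)
    show "\<And>x y. (\<And>i. i < n + k \<Longrightarrow> x i = y i) \<Longrightarrow> g k (replica_overlap Q x) = g k (replica_overlap Q y)"
      by (rule replica_overlap_dep[where k = "n + k" and G = "g k", OF _ g_dep])
  qed
  have int_g: "integrable ?U (\<lambda>v. g k (replica_overlap Q v))" for k
  proof -
    obtain K where K: "\<And>q. q \<in> rost_matrices \<Longrightarrow> \<bar>overlap_char d c t (n + k) q\<bar> \<le> K"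
      using overlap_char_bounded by blast
    show ?thesis
    proof (rule U.integrable_const_bound[of _ K])
      have "\<bar>g k q\<bar> \<le> K" if "q \<in> rost_matrices" for q
        using mult_mono[OF F_bound[of q] K[OF that]] by (simp add: g_def abs_mult)
      then show "AE v in ?U. norm (g k (replica_overlap Q v)) \<le> K"
        by (intro AE_I2) (auto intro!: overlap_rost simp: space_PiM spm)
      have "(\<lambda>v. g k (replica_overlap Q v)) \<in> borel_measurable (\<Pi>\<^sub>M i\<in>UNIV. X)"
        by (rule measurable_compose[OF measurable_replica_overlap])
           (simp add: rost_algebra_def measurable_restrict_space1 borel_measurable_continuous_onI g_cont)
      then show "(\<lambda>v. g k (replica_overlap Q v)) \<in> borel_measurable ?U"
        by (simp cong: measurable_cong_sets sets_PiM_cong add: sm)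
    qed
  qed
  have "(\<integral>l. (\<Sum>k\<le>D. p k * (\<integral>v. ?f k l v \<partial>?P k)) \<partial>L) = (\<Sum>k\<le>D. p k * (\<integral>v. g k (replica_overlap Q v) \<partial>?P k))"
    using swap by (simp add: g_def)
  also have "\<dots> = (\<Sum>k\<le>D. p k * (\<integral>v. g k (replica_overlap Q v) \<partial>?U))"
    by (simp only: gU)
  also have "\<dots> = (\<integral>v. (\<Sum>k\<le>D. p k * g k (replica_overlap Q v)) \<partial>?U)"
    using int_g by simp
  also have "\<dots> = (\<integral>v. cavity_test F n D p d c t (replica_overlap Q v) \<partial>?U)"
    by (simp add: cavity_test_def g_def)
  finally show "(\<integral>l. (\<Sum>k\<le>D. p k * (\<integral>v. ?f k l v \<partial>?P k)) \<partial>L)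
     = (\<integral>v. cavity_test F n D p d c t (replica_overlap Q v) \<partial>?U)" .
qed

lemma measurable_tilted_integral:
  "(\<lambda>z. \<integral>v. F (replica_overlap Q v) \<partial>(\<Pi>\<^sub>M i\<in>UNIV. tilt (fst z) (w (snd z)))) \<in> borel_measurable (prob_algebra X \<Otimes>\<^sub>M L)"
proof -
  have "(\<lambda>z. tilt (fst z) (w (snd z))) \<in> prob_algebra X \<Otimes>\<^sub>M L \<rightarrow>\<^sub>M prob_algebra X"
    using measurable_tilt[OF w_measurable] w_pos by (simp add: split_beta')
  from measurable_compose[OF this measurable_PiM_kernel[where I = UNIV]]
  have "(\<lambda>z. \<Pi>\<^sub>M i\<in>UNIV. tilt (fst z) (w (snd z))) \<in> prob_algebra X \<Otimes>\<^sub>M L \<rightarrow>\<^sub>M prob_algebra (\<Pi>\<^sub>M i\<in>(UNIV :: nat set). X)" .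
  moreover have "(\<lambda>v. F (replica_overlap Q v)) \<in> borel_measurable (\<Pi>\<^sub>M i\<in>UNIV. X)"
    by (rule measurable_compose[OF measurable_replica_overlap block_test_rost_measurable[OF F]])
  ultimately show ?thesis
    by (intro measurable_compose[OF _ integral_measurable_subprob_algebra] measurable_prob_algebraD)
qed

lemma tilted_integral_approx_fixed:
  assumes m: "m \<in> space (prob_algebra X)"
  shows "\<bar>(\<integral>l. \<integral>v. F (replica_overlap Q v) \<partial>(\<Pi>\<^sub>M i\<in>UNIV. tilt m (w l)) \<partial>L) -
      (\<integral>v. cavity_test F n D p d c t (replica_overlap Q v) \<partial>(\<Pi>\<^sub>M i\<in>UNIV. m))\<bar>
    \<le> (2 * real n + 2) / \<delta> * E + 4 * \<delta> * C + B ^ n * \<eta>"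
proof -
  have pm: "prob_space m" and sm [measurable_cong]: "sets m = sets X" using m by (auto simp: space_prob_algebra)
  have spm: "space m = space X" using sets_eq_imp_space_eq[OF sm] .
  interpret m: prob_space m by fact
  have Lm: "sets (L \<Otimes>\<^sub>M m) = sets (L \<Otimes>\<^sub>M X)" by (rule sets_pair_measure_cong) (auto simp: sm)
  have wm [measurable]: "(\<lambda>(l, x). w l x) \<in> borel_measurable (L \<Otimes>\<^sub>M m)"
    using w_measurable by (simp cong: measurable_cong_sets add: Lm)
  have Tm [measurable]: "(\<lambda>(l, x). T l x) \<in> borel_measurable (L \<Otimes>\<^sub>M m)"
    using T_measurable by (simp cong: measurable_cong_sets add: Lm)
  define R where "R l = (\<integral>v. F (replica_overlap Q v) \<partial>(\<Pi>\<^sub>M i\<in>UNIV. tilt m (w l)))" for l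
  define S where "S l = (\<Sum>k\<le>D. p k * (\<integral>v. F (replica_overlap Q v) * (\<Prod>i<n + k. T l (v i)) \<partial>(\<Pi>\<^sub>M i\<in>{..<n + k}. m)))" for l
  \<comment> \<open>The random error for a fixed field; it is affine in two integrals whose means
    over \<open>l\<close> are at most \<open>E\<close> and \<open>C\<close>.\<close>
  define u where "u l = (2 * real n + 2) / \<delta> * (\<integral>x. \<bar>T l x - w l x\<bar> \<partial>m) + 4 * \<delta> * (\<integral>x. 1 / w l x \<partial>m) + B ^ n * \<eta>" for l
  have intT: "integrable L (\<lambda>l. T l x)" if "x \<in> space X" for x
    using that T_nonneg T_le by (intro integrable_const_bound[of _ B]) auto
  have TwI: "AE l in L. integrable m (\<lambda>x. \<bar>T l x - w l x\<bar>)" "integrable L (\<lambda>l. \<integral>x. \<bar>T l x - w l x\<bar> \<partial>m)"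
    "(\<integral>l. \<integral>x. \<bar>T l x - w l x\<bar> \<partial>m \<partial>L) \<le> E"
    by (rule fubini_nonneg_bound[where g = "\<lambda>l x. \<bar>T l x - w l x\<bar>", OF prob_space_axioms pm],
        use integral_T_w intT integrable_w spm in \<open>auto\<close>)+
  have iwI: "AE l in L. integrable m (\<lambda>x. 1 / w l x)" "integrable L (\<lambda>l. \<integral>x. 1 / w l x \<partial>m)"
    "(\<integral>l. \<integral>x. 1 / w l x \<partial>m \<partial>L) \<le> C"
    by (rule fubini_nonneg_bound[where g = "\<lambda>l x. 1 / w l x", OF prob_space_axioms pm],
        use integral_inverse_w integrable_inverse_w spm w_pos in \<open>auto simp: less_imp_le\<close>)+
  have wI: "AE l in L. integrable m (\<lambda>x. w l x)"
    by (rule fubini_nonneg_bound[where g = w, OF prob_space_axioms pm],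
        use integral_w integrable_w spm w_pos in \<open>auto simp: less_imp_le\<close>)
  have RS: "AE l in L. \<bar>R l - S l\<bar> \<le> u l"
    using wI iwI(1) AE_space
  proof eventually_elim
    case (elim l)
    have Tl: "T l \<in> borel_measurable m" using elim(3) by measurable
    have wl: "w l \<in> borel_measurable m" using elim(3) by measurable
    have Fm: "(\<lambda>v. F (replica_overlap Q v)) \<in> borel_measurable (\<Pi>\<^sub>M i\<in>{..<n}. X)"
      using F by (intro measurable_block_overlap[where k = n] F_dep) (auto simp: block_test_def)
    have Fmm: "(\<lambda>v. F (replica_overlap Q v)) \<in> borel_measurable (\<Pi>\<^sub>M i\<in>{..<n}. m)"
      using Fm by (simp cong: measurable_cong_sets sets_PiM_cong add: sm)
    have Fmt: "(\<lambda>v. F (replica_overlap Q v)) \<in> borel_measurable (\<Pi>\<^sub>M i\<in>{..<n}. tilt m (w l))"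
      using Fm by (simp cong: measurable_cong_sets sets_PiM_cong add: sm)
    have dep: "F (replica_overlap Q x) = F (replica_overlap Q y)" if "\<And>i. i < n \<Longrightarrow> x i = y i" for x y
      by (rule replica_overlap_dep[where k = n, OF that F_dep]) auto
    have "R l = (\<integral>v. F (replica_overlap Q v) \<partial>(\<Pi>\<^sub>M i\<in>{..<n}. tilt m (w l)))"
      unfolding R_def by (rule integral_PiM_UNIV_restrict[OF prob_space_tilt[OF pm wl w_pos] Fmt dep])
    then show ?case
      unfolding S_def u_def
      using tilt_replicas_polynomial[OF pm elim(1) w_pos elim(2) Tl T_nonneg T_le \<delta> Fmm F_bound dep p] by simp
  qed
  have u_int: "integrable L u" unfolding u_def using TwI(2) iwI(2) by auto
  have Rm: "R \<in> borel_measurable L"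
  proof -
    have "(\<lambda>l. (m, l)) \<in> L \<rightarrow>\<^sub>M prob_algebra X \<Otimes>\<^sub>M L" using m by measurable
    from measurable_compose[OF this measurable_tilted_integral] show ?thesis unfolding R_def[abs_def] by simp
  qed
  have S_int: "integrable L S" unfolding S_def[abs_def] by (rule integral_cavity_test[OF m])
  have R_int: "integrable L R"
  proof (rule integrable_const_bound[of _ 1])
    show "AE l in L. norm (R l) \<le> 1"
    proof (rule AE_I2)
      fix l assume l: "l \<in> space L"
      have wl: "w l \<in> borel_measurable m" using l by measurable
      interpret U: prob_space "\<Pi>\<^sub>M i\<in>(UNIV :: nat set). tilt m (w l)"
        by (intro prob_space_PiM prob_space_tilt[OF pm wl w_pos])
      have "norm (R l) \<le> (\<integral>v. 1 \<partial>(\<Pi>\<^sub>M i\<in>(UNIV :: nat set). tilt m (w l)))"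
        unfolding R_def real_norm_def
        by (rule order.trans[OF integral_abs_bound integral_mono']) (use F_bound in auto)
      then show "norm (R l) \<le> 1" by (simp add: U.prob_space)
    qed
  qed (rule Rm)
  have "\<bar>(\<integral>l. R l \<partial>L) - (\<integral>l. S l \<partial>L)\<bar> = \<bar>\<integral>l. R l - S l \<partial>L\<bar>"
    using R_int S_int by simp
  also have "\<dots> \<le> (\<integral>l. \<bar>R l - S l\<bar> \<partial>L)" by (rule integral_abs_bound)
  also have "\<dots> \<le> (\<integral>l. u l \<partial>L)"
    using R_int S_int u_int RS by (intro integral_mono_AE) auto
  also have "\<dots> = (2 * real n + 2) / \<delta> * (\<integral>l. \<integral>x. \<bar>T l x - w l x\<bar> \<partial>m \<partial>L) + 4 * \<delta> * (\<integral>l. \<integral>x. 1 / w l x \<partial>m \<partial>L) + B ^ n * \<eta>"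
    unfolding u_def using TwI(2) iwI(2) by (simp add: prob_space)
  also have "\<dots> \<le> (2 * real n + 2) / \<delta> * E + 4 * \<delta> * C + B ^ n * \<eta>"
    using TwI(3) iwI(3) \<delta> by (intro add_right_mono add_mono mult_left_mono) auto
  finally show ?thesis
    using integral_cavity_test(1)[OF m] unfolding R_def S_def by simp
qed

text \<open>The error bound for a fixed measure does not depend on that measure, so averaging over
  the law \<open>D'\<close> costs nothing.\<close>

lemma tilted_integral_approx:
  assumes D': "D' \<in> space (prob_algebra (prob_algebra X))"
  shows "\<bar>(\<integral>m. \<integral>l. \<integral>v. F (replica_overlap Q v) \<partial>(\<Pi>\<^sub>M i\<in>UNIV. tilt m (w l)) \<partial>L \<partial>D') -
      (\<integral>m. \<integral>v. cavity_test F n D p d c t (replica_overlap Q v) \<partial>(\<Pi>\<^sub>M i\<in>UNIV. m) \<partial>D')\<bar>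
    \<le> (2 * real n + 2) / \<delta> * E + 4 * \<delta> * C + B ^ n * \<eta>" (is "\<bar>(\<integral>m. ?R m \<partial>D') - (\<integral>m. ?S m \<partial>D')\<bar> \<le> ?b")
proof -
  have pD: "prob_space D'" and sD [measurable_cong]: "sets D' = sets (prob_algebra X)"
    using D' by (auto simp: space_prob_algebra)
  interpret D: prob_space D' by fact
  have spD: "space D' = space (prob_algebra X)" using sets_eq_imp_space_eq[OF sD] .
  have Rm: "?R \<in> borel_measurable D'"
  proof -
    have "(\<lambda>(m, l). \<integral>v. F (replica_overlap Q v) \<partial>(\<Pi>\<^sub>M i\<in>UNIV. tilt m (w l))) \<in> borel_measurable (D' \<Otimes>\<^sub>M L)"
      using measurable_tilted_integral by (simp add: split_beta' cong: measurable_cong_sets sets_pair_measure_cong add: sD)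
    then show ?thesis by (rule borel_measurable_lebesgue_integral)
  qed
  have Sm: "?S \<in> borel_measurable D'"
  proof -
    have "(\<lambda>v. cavity_test F n D p d c t (replica_overlap Q v)) \<in> borel_measurable (\<Pi>\<^sub>M i\<in>UNIV. X)"
      by (rule measurable_compose[OF measurable_replica_overlap])
         (simp add: rost_algebra_def measurable_restrict_space1 borel_measurable_continuous_onI continuous_cavity_test[OF F])
    then have "?S \<in> borel_measurable (prob_algebra X)"
      by (intro measurable_compose[OF measurable_PiM_kernel[THEN measurable_prob_algebraD] integral_measurable_subprob_algebra])
    then show ?thesis by (simp cong: measurable_cong_sets add: sD)
  qed
  have Rb: "\<bar>?R m\<bar> \<le> 1" if m: "m \<in> space D'" for m
  proof -
    have pm: "prob_space m" and sm [measurable_cong]: "sets m = sets X" using m by (auto simp: spD space_prob_algebra)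
    have inner: "\<bar>\<integral>v. F (replica_overlap Q v) \<partial>(\<Pi>\<^sub>M i\<in>UNIV. tilt m (w l))\<bar> \<le> 1" if l: "l \<in> space L" for l
    proof -
      have wl: "w l \<in> borel_measurable m" using l by measurable
      interpret U: prob_space "\<Pi>\<^sub>M i\<in>(UNIV :: nat set). tilt m (w l)"
        by (intro prob_space_PiM prob_space_tilt[OF pm wl w_pos])
      have "\<bar>\<integral>v. F (replica_overlap Q v) \<partial>(\<Pi>\<^sub>M i\<in>UNIV. tilt m (w l))\<bar> \<le> (\<integral>v. 1 \<partial>(\<Pi>\<^sub>M i\<in>(UNIV :: nat set). tilt m (w l)))"
        by (rule order.trans[OF integral_abs_bound integral_mono']) (use F_bound in auto)
      then show ?thesis by (simp add: U.prob_space)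
    qed
    have "\<bar>?R m\<bar> \<le> (\<integral>l. 1 \<partial>L)"
      by (rule order.trans[OF integral_abs_bound integral_mono']) (use inner in auto)
    then show ?thesis by (simp add: prob_space)
  qed
  have close: "\<bar>?R m - ?S m\<bar> \<le> ?b" if "m \<in> space D'" for m
    using tilted_integral_approx_fixed[of m] that by (simp add: spD)
  have R_int: "integrable D' ?R"
    using Rb Rm by (intro D.integrable_const_bound[of _ 1]) auto
  have S_int: "integrable D' ?S"
  proof (intro D.integrable_const_bound[of _ "1 + ?b"] AE_I2 Sm)
    fix m assume m: "m \<in> space D'"
    show "norm (?S m) \<le> 1 + ?b" using Rb[OF m] close[OF m] by simp
  qed
  have "\<bar>(\<integral>m. ?R m \<partial>D') - (\<integral>m. ?S m \<partial>D')\<bar> = \<bar>\<integral>m. ?R m - ?S m \<partial>D'\<bar>"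
    using R_int S_int by simp
  also have "\<dots> \<le> (\<integral>m. \<bar>?R m - ?S m\<bar> \<partial>D')" by (rule integral_abs_bound)
  also have "\<dots> \<le> ?b"
    using R_int S_int close by (intro D.integral_le_const AE_I2) auto
  finally show ?thesis .
qed

end

end

section \<open>The Gaussian cavity field\<close>

lemma integral_std_normal_cis: "(\<integral>x. cis (s * x) \<partial>std_normal_distribution) = complex_of_real (exp (- s\<^sup>2 / 2))"
  using fun_cong[OF char_std_normal_distribution, of s] by (simp add: char_def cis_conv_exp)

text \<open>Levy's uniqueness theorem. The factor \<open>a\<close> may be 0, so degenerate Gaussian
  laws are covered by the same formula.\<close>

lemma distr_scaled_normalI:
  assumes M: "prob_space M" and X [measurable]: "X \<in> borel_measurable M"
    and char: "\<And>s. (\<integral>\<omega>. cis (s * X \<omega>) \<partial>M) = complex_of_real (exp (- (s * a)\<^sup>2 / 2))"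
  shows "distr M borel X = distr std_normal_distribution borel (\<lambda>x. a * x)"
proof (rule Levy_uniqueness)
  interpret M: prob_space M by fact
  show "real_distribution (distr M borel X)" by (rule M.real_distribution_distr) simp
  show "real_distribution (distr std_normal_distribution borel (\<lambda>x. a * x))"
    by (rule std_normal.real_distribution_distr) simp
  show "char (distr M borel X) = char (distr std_normal_distribution borel ((*) a))"
  proof
    fix s
    have "char (distr M borel X) s = (\<integral>\<omega>. cis (s * X \<omega>) \<partial>M)"
      by (simp add: char_def integral_distr cis_conv_exp)
    also have "\<dots> = (\<integral>x. cis (s * a * x) \<partial>std_normal_distribution)"
      by (simp add: char integral_std_normal_cis)
    also have "\<dots> = char (distr std_normal_distribution borel ((*) a)) s"
      by (simp add: char_def integral_distr cis_conv_exp ac_simps)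
    finally show "char (distr M borel X) s = char (distr std_normal_distribution borel ((*) a)) s" .
  qed
qed

lemma
  assumes M: "prob_space M" and X [measurable]: "X \<in> borel_measurable M"
    and char: "\<And>s. (\<integral>\<omega>. cis (s * X \<omega>) \<partial>M) = complex_of_real (exp (- (s * a)\<^sup>2 / 2))"
  shows integrable_exp_of_char: "integrable M (\<lambda>\<omega>. exp (b * X \<omega>))"
    and integral_exp_of_char: "(\<integral>\<omega>. exp (b * X \<omega>) \<partial>M) = exp ((b * a)\<^sup>2 / 2)"
    and integral_square_of_char: "(\<integral>\<omega>. (X \<omega>)\<^sup>2 \<partial>M) = a\<^sup>2"
    and integrable_square_of_char: "integrable M (\<lambda>\<omega>. (X \<omega>)\<^sup>2)"
proof -
  note d = distr_scaled_normalI[OF assms]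
  have I: "integrable M (\<lambda>\<omega>. f (X \<omega>)) \<longleftrightarrow> integrable std_normal_distribution (\<lambda>x. f (a * x))"
    and J: "(\<integral>\<omega>. f (X \<omega>) \<partial>M) = (\<integral>x. f (a * x) \<partial>std_normal_distribution)"
    if [measurable]: "f \<in> borel_measurable borel" for f :: "real \<Rightarrow> real"
  proof -
    have "integrable (distr M borel X) f \<longleftrightarrow> integrable (distr std_normal_distribution borel (\<lambda>x. a * x)) f"
      by (simp only: d)
    then show "integrable M (\<lambda>\<omega>. f (X \<omega>)) \<longleftrightarrow> integrable std_normal_distribution (\<lambda>x. f (a * x))"
      by (simp add: integrable_distr_eq)
    have "integral\<^sup>L (distr M borel X) f = integral\<^sup>L (distr std_normal_distribution borel (\<lambda>x. a * x)) f"
      by (simp only: d)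
    then show "(\<integral>\<omega>. f (X \<omega>) \<partial>M) = (\<integral>x. f (a * x) \<partial>std_normal_distribution)"
      by (simp add: integral_distr)
  qed
  have e: "(\<lambda>x. exp (b * (a * x))) = (\<lambda>x. exp (b * a * x))" by (simp add: mult.assoc)
  show "integrable M (\<lambda>\<omega>. exp (b * X \<omega>))"
    by (subst I) (simp_all add: e integrable_std_normal_exp)
  show "(\<integral>\<omega>. exp (b * X \<omega>) \<partial>M) = exp ((b * a)\<^sup>2 / 2)"
    by (subst J) (simp_all add: e integral_std_normal_exp)
  have m2: "(\<integral>x. x\<^sup>2 \<partial>std_normal_distribution) = 1"
    using std_normal_distribution_even_moments(1)[of 1] by (simp add: fact_numeral)
  show "(\<integral>\<omega>. (X \<omega>)\<^sup>2 \<partial>M) = a\<^sup>2"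
    by (subst J) (simp_all add: power_mult_distrib m2)
  show "integrable M (\<lambda>\<omega>. (X \<omega>)\<^sup>2)"
    by (subst I) (simp_all add: power_mult_distrib integrable_std_normal_distribution_moment)
qed

section \<open>Symmetry of the Gaussian sequence and convergence of Gaussian series\<close>

lemma distr_std_normal_uminus: "distr std_normal_distribution borel uminus = std_normal_distribution"
proof -
  have "distr std_normal_distribution borel (\<lambda>x. - x) = distr std_normal_distribution borel (\<lambda>x. 1 * x)"
  proof (rule distr_scaled_normalI)
    show "(\<integral>x. cis (s * - x) \<partial>std_normal_distribution) = complex_of_real (exp (- (s * 1)\<^sup>2 / 2))" for s
      using integral_std_normal_cis[of "- s"] by simp
  qed (auto intro: std_normal.prob_space_axioms)
  also have "\<dots> = std_normal_distribution" by (simp add: distr_id2)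
  finally show ?thesis by simp
qed

lemma sets_gaussian_sequence [measurable_cong]:
  "sets gaussian_sequence = sets (\<Pi>\<^sub>M i\<in>(UNIV :: nat set). (borel :: real measure))"
  unfolding gaussian_sequence_def by (rule sets_PiM_cong) auto

lemma space_gaussian_sequence: "space gaussian_sequence = UNIV"
  using sets_eq_imp_space_eq[OF sets_gaussian_sequence] by (simp add: space_PiM)

interpretation gaussian: prob_space gaussian_sequence
  unfolding gaussian_sequence_def by (intro prob_space_PiM) (rule std_normal.prob_space_axioms)

text \<open>Independent symmetric coordinates may change sign without changing the joint law; it is
  enough to see this on cylinders. The index \<open>k\<close> is deterministic: it will be the value
  of a first passage time, on the event where this value is taken.\<close>

lemma distr_gaussian_flip:
  "distr gaussian_sequence gaussian_sequence (\<lambda>l i. if i < k then l i else - l i) = gaussian_sequence"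
proof -
  let ?N = std_normal_distribution and ?f = "\<lambda>(l :: nat \<Rightarrow> real) i. if i < k then l i else - l i"
  interpret product_prob_space "\<lambda>_ :: nat. ?N" UNIV
    by (intro product_prob_spaceI) (rule std_normal.prob_space_axioms)
  have fm: "?f \<in> gaussian_sequence \<rightarrow>\<^sub>M gaussian_sequence"
    unfolding gaussian_sequence_def
    by (rule measurable_PiM_single') (auto simp: space_PiM)
  have "distr gaussian_sequence gaussian_sequence ?f = (\<Pi>\<^sub>M i\<in>UNIV. ?N)"
  proof (rule PiM_eq)
    show "sets (distr gaussian_sequence gaussian_sequence ?f) = sets (\<Pi>\<^sub>M i\<in>(UNIV :: nat set). ?N)"
      by (simp add: gaussian_sequence_def)
    fix J :: "nat set" and A assume J: "finite J" and A: "\<And>j. j \<in> J \<Longrightarrow> A j \<in> sets ?N"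
    define A' where "A' j = (if j < k then A j else uminus -` A j)" for j
    have um: "uminus -` B \<in> sets borel" if "B \<in> sets borel" for B :: "real set"
      using measurable_sets[of uminus borel borel B] that by simp
    have A': "A' j \<in> sets ?N" if "j \<in> J" for j using A[OF that] um by (simp add: A'_def)
    have eA': "emeasure ?N (A' j) = emeasure ?N (A j)" if "j \<in> J" for j
    proof (cases "j < k")
      case False
      have "emeasure ?N (A j) = emeasure (distr ?N borel uminus) (A j)" by (simp only: distr_std_normal_uminus)
      also have "\<dots> = emeasure ?N (uminus -` A j)" using A[OF that] by (simp add: emeasure_distr)
      finally show ?thesis using False by (simp add: A'_def)
    qed (simp add: A'_def)
    have E: "prod_emb UNIV (\<lambda>_. ?N) J (Pi\<^sub>E J A) \<in> sets gaussian_sequence"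
      unfolding gaussian_sequence_def using J A by (intro sets_PiM_I) auto
    have "?f -` prod_emb UNIV (\<lambda>_. ?N) J (Pi\<^sub>E J A) \<inter> space gaussian_sequence = prod_emb UNIV (\<lambda>_. ?N) J (Pi\<^sub>E J A')"
      by (auto simp: prod_emb_def space_gaussian_sequence A'_def PiE_iff split: if_splits)
    then have "emeasure (distr gaussian_sequence gaussian_sequence ?f) (prod_emb UNIV (\<lambda>_. ?N) J (Pi\<^sub>E J A)) =
        emeasure (\<Pi>\<^sub>M i\<in>UNIV. ?N) (prod_emb UNIV (\<lambda>_. ?N) J (Pi\<^sub>E J A'))"
      using fm E by (simp add: emeasure_distr) (simp add: gaussian_sequence_def)
    also have "\<dots> = (\<Prod>j\<in>J. emeasure ?N (A' j))"
      using J A' by (intro emeasure_PiM_emb) auto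
    also have "\<dots> = (\<Prod>j\<in>J. emeasure ?N (A j))" by (intro prod.cong refl eA')
    finally show "emeasure (distr gaussian_sequence gaussian_sequence ?f) (prod_emb UNIV (\<lambda>_. ?N) J (Pi\<^sub>E J A)) =
      (\<Prod>j\<in>J. emeasure ?N (A j))" .
  qed
  then show ?thesis by (simp add: gaussian_sequence_def)
qed

lemma gaussian_coordinate [measurable]: "(\<lambda>l. l i) \<in> borel_measurable gaussian_sequence"
  by measurable

lemma gaussian_sum_char:
  "(\<integral>l. cis (s * (\<Sum>i<n. l i * a i)) \<partial>gaussian_sequence) =
     complex_of_real (exp (- s\<^sup>2 * (\<Sum>i<n. (a i)\<^sup>2) / 2))"
proof -
  let ?N = std_normal_distribution
  interpret product_sigma_finite "\<lambda>_ :: nat. ?N"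
    by (simp add: product_sigma_finite_def prob_space_imp_sigma_finite std_normal.prob_space_axioms)
  have prod_cis: "cis (s * (\<Sum>i<n. l i * a i)) = (\<Prod>i<n. cis (s * a i * l i))" for l :: "nat \<Rightarrow> real"
    by (induction n) (auto simp: algebra_simps simp flip: cis_mult)
  have int: "integrable ?N (\<lambda>x. cis (b * x))" for b
    by (rule std_normal.integrable_const_bound[of _ 1]) (auto simp: cis_conv_exp)
  have "(\<integral>l. cis (s * (\<Sum>i<n. l i * a i)) \<partial>gaussian_sequence) = (\<integral>l. (\<Prod>i<n. cis (s * a i * l i)) \<partial>(\<Pi>\<^sub>M i\<in>UNIV. ?N))"
    by (simp add: gaussian_sequence_def prod_cis)
  also have "\<dots> = (\<integral>l. (\<Prod>i<n. cis (s * a i * l i)) \<partial>(\<Pi>\<^sub>M i\<in>{..<n}. ?N))"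
  proof (rule integral_PiM_UNIV_restrict[OF std_normal.prob_space_axioms])
    show "(\<lambda>l. \<Prod>i<n. cis (s * a i * l i)) \<in> borel_measurable (\<Pi>\<^sub>M i\<in>{..<n}. ?N)"
      using int by (intro borel_measurable_prod measurable_compose[OF measurable_component_singleton borel_measurable_integrable])
  qed auto
  also have "\<dots> = (\<Prod>i<n. \<integral>x. cis (s * a i * x) \<partial>?N)"
    using int by (intro product_integral_prod) auto
  also have "\<dots> = (\<Prod>i<n. complex_of_real (exp (- (s * a i)\<^sup>2 / 2)))"
    by (simp add: integral_std_normal_cis)
  also have "\<dots> = complex_of_real (exp (\<Sum>i<n. - (s * a i)\<^sup>2 / 2))"
    by (simp add: exp_sum)
  also have "(\<Sum>i<n. - (s * a i)\<^sup>2 / 2) = - s\<^sup>2 * (\<Sum>i<n. (a i)\<^sup>2) / 2"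
    by (simp add: sum_distrib_left sum_divide_distrib sum_negf power_mult_distrib)
  finally show ?thesis .
qed

lemma gaussian_sum_chebyshev:
  assumes "0 < r"
  shows "measure gaussian_sequence {l. r < \<bar>\<Sum>i<n. l i * a i\<bar>} \<le> (\<Sum>i<n. (a i)\<^sup>2) / r\<^sup>2"
proof -
  let ?S = "\<lambda>l :: nat \<Rightarrow> real. \<Sum>i<n. l i * a i"
  have char: "(\<integral>l. cis (s * ?S l) \<partial>gaussian_sequence) = complex_of_real (exp (- (s * sqrt (\<Sum>i<n. (a i)\<^sup>2))\<^sup>2 / 2))" for s
    by (simp add: gaussian_sum_char power_mult_distrib sum_nonneg)
  have S [measurable]: "?S \<in> borel_measurable gaussian_sequence" by measurable
  note sq = integral_square_of_char[OF gaussian.prob_space_axioms S char]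
    integrable_square_of_char[OF gaussian.prob_space_axioms S char]
  have "measure gaussian_sequence {l. r < \<bar>?S l\<bar>} \<le> measure gaussian_sequence {l\<in>space gaussian_sequence. r\<^sup>2 \<le> (?S l)\<^sup>2}"
  proof (rule gaussian.finite_measure_mono)
    have "r\<^sup>2 \<le> (?S l)\<^sup>2" if "r < \<bar>?S l\<bar>" for l
      using that assms by (metis less_imp_le power2_abs power_mono)
    then show "{l. r < \<bar>?S l\<bar>} \<subseteq> {l\<in>space gaussian_sequence. r\<^sup>2 \<le> (?S l)\<^sup>2}"
      by (auto simp: space_gaussian_sequence)
  qed measurable
  also have "\<dots> \<le> (\<integral>l. (?S l)\<^sup>2 \<partial>gaussian_sequence) / r\<^sup>2"
    by (rule integral_Markov_inequality_measure[where A = "space gaussian_sequence"]) (use sq assms in auto)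
  also have "\<dots> = (\<Sum>i<n. (a i)\<^sup>2) / r\<^sup>2" by (simp add: sq sum_nonneg)
  finally show ?thesis .
qed

text \<open>Reflecting the coordinates from the first passage time on preserves the law and maps
  \<open>S\<^sub>n\<close> to \<open>2 S\<^sub>k - S\<^sub>n\<close>.\<close>

lemma gaussian_sum_maximal:
  assumes r: "0 < r"
  shows "measure gaussian_sequence {l. \<exists>k\<le>n. r < \<bar>\<Sum>i<k. l i * a i\<bar>} \<le> 2 * (\<Sum>i<n. (a i)\<^sup>2) / r\<^sup>2"
proof -
  let ?G = gaussian_sequence
  define S where "S k l = (\<Sum>i<k. l i * a i)" for k and l :: "nat \<Rightarrow> real"
  \<comment> \<open>The event that \<open>k\<close> is the first passage time; it depends only on
    the coordinates below \<open>k\<close>, so the reflection preserves it.\<close>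
  define A where "A k = {l. r < \<bar>S k l\<bar> \<and> (\<forall>j<k. \<not> r < \<bar>S j l\<bar>)}" for k
  define U where "U = {l. r < \<bar>S n l\<bar>}"
  have S [measurable]: "S k \<in> borel_measurable ?G" for k unfolding S_def by measurable
  have A_sets [measurable]: "A k \<in> sets ?G" for k
  proof -
    have "{l\<in>space ?G. r < \<bar>S k l\<bar> \<and> (\<forall>j<k. \<not> r < \<bar>S j l\<bar>)} \<in> sets ?G" by measurable
    then show ?thesis by (simp add: A_def space_gaussian_sequence)
  qed
  have U_sets [measurable]: "U \<in> sets ?G"
  proof -
    have "{l\<in>space ?G. r < \<bar>S n l\<bar>} \<in> sets ?G" by measurable
    then show ?thesis by (simp add: U_def space_gaussian_sequence)
  qed
  have un: "{l. \<exists>k\<le>n. r < \<bar>S k l\<bar>} = (\<Union>k\<le>n. A k)"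
  proof (intro equalityI subsetI)
    fix l assume "l \<in> {l. \<exists>k\<le>n. r < \<bar>S k l\<bar>}"
    then obtain k where k: "k \<le> n" "r < \<bar>S k l\<bar>" by blast
    define j where "j = (LEAST j. r < \<bar>S j l\<bar>)"
    have "r < \<bar>S j l\<bar>" "j \<le> k" unfolding j_def using k by (auto intro: LeastI Least_le)
    moreover have "\<not> r < \<bar>S i l\<bar>" if "i < j" for i using that not_less_Least unfolding j_def by blast
    ultimately show "l \<in> (\<Union>k\<le>n. A k)" using k by (auto simp: A_def)
  qed (auto simp: A_def)
  have disj: "disjoint_family_on A {..n}"
    unfolding disjoint_family_on_def
  proof (intro ballI impI)
    fix j k :: nat assume "j \<noteq> k"
    then show "A j \<inter> A k = {}" by (cases j k rule: linorder_cases) (auto simp: A_def)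
  qed
  have half: "measure ?G (A k) \<le> 2 * measure ?G (A k \<inter> U)" if "k \<le> n" for k
  proof -
    let ?f = "\<lambda>(l :: nat \<Rightarrow> real) i. if i < k then l i else - l i"
    have fm: "?f \<in> ?G \<rightarrow>\<^sub>M ?G"
      unfolding gaussian_sequence_def by (rule measurable_PiM_single') (auto simp: space_PiM)
    have Sk: "S j (?f l) = S j l" if "j \<le> k" for j l
      unfolding S_def using that by (intro sum.cong) auto
    have Sn: "S n (?f l) = 2 * S k l - S n l" for l
    proof -
      have split: "S n l' = S k l' + (\<Sum>i\<in>{k..<n}. l' i * a i)" for l'
      proof -
        have "{..<n} = {..<k} \<union> {k..<n}" using \<open>k \<le> n\<close> by auto
        then show ?thesis unfolding S_def by (simp add: sum.union_disjoint[symmetric] ivl_disj_int)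
      qed
      have "(\<Sum>i\<in>{k..<n}. ?f l i * a i) = - (\<Sum>i\<in>{k..<n}. l i * a i)"
        unfolding sum_negf[symmetric] by (intro sum.cong) auto
      then show ?thesis using split[of "?f l"] split[of l] Sk[of k l] by simp
    qed
    \<comment> \<open>If \<open>\<bar>S n l\<bar> \<le> r < \<bar>S k l\<bar>\<close>, then
      \<open>2 * S k l - S n l\<close> exceeds \<open>r\<close> in absolute value.\<close>
    have "A k - U \<subseteq> ?f -` (A k \<inter> U) \<inter> space ?G"
    proof
      fix l assume l: "l \<in> A k - U"
      have "?f l \<in> A k" using l Sk by (auto simp: A_def)
      moreover have "r < \<bar>S n (?f l)\<bar>" using l Sn[of l] by (auto simp: A_def U_def)
      ultimately show "l \<in> ?f -` (A k \<inter> U) \<inter> space ?G" by (simp add: U_def space_gaussian_sequence)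
    qed
    then have "measure ?G (A k - U) \<le> measure ?G (?f -` (A k \<inter> U) \<inter> space ?G)"
      using fm by (intro gaussian.finite_measure_mono measurable_sets) auto
    also have "\<dots> = measure (distr ?G ?G ?f) (A k \<inter> U)"
      using fm by (simp add: measure_distr)
    finally have "measure ?G (A k - U) \<le> measure ?G (A k \<inter> U)" by (simp only: distr_gaussian_flip)
    moreover have "measure ?G (A k) = measure ?G (A k - U) + measure ?G (A k \<inter> U)"
    proof -
      have "(A k - U) \<union> (A k \<inter> U) = A k" "(A k - U) \<inter> (A k \<inter> U) = {}" by auto
      then show ?thesis using gaussian.finite_measure_Union[of "A k - U" "A k \<inter> U"] by simp
    qed
    ultimately show ?thesis by simp
  qed
  have "measure ?G {l. \<exists>k\<le>n. r < \<bar>S k l\<bar>} = (\<Sum>k\<le>n. measure ?G (A k))"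
    unfolding un using disj by (intro gaussian.finite_measure_finite_Union) auto
  also have "\<dots> \<le> (\<Sum>k\<le>n. 2 * measure ?G (A k \<inter> U))" using half by (intro sum_mono) auto
  also have "\<dots> = 2 * measure ?G (\<Union>k\<le>n. A k \<inter> U)"
    using disj by (subst gaussian.finite_measure_finite_Union)
      (auto simp: sum_distrib_left disjoint_family_on_def)
  also have "\<dots> \<le> 2 * measure ?G U"
    by (intro mult_left_mono gaussian.finite_measure_mono) auto
  also have "\<dots> \<le> 2 * ((\<Sum>i<n. (a i)\<^sup>2) / r\<^sup>2)"
    using gaussian_sum_chebyshev[OF r, where n = n and a = a] by (simp add: U_def S_def)
  finally show ?thesis by (simp add: S_def)
qed

text \<open>Uniformly in the number of further terms, the partial sums stay within \<open>r\<close>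
  of the \<open>N\<close>-th one except on an event whose probability is bounded by the tail of the
  squares; hence they are almost surely Cauchy.\<close>

lemma gaussian_series_summable:
  assumes a: "summable (\<lambda>i. (a i)\<^sup>2)"
  shows "AE l in gaussian_sequence. summable (\<lambda>i. l i * a i)"
proof -
  let ?G = gaussian_sequence
  \<comment> \<open>Zeroing the coefficients below \<open>N\<close> turns the increments after
    \<open>N\<close> into partial sums from 0, to which the maximal inequality applies.\<close>
  define B where "B N r = {l. \<exists>k. r < \<bar>(\<Sum>i<k. l i * (if i < N then 0 else a i))\<bar>}" for N and r :: real
  have tail: "(\<lambda>N. \<Sum>i. (a (i + N))\<^sup>2) \<longlonglongrightarrow> 0"
    using suminf_exist_split2[OF a] by simp
  have B_sets [measurable]: "B N r \<in> sets ?G" for N r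
  proof -
    have "{l\<in>space ?G. \<exists>k. r < \<bar>(\<Sum>i<k. l i * (if i < N then 0 else a i))\<bar>} \<in> sets ?G" by measurable
    then show ?thesis by (simp add: B_def space_gaussian_sequence)
  qed
  have B_le: "measure ?G (B N r) \<le> 2 * (\<Sum>i. (a (i + N))\<^sup>2) / r\<^sup>2" if r: "0 < r" for N r
  proof -
    let ?b = "\<lambda>i. if i < N then 0 else a i"
    let ?C = "\<lambda>n. {l. \<exists>k\<le>n. r < \<bar>\<Sum>i<k. l i * ?b i\<bar>}"
    have C_sets: "?C n \<in> sets ?G" for n
    proof -
      have "{l\<in>space ?G. \<exists>k\<le>n. r < \<bar>\<Sum>i<k. l i * ?b i\<bar>} \<in> sets ?G" by measurable
      then show ?thesis by (simp add: space_gaussian_sequence)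
    qed
    have conv: "(\<lambda>n. measure ?G (?C n)) \<longlonglongrightarrow> measure ?G (\<Union>n. ?C n)"
      using C_sets by (intro gaussian.finite_Lim_measure_incseq) (auto simp: incseq_def intro: order.trans)
    have B_un: "(\<Union>n. ?C n) = B N r" unfolding B_def by blast
    have le: "measure ?G (?C n) \<le> 2 * (\<Sum>i. (a (i + N))\<^sup>2) / r\<^sup>2" for n
    proof -
      have "(\<Sum>i<n. (?b i)\<^sup>2) \<le> (\<Sum>i<n + N. (?b i)\<^sup>2)" by (intro sum_mono2) auto
      also have "\<dots> = (\<Sum>i<n. (a (i + N))\<^sup>2)"
      proof -
        have "(\<Sum>i<n + N. (?b i)\<^sup>2) = (\<Sum>i\<in>{N..<n + N}. (?b i)\<^sup>2)"
          by (rule sum.mono_neutral_right) auto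
        also have "\<dots> = (\<Sum>i\<in>{N..<n + N}. (a i)\<^sup>2)" by (intro sum.cong) auto
        also have "\<dots> = (\<Sum>i<n. (a (i + N))\<^sup>2)"
          using sum.shift_bounds_nat_ivl[of "\<lambda>i. (a i)\<^sup>2" 0 N n] by (simp add: atLeast0LessThan)
        finally show ?thesis .
      qed
      also have "\<dots> \<le> (\<Sum>i. (a (i + N))\<^sup>2)"
        by (rule sum_le_suminf) (use a in \<open>auto simp: summable_iff_shift[of "\<lambda>i. (a i)\<^sup>2"]\<close>)
      finally have "2 * (\<Sum>i<n. (?b i)\<^sup>2) / r\<^sup>2 \<le> 2 * (\<Sum>i. (a (i + N))\<^sup>2) / r\<^sup>2"
        by (intro divide_right_mono) auto
      with gaussian_sum_maximal[OF r, where n = n and a = ?b] show ?thesis by linarith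
    qed
    show ?thesis
      by (rule LIMSEQ_le_const2[OF conv[unfolded B_un]]) (use le in blast)
  qed
  have null: "AE l in ?G. \<exists>N. l \<notin> B N (1 / real (Suc j))" for j
  proof -
    have "measure ?G (\<Inter>N. B N (1 / real (Suc j))) \<le> 0"
    proof (rule LIMSEQ_le_const[of "\<lambda>N. 2 * (\<Sum>i. (a (i + N))\<^sup>2) / (1 / real (Suc j))\<^sup>2"])
      show "(\<lambda>N. 2 * (\<Sum>i. (a (i + N))\<^sup>2) / (1 / real (Suc j))\<^sup>2) \<longlonglongrightarrow> 0"
        using tendsto_divide[OF tendsto_mult[OF tendsto_const[of 2] tail] tendsto_const[of "(1 / real (Suc j))\<^sup>2"]] by simp
      have "measure ?G (\<Inter>N. B N (1 / real (Suc j))) \<le> 2 * (\<Sum>i. (a (i + N))\<^sup>2) / (1 / real (Suc j))\<^sup>2" for N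
        by (rule order.trans[OF gaussian.finite_measure_mono B_le]) auto
      then show "\<exists>M. \<forall>N\<ge>M. measure ?G (\<Inter>N. B N (1 / real (Suc j))) \<le> 2 * (\<Sum>i. (a (i + N))\<^sup>2) / (1 / real (Suc j))\<^sup>2"
        by blast
    qed
    then have "emeasure ?G (\<Inter>N. B N (1 / real (Suc j))) = 0"
      by (simp add: gaussian.emeasure_eq_measure measure_nonneg order.antisym)
    then have "(\<Inter>N. B N (1 / real (Suc j))) \<in> null_sets ?G" by (auto intro!: null_setsI)
    from AE_not_in[OF this] show ?thesis by simp
  qed
  then have "AE l in ?G. \<forall>j. \<exists>N. l \<notin> B N (1 / real (Suc j))" by (simp add: AE_all_countable)
  then show ?thesis
  proof eventually_elim
    case (elim l)
    define S where "S k = (\<Sum>i<k. l i * a i)" for k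
    have diff: "S m - S N = (\<Sum>i<m. l i * (if i < N then 0 else a i))" if "N \<le> m" for N m
    proof -
      have "(\<Sum>i<m. l i * (if i < N then 0 else a i)) = (\<Sum>i\<in>{N..<m}. l i * (if i < N then 0 else a i))"
        by (rule sum.mono_neutral_right) auto
      also have "\<dots> = (\<Sum>i\<in>{N..<m}. l i * a i)" by (intro sum.cong) auto
      also have "\<dots> = S m - S N" unfolding S_def lessThan_atLeast0 using that by (simp add: sum_diff_nat_ivl)
      finally show ?thesis by simp
    qed
    have "Cauchy S"
    proof (rule CauchyI')
      fix r :: real assume "0 < r"
      then obtain j where j: "1 / real (Suc j) < r / 2" by (metis half_gt_zero nat_approx_posE)
      obtain N where N: "l \<notin> B N (1 / real (Suc j))" using elim by blast
      have near: "\<bar>S m - S N\<bar> < r / 2" if "N \<le> m" for m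
      proof -
        have "\<bar>\<Sum>i<m. l i * (if i < N then 0 else a i)\<bar> \<le> 1 / real (Suc j)"
          using N unfolding B_def not_less[symmetric] by blast
        then show ?thesis using j by (simp only: diff[OF that])
      qed
      show "\<exists>M. \<forall>m\<ge>M. \<forall>n>m. dist (S m) (S n) < r"
      proof (intro exI[of _ N] allI impI)
        fix m n assume "N \<le> m" "m < n"
        then have "N \<le> n" by simp
        note near[OF \<open>N \<le> m\<close>] near[OF \<open>N \<le> n\<close>]
        then show "dist (S m) (S n) < r" unfolding dist_real_def by linarith
      qed
    qed
    then show "summable (\<lambda>i. l i * a i)"
      by (simp add: summable_iff_convergent Cauchy_convergent_iff S_def[abs_def])
  qed
qed

text \<open>Parseval's identity. Bessel's inequality bounds the partial sums from above; density of
  the span bounds them from below, since the orthogonal projection is the best approximation among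
  the combinations.\<close>

lemma sums_square_basis:
  fixes e :: "nat \<Rightarrow> 'h :: {real_inner, polish_space}"
  assumes e: "orthonormal_basis e"
  shows "(\<lambda>i. (u \<bullet> e i)\<^sup>2) sums (norm u)\<^sup>2"
proof -
  have ee: "e i \<bullet> e j = (if i = j then 1 else 0)" for i j using e by (simp add: orthonormal_basis_def)
  have comb: "\<exists>n b. v = (\<Sum>i<n. b i *\<^sub>R e i)" if "v \<in> span (range e)" for v
    using that
  proof (induction rule: span_induct_alt)
    case base then show ?case by (intro exI[of _ 0]) simp
  next
    case (step c x y)
    obtain k where k: "x = e k" using step by blast
    obtain n b where nb: "y = (\<Sum>i<n. b i *\<^sub>R e i)" using step by blast
    define N where "N = max n (Suc k)"
    have "y = (\<Sum>i<N. (if i < n then b i else 0) *\<^sub>R e i)"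
      unfolding nb by (rule sum.mono_neutral_cong_left) (auto simp: N_def)
    moreover have "c *\<^sub>R x = (\<Sum>i<N. (if i = k then c else 0) *\<^sub>R e i)"
      by (simp add: k if_distrib[of "\<lambda>a. a *\<^sub>R _"] sum.delta N_def less_max_iff_disj cong: if_cong)
    ultimately have "c *\<^sub>R x + y = (\<Sum>i<N. ((if i = k then c else 0) + (if i < n then b i else 0)) *\<^sub>R e i)"
      by (simp only: scaleR_add_left sum.distrib)
    then show ?case
      by (intro exI[of _ N] exI[of _ "\<lambda>i. (if i = k then c else 0) + (if i < n then b i else 0)"])
  qed
  define S where "S n = (\<Sum>i<n. (u \<bullet> e i)\<^sup>2)" for n
  \<comment> \<open>Completing the square: the squared distance to an arbitrary combination is that
    to the projection plus the squared deviations of the coefficients. With the Fourier coefficients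
    it gives Bessel's inequality, with an approximating combination the converse.\<close>
  have expand: "(norm (u - (\<Sum>i<n. b i *\<^sub>R e i)))\<^sup>2 = (norm u)\<^sup>2 - S n + (\<Sum>i<n. (b i - u \<bullet> e i)\<^sup>2)" for n b
  proof -
    have "(\<Sum>i<n. b i *\<^sub>R e i) \<bullet> (\<Sum>i<n. b i *\<^sub>R e i) = (\<Sum>i<n. (b i)\<^sup>2)"
      by (simp add: inner_sum_left inner_sum_right ee sum.delta if_distrib[of "\<lambda>a. _ * a"] power2_eq_square cong: if_cong)
    moreover have "u \<bullet> (\<Sum>i<n. b i *\<^sub>R e i) = (\<Sum>i<n. b i * (u \<bullet> e i))"
      by (simp add: inner_sum_right)
    ultimately have "(norm (u - (\<Sum>i<n. b i *\<^sub>R e i)))\<^sup>2 = (norm u)\<^sup>2 - 2 * (\<Sum>i<n. b i * (u \<bullet> e i)) + (\<Sum>i<n. (b i)\<^sup>2)"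
      by (simp add: power2_norm_eq_inner inner_diff_left inner_diff_right inner_commute)
    also have "\<dots> = (norm u)\<^sup>2 - S n + (\<Sum>i<n. (b i - u \<bullet> e i)\<^sup>2)"
      by (simp add: S_def power2_diff sum.distrib sum_subtractf sum_distrib_left algebra_simps)
    finally show ?thesis .
  qed
  have S_le: "S n \<le> (norm u)\<^sup>2" for n
    using expand[of "\<lambda>i. u \<bullet> e i" n] zero_le_power2[of "norm (u - (\<Sum>i<n. (u \<bullet> e i) *\<^sub>R e i))"] by simp
  have mono: "S n \<le> S m" if "n \<le> m" for n m
    unfolding S_def using that by (intro sum_mono2) auto
  have "S \<longlonglongrightarrow> (norm u)\<^sup>2"
  proof (rule LIMSEQ_I)
    fix r :: real assume r: "0 < r"
    have "u \<in> closure (span (range e))" using e by (simp add: orthonormal_basis_def)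
    then obtain v where v: "v \<in> span (range e)" "dist v u < sqrt r"
      using r unfolding closure_approachable by (meson real_sqrt_gt_zero)
    obtain n b where nb: "v = (\<Sum>i<n. b i *\<^sub>R e i)" using comb[OF v(1)] by blast
    have "(norm (u - v))\<^sup>2 < (sqrt r)\<^sup>2"
      using v(2) by (intro power_strict_mono) (auto simp: dist_norm norm_minus_commute)
    then have "(norm u)\<^sup>2 - S n + (\<Sum>i<n. (b i - u \<bullet> e i)\<^sup>2) < r" using r by (simp add: nb expand)
    then have "(norm u)\<^sup>2 - S n < r" using sum_nonneg[of "{..<n}" "\<lambda>i. (b i - u \<bullet> e i)\<^sup>2"] by auto
    then have "norm (S m - (norm u)\<^sup>2) < r" if "n \<le> m" for m
      using mono[OF that] S_le[of m] by simp
    then show "\<exists>no. \<forall>m\<ge>no. norm (S m - (norm u)\<^sup>2) < r" by blast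
  qed
  then show ?thesis by (simp add: sums_def S_def[abs_def])
qed

section \<open>The cavity field of points of the Hilbert space\<close>

context
  fixes e :: "nat \<Rightarrow> 'h :: {real_inner, polish_space}"
  assumes e: "orthonormal_basis e"
begin

lemma AE_cavity_field_summable: "AE l in gaussian_sequence. summable (\<lambda>i. l i * (v \<bullet> e i))"
  by (rule gaussian_series_summable, rule sums_summable, rule sums_square_basis[OF e])

lemma cavity_field_measurable [measurable]:
  "(\<lambda>(l, v). cavity_field e l v) \<in> borel_measurable (gaussian_sequence \<Otimes>\<^sub>M unit_ball_algebra)"
proof -
  have 1: "(\<lambda>z. fst z i) \<in> borel_measurable (gaussian_sequence \<Otimes>\<^sub>M unit_ball_algebra)" for i
    by (rule measurable_compose[OF measurable_fst gaussian_coordinate])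
  have "(\<lambda>v. v \<bullet> e i) \<in> borel_measurable unit_ball_algebra" for i
    unfolding unit_ball_algebra_def by (intro measurable_restrict_space1) measurable
  then have 2: "(\<lambda>z. snd z \<bullet> e i) \<in> borel_measurable (gaussian_sequence \<Otimes>\<^sub>M unit_ball_algebra)" for i
    by (rule measurable_compose[OF measurable_snd])
  show ?thesis unfolding cavity_field_def split_beta'
    by (intro borel_measurable_suminf borel_measurable_times 1 2)
qed

lemma cavity_field_measurable1 [measurable]: "(\<lambda>l. cavity_field e l v) \<in> borel_measurable gaussian_sequence"
  unfolding cavity_field_def by measurable

lemma cavity_field_char:
  "(\<integral>l. cis (s * cavity_field e l v) \<partial>gaussian_sequence) = complex_of_real (exp (- (s * norm v)\<^sup>2 / 2))"
proof (rule LIMSEQ_unique)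
  show "(\<lambda>n. \<integral>l. cis (s * (\<Sum>i<n. l i * (v \<bullet> e i))) \<partial>gaussian_sequence) \<longlonglongrightarrow> (\<integral>l. cis (s * cavity_field e l v) \<partial>gaussian_sequence)"
  proof (rule integral_dominated_convergence[where w = "\<lambda>_. 1"])
    show "AE l in gaussian_sequence. (\<lambda>n. cis (s * (\<Sum>i<n. l i * (v \<bullet> e i)))) \<longlonglongrightarrow> cis (s * cavity_field e l v)"
      using AE_cavity_field_summable[of v]
    proof eventually_elim
      case (elim l)
      then show ?case unfolding cavity_field_def cis_conv_exp
        by (intro tendsto_intros summable_LIMSEQ)
    qed
  qed (auto simp: cis_conv_exp)
  have "(\<lambda>n. complex_of_real (exp (- s\<^sup>2 * (\<Sum>i<n. (v \<bullet> e i)\<^sup>2) / 2))) \<longlonglongrightarrow> complex_of_real (exp (- s\<^sup>2 * (norm v)\<^sup>2 / 2))"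
    by (intro tendsto_intros) (use sums_square_basis[OF e, of v] in \<open>auto simp: sums_def\<close>)
  then show "(\<lambda>n. \<integral>l. cis (s * (\<Sum>i<n. l i * (v \<bullet> e i))) \<partial>gaussian_sequence) \<longlonglongrightarrow> complex_of_real (exp (- (s * norm v)\<^sup>2 / 2))"
    by (simp add: gaussian_sum_char power_mult_distrib)
qed

text \<open>Linearity holds where the series converge, and the exceptional null set depends on the
  points. The replicas are fixed before the field is averaged, so a null set for one sequence of
  points suffices.\<close>

lemma AE_cavity_field_linear:
  fixes k :: nat
  shows
  "AE l in gaussian_sequence. (\<Sum>i<k. s i * cavity_field e l (v i)) = cavity_field e l (\<Sum>i<k. s i *\<^sub>R v i)"
proof -
  have "AE l in gaussian_sequence. \<forall>j. summable (\<lambda>i. l i * (v j \<bullet> e i))"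
    by (simp add: AE_all_countable AE_cavity_field_summable)
  then show ?thesis
  proof eventually_elim
    case (elim l)
    have "cavity_field e l (\<Sum>i<k. s i *\<^sub>R v i) = (\<Sum>m. \<Sum>i<k. s i * (l m * (v i \<bullet> e m)))"
      by (simp add: cavity_field_def inner_sum_left sum_distrib_left ac_simps)
    also have "\<dots> = (\<Sum>i<k. \<Sum>m. s i * (l m * (v i \<bullet> e m)))"
      using elim by (intro suminf_sum) (auto intro: summable_mult)
    also have "\<dots> = (\<Sum>i<k. s i * cavity_field e l (v i))"
      using elim by (simp add: cavity_field_def suminf_mult)
    finally show ?case by simp
  qed
qed

lemma cavity_field_joint_char:
  fixes k :: nat
  shows
  "(\<integral>l. cis (\<Sum>i<k. s i * cavity_field e l (v i)) \<partial>gaussian_sequence) =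
     complex_of_real (exp (- (norm (\<Sum>i<k. s i *\<^sub>R v i))\<^sup>2 / 2))"
proof -
  have "(\<integral>l. cis (\<Sum>i<k. s i * cavity_field e l (v i)) \<partial>gaussian_sequence) =
      (\<integral>l. cis (1 * cavity_field e l (\<Sum>i<k. s i *\<^sub>R v i)) \<partial>gaussian_sequence)"
  proof (rule integral_cong_AE)
    show "AE l in gaussian_sequence. cis (\<Sum>i<k. s i * cavity_field e l (v i)) = cis (1 * cavity_field e l (\<Sum>i<k. s i *\<^sub>R v i))"
      using AE_cavity_field_linear[where k = k and s = s and v = v] by eventually_elim simp
  qed (auto simp: cis_conv_exp)
  then show ?thesis by (simp only: cavity_field_char) simp
qed

text \<open>Putting ones on the diagonal adds \<open>1 - (norm (v i))\<^sup>2\<close> there. On the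
  unit ball this is nonnegative, which makes the overlap matrix positive semidefinite; it is also
  the variance that the Gaussian smoothing of the weight supplies.\<close>

lemma overlap_quadratic_form:
  fixes v :: "nat \<Rightarrow> 'h"
  shows "(\<Sum>i<k. \<Sum>j<k. s i * s j * replica_overlap (\<bullet>) v i j) =
    (\<Sum>i<k. (s i)\<^sup>2 * (1 - (norm (v i))\<^sup>2)) + (norm (\<Sum>i<k. s i *\<^sub>R v i))\<^sup>2"
proof -
  have "s i * s j * replica_overlap (\<bullet>) v i j =
      s i * s j * (v i \<bullet> v j) + (if j = i then (s i)\<^sup>2 * (1 - (norm (v i))\<^sup>2) else 0)" for i j
    by (auto simp: replica_overlap_def power2_eq_square power2_norm_eq_inner[unfolded power2_eq_square] algebra_simps)
  then have "(\<Sum>i<k. \<Sum>j<k. s i * s j * replica_overlap (\<bullet>) v i j) =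
     (\<Sum>i<k. \<Sum>j<k. s i * s j * (v i \<bullet> v j)) + (\<Sum>i<k. (s i)\<^sup>2 * (1 - (norm (v i))\<^sup>2))"
    by (simp add: sum.distrib sum.delta)
  moreover have "(norm (\<Sum>i<k. s i *\<^sub>R v i))\<^sup>2 = (\<Sum>i<k. \<Sum>j<k. s i * s j * (v i \<bullet> v j))"
    by (simp add: power2_norm_eq_inner inner_sum_left inner_sum_right sum_distrib_left mult.assoc)
       (simp add: inner_commute)
  ultimately show ?thesis by simp
qed

lemma replica_overlap_inner_rost:
  fixes v :: "nat \<Rightarrow> 'h"
  assumes "\<And>i. v i \<in> cball 0 1"
  shows "replica_overlap (\<bullet>) v \<in> rost_matrices"
proof -
  have "(norm (v i))\<^sup>2 \<le> 1" for i using assms[of i] by (simp add: abs_square_le_1)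
  then have "0 \<le> (\<Sum>i<n. \<Sum>j<n. x i * x j * replica_overlap (\<bullet>) v i j)" for n x
    unfolding overlap_quadratic_form by (intro add_nonneg_nonneg sum_nonneg mult_nonneg_nonneg) auto
  then show ?thesis by (simp add: rost_matrices_def replica_overlap_def inner_commute)
qed

section \<open>Smoothed trigonometric weights on the ball\<close>

context
  fixes d c t B
  assumes Im0: "\<And>x. Im (trig_poly d c t x) = 0" and Re0: "\<And>x. 0 \<le> Re (trig_poly d c t x)"
    and ReB: "\<And>x. Re (trig_poly d c t x) \<le> B"
begin

text \<open>The weight is averaged over an independent Gaussian of variance \<open>1 - \<parallel>v\<parallel>\<^sup>2\<close>, which
  turns the diagonal of the Gram matrix into ones.\<close>

definition ball_weight :: "(nat \<Rightarrow> real) \<Rightarrow> 'h \<Rightarrow> real" where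
  "ball_weight l v = (if v \<in> cball 0 1 then
     Re (\<Sum>j<d. c j * complex_of_real (exp (- (t j)\<^sup>2 * (1 - (norm v)\<^sup>2) / 2)) * cis (t j * cavity_field e l v)) else 0)"

lemma integral_trig_poly_shift:
  "(\<integral>g. trig_poly d c t (x + b * g) \<partial>std_normal_distribution) =
    (\<Sum>j<d. c j * complex_of_real (exp (- (t j)\<^sup>2 * b\<^sup>2 / 2)) * cis (t j * x))"
proof -
  have int: "integrable std_normal_distribution (\<lambda>x. cis (b * x))" for b
    by (rule std_normal.integrable_const_bound[of _ 1]) (auto simp: cis_conv_exp)
  have "trig_poly d c t (x + b * g) = (\<Sum>j<d. (c j * cis (t j * x)) * cis (t j * b * g))" for g
    by (simp add: trig_poly_def algebra_simps flip: cis_mult)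
  then have "(\<integral>g. trig_poly d c t (x + b * g) \<partial>std_normal_distribution) =
      (\<Sum>j<d. (c j * cis (t j * x)) * complex_of_real (exp (- (t j * b)\<^sup>2 / 2)))"
    using int by (simp add: integral_std_normal_cis)
  then show ?thesis by (simp add: power_mult_distrib ac_simps)
qed

lemma integral_Re_trig_poly_shift:
  shows "complex_of_real (\<integral>g. Re (trig_poly d c t (x + b * g)) \<partial>std_normal_distribution) =
    (\<Sum>j<d. c j * complex_of_real (exp (- (t j)\<^sup>2 * b\<^sup>2 / 2)) * cis (t j * x))"
proof -
  have "trig_poly d c t y = complex_of_real (Re (trig_poly d c t y))" for y
    using Im0[of y] by (simp add: complex_eq_iff)
  then show ?thesis
    by (metis (no_types, lifting) integral_trig_poly_shift integral_complex_of_real Bochner_Integration.integral_cong)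
qed

lemma trig_poly_measurable [measurable]: "(\<lambda>x. Re (trig_poly d c t x)) \<in> borel_measurable borel"
  unfolding trig_poly_def cis_conv_exp by measurable

lemma ball_weight_eq:
  assumes "v \<in> cball 0 1"
  shows "ball_weight l v = (\<integral>g. Re (trig_poly d c t (cavity_field e l v + sqrt (1 - (norm v)\<^sup>2) * g)) \<partial>std_normal_distribution)"
    and "complex_of_real (ball_weight l v) =
      (\<Sum>j<d. c j * complex_of_real (exp (- (t j)\<^sup>2 * (1 - (norm v)\<^sup>2) / 2)) * cis (t j * cavity_field e l v))"
proof -
  have "(norm v)\<^sup>2 \<le> 1" using assms by (simp add: abs_square_le_1)
  then have *: "complex_of_real (\<integral>g. Re (trig_poly d c t (cavity_field e l v + sqrt (1 - (norm v)\<^sup>2) * g)) \<partial>std_normal_distribution) =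
      (\<Sum>j<d. c j * complex_of_real (exp (- (t j)\<^sup>2 * (1 - (norm v)\<^sup>2) / 2)) * cis (t j * cavity_field e l v))"
    by (simp add: integral_Re_trig_poly_shift)
  show **: "ball_weight l v = (\<integral>g. Re (trig_poly d c t (cavity_field e l v + sqrt (1 - (norm v)\<^sup>2) * g)) \<partial>std_normal_distribution)"
    unfolding ball_weight_def using assms arg_cong[OF *, of Re] by simp
  show "complex_of_real (ball_weight l v) =
      (\<Sum>j<d. c j * complex_of_real (exp (- (t j)\<^sup>2 * (1 - (norm v)\<^sup>2) / 2)) * cis (t j * cavity_field e l v))"
    unfolding ** by (rule *)
qed

lemma integrable_trig_poly_shift: "integrable std_normal_distribution (\<lambda>g. Re (trig_poly d c t (x + b * g)))"
  using Re0 ReB by (intro std_normal.integrable_const_bound[of _ B]) auto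

lemma ball_weight_bounds: "0 \<le> ball_weight l v" "ball_weight l v \<le> B"
proof -
  have B: "0 \<le> B" using Re0 ReB order.trans by blast
  show "0 \<le> ball_weight l v"
    by (cases "v \<in> cball 0 1") (simp_all add: ball_weight_eq(1) Re0 del: mem_cball, simp add: ball_weight_def)
  show "ball_weight l v \<le> B"
  proof (cases "v \<in> cball 0 1")
    case True
    then show ?thesis unfolding ball_weight_eq(1)[OF True]
      by (intro std_normal.integral_le_const integrable_trig_poly_shift AE_I2 ReB)
  qed (simp add: ball_weight_def B)
qed

text \<open>The same Gaussian smoothing as in \<open>ball_weight\<close>: the extra variance changes
  \<open>lam\<^sup>2 / 2\<close> in the exponent into
  \<open>lam\<^sup>2 / 2 * (norm v)\<^sup>2\<close>. Exact and approximate weights are thus averages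
  of functions of one real variable.\<close>

lemma cavity_weight_eq:
  assumes "v \<in> cball 0 1"
  shows "cavity_weight lam e l v = (\<integral>g. gauss_weight lam (cavity_field e l v + sqrt (1 - (norm v)\<^sup>2) * g) \<partial>std_normal_distribution)"
    and "integrable std_normal_distribution (\<lambda>g. gauss_weight lam (cavity_field e l v + sqrt (1 - (norm v)\<^sup>2) * g))"
proof -
  let ?b = "sqrt (1 - (norm v)\<^sup>2)"
  have b: "?b\<^sup>2 = 1 - (norm v)\<^sup>2" using assms by (simp add: abs_square_le_1)
  have eq: "gauss_weight lam (cavity_field e l v + ?b * g) = exp (lam * cavity_field e l v - lam\<^sup>2 / 2) * exp (lam * ?b * g)" for g
    by (simp add: gauss_weight_def algebra_simps flip: exp_add)
  show "integrable std_normal_distribution (\<lambda>g. gauss_weight lam (cavity_field e l v + ?b * g))"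
    unfolding eq by (intro integrable_mult_right integrable_std_normal_exp)
  have "(\<integral>g. gauss_weight lam (cavity_field e l v + ?b * g) \<partial>std_normal_distribution) =
      exp (lam * cavity_field e l v - lam\<^sup>2 / 2) * exp ((lam * ?b)\<^sup>2 / 2)"
    unfolding eq by (simp only: integral_mult_right_zero integral_std_normal_exp)
  also have "\<dots> = cavity_weight lam e l v"
    unfolding cavity_weight_def exp_add[symmetric] power_mult_distrib b by (simp add: algebra_simps diff_divide_distrib add_divide_distrib)
  finally show "cavity_weight lam e l v = (\<integral>g. gauss_weight lam (cavity_field e l v + ?b * g) \<partial>std_normal_distribution)" by simp
qed

text \<open>The variances add up to 1 for every \<open>v\<close> in the ball, so the approximation
  error reduces to a one-dimensional integral, uniformly in \<open>v\<close>.\<close>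

lemma distr_field_plus_normal:
  assumes v: "v \<in> cball 0 1"
  shows "distr (gaussian_sequence \<Otimes>\<^sub>M std_normal_distribution) borel
     (\<lambda>(l, g). cavity_field e l v + sqrt (1 - (norm v)\<^sup>2) * g) = std_normal_distribution"
proof -
  let ?b = "sqrt (1 - (norm v)\<^sup>2)"
  have b: "?b\<^sup>2 = 1 - (norm v)\<^sup>2" using v by (simp add: abs_square_le_1)
  interpret P: pair_prob_space gaussian_sequence std_normal_distribution ..
  have m [measurable]: "(\<lambda>z. cavity_field e (fst z) v) \<in> borel_measurable (gaussian_sequence \<Otimes>\<^sub>M std_normal_distribution)"
    by (rule measurable_compose[OF measurable_fst cavity_field_measurable1])
  have "distr (gaussian_sequence \<Otimes>\<^sub>M std_normal_distribution) borel (\<lambda>z. cavity_field e (fst z) v + ?b * snd z) =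
      distr std_normal_distribution borel (\<lambda>x. 1 * x)"
  proof (rule distr_scaled_normalI[OF P.prob_space_axioms])
    fix s :: real
    have pm: "(\<lambda>z. cis (s * (cavity_field e (fst z) v + ?b * snd z))) \<in> borel_measurable (gaussian_sequence \<Otimes>\<^sub>M std_normal_distribution)"
      unfolding cis_conv_exp by measurable
    have int: "integrable (gaussian_sequence \<Otimes>\<^sub>M std_normal_distribution) (\<lambda>z. cis (s * (cavity_field e (fst z) v + ?b * snd z)))"
      using pm by (intro P.integrable_const_bound[of _ 1]) auto
    have "(\<integral>z. cis (s * (cavity_field e (fst z) v + ?b * snd z)) \<partial>(gaussian_sequence \<Otimes>\<^sub>M std_normal_distribution)) =
        (\<integral>l. \<integral>g. cis (s * (cavity_field e l v + ?b * g)) \<partial>std_normal_distribution \<partial>gaussian_sequence)"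
      using P.integral_fst'[OF int] by simp
    also have "\<dots> = (\<integral>l. cis (s * cavity_field e l v) * (\<integral>g. cis (s * ?b * g) \<partial>std_normal_distribution) \<partial>gaussian_sequence)"
      by (simp add: distrib_left mult.assoc flip: cis_mult)
    also have "\<dots> = complex_of_real (exp (- (s * norm v)\<^sup>2 / 2)) * complex_of_real (exp (- (s * ?b)\<^sup>2 / 2))"
      by (simp only: integral_std_normal_cis integral_mult_left_zero cavity_field_char)
    also have "\<dots> = complex_of_real (exp (- (s * 1)\<^sup>2 / 2))"
      unfolding of_real_mult[symmetric] exp_add[symmetric] power_mult_distrib b
      by (simp add: algebra_simps diff_divide_distrib add_divide_distrib)
    finally show "(\<integral>z. cis (s * (cavity_field e (fst z) v + ?b * snd z)) \<partial>(gaussian_sequence \<Otimes>\<^sub>M std_normal_distribution)) =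
       complex_of_real (exp (- (s * 1)\<^sup>2 / 2))" .
  qed measurable
  also have "distr std_normal_distribution borel (\<lambda>x. 1 * x) = std_normal_distribution" by (simp add: distr_id2)
  finally show ?thesis by (simp add: split_beta')
qed

text \<open>The constant \<open>exp (lam\<^sup>2)\<close> comes from the inverse weight, whose mean
  is \<open>exp (lam\<^sup>2 * (norm x)\<^sup>2)\<close>; the weight itself has mean 1.\<close>

lemma cavity_model_ball:
  "cavity_model gaussian_sequence unit_ball_algebra (\<bullet>) (cavity_weight lam e) ball_weight d c t B (exp (lam\<^sup>2))
     (\<integral>x. \<bar>Re (trig_poly d c t x) - gauss_weight lam x\<bar> \<partial>std_normal_distribution)"
proof
  have space_ball: "space unit_ball_algebra = (cball 0 1 :: 'h set)"
    by (simp add: unit_ball_algebra_def space_restrict_space)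
  have nm: "(\<lambda>v :: 'h. norm v) \<in> borel_measurable unit_ball_algebra"
    unfolding unit_ball_algebra_def by (intro measurable_restrict_space1) measurable
  have nm' [measurable]: "(\<lambda>z :: (nat \<Rightarrow> real) \<times> 'h. norm (snd z)) \<in> borel_measurable (gaussian_sequence \<Otimes>\<^sub>M unit_ball_algebra)"
    by (rule measurable_compose[OF measurable_snd nm])
  have fm [measurable]: "(\<lambda>z. cavity_field e (fst z) (snd z)) \<in> borel_measurable (gaussian_sequence \<Otimes>\<^sub>M unit_ball_algebra)"
    using cavity_field_measurable by (simp add: split_beta')
  show "(\<lambda>(l, x). cavity_weight lam e l x) \<in> borel_measurable (gaussian_sequence \<Otimes>\<^sub>M unit_ball_algebra)"
    unfolding cavity_weight_def split_beta' by measurable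
  have "(\<lambda>z. Re (\<Sum>j<d. c j * complex_of_real (exp (- (t j)\<^sup>2 * (1 - (norm (snd z))\<^sup>2) / 2)) * cis (t j * cavity_field e (fst z) (snd z))))
      \<in> borel_measurable (gaussian_sequence \<Otimes>\<^sub>M (unit_ball_algebra :: 'h measure))"
    unfolding cis_conv_exp by measurable
  then show "(\<lambda>(l, x). ball_weight l x) \<in> borel_measurable (gaussian_sequence \<Otimes>\<^sub>M unit_ball_algebra)"
    by (rule measurable_cong[THEN iffD2, rotated]) (auto simp: ball_weight_def space_pair_measure space_ball simp del: mem_cball)
  have "(\<lambda>v :: 'h. v) \<in> unit_ball_algebra \<rightarrow>\<^sub>M borel"
    unfolding unit_ball_algebra_def by (intro measurable_restrict_space1) measurable
  then have [measurable]: "(\<lambda>z :: 'h \<times> 'h. fst z) \<in> unit_ball_algebra \<Otimes>\<^sub>M unit_ball_algebra \<rightarrow>\<^sub>M borel"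
    "(\<lambda>z :: 'h \<times> 'h. snd z) \<in> unit_ball_algebra \<Otimes>\<^sub>M unit_ball_algebra \<rightarrow>\<^sub>M borel"
    by (auto intro: measurable_compose[OF measurable_fst] measurable_compose[OF measurable_snd])
  show "(\<lambda>(x :: 'h, y). x \<bullet> y) \<in> borel_measurable (unit_ball_algebra \<Otimes>\<^sub>M unit_ball_algebra)"
    unfolding split_beta' by (intro borel_measurable_inner) measurable
  show "0 < cavity_weight lam e l x" for l x by (simp add: cavity_weight_def)
  show "0 \<le> ball_weight l x" "ball_weight l x \<le> B" for l x by (rule ball_weight_bounds)+
  fix x :: 'h assume "x \<in> space unit_ball_algebra"
  then have x: "x \<in> cball 0 1" by (simp add: space_ball)
  then have x1: "(norm x)\<^sup>2 \<le> 1" by (simp add: abs_square_le_1)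
  note E = integrable_exp_of_char[OF gaussian.prob_space_axioms cavity_field_measurable1 cavity_field_char]
    integral_exp_of_char[OF gaussian.prob_space_axioms cavity_field_measurable1 cavity_field_char]
  have w: "cavity_weight lam e l x = exp (- lam\<^sup>2 / 2 * (norm x)\<^sup>2) * exp (lam * cavity_field e l x)" for l
    by (simp add: cavity_weight_def flip: exp_add)
  have iw: "1 / cavity_weight lam e l x = exp (lam\<^sup>2 / 2 * (norm x)\<^sup>2) * exp (- lam * cavity_field e l x)" for l
  proof -
    have "1 / exp a = exp (- a)" for a :: real by (simp add: exp_minus inverse_eq_divide)
    then show ?thesis unfolding cavity_weight_def exp_add[symmetric] by (simp only:) simp
  qed
  show wi: "integrable gaussian_sequence (\<lambda>l. cavity_weight lam e l x)"
    unfolding w by (intro integrable_mult_right E)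
  show "integrable gaussian_sequence (\<lambda>l. 1 / cavity_weight lam e l x)"
    unfolding iw by (intro integrable_mult_right E)
  have "(\<integral>l. cavity_weight lam e l x \<partial>gaussian_sequence) = 1"
    unfolding w by (simp only: integral_mult_right_zero E) (simp add: power_mult_distrib flip: exp_add)
  then show "(\<integral>l. cavity_weight lam e l x \<partial>gaussian_sequence) \<le> exp (lam\<^sup>2)" by simp
  have "(\<integral>l. 1 / cavity_weight lam e l x \<partial>gaussian_sequence) = exp (lam\<^sup>2 * (norm x)\<^sup>2)"
    unfolding iw by (simp only: integral_mult_right_zero E) (simp add: power_mult_distrib flip: exp_add)
  also have "\<dots> \<le> exp (lam\<^sup>2)" using x1 by (simp add: mult_left_le)
  finally show "(\<integral>l. 1 / cavity_weight lam e l x \<partial>gaussian_sequence) \<le> exp (lam\<^sup>2)" .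
  \<comment> \<open>Both weights average over the same extra Gaussian, so their difference is at
    most the average of the one-dimensional difference at a standard normal argument.\<close>
  show "(\<integral>l. \<bar>ball_weight l x - cavity_weight lam e l x\<bar> \<partial>gaussian_sequence)
      \<le> (\<integral>x. \<bar>Re (trig_poly d c t x) - gauss_weight lam x\<bar> \<partial>std_normal_distribution)"
  proof -
    interpret P: pair_prob_space gaussian_sequence std_normal_distribution ..
    define h where "h y = \<bar>Re (trig_poly d c t y) - gauss_weight lam y\<bar>" for y
    have hm [measurable]: "h \<in> borel_measurable borel" unfolding h_def by measurable
    let ?X = "\<lambda>z. cavity_field e (fst z) x + sqrt (1 - (norm x)\<^sup>2) * snd z"
    have Xm [measurable]: "?X \<in> borel_measurable (gaussian_sequence \<Otimes>\<^sub>M std_normal_distribution)"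
      by (intro borel_measurable_add measurable_compose[OF measurable_fst cavity_field_measurable1]) measurable
    have D: "distr (gaussian_sequence \<Otimes>\<^sub>M std_normal_distribution) borel ?X = std_normal_distribution"
      using distr_field_plus_normal[OF x] by (simp add: split_beta')
    have h_int: "integrable std_normal_distribution h"
    proof -
      have "integrable std_normal_distribution (\<lambda>x. Re (trig_poly d c t x))"
        using integrable_trig_poly_shift[of 0 1] by simp
      then show ?thesis unfolding h_def using integrable_gauss_weight[of lam] by auto
    qed
    then have "integrable (distr (gaussian_sequence \<Otimes>\<^sub>M std_normal_distribution) borel ?X) h" by (simp only: D)
    then have hX: "integrable (gaussian_sequence \<Otimes>\<^sub>M std_normal_distribution) (\<lambda>z. h (?X z))"
      by (subst (asm) integrable_distr_eq) auto
    then have hX': "integrable (gaussian_sequence \<Otimes>\<^sub>M std_normal_distribution) (\<lambda>(l, g). h (?X (l, g)))"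
      by (simp add: split_beta')
    have "(\<integral>l. \<bar>ball_weight l x - cavity_weight lam e l x\<bar> \<partial>gaussian_sequence) \<le>
       (\<integral>l. \<integral>g. h (?X (l, g)) \<partial>std_normal_distribution \<partial>gaussian_sequence)"
    proof (rule integral_mono')
      show "integrable gaussian_sequence (\<lambda>l. \<integral>g. h (?X (l, g)) \<partial>std_normal_distribution)"
        using P.integrable_fst[OF hX'] by simp
      fix l
      let ?y = "\<lambda>g. cavity_field e l x + sqrt (1 - (norm x)\<^sup>2) * g"
      have "\<bar>ball_weight l x - cavity_weight lam e l x\<bar> =
          \<bar>\<integral>g. Re (trig_poly d c t (?y g)) - gauss_weight lam (?y g) \<partial>std_normal_distribution\<bar>"
        unfolding ball_weight_eq(1)[OF x] cavity_weight_eq(1)[OF x]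
        by (subst Bochner_Integration.integral_diff) (auto intro: integrable_trig_poly_shift cavity_weight_eq(2)[OF x])
      also have "\<dots> \<le> (\<integral>g. h (?y g) \<partial>std_normal_distribution)"
        unfolding h_def by (rule integral_abs_bound)
      finally show "\<bar>ball_weight l x - cavity_weight lam e l x\<bar> \<le> (\<integral>g. h (?X (l, g)) \<partial>std_normal_distribution)" by simp
    qed (auto simp: h_def)
    also have "\<dots> = (\<integral>z. h (?X z) \<partial>(gaussian_sequence \<Otimes>\<^sub>M std_normal_distribution))"
      using P.integral_fst[OF hX'] by (simp add: split_beta')
    also have "\<dots> = (\<integral>y. h y \<partial>distr (gaussian_sequence \<Otimes>\<^sub>M std_normal_distribution) borel ?X)"
      by (subst integral_distr) auto
    finally show ?thesis unfolding D by (simp add: h_def)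
  qed
next
  show "replica_overlap (\<bullet>) v \<in> rost_matrices" if "\<And>i. v i \<in> space unit_ball_algebra" for v :: "nat \<Rightarrow> 'h"
    using that by (intro replica_overlap_inner_rost) (simp add: unit_ball_algebra_def space_restrict_space)
next
  fix k and v :: "nat \<Rightarrow> 'h"
  assume v: "\<And>i. i < k \<Longrightarrow> v i \<in> space unit_ball_algebra"
  show "(\<integral>l. (\<Prod>i<k. ball_weight l (v i)) \<partial>gaussian_sequence) = overlap_char d c t k (replica_overlap (\<bullet>) v)"
  proof (rule integral_prod_trig[OF gaussian.prob_space_axioms cavity_field_measurable1 cavity_field_joint_char[where k = k and v = v]])
    fix i l assume "i < k"
    then have "v i \<in> cball 0 1" using v[of i] by (simp add: unit_ball_algebra_def space_restrict_space)
    from ball_weight_eq(2)[OF this]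
    show "complex_of_real (ball_weight l (v i)) =
      (\<Sum>j<d. c j * complex_of_real (exp (- (t j)\<^sup>2 * (1 - (norm (v i))\<^sup>2) / 2)) * cis (t j * cavity_field e l (v i)))" .
  next
    fix \<phi> :: "nat \<Rightarrow> nat"
    \<comment> \<open>The dampings supply the diagonal part and the characteristic function the Gram
      part of the quadratic form.\<close>
    show "(\<Prod>i<k. exp (- (t (\<phi> i))\<^sup>2 * (1 - (norm (v i))\<^sup>2) / 2)) * exp (- (norm (\<Sum>i<k. t (\<phi> i) *\<^sub>R v i))\<^sup>2 / 2) =
        exp (- (\<Sum>i<k. \<Sum>j<k. t (\<phi> i) * t (\<phi> j) * replica_overlap (\<bullet>) v i j) / 2)"
      unfolding overlap_quadratic_form
      by (simp add: exp_add[symmetric] exp_sum[symmetric] sum_negf sum_divide_distrib add_divide_distrib diff_divide_distrib)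
  qed
qed

end

end

section \<open>The cavity mapping on sampled laws\<close>

text \<open>Common to the ball and the spin glass: a law obtained by drawing a random measure \<mu>,
  then independent replicas, then a matrix from them.\<close>

lemma
  fixes G :: "(nat \<Rightarrow> nat \<Rightarrow> real) \<Rightarrow> real"
  assumes M: "prob_space M" and \<mu>: "\<mu> \<in> M \<rightarrow>\<^sub>M prob_algebra X" and f: "f \<in> (\<Pi>\<^sub>M i\<in>(UNIV :: nat set). X) \<rightarrow>\<^sub>M rost_algebra"
  shows replica_bind_in_prob_algebra:
      "(M \<bind> (\<lambda>\<omega>. distr (\<Pi>\<^sub>M i\<in>UNIV. \<mu> \<omega>) rost_algebra f)) \<in> space (prob_algebra rost_algebra)"
    and integral_replica_bind: "G \<in> borel_measurable rost_algebra \<Longrightarrow> (\<And>q. q \<in> rost_matrices \<Longrightarrow> \<bar>G q\<bar> \<le> K) \<Longrightarrow>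
      (\<integral>q. G q \<partial>(M \<bind> (\<lambda>\<omega>. distr (\<Pi>\<^sub>M i\<in>UNIV. \<mu> \<omega>) rost_algebra f))) =
      (\<integral>\<omega>. \<integral>v. G (f v) \<partial>(\<Pi>\<^sub>M i\<in>UNIV. \<mu> \<omega>) \<partial>M)"
proof -
  interpret prob_space M by fact
  have "(\<lambda>\<omega>. \<Pi>\<^sub>M i\<in>UNIV. \<mu> \<omega>) \<in> M \<rightarrow>\<^sub>M prob_algebra (\<Pi>\<^sub>M i\<in>(UNIV :: nat set). X)"
    by (rule measurable_compose[OF \<mu> measurable_PiM_kernel])
  from measurable_compose[OF this measurable_distr_prob_space[OF f]]
  have k: "(\<lambda>\<omega>. distr (\<Pi>\<^sub>M i\<in>UNIV. \<mu> \<omega>) rost_algebra f) \<in> M \<rightarrow>\<^sub>M prob_algebra rost_algebra" .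
  have MM: "M \<in> space (prob_algebra M)" by (simp add: space_prob_algebra prob_space_axioms)
  show "(M \<bind> (\<lambda>\<omega>. distr (\<Pi>\<^sub>M i\<in>UNIV. \<mu> \<omega>) rost_algebra f)) \<in> space (prob_algebra rost_algebra)"
    using prob_space_bind'[OF MM k] sets_bind'[OF MM k] by (simp add: space_prob_algebra)
  assume G: "G \<in> borel_measurable rost_algebra" and K: "\<And>q. q \<in> rost_matrices \<Longrightarrow> \<bar>G q\<bar> \<le> K"
  have "(\<integral>q. G q \<partial>(M \<bind> (\<lambda>\<omega>. distr (\<Pi>\<^sub>M i\<in>UNIV. \<mu> \<omega>) rost_algebra f))) =
      (\<integral>\<omega>. \<integral>q. G q \<partial>distr (\<Pi>\<^sub>M i\<in>UNIV. \<mu> \<omega>) rost_algebra f \<partial>M)"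
  proof (rule integral_bind[OF G _ measurable_prob_algebraD[OF k], where B' = 1])
    show "\<bar>G q\<bar> \<le> K" if "q \<in> space rost_algebra" for q using K that by (simp add: space_rost_algebra)
    show "finite_measure M" by (rule finite_measure_axioms)
    show "AE \<omega> in M. emeasure (distr (\<Pi>\<^sub>M i\<in>UNIV. \<mu> \<omega>) rost_algebra f)
        (space (distr (\<Pi>\<^sub>M i\<in>UNIV. \<mu> \<omega>) rost_algebra f)) \<le> ennreal 1"
    proof (rule AE_I2)
      fix \<omega> assume "\<omega> \<in> space M"
      then have "prob_space (distr (\<Pi>\<^sub>M i\<in>UNIV. \<mu> \<omega>) rost_algebra f)"
        using measurable_space[OF k] by (simp add: space_prob_algebra)
      from prob_space.emeasure_space_1[OF this]
      show "emeasure (distr (\<Pi>\<^sub>M i\<in>UNIV. \<mu> \<omega>) rost_algebra f)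
        (space (distr (\<Pi>\<^sub>M i\<in>UNIV. \<mu> \<omega>) rost_algebra f)) \<le> ennreal 1" by simp
    qed
  qed
  also have "\<dots> = (\<integral>\<omega>. \<integral>v. G (f v) \<partial>(\<Pi>\<^sub>M i\<in>UNIV. \<mu> \<omega>) \<partial>M)"
  proof (intro Bochner_Integration.integral_cong refl integral_distr G)
    fix \<omega> assume "\<omega> \<in> space M"
    then have "sets (\<mu> \<omega>) = sets X" using measurable_space[OF \<mu>] by (simp add: space_prob_algebra)
    then show "f \<in> (\<Pi>\<^sub>M i\<in>UNIV. \<mu> \<omega>) \<rightarrow>\<^sub>M rost_algebra"
      using f by (simp cong: measurable_cong_sets sets_PiM_cong)
  qed
  finally show "(\<integral>q. G q \<partial>(M \<bind> (\<lambda>\<omega>. distr (\<Pi>\<^sub>M i\<in>UNIV. \<mu> \<omega>) rost_algebra f))) =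
      (\<integral>\<omega>. \<integral>v. G (f v) \<partial>(\<Pi>\<^sub>M i\<in>UNIV. \<mu> \<omega>) \<partial>M)" .
qed

lemma cavity_test_measurable:
  "block_test n F \<Longrightarrow> cavity_test F n D p d c t \<in> borel_measurable rost_algebra"
  by (simp add: rost_algebra_def measurable_restrict_space1 borel_measurable_continuous_onI continuous_cavity_test)

lemma cavity_test_bounded:
  assumes F: "block_test n F"
  shows "\<exists>K. \<forall>q\<in>rost_matrices. \<bar>cavity_test F n D p d c t q\<bar> \<le> K"
proof -
  have "\<exists>K. \<forall>q\<in>rost_matrices. \<bar>overlap_char d c t (n + k) q\<bar> \<le> K" for k by (rule overlap_char_bounded)
  then obtain K where K: "\<And>k q. q \<in> rost_matrices \<Longrightarrow> \<bar>overlap_char d c t (n + k) q\<bar> \<le> K k" by metis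
  have "\<bar>cavity_test F n D p d c t q\<bar> \<le> (\<Sum>k\<le>D. \<bar>p k\<bar> * K k)" if q: "q \<in> rost_matrices" for q
    unfolding cavity_test_def
  proof (rule order.trans[OF sum_abs sum_mono])
    fix k
    have "\<bar>F q\<bar> \<le> 1" using F by (simp add: block_test_def)
    then have "\<bar>F q\<bar> * \<bar>overlap_char d c t (n + k) q\<bar> \<le> 1 * K k" using K[OF q] by (intro mult_mono) auto
    then show "\<bar>p k * (F q * overlap_char d c t (n + k) q)\<bar> \<le> \<bar>p k\<bar> * K k"
      unfolding abs_mult by (intro mult_left_mono) auto
  qed
  then show ?thesis by blast
qed

context
  fixes e :: "nat \<Rightarrow> 'h :: {real_inner, polish_space}"
  assumes e: "orthonormal_basis e"
begin

text \<open>With frequency 0 the trigonometric polynomial is the constant 1; this instance provides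
  the measurability of overlaps and weights on the ball.\<close>

interpretation ball: cavity_model gaussian_sequence "unit_ball_algebra :: 'h measure" "(\<bullet>)" "cavity_weight lam e"
    "ball_weight e 1 (\<lambda>_. 1) (\<lambda>_. 0)" 1 "\<lambda>_. 1" "\<lambda>_. 0" 1 "exp (lam\<^sup>2)"
    "\<integral>x. \<bar>Re (trig_poly 1 (\<lambda>_. 1) (\<lambda>_. 0) x) - gauss_weight lam x\<bar> \<partial>std_normal_distribution" for lam
  by (rule cavity_model_ball[OF e]) (auto simp: trig_poly_def)

lemma overlap_law_alt: "overlap_law m = distr (\<Pi>\<^sub>M i\<in>UNIV. m) rost_algebra (replica_overlap ((\<bullet>) :: 'h \<Rightarrow> _))"
  unfolding overlap_law_def by (rule arg_cong[where f = "distr _ _"]) (simp add: fun_eq_iff replica_overlap_def)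

lemma cavity_measure_tilt: "cavity_measure lam e l m = tilt m (cavity_weight lam e l)"
  by (simp add: cavity_measure_def tilt_def)

lemma
  fixes G :: "(nat \<Rightarrow> nat \<Rightarrow> real) \<Rightarrow> real"
  assumes D: "D \<in> (random_measure_laws :: 'h measure measure set)"
  shows sampled_rost_law_in: "sampled_rost_law D \<in> space (prob_algebra rost_algebra)"
    and integral_sampled_rost_law: "G \<in> borel_measurable rost_algebra \<Longrightarrow> (\<And>q. q \<in> rost_matrices \<Longrightarrow> \<bar>G q\<bar> \<le> K) \<Longrightarrow>
      (\<integral>q. G q \<partial>sampled_rost_law D) = (\<integral>m. \<integral>v. G (replica_overlap (\<bullet>) v) \<partial>(\<Pi>\<^sub>M i\<in>UNIV. m) \<partial>D)"
proof -
  have D': "prob_space D" "sets D = sets (prob_algebra (unit_ball_algebra :: 'h measure))"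
    using D by (auto simp: random_measure_laws_def space_prob_algebra)
  have id: "(\<lambda>m. m) \<in> D \<rightarrow>\<^sub>M prob_algebra unit_ball_algebra"
    using D'(2) by (simp cong: measurable_cong_sets)
  show "sampled_rost_law D \<in> space (prob_algebra rost_algebra)"
    unfolding sampled_rost_law_def overlap_law_alt[abs_def]
    by (rule replica_bind_in_prob_algebra[OF D'(1) id ball.measurable_replica_overlap])
  show "(\<integral>q. G q \<partial>sampled_rost_law D) = (\<integral>m. \<integral>v. G (replica_overlap (\<bullet>) v) \<partial>(\<Pi>\<^sub>M i\<in>UNIV. m) \<partial>D)"
    if "G \<in> borel_measurable rost_algebra" "\<And>q. q \<in> rost_matrices \<Longrightarrow> \<bar>G q\<bar> \<le> K"
    unfolding sampled_rost_law_def overlap_law_alt[abs_def]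
    by (rule integral_replica_bind[OF D'(1) id ball.measurable_replica_overlap that])
qed

lemma measurable_cavity_measure:
  "(\<lambda>(m, l). cavity_measure lam e l m) \<in> prob_algebra unit_ball_algebra \<Otimes>\<^sub>M gaussian_sequence \<rightarrow>\<^sub>M prob_algebra unit_ball_algebra"
  unfolding cavity_measure_tilt by (rule measurable_tilt[OF ball.w_measurable ball.w_pos])

lemma cavity_sampling_law_in:
  assumes D: "D \<in> random_measure_laws"
  shows "cavity_sampling_law lam e D \<in> random_measure_laws"
proof -
  have D': "prob_space D" and sD: "sets D = sets (prob_algebra (unit_ball_algebra :: 'h measure))"
    using D by (auto simp: random_measure_laws_def space_prob_algebra)
  interpret D: prob_space D by fact
  interpret P: pair_prob_space D gaussian_sequence ..
  have "(\<lambda>(m, l). cavity_measure lam e l m) \<in> D \<Otimes>\<^sub>M gaussian_sequence \<rightarrow>\<^sub>M prob_algebra unit_ball_algebra"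
    using measurable_cavity_measure by (simp cong: measurable_cong_sets sets_pair_measure_cong add: sD)
  then show ?thesis
    unfolding cavity_sampling_law_def random_measure_laws_def space_prob_algebra
    by (auto intro: P.prob_space_distr)
qed

lemma integral_cavity_sampled:
  assumes D: "D \<in> random_measure_laws" and F: "block_test n F"
  shows "(\<integral>q. F q \<partial>sampled_rost_law (cavity_sampling_law lam e D)) =
    (\<integral>m. \<integral>l. \<integral>v. F (replica_overlap (\<bullet>) v) \<partial>(\<Pi>\<^sub>M i\<in>UNIV. tilt m (cavity_weight lam e l)) \<partial>gaussian_sequence \<partial>D)"
proof -
  have D': "prob_space D" and sD: "sets D = sets (prob_algebra (unit_ball_algebra :: 'h measure))"
    using D by (auto simp: random_measure_laws_def space_prob_algebra)
  interpret D: prob_space D by fact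
  interpret P: pair_prob_space D gaussian_sequence ..
  have spD: "space D = space (prob_algebra unit_ball_algebra)" using sets_eq_imp_space_eq[OF sD] .
  have cm: "(\<lambda>(m, l). cavity_measure lam e l m) \<in> D \<Otimes>\<^sub>M gaussian_sequence \<rightarrow>\<^sub>M prob_algebra unit_ball_algebra"
    using measurable_cavity_measure by (simp cong: measurable_cong_sets sets_pair_measure_cong add: sD)
  define g where "g m = (\<integral>v. F (replica_overlap (\<bullet>) v) \<partial>(\<Pi>\<^sub>M i\<in>UNIV. m))" for m :: "'h measure"
  have gm: "g \<in> borel_measurable (prob_algebra unit_ball_algebra)"
    unfolding g_def
    by (intro measurable_compose[OF measurable_PiM_kernel[THEN measurable_prob_algebraD] integral_measurable_subprob_algebra]
        measurable_compose[OF ball.measurable_replica_overlap block_test_rost_measurable[OF F]])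
  have g_bound: "\<bar>g m\<bar> \<le> 1" if "prob_space m" for m
  proof -
    interpret U: prob_space "\<Pi>\<^sub>M i\<in>(UNIV :: nat set). m" using that by (intro prob_space_PiM)
    have "\<bar>g m\<bar> \<le> (\<integral>v. 1 \<partial>(\<Pi>\<^sub>M i\<in>(UNIV :: nat set). m))" unfolding g_def
      by (rule order.trans[OF integral_abs_bound integral_mono']) (use F in \<open>auto simp: block_test_def\<close>)
    then show ?thesis by (simp add: U.prob_space)
  qed
  have Fb: "\<bar>F q\<bar> \<le> 1" for q using F by (simp add: block_test_def)
  have "(\<integral>q. F q \<partial>sampled_rost_law (cavity_sampling_law lam e D)) = (\<integral>m. g m \<partial>cavity_sampling_law lam e D)"
    unfolding g_def
    by (rule integral_sampled_rost_law[OF cavity_sampling_law_in[OF D] block_test_rost_measurable[OF F] Fb])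
  also have "\<dots> = (\<integral>z. g (case z of (m, l) \<Rightarrow> cavity_measure lam e l m) \<partial>(D \<Otimes>\<^sub>M gaussian_sequence))"
    unfolding cavity_sampling_law_def by (rule integral_distr[OF cm gm])
  also have "\<dots> = (\<integral>m. \<integral>l. g (cavity_measure lam e l m) \<partial>gaussian_sequence \<partial>D)"
  proof -
    have int: "integrable (D \<Otimes>\<^sub>M gaussian_sequence) (\<lambda>(m, l). g (cavity_measure lam e l m))"
    proof (rule P.integrable_const_bound[of _ 1])
      show "(\<lambda>(m, l). g (cavity_measure lam e l m)) \<in> borel_measurable (D \<Otimes>\<^sub>M gaussian_sequence)"
        using measurable_compose[OF cm gm] by (simp add: split_beta')
      show "AE z in D \<Otimes>\<^sub>M gaussian_sequence. norm (case z of (m, l) \<Rightarrow> g (cavity_measure lam e l m)) \<le> 1"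
      proof (rule AE_I2)
        fix z assume "z \<in> space (D \<Otimes>\<^sub>M gaussian_sequence)"
        from measurable_space[OF cm this] show "norm (case z of (m, l) \<Rightarrow> g (cavity_measure lam e l m)) \<le> 1"
          by (auto simp: space_prob_algebra split: prod.splits intro: g_bound)
      qed
    qed
    show ?thesis using P.integral_fst[OF int] by (simp add: split_beta')
  qed
  finally show ?thesis by (simp add: g_def cavity_measure_tilt)
qed

text \<open>The error bound does not depend on the law \<open>D\<close>: this is continuity of the cavity mapping.\<close>

lemma cavity_sampled_approx:
  assumes D: "D \<in> random_measure_laws" and F: "block_test n F"
    and T: "\<And>x. Im (trig_poly d c t x) = 0" "\<And>x. 0 \<le> Re (trig_poly d c t x)" "\<And>x. Re (trig_poly d c t x) \<le> B"
    and \<delta>: "0 < \<delta>" and p: "\<And>z. 0 \<le> z \<Longrightarrow> z \<le> B \<Longrightarrow> \<bar>(\<Sum>k\<le>N. p k * z ^ k) - 1 / max z \<delta> ^ n\<bar> \<le> \<eta>"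
  shows "\<bar>(\<integral>q. F q \<partial>sampled_rost_law (cavity_sampling_law lam e D)) - (\<integral>q. cavity_test F n N p d c t q \<partial>sampled_rost_law D)\<bar>
    \<le> (2 * real n + 2) / \<delta> * (\<integral>x. \<bar>Re (trig_poly d c t x) - gauss_weight lam x\<bar> \<partial>std_normal_distribution)
       + 4 * \<delta> * exp (lam\<^sup>2) + B ^ n * \<eta>"
proof -
  interpret m: cavity_model gaussian_sequence "unit_ball_algebra :: 'h measure" "(\<bullet>)" "cavity_weight lam e"
    "ball_weight e d c t" d c t B "exp (lam\<^sup>2)"
    "\<integral>x. \<bar>Re (trig_poly d c t x) - gauss_weight lam x\<bar> \<partial>std_normal_distribution"
    by (rule cavity_model_ball[OF e T])
  obtain K where K: "\<And>q. q \<in> rost_matrices \<Longrightarrow> \<bar>cavity_test F n N p d c t q\<bar> \<le> K"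
    using cavity_test_bounded[OF F] by blast
  have "(\<integral>q. cavity_test F n N p d c t q \<partial>sampled_rost_law D) =
      (\<integral>m. \<integral>v. cavity_test F n N p d c t (replica_overlap (\<bullet>) v) \<partial>(\<Pi>\<^sub>M i\<in>UNIV. m) \<partial>D)"
    by (rule integral_sampled_rost_law[OF D cavity_test_measurable[OF F] K])
  then show ?thesis
    using m.tilted_integral_approx[OF F \<delta> p D[unfolded random_measure_laws_def]]
    by (simp only: integral_cavity_sampled[OF D F])
qed

end

section \<open>Exchangeable sequences\<close>

text \<open>A transposition corrects the value at \<open>n\<close>, and injectivity of
  \<open>f\<close> and of the permutation keeps the earlier values in place. Invariance under
  finitary permutations thus gives invariance under every injective choice of \<open>n\<close>
  indices.\<close>

lemma ex_finite_permutation_extending: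
  fixes f :: "nat \<Rightarrow> nat"
  assumes "inj_on f {..<n}"
  shows "\<exists>\<tau>. bij \<tau> \<and> finite {i. \<tau> i \<noteq> i} \<and> (\<forall>i<n. \<tau> i = f i)"
  using assms
proof (induction n)
  case 0
  show ?case by (intro exI[of _ "\<lambda>i. i"]) (simp add: bij_def inj_on_def surj_def)
next
  case (Suc n)
  then obtain \<tau> where \<tau>: "bij \<tau>" "finite {i. \<tau> i \<noteq> i}" "\<And>i. i < n \<Longrightarrow> \<tau> i = f i"
    by (auto simp: lessThan_Suc)
  define \<pi> where "\<pi> = Transposition.transpose (\<tau> n) (f n) \<circ> \<tau>"
  have "bij \<pi>" unfolding \<pi>_def using \<tau>(1) by (intro bij_comp) auto
  moreover have "finite {i. \<pi> i \<noteq> i}"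
  proof (rule finite_subset)
    show "{i. \<pi> i \<noteq> i} \<subseteq> {i. \<tau> i \<noteq> i} \<union> {\<tau> n, f n}"
      by (auto simp: \<pi>_def Transposition.transpose_def)
  qed (use \<tau>(2) in auto)
  moreover have "\<pi> i = f i" if "i < Suc n" for i
  proof (cases "i = n")
    case False
    then have "i < n" using that by simp
    then have "f i \<noteq> f n" using Suc.prems by (auto simp: inj_on_def)
    moreover have "\<tau> i \<noteq> \<tau> n" using \<tau>(1) False by (auto simp: bij_def inj_on_def)
    ultimately show ?thesis using \<tau>(3)[OF \<open>i < n\<close>] by (simp add: \<pi>_def Transposition.transpose_def)
  qed (simp add: \<pi>_def)
  ultimately show ?case by blast
qed

lemma (in prob_space) expectation_abs_le_sqrt:
  fixes X :: "'a \<Rightarrow> real"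
  assumes [measurable]: "X \<in> borel_measurable M" and b: "\<And>\<omega>. \<bar>X \<omega>\<bar> \<le> B"
    and v: "expectation (\<lambda>\<omega>. (X \<omega>)\<^sup>2) \<le> v" "0 < v"
  shows "expectation (\<lambda>\<omega>. \<bar>X \<omega>\<bar>) \<le> sqrt v"
proof -
  have i1: "integrable M (\<lambda>\<omega>. \<bar>X \<omega>\<bar>)" using b by (intro integrable_const_bound[of _ B]) auto
  have i2: "integrable M (\<lambda>\<omega>. (X \<omega>)\<^sup>2)"
  proof (rule integrable_const_bound[of _ "B\<^sup>2"])
    have "(X \<omega>)\<^sup>2 \<le> B\<^sup>2" for \<omega> using power_mono[OF b[of \<omega>], where n = 2] by simp
    then show "AE \<omega> in M. norm ((X \<omega>)\<^sup>2) \<le> B\<^sup>2" by simp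
  qed measurable
  \<comment> \<open>Cauchy-Schwarz by way of the arithmetic-geometric mean inequality, balanced at
    \<open>\<bar>X \<omega>\<bar> = sqrt v\<close>.\<close>
  have "expectation (\<lambda>\<omega>. \<bar>X \<omega>\<bar>) \<le> expectation (\<lambda>\<omega>. (X \<omega>)\<^sup>2 / (2 * sqrt v) + sqrt v / 2)"
  proof (rule integral_mono[OF i1])
    show "integrable M (\<lambda>\<omega>. (X \<omega>)\<^sup>2 / (2 * sqrt v) + sqrt v / 2)" using i2 by auto
    fix \<omega>
    have "0 \<le> (\<bar>X \<omega>\<bar> - sqrt v)\<^sup>2" by simp
    then have "2 * sqrt v * \<bar>X \<omega>\<bar> \<le> (X \<omega>)\<^sup>2 + sqrt v * sqrt v"
      by (simp add: power2_eq_square algebra_simps)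
    then show "\<bar>X \<omega>\<bar> \<le> (X \<omega>)\<^sup>2 / (2 * sqrt v) + sqrt v / 2"
      using v(2) by (simp add: field_simps)
  qed
  also have "\<dots> = expectation (\<lambda>\<omega>. (X \<omega>)\<^sup>2) / (2 * sqrt v) + sqrt v / 2"
    using i2 by (simp add: prob_space)
  also have "\<dots> \<le> v / (2 * sqrt v) + sqrt v / 2"
    using v by (intro add_right_mono divide_right_mono) auto
  also have "\<dots> = sqrt v" using v(2) by (simp add: field_simps)
  finally show ?thesis .
qed

text \<open>Values in the unit interval make the directing distribution functions reach 0 and 1; a
  sequence in a Polish space is brought into this form by a coding.\<close>

locale exchangeable_unit = prob_space M for M :: "'a measure" +
  fixes \<xi> :: "nat \<Rightarrow> 'a \<Rightarrow> real"
  assumes \<xi>_measurable [measurable]: "\<And>i. \<xi> i \<in> borel_measurable M"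
    and \<xi>_nonneg: "\<And>i \<omega>. 0 \<le> \<xi> i \<omega>" and \<xi>_le: "\<And>i \<omega>. \<xi> i \<omega> \<le> 1"
    and exchangeable: "\<And>\<tau>. bij \<tau> \<Longrightarrow> finite {i. \<tau> i \<noteq> i} \<Longrightarrow>
      distr M (\<Pi>\<^sub>M i\<in>UNIV. borel) (\<lambda>\<omega> i. \<xi> (\<tau> i) \<omega>) = distr M (\<Pi>\<^sub>M i\<in>UNIV. borel) (\<lambda>\<omega> i. \<xi> i \<omega>)"
begin

definition unit_fun :: "(real \<Rightarrow> real) \<Rightarrow> bool" where
  "unit_fun h \<longleftrightarrow> h \<in> borel_measurable borel \<and> (\<forall>x. 0 \<le> h x \<and> h x \<le> 1)"

lemma unit_funD: "unit_fun h \<Longrightarrow> h \<in> borel_measurable borel" "unit_fun h \<Longrightarrow> 0 \<le> h x" "unit_fun h \<Longrightarrow> h x \<le> 1"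
  by (auto simp: unit_fun_def)

lemma measurable_unit_fun: "unit_fun h \<Longrightarrow> (\<lambda>\<omega>. h (\<xi> i \<omega>)) \<in> borel_measurable M"
  by (rule measurable_compose[OF \<xi>_measurable]) (auto simp: unit_fun_def)

lemma prod_unit_le: "(\<And>i. i \<in> I \<Longrightarrow> 0 \<le> a i \<and> a i \<le> 1) \<Longrightarrow> (\<Prod>i\<in>I. a i :: real) \<le> 1 \<and> 0 \<le> (\<Prod>i\<in>I. a i)"
  by (auto intro: prod_le_1 prod_nonneg)

lemma expectation_prod_inj:
  assumes f: "inj_on f {..<n}" and h: "\<And>i. unit_fun (h i)"
  shows "expectation (\<lambda>\<omega>. \<Prod>i<n. h i (\<xi> (f i) \<omega>)) = expectation (\<lambda>\<omega>. \<Prod>i<n. h i (\<xi> i \<omega>))"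
proof -
  obtain \<tau> where \<tau>: "bij \<tau>" "finite {i. \<tau> i \<noteq> i}" "\<And>i. i < n \<Longrightarrow> \<tau> i = f i"
    using ex_finite_permutation_extending[OF f] by blast
  let ?P = "\<Pi>\<^sub>M i\<in>(UNIV :: nat set). (borel :: real measure)"
  have "(\<lambda>x. h i (x i)) \<in> borel_measurable ?P" for i
    by (rule measurable_compose[of "\<lambda>x. x i" ?P borel "h i"]) (auto intro: unit_funD(1)[OF h])
  then have G: "(\<lambda>x. \<Prod>i<n. h i (x i)) \<in> borel_measurable ?P"
    by (intro borel_measurable_prod)
  have m: "(\<lambda>\<omega> i. \<xi> (g i) \<omega>) \<in> M \<rightarrow>\<^sub>M ?P" for g
    by (rule measurable_PiM_single') (auto simp: space_PiM)
  have "expectation (\<lambda>\<omega>. \<Prod>i<n. h i (\<xi> (f i) \<omega>)) = expectation (\<lambda>\<omega>. \<Prod>i<n. h i (\<xi> (\<tau> i) \<omega>))"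
    using \<tau>(3) by simp
  also have "\<dots> = (\<integral>x. (\<Prod>i<n. h i (x i)) \<partial>distr M ?P (\<lambda>\<omega> i. \<xi> (\<tau> i) \<omega>))"
    by (subst integral_distr[OF m G]) simp
  also have "\<dots> = (\<integral>x. (\<Prod>i<n. h i (x i)) \<partial>distr M ?P (\<lambda>\<omega> i. \<xi> i \<omega>))"
    by (simp only: exchangeable[OF \<tau>(1,2)])
  also have "\<dots> = expectation (\<lambda>\<omega>. \<Prod>i<n. h i (\<xi> i \<omega>))"
    by (subst integral_distr[OF m G]) simp
  finally show ?thesis .
qed

text \<open>Exchangeability leaves two second moments, \<open>a\<close> on the diagonal and
  \<open>b\<close> off it. As the coefficients sum to 0 the part with \<open>b\<close> cancels,
  leaving \<open>a - b \<le> 1\<close> times the sum of squares: a quantitative law of large numbers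
  without independence.\<close>

lemma expectation_square_balanced:
  assumes h: "unit_fun h" and I: "finite I" and d: "(\<Sum>i\<in>I. d i) = 0"
  shows "expectation (\<lambda>\<omega>. (\<Sum>i\<in>I. d i * h (\<xi> i \<omega>))\<^sup>2) \<le> (\<Sum>i\<in>I. (d i)\<^sup>2)"
proof -
  define a where "a = expectation (\<lambda>\<omega>. (h (\<xi> 0 \<omega>))\<^sup>2)"
  define b where "b = expectation (\<lambda>\<omega>. h (\<xi> 0 \<omega>) * h (\<xi> 1 \<omega>))"
  have h2: "unit_fun (\<lambda>x. (h x)\<^sup>2)"
    using h by (auto simp: unit_fun_def abs_square_le_1)
  have hh: "0 \<le> h (\<xi> i \<omega>) * h (\<xi> j \<omega>)" "h (\<xi> i \<omega>) * h (\<xi> j \<omega>) \<le> 1" for i j \<omega>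
    using unit_funD[OF h] by (auto intro: mult_le_one)
  have int: "integrable M (\<lambda>\<omega>. h (\<xi> i \<omega>) * h (\<xi> j \<omega>))" for i j
    using hh measurable_unit_fun[OF h] by (intro integrable_const_bound[of _ 1]) auto
  have E: "expectation (\<lambda>\<omega>. h (\<xi> i \<omega>) * h (\<xi> j \<omega>)) = (if i = j then a else b)" for i j
  proof (cases "i = j")
    case True
    have "expectation (\<lambda>\<omega>. \<Prod>k<1::nat. (h (\<xi> ((\<lambda>_. i) k) \<omega>))\<^sup>2) = expectation (\<lambda>\<omega>. \<Prod>k<1::nat. (h (\<xi> k \<omega>))\<^sup>2)"
      by (rule expectation_prod_inj[of "\<lambda>_. i" 1 "\<lambda>_ x. (h x)\<^sup>2"]) (auto intro: h2 simp: inj_on_def)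
    then show ?thesis using True by (simp add: a_def power2_eq_square)
  next
    case False
    have "expectation (\<lambda>\<omega>. \<Prod>k<2::nat. h (\<xi> (if k = 0 then i else j) \<omega>)) = expectation (\<lambda>\<omega>. \<Prod>k<2::nat. h (\<xi> k \<omega>))"
      using False by (intro expectation_prod_inj[of "\<lambda>k. if k = 0 then i else j" 2 "\<lambda>_. h"])
        (auto intro: h simp: inj_on_def)
    then show ?thesis using False by (simp add: b_def numeral_2_eq_2)
  qed
  have "a \<le> 1" "0 \<le> b"
    unfolding a_def b_def using hh unit_funD[OF h2] measurable_unit_fun[OF h2]
    by (auto intro!: integral_le_const integrable_const_bound[of _ 1])
  have "expectation (\<lambda>\<omega>. (\<Sum>i\<in>I. d i * h (\<xi> i \<omega>))\<^sup>2) =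
      expectation (\<lambda>\<omega>. \<Sum>i\<in>I. \<Sum>j\<in>I. d i * d j * (h (\<xi> i \<omega>) * h (\<xi> j \<omega>)))"
    by (simp add: power2_eq_square sum_product ac_simps)
  also have "\<dots> = (\<Sum>i\<in>I. \<Sum>j\<in>I. d i * d j * (if i = j then a else b))"
    using int by (simp add: E)
  also have "\<dots> = (\<Sum>i\<in>I. \<Sum>j\<in>I. b * (d i * d j) + (if i = j then (a - b) * (d i)\<^sup>2 else 0))"
    by (intro sum.cong refl) (auto simp: power2_eq_square algebra_simps)
  also have "\<dots> = b * ((\<Sum>i\<in>I. d i) * (\<Sum>j\<in>I. d j)) + (a - b) * (\<Sum>i\<in>I. (d i)\<^sup>2)"
    using I by (simp add: sum.distrib sum.delta' flip: sum_distrib_left sum_distrib_right)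
  also have "\<dots> = (a - b) * (\<Sum>i\<in>I. (d i)\<^sup>2)" by (simp add: d)
  also have "\<dots> \<le> 1 * (\<Sum>i\<in>I. (d i)\<^sup>2)"
    using \<open>a \<le> 1\<close> \<open>0 \<le> b\<close> by (intro mult_right_mono sum_nonneg) auto
  finally show ?thesis by simp
qed

section \<open>Block averages and their limits\<close>

definition block_avg :: "nat \<Rightarrow> nat \<Rightarrow> (real \<Rightarrow> real) \<Rightarrow> 'a \<Rightarrow> real" where
  "block_avg K a h \<omega> = (\<Sum>k<K. h (\<xi> (a * K + k) \<omega>)) / K"

lemma block_avg_unit:
  assumes h: "unit_fun h"
  shows "0 \<le> block_avg K a h \<omega>" "block_avg K a h \<omega> \<le> 1"
proof -
  show "0 \<le> block_avg K a h \<omega>" unfolding block_avg_def using unit_funD[OF h] by (intro divide_nonneg_nonneg sum_nonneg) auto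
  have "(\<Sum>k<K. h (\<xi> (a * K + k) \<omega>)) \<le> (\<Sum>k<K. 1)" using unit_funD[OF h] by (intro sum_mono) auto
  then show "block_avg K a h \<omega> \<le> 1" unfolding block_avg_def by (cases "K = 0") (auto simp: divide_le_eq)
qed

lemma measurable_block_avg: "unit_fun h \<Longrightarrow> block_avg K a h \<in> borel_measurable M"
  unfolding block_avg_def by (intro borel_measurable_divide borel_measurable_sum borel_measurable_const measurable_unit_fun)

lemma abs_diff_unit: "0 \<le> x \<Longrightarrow> x \<le> 1 \<Longrightarrow> 0 \<le> y \<Longrightarrow> y \<le> 1 \<Longrightarrow> \<bar>x - y :: real\<bar> \<le> 1"
  by linarith

text \<open>On two disjoint blocks the coefficients \<open>1 / K\<close> and \<open>- 1 / K\<close>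
  sum to 0 and their squares to \<open>2 / K\<close>.\<close>

lemma block_avg_blocks_close:
  assumes h: "unit_fun h" and K: "0 < K"
  shows "expectation (\<lambda>\<omega>. \<bar>block_avg K a h \<omega> - block_avg K 0 h \<omega>\<bar>) \<le> sqrt (2 / K)"
proof (cases "a = 0")
  case False
  define I where "I = {..<K} \<union> {a * K..<a * K + K}"
  define d where "d i = (if i < K then - 1 / real K else 1 / real K)" for i
  have disj: "{..<K} \<inter> {a * K..<a * K + K} = {}"
  proof -
    have "K \<le> a * K" using False by (cases a) auto
    then have "x \<notin> {a * K..<a * K + K}" if "x < K" for x
      using that by (simp only: atLeastLessThan_iff) linarith
    then show ?thesis by blast
  qed
  have sumI: "(\<Sum>i\<in>I. f i) = (\<Sum>i<K. f i) + (\<Sum>k<K. f (a * K + k))" for f :: "nat \<Rightarrow> real"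
  proof -
    have "(\<Sum>i\<in>{a * K..<a * K + K}. f i) = (\<Sum>k<K. f (a * K + k))"
      using sum.shift_bounds_nat_ivl[of f 0 "a * K" K] by (simp add: atLeast0LessThan add.commute)
    then show ?thesis unfolding I_def using disj by (simp add: sum.union_disjoint)
  qed
  have nl: "\<not> a * K + k < K" for k using False by (cases a) auto
  have "(\<Sum>i\<in>I. d i) = 0" using K by (simp add: sumI d_def nl)
  moreover have "(\<Sum>i\<in>I. (d i)\<^sup>2) = 2 / K"
  proof -
    have "(\<Sum>i\<in>I. (d i)\<^sup>2) = (\<Sum>i<K. (1 / real K)\<^sup>2) + (\<Sum>k<K. (1 / real K)\<^sup>2)"
      unfolding sumI by (intro arg_cong2[where f = "(+)"] sum.cong refl) (simp_all add: d_def nl)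
    then show ?thesis using K by (simp add: power2_eq_square)
  qed
  moreover have "block_avg K a h \<omega> - block_avg K 0 h \<omega> = (\<Sum>i\<in>I. d i * h (\<xi> i \<omega>))" for \<omega>
    by (simp add: sumI d_def nl block_avg_def sum_divide_distrib sum_negf)
  ultimately have "expectation (\<lambda>\<omega>. (block_avg K a h \<omega> - block_avg K 0 h \<omega>)\<^sup>2) \<le> 2 / K"
    using expectation_square_balanced[OF h, of I d] by (simp add: I_def)
  then show ?thesis
    using K measurable_block_avg[OF h] block_avg_unit[OF h]
    by (intro expectation_abs_le_sqrt[of _ 1] abs_diff_unit) auto
qed simp

text \<open>The coefficients \<open>1 / L - 1 / K\<close> below \<open>K\<close> and
  \<open>1 / L\<close> from there on sum to 0 and their squares to
  \<open>1 / K - 1 / L\<close>.\<close>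

lemma block_avg_doubling_close:
  assumes h: "unit_fun h" and KL: "0 < K" "K \<le> L"
  shows "expectation (\<lambda>\<omega>. \<bar>block_avg L 0 h \<omega> - block_avg K 0 h \<omega>\<bar>) \<le> sqrt (1 / K)"
proof -
  define d where "d i = 1 / real L - (if i < K then 1 / real K else 0)" for i
  have ind: "(\<Sum>i<L. if i < K then f i else 0) = (\<Sum>i<K. f i)" for f :: "nat \<Rightarrow> real"
    using KL by (intro sum.mono_neutral_cong_right) auto
  have "(\<Sum>i<L. d i) = 0" using KL by (simp add: d_def sum_subtractf ind)
  moreover have "(\<Sum>i<L. (d i)\<^sup>2) \<le> 1 / K"
  proof -
    have "(d i)\<^sup>2 = (1 / real L)\<^sup>2 + (if i < K then (1 / real K)\<^sup>2 - 2 * (1 / real L) * (1 / real K) else 0)" for i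
      by (simp add: d_def power2_diff)
    then have "(\<Sum>i<L. (d i)\<^sup>2) = L * (1 / real L)\<^sup>2 + K * ((1 / real K)\<^sup>2 - 2 * (1 / real L) * (1 / real K))"
      by (simp add: sum.distrib ind)
    also have "\<dots> = 1 / K - 1 / L" using KL by (simp add: power2_eq_square field_simps)
    finally show ?thesis by simp
  qed
  moreover have "block_avg L 0 h \<omega> - block_avg K 0 h \<omega> = (\<Sum>i<L. d i * h (\<xi> i \<omega>))" for \<omega>
  proof -
    have "d i * h (\<xi> i \<omega>) = h (\<xi> i \<omega>) / L - (if i < K then h (\<xi> i \<omega>) / K else 0)" for i
      by (simp add: d_def left_diff_distrib)
    then show ?thesis by (simp add: sum_subtractf ind block_avg_def sum_divide_distrib)
  qed
  ultimately have "expectation (\<lambda>\<omega>. (block_avg L 0 h \<omega> - block_avg K 0 h \<omega>)\<^sup>2) \<le> 1 / K"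
    using expectation_square_balanced[OF h, of "{..<L}" d] by (simp add: order.trans)
  then show ?thesis
    using KL measurable_block_avg[OF h] block_avg_unit[OF h]
    by (intro expectation_abs_le_sqrt[of _ 1] abs_diff_unit) auto
qed

text \<open>Block lengths \<open>4 ^ j\<close> make the mean increments at most
  \<open>(1 / 2) ^ j\<close>, hence summable. The upper limit is defined at every outcome and
  monotone in \<open>h\<close> everywhere, so distribution functions can be built from it without
  exceptional sets.\<close>

definition dir :: "(real \<Rightarrow> real) \<Rightarrow> 'a \<Rightarrow> real" where
  "dir h \<omega> = real_of_ereal (limsup (\<lambda>j. ereal (block_avg (4 ^ j) 0 h \<omega>)))"

lemma limsup_block_avg:
  assumes h: "unit_fun h"
  shows "ereal (dir h \<omega>) = limsup (\<lambda>j. ereal (block_avg (4 ^ j) 0 h \<omega>))" and "0 \<le> dir h \<omega>" "dir h \<omega> \<le> 1"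
proof -
  let ?L = "limsup (\<lambda>j. ereal (block_avg (4 ^ j) 0 h \<omega>))"
  have "limsup (\<lambda>j. ereal 0) \<le> ?L" using block_avg_unit[OF h] by (intro Limsup_mono always_eventually) auto
  moreover have "?L \<le> limsup (\<lambda>j. ereal 1)" using block_avg_unit[OF h] by (intro Limsup_mono always_eventually) auto
  ultimately have "0 \<le> ?L" "?L \<le> 1" by (simp_all add: Limsup_const zero_ereal_def one_ereal_def)
  then obtain r where "?L = ereal r" "0 \<le> r" "r \<le> 1" by (cases ?L) auto
  then show "ereal (dir h \<omega>) = ?L" "0 \<le> dir h \<omega>" "dir h \<omega> \<le> 1" by (simp_all add: dir_def)
qed

lemma measurable_dir: "unit_fun h \<Longrightarrow> dir h \<in> borel_measurable M"
  unfolding dir_def using measurable_block_avg by measurable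

lemma dir_mono:
  assumes "unit_fun h" "unit_fun h'" "\<And>x. h x \<le> h' x"
  shows "dir h \<omega> \<le> dir h' \<omega>"
proof -
  have "block_avg K 0 h \<omega> \<le> block_avg K 0 h' \<omega>" for K
    unfolding block_avg_def using assms(3) by (intro divide_right_mono sum_mono) auto
  then have "ereal (dir h \<omega>) \<le> ereal (dir h' \<omega>)"
    unfolding limsup_block_avg[OF assms(1)] limsup_block_avg[OF assms(2)] by (intro Limsup_mono always_eventually) auto
  then show ?thesis by simp
qed

lemma dir_const:
  assumes "\<And>x. 0 \<le> x \<Longrightarrow> x \<le> 1 \<Longrightarrow> h x = c"
  shows "dir h \<omega> = c"
proof -
  have "block_avg (4 ^ j) 0 h \<omega> = c" for j
    using assms[OF \<xi>_nonneg \<xi>_le] by (simp add: block_avg_def)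
  then show ?thesis by (simp add: dir_def Limsup_const)
qed

text \<open>Increments with summable means are almost surely summable, so the block averages
  converge and their limit is the upper limit \<open>dir\<close>.\<close>

lemma AE_block_avg_tendsto:
  assumes h: "unit_fun h"
  shows "AE \<omega> in M. (\<lambda>j. block_avg (4 ^ j) 0 h \<omega>) \<longlonglongrightarrow> dir h \<omega>"
proof -
  define x where "x j \<omega> = \<bar>block_avg (4 ^ Suc j) 0 h \<omega> - block_avg (4 ^ j) 0 h \<omega>\<bar>" for j \<omega>
  have xm [measurable]: "x j \<in> borel_measurable M" for j
    unfolding x_def by (intro borel_measurable_abs borel_measurable_diff measurable_block_avg h)
  have x1: "0 \<le> x j \<omega>" "x j \<omega> \<le> 1" for j \<omega>
    unfolding x_def using block_avg_unit[OF h] by (auto intro: abs_diff_unit)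
  have xi: "integrable M (x j)" for j using x1 by (intro integrable_const_bound[of _ 1]) auto
  have "expectation (x j) \<le> (1 / 2) ^ j" for j
  proof -
    have "expectation (x j) \<le> sqrt (1 / real (4 ^ j))"
      unfolding x_def by (rule block_avg_doubling_close[OF h]) (auto intro: power_increasing)
    also have "\<dots> = (1 / 2) ^ j"
    proof (rule real_sqrt_unique)
      have "((1 / 2 :: real) ^ j)\<^sup>2 = ((1 / 2)\<^sup>2) ^ j" by (simp only: power_mult[symmetric] mult.commute)
      then show "((1 / 2) ^ j)\<^sup>2 = 1 / real (4 ^ j)" by (simp add: power2_eq_square power_one_over)
    qed simp
    finally show ?thesis .
  qed
  then have "(\<integral>\<^sup>+ \<omega>. ennreal (x j \<omega>) \<partial>M) \<le> ennreal ((1 / 2) ^ j)" for j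
    using xi x1 by (simp add: nn_integral_eq_integral ennreal_leI)
  then have "(\<Sum>j. \<integral>\<^sup>+ \<omega>. ennreal (x j \<omega>) \<partial>M) \<le> (\<Sum>j. ennreal ((1 / 2) ^ j))"
    by (intro suminf_le summableI) auto
  also have "\<dots> = ennreal (\<Sum>j. (1 / 2) ^ j)" by (intro suminf_ennreal2) (auto intro: summable_geometric)
  finally have "(\<integral>\<^sup>+ \<omega>. (\<Sum>j. ennreal (x j \<omega>)) \<partial>M) \<noteq> \<infinity>"
    by (subst nn_integral_suminf) (auto simp: top_unique)
  then have "AE \<omega> in M. (\<Sum>j. ennreal (x j \<omega>)) \<noteq> \<infinity>"
    by (intro nn_integral_noteq_infinite) auto
  then show ?thesis
  proof eventually_elim
    case (elim \<omega>)
    then have "summable (\<lambda>j. x j \<omega>)" using x1 by (intro summable_suminf_not_top) auto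
    then have "summable (\<lambda>j. block_avg (4 ^ Suc j) 0 h \<omega> - block_avg (4 ^ j) 0 h \<omega>)"
      unfolding x_def by (rule summable_rabs_cancel)
    then have "convergent (\<lambda>n. block_avg (4 ^ n) 0 h \<omega> - block_avg (4 ^ 0) 0 h \<omega>)"
      unfolding summable_iff_convergent sum_lessThan_telescope[of "\<lambda>j. block_avg (4 ^ j) 0 h \<omega>"] .
    then have "convergent (\<lambda>n. block_avg (4 ^ n) 0 h \<omega>)"
      by (simp only: convergent_diff_const_right_iff)
    then obtain l where l: "(\<lambda>n. block_avg (4 ^ n) 0 h \<omega>) \<longlonglongrightarrow> l" by (auto simp: convergent_def)
    then have "(\<lambda>n. ereal (block_avg (4 ^ n) 0 h \<omega>)) \<longlonglongrightarrow> ereal l" by simp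
    then have "limsup (\<lambda>n. ereal (block_avg (4 ^ n) 0 h \<omega>)) = ereal l" by (intro lim_imp_Limsup) auto
    then show ?case using l by (simp add: dir_def)
  qed
qed

text \<open>Expanding the product picks one index from each block; the block of an index is its
  quotient by \<open>K\<close>, so the picked indices are distinct and exchangeability moves them to
  \<open>0, ..., n - 1\<close>.\<close>

lemma expectation_prod_block_avg:
  assumes h: "\<And>a. unit_fun (h a)" and K: "0 < K"
  shows "expectation (\<lambda>\<omega>. \<Prod>a<n. block_avg K a (h a) \<omega>) = expectation (\<lambda>\<omega>. \<Prod>a<n. h a (\<xi> a \<omega>))"
proof -
  let ?\<Phi> = "PiE {..<n} (\<lambda>_. {..<K})"
  have int: "integrable M (\<lambda>\<omega>. \<Prod>a<n. h a (\<xi> (a * K + \<phi> a) \<omega>))" for \<phi>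
    using prod_unit_le[of "{..<n}" "\<lambda>a. h a (\<xi> (a * K + \<phi> a) _)"] unit_funD[OF h]
    by (intro integrable_const_bound[of _ 1] borel_measurable_prod measurable_unit_fun h AE_I2) auto
  have "(\<Prod>a<n. block_avg K a (h a) \<omega>) = (\<Sum>\<phi>\<in>?\<Phi>. \<Prod>a<n. h a (\<xi> (a * K + \<phi> a) \<omega>)) / real K ^ n" for \<omega>
  proof -
    have "(\<Prod>a<n. \<Sum>k<K. h a (\<xi> (a * K + k) \<omega>)) = (\<Sum>\<phi>\<in>?\<Phi>. \<Prod>a<n. h a (\<xi> (a * K + \<phi> a) \<omega>))"
      by (rule prod_sum_PiE) auto
    then show ?thesis by (simp add: block_avg_def prod_dividef)
  qed
  then have "expectation (\<lambda>\<omega>. \<Prod>a<n. block_avg K a (h a) \<omega>) =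
      (\<Sum>\<phi>\<in>?\<Phi>. expectation (\<lambda>\<omega>. \<Prod>a<n. h a (\<xi> (a * K + \<phi> a) \<omega>))) / real K ^ n"
    using int by simp
  also have "(\<Sum>\<phi>\<in>?\<Phi>. expectation (\<lambda>\<omega>. \<Prod>a<n. h a (\<xi> (a * K + \<phi> a) \<omega>))) =
      (\<Sum>\<phi>\<in>?\<Phi>. expectation (\<lambda>\<omega>. \<Prod>a<n. h a (\<xi> a \<omega>)))"
  proof (intro sum.cong refl expectation_prod_inj h)
    fix \<phi> assume \<phi>: "\<phi> \<in> ?\<Phi>"
    show "inj_on (\<lambda>a. a * K + \<phi> a) {..<n}"
    proof (rule inj_onI)
      fix a b assume ab: "a \<in> {..<n}" "b \<in> {..<n}" "a * K + \<phi> a = b * K + \<phi> b"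
      then have "\<phi> a < K" "\<phi> b < K" using \<phi> by (auto simp: PiE_iff)
      then have "a = (a * K + \<phi> a) div K" "b = (b * K + \<phi> b) div K" by auto
      then show "a = b" using ab(3) by simp
    qed
  qed
  also have "\<dots> = real K ^ n * expectation (\<lambda>\<omega>. \<Prod>a<n. h a (\<xi> a \<omega>))"
    by (simp add: card_PiE)
  finally show ?thesis using K by simp
qed

text \<open>The product over distinct blocks has exactly the right mean. Replacing each block by the
  first one costs at most \<open>sqrt (2 / 4 ^ j)\<close> per factor, and along \<open>j\<close> the
  first block averages tend to \<open>dir\<close>. This is the conditional independence in de
  Finetti's theorem.\<close>

lemma expectation_prod_dir:
  assumes h: "\<And>a. unit_fun (h a)"
  shows "expectation (\<lambda>\<omega>. \<Prod>a<n. dir (h a) \<omega>) = expectation (\<lambda>\<omega>. \<Prod>a<n. h a (\<xi> a \<omega>))"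
proof (rule LIMSEQ_unique)
  let ?A = "\<lambda>j a. block_avg (4 ^ j) 0 (h a)"
  have Au: "0 \<le> block_avg K b (h a) \<omega> \<and> block_avg K b (h a) \<omega> \<le> 1" for K a b \<omega>
    using block_avg_unit[OF h] by auto
  show "(\<lambda>j. expectation (\<lambda>\<omega>. \<Prod>a<n. ?A j a \<omega>)) \<longlonglongrightarrow> expectation (\<lambda>\<omega>. \<Prod>a<n. dir (h a) \<omega>)"
  proof (rule integral_dominated_convergence[where w = "\<lambda>_. 1"])
    have "AE \<omega> in M. \<forall>a\<in>{..<n}. (\<lambda>j. ?A j a \<omega>) \<longlonglongrightarrow> dir (h a) \<omega>"
      using AE_block_avg_tendsto[OF h] by (intro AE_finite_allI) auto
    then show "AE \<omega> in M. (\<lambda>j. \<Prod>a<n. ?A j a \<omega>) \<longlonglongrightarrow> (\<Prod>a<n. dir (h a) \<omega>)"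
      by eventually_elim (auto intro!: tendsto_prod)
    show "(\<lambda>\<omega>. \<Prod>a<n. dir (h a) \<omega>) \<in> borel_measurable M"
      by (intro borel_measurable_prod measurable_dir h)
    show "(\<lambda>\<omega>. \<Prod>a<n. ?A j a \<omega>) \<in> borel_measurable M" for j
      by (intro borel_measurable_prod measurable_block_avg h)
    show "AE \<omega> in M. norm (\<Prod>a<n. ?A j a \<omega>) \<le> 1" for j
      using prod_unit_le[of "{..<n}" "\<lambda>a. ?A j a _"] Au by (intro AE_I2) (simp add: abs_of_nonneg)
  qed simp
  have close: "\<bar>expectation (\<lambda>\<omega>. \<Prod>a<n. ?A j a \<omega>) - expectation (\<lambda>\<omega>. \<Prod>a<n. h a (\<xi> a \<omega>))\<bar>
      \<le> n * sqrt (2 / real (4 ^ j))" for j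
  proof -
    let ?K = "4 ^ j :: nat"
    have ip: "integrable M (\<lambda>\<omega>. \<Prod>a<n. block_avg ?K (b a) (h a) \<omega>)" for b
      using prod_unit_le[of "{..<n}" "\<lambda>a. block_avg ?K (b a) (h a) _"] Au
      by (intro integrable_const_bound[of _ 1] borel_measurable_prod measurable_block_avg h AE_I2) (simp add: abs_of_nonneg)
    have id: "integrable M (\<lambda>\<omega>. \<bar>block_avg ?K a (h a) \<omega> - ?A j a \<omega>\<bar>)" for a
      using Au by (intro integrable_const_bound[of _ 1] borel_measurable_abs borel_measurable_diff measurable_block_avg h AE_I2)
        (auto intro!: abs_diff_unit)
    have "\<bar>expectation (\<lambda>\<omega>. \<Prod>a<n. ?A j a \<omega>) - expectation (\<lambda>\<omega>. \<Prod>a<n. h a (\<xi> a \<omega>))\<bar> =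
       \<bar>expectation (\<lambda>\<omega>. (\<Prod>a<n. block_avg ?K a (h a) \<omega>) - (\<Prod>a<n. ?A j a \<omega>))\<bar>"
      using ip[of "\<lambda>a. a"] ip[of "\<lambda>_. 0"] expectation_prod_block_avg[where K = ?K and h = h and n = n, OF h]
      by (simp add: abs_minus_commute)
    also have "\<dots> \<le> expectation (\<lambda>\<omega>. \<bar>(\<Prod>a<n. block_avg ?K a (h a) \<omega>) - (\<Prod>a<n. ?A j a \<omega>)\<bar>)"
      by (rule integral_abs_bound)
    also have "\<dots> \<le> expectation (\<lambda>\<omega>. \<Sum>a<n. \<bar>block_avg ?K a (h a) \<omega> - ?A j a \<omega>\<bar>)"
    proof (rule integral_mono)
      show "integrable M (\<lambda>\<omega>. \<bar>(\<Prod>a<n. block_avg ?K a (h a) \<omega>) - (\<Prod>a<n. ?A j a \<omega>)\<bar>)"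
        using ip[of "\<lambda>a. a"] ip[of "\<lambda>_. 0"] by auto
      show "integrable M (\<lambda>\<omega>. \<Sum>a<n. \<bar>block_avg ?K a (h a) \<omega> - ?A j a \<omega>\<bar>)" using id by auto
      show "\<bar>(\<Prod>a<n. block_avg ?K a (h a) \<omega>) - (\<Prod>a<n. ?A j a \<omega>)\<bar>
          \<le> (\<Sum>a<n. \<bar>block_avg ?K a (h a) \<omega> - ?A j a \<omega>\<bar>)" for \<omega>
        using norm_prod_diff[of "{..<n}" "\<lambda>a. block_avg ?K a (h a) \<omega>" "\<lambda>a. ?A j a \<omega>"] Au by simp
    qed
    also have "\<dots> = (\<Sum>a<n. expectation (\<lambda>\<omega>. \<bar>block_avg ?K a (h a) \<omega> - ?A j a \<omega>\<bar>))"
      using id by simp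
    also have "\<dots> \<le> (\<Sum>a<n. sqrt (2 / real ?K))"
      by (intro sum_mono block_avg_blocks_close h) auto
    finally show ?thesis by simp
  qed
  have "(\<lambda>j. n * sqrt (2 / real (4 ^ j))) \<longlonglongrightarrow> n * sqrt (2 * 0)"
  proof (intro tendsto_intros)
    have "(\<lambda>j. 2 * (1 / 4 :: real) ^ j) \<longlonglongrightarrow> 2 * 0" by (intro tendsto_intros LIMSEQ_realpow_zero) auto
    then show "(\<lambda>j. 2 / real (4 ^ j)) \<longlonglongrightarrow> 2 * 0" by (simp add: power_one_over)
  qed
  then have lim: "(\<lambda>j. n * sqrt (2 / real (4 ^ j))) \<longlonglongrightarrow> 0" by simp
  have "(\<lambda>j. expectation (\<lambda>\<omega>. \<Prod>a<n. ?A j a \<omega>) - expectation (\<lambda>\<omega>. \<Prod>a<n. h a (\<xi> a \<omega>))) \<longlonglongrightarrow> 0"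
    by (rule Lim_null_comparison[OF always_eventually lim]) (simp only: real_norm_def close simp_thms)
  then show "(\<lambda>j. expectation (\<lambda>\<omega>. \<Prod>a<n. ?A j a \<omega>)) \<longlonglongrightarrow> expectation (\<lambda>\<omega>. \<Prod>a<n. h a (\<xi> a \<omega>))"
    by (rule LIM_zero_cancel)
qed

end

section \<open>The directing measure\<close>

context exchangeable_unit
begin

text \<open>For a fixed outcome the upper limits of the empirical distribution functions are
  monotone but need not be right-continuous; the infimum over points to the right repairs this for
  every \<omega>.\<close>

definition dir_cdf :: "'a \<Rightarrow> real \<Rightarrow> real" where
  "dir_cdf \<omega> x = (INF k. dir (indicator {..x + 1 / real (Suc k)}) \<omega>)"

lemma unit_fun_indicator: "unit_fun (indicator {..x})"
  by (simp add: unit_fun_def)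

lemma dir_indicator_mono: "x \<le> y \<Longrightarrow> dir (indicator {..x}) \<omega> \<le> dir (indicator {..y}) \<omega>"
  by (intro dir_mono unit_fun_indicator) (auto simp: indicator_def)

lemma dir_cdf_tendsto: "(\<lambda>k. dir (indicator {..x + 1 / real (Suc k)}) \<omega>) \<longlonglongrightarrow> dir_cdf \<omega> x"
  unfolding dir_cdf_def
proof (rule LIMSEQ_decseq_INF)
  show "bdd_below (range (\<lambda>k. dir (indicator {..x + 1 / real (Suc k)}) \<omega>))"
    using limsup_block_avg(2)[OF unit_fun_indicator] by (intro bdd_belowI2)
  show "decseq (\<lambda>k. dir (indicator {..x + 1 / real (Suc k)}) \<omega>)"
    unfolding decseq_def by (auto intro!: dir_indicator_mono divide_left_mono)
qed

lemma dir_cdf_le: "dir_cdf \<omega> x \<le> dir (indicator {..x + 1 / real (Suc k)}) \<omega>"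
  unfolding dir_cdf_def using limsup_block_avg(2)[OF unit_fun_indicator]
  by (intro cINF_lower bdd_belowI2) auto

lemma dir_cdf_mono: "x \<le> y \<Longrightarrow> dir_cdf \<omega> x \<le> dir_cdf \<omega> y"
  by (rule LIMSEQ_le[OF dir_cdf_tendsto dir_cdf_tendsto]) (auto intro!: dir_indicator_mono)

lemma dir_cdf_bounds: "0 \<le> dir_cdf \<omega> x" "dir_cdf \<omega> x \<le> 1"
proof -
  show "0 \<le> dir_cdf \<omega> x"
    by (rule LIMSEQ_le_const[OF dir_cdf_tendsto]) (use limsup_block_avg(2)[OF unit_fun_indicator] in auto)
  show "dir_cdf \<omega> x \<le> 1"
    using dir_cdf_le limsup_block_avg(3)[OF unit_fun_indicator] by (rule order.trans)
qed

lemma dir_cdf_right_continuous: "continuous (at_right a) (dir_cdf \<omega>)"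
proof (rule iffD2[OF continuous_at_right_real_increasing[OF dir_cdf_mono]], assumption, intro allI impI)
  fix r :: real assume "0 < r"
  then have "\<forall>\<^sub>F k in sequentially. dir (indicator {..a + 1 / real (Suc k)}) \<omega> < dir_cdf \<omega> a + r"
    by (intro order_tendstoD[OF dir_cdf_tendsto]) auto
  then obtain k where k: "dir (indicator {..a + 1 / real (Suc k)}) \<omega> < dir_cdf \<omega> a + r"
    by (auto simp: eventually_sequentially)
  \<comment> \<open>Half of the gap \<open>1 / Suc k\<close>; the other half is the shift with index
    \<open>2 * k + 1\<close> in the infimum.\<close>
  define s where "s = 1 / (2 * real (Suc k))"
  have "dir_cdf \<omega> (a + s) \<le> dir (indicator {..a + s + 1 / real (Suc (2 * k + 1))}) \<omega>" by (rule dir_cdf_le)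
  also have "a + s + 1 / real (Suc (2 * k + 1)) = a + 1 / real (Suc k)"
  proof -
    have "real (Suc (2 * k + 1)) = 2 * real (Suc k)" by simp
    then show ?thesis unfolding s_def by (simp only:) (simp add: field_simps)
  qed
  finally have "dir_cdf \<omega> (a + s) - dir_cdf \<omega> a < r" using k by linarith
  then show "\<exists>\<delta>>0. dir_cdf \<omega> (a + \<delta>) - dir_cdf \<omega> a < r" by (intro exI[of _ s]) (simp add: s_def)
qed

lemma dir_cdf_outside: "x < 0 \<Longrightarrow> dir_cdf \<omega> x = 0" "1 \<le> x \<Longrightarrow> dir_cdf \<omega> x = 1"
proof -
  assume x: "x < 0"
  then obtain k where "1 / real (Suc k) < - x" by (metis neg_0_less_iff_less nat_approx_posE)
  then have "dir (indicator {..x + 1 / real (Suc k)}) \<omega> = 0" by (intro dir_const) (auto simp: indicator_def)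
  then show "dir_cdf \<omega> x = 0" using dir_cdf_le[of \<omega> x k] dir_cdf_bounds(1)[of \<omega> x] by simp
next
  assume x: "1 \<le> x"
  have "indicator {..x + 1 / real (Suc k)} y = (1 :: real)" if "y \<le> 1" for y k
  proof -
    have "0 \<le> 1 / real (Suc k)" by simp
    then have "y \<le> x + 1 / real (Suc k)" using x that by linarith
    then show ?thesis by simp
  qed
  then have "dir (indicator {..x + 1 / real (Suc k)}) \<omega> = 1" for k by (intro dir_const)
  then show "dir_cdf \<omega> x = 1" using LIMSEQ_unique[OF dir_cdf_tendsto[of x \<omega>]] by simp
qed

lemma dir_cdf_limits: "(dir_cdf \<omega> \<longlongrightarrow> 0) at_bot" "(dir_cdf \<omega> \<longlongrightarrow> 1) at_top"
proof -
  show "(dir_cdf \<omega> \<longlongrightarrow> 0) at_bot"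
    by (rule tendsto_eventually, rule eventually_mono[OF eventually_gt_at_bot[of 0]]) (rule dir_cdf_outside(1))
  show "(dir_cdf \<omega> \<longlongrightarrow> 1) at_top"
    by (rule tendsto_eventually, rule eventually_mono[OF eventually_ge_at_top[of 1]]) (rule dir_cdf_outside(2))
qed

definition dir_measure :: "'a \<Rightarrow> real measure" where
  "dir_measure \<omega> = interval_measure (dir_cdf \<omega>)"

lemma real_distribution_dir: "real_distribution (dir_measure \<omega>)"
  unfolding dir_measure_def
  by (rule real_distribution_interval_measure[OF dir_cdf_mono dir_cdf_right_continuous dir_cdf_limits])

lemma emeasure_dir: "emeasure (dir_measure \<omega>) {..x} = ennreal (dir_cdf \<omega> x)"
proof -
  interpret d: real_distribution "dir_measure \<omega>" by (rule real_distribution_dir)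
  have "cdf (dir_measure \<omega>) = dir_cdf \<omega>"
    unfolding dir_measure_def by (rule cdf_interval_measure[OF dir_cdf_mono dir_cdf_right_continuous dir_cdf_limits(1)])
  then show ?thesis by (metis cdf_def d.emeasure_eq_measure)
qed

lemma measurable_dir_cdf: "(\<lambda>\<omega>. dir_cdf \<omega> x) \<in> borel_measurable M"
  by (rule borel_measurable_LIMSEQ_metric[OF measurable_dir[OF unit_fun_indicator] dir_cdf_tendsto])

lemma measurable_dir_measure: "dir_measure \<in> M \<rightarrow>\<^sub>M prob_algebra borel"
proof (rule measurable_prob_algebra_generated[where \<Omega> = UNIV and G = "range (\<lambda>x :: real. {..x})"])
  show "sets borel = sigma_sets UNIV (range (\<lambda>x :: real. {..x}))"
    by (simp add: borel_eq_atMost)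
  show "Int_stable (range (\<lambda>x :: real. {..x}))"
    by (auto simp: Int_stable_def)
  show "prob_space (dir_measure \<omega>)" "sets (dir_measure \<omega>) = sets borel" for \<omega>
    using real_distribution_dir[of \<omega>] by (auto simp: real_distribution_def real_distribution_axioms_def)
  show "(\<lambda>\<omega>. emeasure (dir_measure \<omega>) A) \<in> borel_measurable M" if A: "A \<in> range (\<lambda>x :: real. {..x})" for A
  proof -
    obtain x where "A = {..x}" using A by blast
    then show ?thesis using measurable_dir_cdf[of x] by (simp add: emeasure_dir)
  qed
qed auto

text \<open>The identity holds for the indicators of \<open>{..t a + 1 / Suc k}\<close>; both sides
  pass to the limit by dominated convergence.\<close>

lemma expectation_prod_cdf:
  assumes J: "finite (J :: nat set)"
  shows "expectation (\<lambda>\<omega>. \<Prod>a\<in>J. dir_cdf \<omega> (t a)) = expectation (\<lambda>\<omega>. \<Prod>a\<in>J. indicator {..t a} (\<xi> a \<omega>))"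
proof (rule LIMSEQ_unique)
  obtain n where n: "J \<subseteq> {..<n}" using J finite_nat_iff_bounded by blast
  let ?s = "\<lambda>k a. t a + 1 / real (Suc k)"
  \<comment> \<open>Indices outside \<open>J\<close> get the constant function 1, whose
    \<open>dir\<close> is 1.\<close>
  define h where "h k a = (if a \<in> J then indicator {..?s k a} else (\<lambda>_. 1 :: real))" for k a
  have h: "unit_fun (h k a)" for k a
    unfolding h_def by (cases "a \<in> J") (simp_all add: unit_fun_def)
  have J1: "(\<Prod>a<n. dir (h k a) \<omega>) = (\<Prod>a\<in>J. dir (indicator {..?s k a}) \<omega>)" for k \<omega>
    using n by (intro prod.mono_neutral_cong_right) (auto simp: h_def intro: dir_const)
  have J2: "(\<Prod>a<n. h k a (\<xi> a \<omega>)) = (\<Prod>a\<in>J. indicator {..?s k a} (\<xi> a \<omega>))" for k \<omega>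
    using n by (intro prod.mono_neutral_cong_right) (auto simp: h_def)
  have eq: "expectation (\<lambda>\<omega>. \<Prod>a\<in>J. dir (indicator {..?s k a}) \<omega>) = expectation (\<lambda>\<omega>. \<Prod>a\<in>J. indicator {..?s k a} (\<xi> a \<omega>))" for k
    using expectation_prod_dir[of "h k" n, OF h] unfolding J1 J2 .
  show "(\<lambda>k. expectation (\<lambda>\<omega>. \<Prod>a\<in>J. dir (indicator {..?s k a}) \<omega>)) \<longlonglongrightarrow> expectation (\<lambda>\<omega>. \<Prod>a\<in>J. dir_cdf \<omega> (t a))"
  proof (rule integral_dominated_convergence[where w = "\<lambda>_. 1"])
    show "AE \<omega> in M. (\<lambda>k. \<Prod>a\<in>J. dir (indicator {..?s k a}) \<omega>) \<longlonglongrightarrow> (\<Prod>a\<in>J. dir_cdf \<omega> (t a))"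
      by (intro AE_I2 tendsto_prod dir_cdf_tendsto)
    show "AE \<omega> in M. norm (\<Prod>a\<in>J. dir (indicator {..?s k a}) \<omega>) \<le> 1" for k
      using prod_unit_le[of J "\<lambda>a. dir (indicator {..?s k a}) _"] limsup_block_avg[OF unit_fun_indicator]
      by (intro AE_I2) (simp add: abs_of_nonneg)
    show "(\<lambda>\<omega>. \<Prod>a\<in>J. dir_cdf \<omega> (t a)) \<in> borel_measurable M"
      by (intro borel_measurable_prod measurable_dir_cdf)
    show "(\<lambda>\<omega>. \<Prod>a\<in>J. dir (indicator {..?s k a}) \<omega>) \<in> borel_measurable M" for k
      by (intro borel_measurable_prod measurable_dir unit_fun_indicator)
  qed simp
  have "(\<lambda>k. expectation (\<lambda>\<omega>. \<Prod>a\<in>J. indicator {..?s k a} (\<xi> a \<omega>))) \<longlonglongrightarrow> expectation (\<lambda>\<omega>. \<Prod>a\<in>J. indicator {..t a} (\<xi> a \<omega>) :: real)"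
  proof (rule integral_dominated_convergence[where w = "\<lambda>_. 1"])
    have one: "(\<lambda>k. indicator {..?s k a} x :: real) \<longlonglongrightarrow> indicator {..t a} x" for a x
    proof (cases "x \<le> t a")
      case True
      have "indicator {..?s k a} x = (1 :: real)" for k
      proof -
        have "0 \<le> 1 / real (Suc k)" by simp
        then have "x \<le> ?s k a" using True by linarith
        then show ?thesis by simp
      qed
      then show ?thesis using True by simp
    next
      case False
      then obtain k0 where k0: "1 / real (Suc k0) < x - t a" by (metis diff_gt_0_iff_gt nat_approx_posE not_le)
      have "indicator {..?s k a} x = (0 :: real)" if "k0 \<le> k" for k
      proof -
        have "1 / real (Suc k) \<le> 1 / real (Suc k0)" using that by (intro divide_left_mono) auto
        then show ?thesis using k0 by (simp add: indicator_def)
      qed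
      then show ?thesis using False by (intro tendsto_eventually) (auto simp: eventually_sequentially)
    qed
    show "AE \<omega> in M. (\<lambda>k. \<Prod>a\<in>J. indicator {..?s k a} (\<xi> a \<omega>) :: real) \<longlonglongrightarrow> (\<Prod>a\<in>J. indicator {..t a} (\<xi> a \<omega>))"
      by (intro AE_I2 tendsto_prod one)
    show "AE \<omega> in M. norm (\<Prod>a\<in>J. indicator {..?s k a} (\<xi> a \<omega>) :: real) \<le> 1" for k
      using prod_unit_le[of J "\<lambda>a. indicator {..?s k a} (\<xi> a _)"]
      by (intro AE_I2) (simp add: abs_of_nonneg)
    have ind: "(\<lambda>\<omega>. indicator {..x} (\<xi> a \<omega>) :: real) \<in> borel_measurable M" for x a
      by (rule measurable_unit_fun[OF unit_fun_indicator])
    show "(\<lambda>\<omega>. \<Prod>a\<in>J. indicator {..t a} (\<xi> a \<omega>) :: real) \<in> borel_measurable M"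
      by (intro borel_measurable_prod ind)
    show "(\<lambda>\<omega>. \<Prod>a\<in>J. indicator {..?s k a} (\<xi> a \<omega>) :: real) \<in> borel_measurable M" for k
      by (intro borel_measurable_prod ind)
  qed simp
  then show "(\<lambda>k. expectation (\<lambda>\<omega>. \<Prod>a\<in>J. dir (indicator {..?s k a}) \<omega>)) \<longlonglongrightarrow> expectation (\<lambda>\<omega>. \<Prod>a\<in>J. indicator {..t a} (\<xi> a \<omega>))"
    by (simp only: eq)
qed

text \<open>On an orthant both sides equal the mean of a product of directing distribution
  functions, one by conditional independence and the other because the kernel consists of product
  measures.\<close>

theorem de_Finetti:
  "distr M (\<Pi>\<^sub>M i\<in>UNIV. borel) (\<lambda>\<omega> i. \<xi> i \<omega>) = M \<bind> (\<lambda>\<omega>. \<Pi>\<^sub>M i\<in>UNIV. dir_measure \<omega>)"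
proof -
  let ?P = "\<Pi>\<^sub>M i\<in>(UNIV :: nat set). (borel :: real measure)"
  have m: "(\<lambda>\<omega> i. \<xi> i \<omega>) \<in> M \<rightarrow>\<^sub>M ?P" by (rule measurable_PiM_single') (auto simp: space_PiM)
  have k: "(\<lambda>\<omega>. \<Pi>\<^sub>M i\<in>UNIV. dir_measure \<omega>) \<in> M \<rightarrow>\<^sub>M prob_algebra ?P"
    by (rule measurable_compose[OF measurable_dir_measure measurable_PiM_kernel])
  have MM: "M \<in> space (prob_algebra M)" by (simp add: space_prob_algebra prob_space_axioms)
  interpret D: prob_space "distr M ?P (\<lambda>\<omega> i. \<xi> i \<omega>)" by (rule prob_space_distr[OF m])
  show ?thesis
  proof (rule measure_eqI_generator_eq[OF Int_stable_seq_le, where \<Omega> = UNIV and A = "\<lambda>_. UNIV"])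
    show "sets (distr M ?P (\<lambda>\<omega> i. \<xi> i \<omega>)) = sigma_sets UNIV {{x. \<forall>a\<in>J. x a \<le> t a} | J t. finite J}"
      by (simp add: sets_sigma_seq_le)
    show "sets (M \<bind> (\<lambda>\<omega>. \<Pi>\<^sub>M i\<in>(UNIV :: nat set). dir_measure \<omega>)) = sigma_sets UNIV {{x. \<forall>a\<in>J. x a \<le> t a} | J t. finite J}"
      by (rule trans[OF sets_bind'[OF MM k] sets_sigma_seq_le])
    fix X :: "(nat \<Rightarrow> real) set" assume X: "X \<in> {{x. \<forall>a\<in>J. x a \<le> t a} | J t. finite J}"
    then obtain J t where J: "finite J" and Xeq: "X = {x. \<forall>a\<in>J. x a \<le> t a}" by blast
    have X_sets: "X \<in> sets ?P" unfolding sets_sigma_seq_le using X by (rule sigma_sets.Basic)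
    have "emeasure (distr M ?P (\<lambda>\<omega> i. \<xi> i \<omega>)) X = ennreal (measure M ((\<lambda>\<omega> i. \<xi> i \<omega>) -` X \<inter> space M))"
      using m X_sets by (simp add: emeasure_distr emeasure_eq_measure)
    also have "measure M ((\<lambda>\<omega> i. \<xi> i \<omega>) -` X \<inter> space M) = expectation (\<lambda>\<omega>. indicator ((\<lambda>\<omega> i. \<xi> i \<omega>) -` X) \<omega>)"
      by simp
    also have "\<dots> = expectation (\<lambda>\<omega>. \<Prod>a\<in>J. indicator {..t a} (\<xi> a \<omega>))"
    proof (rule Bochner_Integration.integral_cong[OF refl])
      fix \<omega>
      show "(indicator ((\<lambda>\<omega> i. \<xi> i \<omega>) -` X) \<omega> :: real) = (\<Prod>a\<in>J. indicator {..t a} (\<xi> a \<omega>))"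
      proof (cases "\<forall>a\<in>J. \<xi> a \<omega> \<le> t a")
        case True
        then have "(\<Prod>a\<in>J. indicator {..t a} (\<xi> a \<omega>)) = (1 :: real)" by (intro prod.neutral) auto
        then show ?thesis using True by (simp add: Xeq)
      next
        case False
        then obtain a where a: "a \<in> J" "\<not> \<xi> a \<omega> \<le> t a" by blast
        have "(\<Prod>a\<in>J. indicator {..t a} (\<xi> a \<omega>)) = (0 :: real)"
          using J by (rule prod_zero) (use a in \<open>auto intro!: bexI[of _ a]\<close>)
        then show ?thesis using False by (simp add: Xeq)
      qed
    qed
    also have "\<dots> = expectation (\<lambda>\<omega>. \<Prod>a\<in>J. dir_cdf \<omega> (t a))" by (rule expectation_prod_cdf[OF J, symmetric])
    also have "ennreal \<dots> = (\<integral>\<^sup>+ \<omega>. ennreal (\<Prod>a\<in>J. dir_cdf \<omega> (t a)) \<partial>M)"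
    proof (rule nn_integral_eq_integral[symmetric])
      have "norm (\<Prod>a\<in>J. dir_cdf \<omega> (t a)) \<le> 1" for \<omega>
        using prod_unit_le[of J "\<lambda>a. dir_cdf \<omega> (t a)"] dir_cdf_bounds by (simp add: abs_of_nonneg)
      then show "integrable M (\<lambda>\<omega>. \<Prod>a\<in>J. dir_cdf \<omega> (t a))"
        by (intro integrable_const_bound[of _ 1] AE_I2 borel_measurable_prod measurable_dir_cdf)
    qed (auto intro!: prod_nonneg dir_cdf_bounds)
    also have "\<dots> = (\<integral>\<^sup>+ \<omega>. emeasure (\<Pi>\<^sub>M i\<in>UNIV. dir_measure \<omega>) X \<partial>M)"
    proof (intro nn_integral_cong)
      fix \<omega>
      interpret d: real_distribution "dir_measure \<omega>" by (rule real_distribution_dir)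
      have "X = prod_emb UNIV (\<lambda>_. dir_measure \<omega>) J (\<Pi>\<^sub>E a\<in>J. {..t a})"
        by (auto simp: Xeq prod_emb_def PiE_iff)
      then have "emeasure (\<Pi>\<^sub>M i\<in>UNIV. dir_measure \<omega>) X = (\<Prod>a\<in>J. emeasure (dir_measure \<omega>) {..t a})"
        using J by (simp only:) (intro emeasure_PiM_emb, auto intro: d.prob_space_axioms)
      then show "ennreal (\<Prod>a\<in>J. dir_cdf \<omega> (t a)) = emeasure (\<Pi>\<^sub>M i\<in>UNIV. dir_measure \<omega>) X"
        by (simp add: emeasure_dir prod_ennreal dir_cdf_bounds)
    qed
    also have "\<dots> = emeasure (M \<bind> (\<lambda>\<omega>. \<Pi>\<^sub>M i\<in>UNIV. dir_measure \<omega>)) X"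
      by (rule emeasure_bind_prob_algebra[OF MM k X_sets, symmetric])
    finally show "emeasure (distr M ?P (\<lambda>\<omega> i. \<xi> i \<omega>)) X = emeasure (M \<bind> (\<lambda>\<omega>. \<Pi>\<^sub>M i\<in>UNIV. dir_measure \<omega>)) X" .
  next
    show "range (\<lambda>_ :: nat. UNIV) \<subseteq> {{x :: nat \<Rightarrow> real. \<forall>a\<in>J. x a \<le> t a} | J t. finite J}"
      using seq_le_in_generator[of "{} :: nat set"] by (simp add: image_subset_iff)
  qed auto
qed

end

section \<open>Coding a Polish space in the unit interval\<close>

text \<open>Using only the digits 0 and 1 in base 4 keeps every tail at most 1/3. Hence the integer
  part of \<open>4 * s n\<close> is the digit, with no ambiguous expansions, and digits are Borel
  functions of the number.\<close>

lemma quaternary_digits: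
  fixes b :: "nat \<Rightarrow> nat"
  assumes b: "\<And>n. b n \<le> 1"
  defines "s \<equiv> \<lambda>n. \<Sum>m. real (b (m + n)) / 4 ^ Suc m"
  shows "0 \<le> s n" "s n \<le> 1 / 3" "\<lfloor>4 * s n\<rfloor> = int (b n)" "s (Suc n) = frac (4 * s n)"
proof -
  have g: "(\<lambda>m. (1 / 4) * (1 / 4 :: real) ^ m) sums ((1 / 4) * (1 / (1 - 1 / 4)))"
    by (intro sums_mult geometric_sums) auto
  have le: "real (b (m + n)) / 4 ^ Suc m \<le> (1 / 4) * (1 / 4) ^ m" for m n
    using b[of "m + n"] by (simp add: power_one_over divide_right_mono)
  have summ: "summable (\<lambda>m. real (b (m + n)) / 4 ^ Suc m)" for n
    by (rule summable_comparison_test[OF _ sums_summable[OF g]]) (use le in auto)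
  have s0: "0 \<le> s n" for n unfolding s_def by (intro suminf_nonneg summ) auto
  have s1: "s n \<le> 1 / 3" for n
  proof -
    have "s n \<le> (\<Sum>m. (1 / 4) * (1 / 4 :: real) ^ m)"
      unfolding s_def by (intro suminf_le summ sums_summable[OF g] le)
    then show ?thesis using sums_unique[OF g] by simp
  qed
  have rec: "4 * s n = real (b n) + s (Suc n)"
  proof -
    have "s n = real (b n) / 4 + (\<Sum>m. real (b (Suc m + n)) / 4 ^ Suc (Suc m))"
      using suminf_split_head[OF summ[of n]] by (simp add: s_def)
    also have "(\<Sum>m. real (b (Suc m + n)) / 4 ^ Suc (Suc m)) = (\<Sum>m. (1 / 4) * (real (b (m + Suc n)) / 4 ^ Suc m))"
      by simp
    also have "\<dots> = (1 / 4) * s (Suc n)" unfolding s_def by (rule suminf_mult[OF summ])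
    finally show ?thesis by simp
  qed
  show "0 \<le> s n" "s n \<le> 1 / 3" by (rule s0, rule s1)
  show fl: "\<lfloor>4 * s n\<rfloor> = int (b n)"
    unfolding rec using s0[of "Suc n"] s1[of "Suc n"] by (intro floor_unique) auto
  show "s (Suc n) = frac (4 * s n)" unfolding frac_def fl using rec by simp
qed

primrec quaternary_shift :: "real \<Rightarrow> nat \<Rightarrow> real" where
  "quaternary_shift r 0 = r"
| "quaternary_shift r (Suc n) = frac (4 * quaternary_shift r n)"

lemma measurable_quaternary_shift [measurable]: "(\<lambda>r. quaternary_shift r n) \<in> borel_measurable borel"
proof (induction n)
  case (Suc n)
  then have m: "(\<lambda>r. 4 * quaternary_shift r n) \<in> borel_measurable borel"
    by (intro borel_measurable_times borel_measurable_const)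
  show ?case unfolding quaternary_shift.simps frac_def
    by (intro borel_measurable_diff m measurable_compose[OF m borel_measurable_real_floor])
qed simp

text \<open>A point is encoded by the answers to all questions whether it lies within
  \<open>1 / 2 ^ k\<close> of the \<open>a\<close>-th point of a dense sequence. The decoder takes
  the first such point at each scale and passes to the limit.\<close>

lemma polish_coding:
  obtains \<phi> :: "'h :: polish_space \<Rightarrow> real" and g :: "real \<Rightarrow> 'h"
  where "\<phi> \<in> borel_measurable borel" "\<And>y. 0 \<le> \<phi> y" "\<And>y. \<phi> y \<le> 1" "g \<in> borel_measurable borel" "\<And>y. g (\<phi> y) = y"
proof -
  obtain Q :: "'h set" where Q: "countable Q" "\<And>X. open X \<Longrightarrow> X \<noteq> {} \<Longrightarrow> \<exists>d\<in>Q. d \<in> X"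
    using countable_dense_setE by blast
  have Q0: "Q \<noteq> {}" using Q(2)[of UNIV] by auto
  define x where "x = from_nat_into Q"
  have near: "\<exists>a. dist y (x a) < r" if "0 < r" for y r
  proof -
    have "\<exists>d\<in>Q. d \<in> ball y r" by (rule Q(2)) (use that in auto)
    then obtain d where "d \<in> Q" "dist y d < r" by auto
    then show ?thesis using Q(1) from_nat_into_surj[of Q d] by (auto simp: x_def dest: sym)
  qed
  define b :: "nat \<Rightarrow> 'h \<Rightarrow> nat" where
    "b n y = (if dist y (x (fst (prod_decode n))) < 1 / 2 ^ snd (prod_decode n) then 1 else 0)" for n y
  have b1: "b n y \<le> 1" for n y by (simp add: b_def)
  define \<phi> where "\<phi> y = (\<Sum>m. real (b (m + 0) y) / 4 ^ Suc m)" for y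
  have dig: "quaternary_shift (\<phi> y) n = (\<Sum>m. real (b (m + n) y) / 4 ^ Suc m)" for y n
  proof (induction n)
    case (Suc n)
    then show ?case using quaternary_digits(4)[of "\<lambda>n. b n y" n, OF b1] by simp
  qed (simp add: \<phi>_def)
  define P where "P k a r \<longleftrightarrow> \<lfloor>4 * quaternary_shift r (prod_encode (a, k))\<rfloor> = 1" for k a :: nat and r
  have P\<phi>: "P k a (\<phi> y) \<longleftrightarrow> dist y (x a) < 1 / 2 ^ k" for k a y
    unfolding P_def dig quaternary_digits(3)[of "\<lambda>n. b n y" "prod_encode (a, k)", OF b1] by (simp add: b_def)
  define f where "f k r = x (LEAST a. P k a r)" for k r
  have fm [measurable]: "f k \<in> borel_measurable borel" for k
  proof -
    have [measurable]: "Measurable.pred borel (\<lambda>r. P k a r)" for a unfolding P_def by measurable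
    have "(\<lambda>r. LEAST a. P k a r) \<in> borel \<rightarrow>\<^sub>M count_space UNIV" by measurable
    then show ?thesis unfolding f_def by (rule measurable_compose) simp
  qed
  \<comment> \<open>Where the decoded points are not Cauchy the constant \<open>x 0\<close> is taken
    instead, so that a limit exists for every real \<open>r\<close> and \<open>g\<close> is Borel on
    the whole line.\<close>
  define g where "g r = lim (\<lambda>k. if Cauchy (\<lambda>k. f k r) then f k r else x 0)" for r
  have gm: "g \<in> borel_measurable borel"
  proof (rule borel_measurable_LIMSEQ_metric)
    show "(\<lambda>r. if Cauchy (\<lambda>k. f k r) then f k r else x 0) \<in> borel_measurable borel" for k
      by measurable
    fix r
    have "convergent (\<lambda>k. if Cauchy (\<lambda>k. f k r) then f k r else x 0)"
      by (cases "Cauchy (\<lambda>k. f k r)") (auto simp: Cauchy_convergent_iff convergent_const)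
    then show "(\<lambda>k. if Cauchy (\<lambda>k. f k r) then f k r else x 0) \<longlonglongrightarrow> g r"
      unfolding g_def by (simp only: convergent_LIMSEQ_iff)
  qed
  have g\<phi>: "g (\<phi> y) = y" for y
  proof -
    have "dist y (f k (\<phi> y)) < (1 / 2) ^ k" for k
    proof -
      have "\<exists>a. P k a (\<phi> y)" unfolding P\<phi> by (rule near) simp
      then have "P k (LEAST a. P k a (\<phi> y)) (\<phi> y)" by (rule LeastI_ex)
      then show ?thesis unfolding P\<phi> f_def by (simp add: power_one_over)
    qed
    then have "\<forall>k. dist (f k (\<phi> y)) y \<le> (1 / 2) ^ k" by (simp add: dist_commute less_imp_le)
    then have "(\<lambda>k. dist (f k (\<phi> y)) y) \<longlonglongrightarrow> 0"
      by (intro Lim_null_comparison[OF always_eventually LIMSEQ_realpow_zero[of "1 / 2"]]) auto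
    then have lim: "(\<lambda>k. f k (\<phi> y)) \<longlonglongrightarrow> y" by (simp only: tendsto_dist_iff[symmetric])
    then have "Cauchy (\<lambda>k. f k (\<phi> y))" by (rule LIMSEQ_imp_Cauchy)
    then show ?thesis unfolding g_def using limI[OF lim] by simp
  qed
  have \<phi>m: "\<phi> \<in> borel_measurable borel"
  proof -
    have [measurable]: "(\<lambda>y. real (b n y)) \<in> borel_measurable borel" for n
    proof -
      have "(\<lambda>y. real (b n y)) = (\<lambda>y. if dist y (x (fst (prod_decode n))) < 1 / 2 ^ snd (prod_decode n) then 1 else 0)"
        by (auto simp: b_def)
      then show ?thesis by simp
    qed
    show ?thesis unfolding \<phi>_def by measurable
  qed
  have "0 \<le> \<phi> y" "\<phi> y \<le> 1" for y
    using quaternary_digits(1,2)[of "\<lambda>n. b n y" 0, OF b1] by (auto simp: \<phi>_def)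
  then show ?thesis using that \<phi>m gm g\<phi> by blast
qed

section \<open>Transfer of de Finetti's theorem to the unit ball\<close>

lemma measurable_PiM_map:
  assumes g: "g \<in> X \<rightarrow>\<^sub>M Y"
  shows "(\<lambda>v i. g (v i)) \<in> (\<Pi>\<^sub>M i\<in>(UNIV :: 'i set). X) \<rightarrow>\<^sub>M (\<Pi>\<^sub>M i\<in>(UNIV :: 'i set). Y)"
proof (rule measurable_PiM_single')
  show "(\<lambda>v. g (v i)) \<in> (\<Pi>\<^sub>M i\<in>(UNIV :: 'i set). X) \<rightarrow>\<^sub>M Y" for i
    by (rule measurable_compose[of "\<lambda>v. v i" _ X g, OF _ g]) measurable
qed (auto simp: space_PiM PiE_iff measurable_space[OF g])

lemma PiM_distr_UNIV:
  assumes m: "prob_space m" and g: "g \<in> m \<rightarrow>\<^sub>M X"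
  shows "(\<Pi>\<^sub>M i\<in>(UNIV :: nat set). distr m X g) = distr (\<Pi>\<^sub>M i\<in>(UNIV :: nat set). m) (\<Pi>\<^sub>M i\<in>(UNIV :: nat set). X) (\<lambda>v i. g (v i))"
proof -
  interpret m: prob_space m by fact
  have d: "prob_space (distr m X g)" by (rule m.prob_space_distr[OF g])
  interpret product_prob_space "\<lambda>_ :: nat. distr m X g" UNIV using d by (intro product_prob_spaceI)
  let ?f = "\<lambda>(v :: nat \<Rightarrow> _) i. g (v i)"
  have fm: "?f \<in> (\<Pi>\<^sub>M i\<in>UNIV. m) \<rightarrow>\<^sub>M (\<Pi>\<^sub>M i\<in>UNIV. X)"
    by (rule measurable_PiM_map[OF g])
  have "distr (\<Pi>\<^sub>M i\<in>UNIV. m) (\<Pi>\<^sub>M i\<in>UNIV. X) ?f = (\<Pi>\<^sub>M i\<in>UNIV. distr m X g)"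
  proof (rule PiM_eq)
    show "sets (distr (\<Pi>\<^sub>M i\<in>UNIV. m) (\<Pi>\<^sub>M i\<in>UNIV. X) ?f) = sets (\<Pi>\<^sub>M i\<in>(UNIV :: nat set). distr m X g)"
      by (simp cong: sets_PiM_cong)
    fix J :: "nat set" and A assume J: "finite J" and A: "\<And>j. j \<in> J \<Longrightarrow> A j \<in> sets (distr m X g)"
    then have A': "\<And>j. j \<in> J \<Longrightarrow> A j \<in> sets X" by simp
    have emb: "prod_emb UNIV (\<lambda>_. distr m X g) J (Pi\<^sub>E J A) = prod_emb UNIV (\<lambda>_. X) J (Pi\<^sub>E J A)"
      by (simp add: prod_emb_def)
    have "emeasure (distr (\<Pi>\<^sub>M i\<in>UNIV. m) (\<Pi>\<^sub>M i\<in>UNIV. X) ?f) (prod_emb UNIV (\<lambda>_. X) J (Pi\<^sub>E J A)) =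
       emeasure (\<Pi>\<^sub>M i\<in>UNIV. m) (?f -` prod_emb UNIV (\<lambda>_. X) J (Pi\<^sub>E J A) \<inter> space (\<Pi>\<^sub>M i\<in>UNIV. m))"
      using J A' by (intro emeasure_distr[OF fm] sets_PiM_I) auto
    also have "?f -` prod_emb UNIV (\<lambda>_. X) J (Pi\<^sub>E J A) \<inter> space (\<Pi>\<^sub>M i\<in>UNIV. m) =
       prod_emb UNIV (\<lambda>_. m) J (\<Pi>\<^sub>E j\<in>J. g -` A j \<inter> space m)"
      using measurable_space[OF g] by (auto simp: prod_emb_def space_PiM PiE_iff)
    also have "emeasure (\<Pi>\<^sub>M i\<in>UNIV. m) \<dots> = (\<Prod>j\<in>J. emeasure m (g -` A j \<inter> space m))"
      using J A' g m by (intro Infinite_Product_Measure.emeasure_PiM_emb) auto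
    also have "\<dots> = (\<Prod>j\<in>J. emeasure (distr m X g) (A j))"
      using A' g by (intro prod.cong refl) (simp add: emeasure_distr)
    finally show "emeasure (distr (\<Pi>\<^sub>M i\<in>UNIV. m) (\<Pi>\<^sub>M i\<in>UNIV. X) ?f) (prod_emb UNIV (\<lambda>_. distr m X g) J (Pi\<^sub>E J A)) =
      (\<Prod>j\<in>J. emeasure (distr m X g) (A j))" unfolding emb .
  qed
  then show ?thesis by (rule sym)
qed

text \<open>The sequence is coded into the unit interval, where the directing measures are
  available; decoding pushes them to the ball.\<close>

lemma de_Finetti_unit_ball:
  fixes Y :: "nat \<Rightarrow> 'a \<Rightarrow> 'h :: {real_inner, polish_space}"
  assumes M: "prob_space M" and Y [measurable]: "\<And>i. Y i \<in> borel_measurable M" and ball: "\<And>i \<omega>. Y i \<omega> \<in> cball 0 1"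
    and exch: "\<And>\<tau>. bij \<tau> \<Longrightarrow> finite {i. \<tau> i \<noteq> i} \<Longrightarrow>
      distr M (\<Pi>\<^sub>M i\<in>UNIV. borel) (\<lambda>\<omega> i. Y (\<tau> i) \<omega>) = distr M (\<Pi>\<^sub>M i\<in>UNIV. borel) (\<lambda>\<omega> i. Y i \<omega>)"
  obtains \<mu> where "\<mu> \<in> M \<rightarrow>\<^sub>M prob_algebra unit_ball_algebra"
    "distr M (\<Pi>\<^sub>M i\<in>UNIV. unit_ball_algebra) (\<lambda>\<omega> i. Y i \<omega>) = M \<bind> (\<lambda>\<omega>. \<Pi>\<^sub>M i\<in>UNIV. \<mu> \<omega>)"
proof -
  interpret prob_space M by fact
  obtain \<phi> :: "'h \<Rightarrow> real" and g where \<phi>: "\<phi> \<in> borel_measurable borel" "\<And>y. 0 \<le> \<phi> y" "\<And>y. \<phi> y \<le> 1"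
    and g [measurable]: "g \<in> borel_measurable borel" and g\<phi>: "\<And>y. g (\<phi> y) = y"
    using polish_coding by blast
  note [measurable] = \<phi>(1)
  let ?R = "\<Pi>\<^sub>M i\<in>(UNIV :: nat set). (borel :: real measure)"
  let ?H = "\<Pi>\<^sub>M i\<in>(UNIV :: nat set). (borel :: 'h measure)"
  let ?B = "\<Pi>\<^sub>M i\<in>(UNIV :: nat set). (unit_ball_algebra :: 'h measure)"
  interpret exchangeable_unit M "\<lambda>i \<omega>. \<phi> (Y i \<omega>)"
  proof
    show "(\<lambda>\<omega>. \<phi> (Y i \<omega>)) \<in> borel_measurable M" for i by measurable
    show "0 \<le> \<phi> (Y i \<omega>)" "\<phi> (Y i \<omega>) \<le> 1" for i \<omega> by (rule \<phi>)+
    fix \<tau> :: "nat \<Rightarrow> nat" assume \<tau>: "bij \<tau>" "finite {i. \<tau> i \<noteq> i}"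
    have Ym: "(\<lambda>\<omega> i. Y (\<sigma> i) \<omega>) \<in> M \<rightarrow>\<^sub>M ?H" for \<sigma>
      by (rule measurable_PiM_single') (auto simp: space_PiM)
    have \<phi>m: "(\<lambda>y i. \<phi> (y i)) \<in> ?H \<rightarrow>\<^sub>M ?R"
      by (rule measurable_PiM_map[OF \<phi>(1)])
    have "distr (distr M ?H (\<lambda>\<omega> i. Y (\<tau> i) \<omega>)) ?R (\<lambda>y i. \<phi> (y i)) = distr (distr M ?H (\<lambda>\<omega> i. Y i \<omega>)) ?R (\<lambda>y i. \<phi> (y i))"
      by (simp only: exch[OF \<tau>])
    then show "distr M ?R (\<lambda>\<omega> i. \<phi> (Y (\<tau> i) \<omega>)) = distr M ?R (\<lambda>\<omega> i. \<phi> (Y i \<omega>))"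
      by (simp add: distr_distr[OF \<phi>m Ym] comp_def distr_distr[OF \<phi>m Ym[of "\<lambda>i. i"]])
  qed
  \<comment> \<open>Reals that decode to points outside the ball are sent to 0, so that
    \<open>\<mu> \<omega>\<close> is carried by the ball for every \<omega>.\<close>
  define g' where "g' r = (if g r \<in> cball 0 1 then g r else 0)" for r
  have [measurable]: "(cball 0 1 :: 'h set) \<in> sets borel" by simp
  have g'm: "g' \<in> borel \<rightarrow>\<^sub>M unit_ball_algebra"
    unfolding unit_ball_algebra_def
  proof (rule measurable_restrict_space2)
    show "g' \<in> space borel \<rightarrow> cball 0 1" by (auto simp: g'_def)
    show "g' \<in> borel \<rightarrow>\<^sub>M borel" unfolding g'_def by measurable
  qed
  have g'Y: "g' (\<phi> (Y i \<omega>)) = Y i \<omega>" for i \<omega> using ball[of i \<omega>] by (simp add: g'_def g\<phi>)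
  define \<mu> where "\<mu> \<omega> = distr (dir_measure \<omega>) unit_ball_algebra g'" for \<omega>
  have \<mu>m: "\<mu> \<in> M \<rightarrow>\<^sub>M prob_algebra unit_ball_algebra"
    unfolding \<mu>_def by (rule measurable_compose[OF measurable_dir_measure measurable_distr_prob_space[OF g'm]])
  have Gm: "(\<lambda>x i. g' (x i)) \<in> ?R \<rightarrow>\<^sub>M ?B"
    by (rule measurable_PiM_map[OF g'm])
  have \<xi>m: "(\<lambda>\<omega> i. \<phi> (Y i \<omega>)) \<in> M \<rightarrow>\<^sub>M ?R"
    by (rule measurable_PiM_single') (auto simp: space_PiM)
  have k: "(\<lambda>\<omega>. \<Pi>\<^sub>M i\<in>UNIV. dir_measure \<omega>) \<in> M \<rightarrow>\<^sub>M prob_algebra ?R"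
    by (rule measurable_compose[OF measurable_dir_measure measurable_PiM_kernel])
  have "distr M ?B (\<lambda>\<omega> i. Y i \<omega>) = distr (distr M ?R (\<lambda>\<omega> i. \<phi> (Y i \<omega>))) ?B (\<lambda>x i. g' (x i))"
    by (simp add: distr_distr[OF Gm \<xi>m] comp_def g'Y)
  also have "\<dots> = distr (M \<bind> (\<lambda>\<omega>. \<Pi>\<^sub>M i\<in>UNIV. dir_measure \<omega>)) ?B (\<lambda>x i. g' (x i))"
    by (simp only: de_Finetti)
  also have "\<dots> = M \<bind> (\<lambda>\<omega>. distr (\<Pi>\<^sub>M i\<in>UNIV. dir_measure \<omega>) ?B (\<lambda>x i. g' (x i)))"
    by (rule distr_bind[OF measurable_prob_algebraD[OF k] not_empty Gm])
  also have "\<dots> = M \<bind> (\<lambda>\<omega>. \<Pi>\<^sub>M i\<in>UNIV. \<mu> \<omega>)"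
  proof (rule arg_cong[where f = "bind M"], rule ext)
    fix \<omega>
    interpret d: real_distribution "dir_measure \<omega>" by (rule real_distribution_dir)
    have "g' \<in> dir_measure \<omega> \<rightarrow>\<^sub>M unit_ball_algebra" using g'm by (simp cong: measurable_cong_sets)
    from PiM_distr_UNIV[OF d.prob_space_axioms this]
    show "distr (\<Pi>\<^sub>M i\<in>UNIV. dir_measure \<omega>) ?B (\<lambda>x i. g' (x i)) = (\<Pi>\<^sub>M i\<in>UNIV. \<mu> \<omega>)"
      by (simp add: \<mu>_def)
  qed
  finally show ?thesis using \<mu>m that by blast
qed

section \<open>Sampling measures of exchangeable overlap matrices\<close>

text \<open>Like \<open>rost_matrices\<close>, but without the unit diagonal, which is lost in the
  Gram-Schmidt procedure.\<close>

definition psd_kernel :: "(nat \<Rightarrow> nat \<Rightarrow> real) \<Rightarrow> bool" where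
  "psd_kernel q \<longleftrightarrow> (\<forall>i j. q i j = q j i) \<and>
     (\<forall>n (x :: nat \<Rightarrow> real). 0 \<le> (\<Sum>i<n. \<Sum>j<n. x i * x j * q i j))"

lemma rost_matrices_iff: "q \<in> rost_matrices \<longleftrightarrow> psd_kernel q \<and> (\<forall>i. q i i = 1)"
  by (auto simp: rost_matrices_def psd_kernel_def)

lemma psd_kernel_sym: "psd_kernel q \<Longrightarrow> q i j = q j i"
  by (simp add: psd_kernel_def)

lemma psd_kernelD: "psd_kernel q \<Longrightarrow> 0 \<le> (\<Sum>i<n. \<Sum>j<n. x i * x j * q i j)"
  by (simp add: psd_kernel_def)

text \<open>The map \<open>f\<close> may repeat values: the coefficients of indices with the same
  image are added. This is how positive semidefiniteness passes to matrices with repeated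
  rows.\<close>

lemma weighted_sum_reindex:
  fixes g :: "'b \<Rightarrow> real" and n :: nat
  assumes S: "finite S" and f: "\<And>i. i < n \<Longrightarrow> f i \<in> S"
  shows "(\<Sum>a\<in>S. (\<Sum>i<n. if f i = a then x i else 0) * g a) = (\<Sum>i<n. x i * g (f i))"
proof -
  have "(\<Sum>a\<in>S. (\<Sum>i<n. if f i = a then x i else 0) * g a) = (\<Sum>i<n. \<Sum>a\<in>S. (if f i = a then x i else 0) * g a)"
    unfolding sum_distrib_right by (rule sum.swap)
  also have "\<dots> = (\<Sum>i<n. x i * g (f i))"
    using S f by (intro sum.cong refl) (simp add: if_distrib[of "\<lambda>y. y * _"] sum.delta' cong: if_cong)
  finally show ?thesis .
qed

lemma quadratic_form_reindex_eq:
  fixes q :: "'b \<Rightarrow> 'b \<Rightarrow> real" and n :: nat and f :: "nat \<Rightarrow> 'b" and x :: "nat \<Rightarrow> real"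
  assumes S: "finite S" and f: "\<And>i. i < n \<Longrightarrow> f i \<in> S"
  defines "X \<equiv> \<lambda>a. \<Sum>i<n. if f i = a then x i else 0"
  shows "(\<Sum>a\<in>S. \<Sum>b\<in>S. X a * X b * q a b) = (\<Sum>i<n. \<Sum>j<n. x i * x j * q (f i) (f j))"
proof -
  have one: "(\<Sum>a\<in>S. X a * g a) = (\<Sum>i<n. x i * g (f i))" for g :: "'b \<Rightarrow> real"
    unfolding X_def by (rule weighted_sum_reindex[OF S f])
  have "(\<Sum>a\<in>S. \<Sum>b\<in>S. X a * X b * q a b) = (\<Sum>a\<in>S. X a * (\<Sum>b\<in>S. X b * q a b))"
    by (simp add: sum_distrib_left mult.assoc)
  also have "\<dots> = (\<Sum>i<n. x i * (\<Sum>j<n. x j * q (f i) (f j)))" by (simp add: one)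
  also have "\<dots> = (\<Sum>i<n. \<Sum>j<n. x i * x j * q (f i) (f j))"
    by (simp add: sum_distrib_left mult.assoc)
  finally show ?thesis .
qed

lemma quadratic_form_reindex:
  fixes q :: "'b \<Rightarrow> 'b \<Rightarrow> real" and n :: nat
  assumes S: "finite S" and f: "\<And>i. i < n \<Longrightarrow> f i \<in> S"
    and psd: "\<And>X. 0 \<le> (\<Sum>a\<in>S. \<Sum>b\<in>S. X a * X b * q a b)"
  shows "0 \<le> (\<Sum>i<n. \<Sum>j<n. x i * x j * q (f i) (f j))"
  using psd[of "\<lambda>a. \<Sum>i<n. if f i = a then x i else 0"]
    quadratic_form_reindex_eq[where f = f and x = x and q = q and n = n, OF S f] by (simp only:)

lemma psd_kernel_reindex:
  assumes "psd_kernel q"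
  shows "psd_kernel (\<lambda>i j. q (f i) (f j))"
  unfolding psd_kernel_def
proof (intro conjI allI)
  show "q (f i) (f j) = q (f j) (f i)" for i j using assms by (rule psd_kernel_sym)
  fix n and x :: "nat \<Rightarrow> real"
  obtain m where "f ` {..<n} \<subseteq> {..<m}" using finite_nat_iff_bounded by blast
  then show "0 \<le> (\<Sum>i<n. \<Sum>j<n. x i * x j * q (f i) (f j))"
    by (intro quadratic_form_reindex[where S = "{..<m}" and f = f and q = q and n = n and x = x,
          OF finite_lessThan _ psd_kernelD[OF assms]]) auto
qed

lemma rost_matrices_reindex: "q \<in> rost_matrices \<Longrightarrow> (\<lambda>i j. q (f i) (f j)) \<in> rost_matrices"
  by (simp add: rost_matrices_iff psd_kernel_reindex)

lemma psd_kernel_two: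
  assumes q: "psd_kernel q"
  shows "0 \<le> x * x * q i i + 2 * x * y * q i j + y * y * q j j"
proof -
  have "0 \<le> (\<Sum>k<2::nat. \<Sum>l<2::nat. (if k = 0 then x else y) * (if l = 0 then x else y) * q (if k = 0 then i else j) (if l = 0 then i else j))"
    by (rule psd_kernelD[OF psd_kernel_reindex[OF q, of "\<lambda>k. if k = 0 then i else j"]])
  then show ?thesis using psd_kernel_sym[OF q, of j i] by (simp add: numeral_2_eq_2 algebra_simps)
qed

lemma psd_kernel_diag: "psd_kernel q \<Longrightarrow> 0 \<le> q i i"
  using psd_kernel_two[of q 1 i 0 i] by simp

lemma psd_kernel_cauchy_schwarz:
  assumes q: "psd_kernel q"
  shows "(q i j)\<^sup>2 \<le> q i i * q j j"
proof (cases "q j j = 0")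
  case True
  \<comment> \<open>The pair \<open>x = q i j\<close>, \<open>y = - (q i i + 1)\<close> makes the
    mixed term dominate when \<open>q j j = 0\<close>, which forces
    \<open>q i j = 0\<close>.\<close>
  have "0 \<le> - ((q i j)\<^sup>2 * q i i) - 2 * (q i j)\<^sup>2"
    using psd_kernel_two[OF q, of "q i j" i "- (q i i + 1)" j] True by (simp add: power2_eq_square algebra_simps)
  moreover have "0 \<le> (q i j)\<^sup>2 * q i i" using psd_kernel_diag[OF q, of i] by simp
  ultimately have "(q i j)\<^sup>2 \<le> 0" by linarith
  then show ?thesis using True by simp
next
  case False
  then have pos: "0 < q j j" using psd_kernel_diag[OF q, of j] by simp
  have "0 \<le> q j j * (q i i * q j j - (q i j)\<^sup>2)"
    using psd_kernel_two[OF q, of "q j j" i "- q i j" j] by (simp add: power2_eq_square algebra_simps)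
  then show ?thesis using pos by (simp add: zero_le_mult_iff)
qed

text \<open>The Schur complement is the Gram matrix after projecting off the vector \<open>s\<close>; when that vector
  vanishes, division by zero makes it the identity.\<close>

definition schur :: "(nat \<Rightarrow> nat \<Rightarrow> real) \<Rightarrow> nat \<Rightarrow> nat \<Rightarrow> nat \<Rightarrow> real" where
  "schur q s i j = q i j - q i s * q j s / q s s"

lemma psd_kernel_schur:
  assumes q: "psd_kernel q"
  shows "psd_kernel (schur q s)"
proof (cases "q s s = 0")
  case True
  then show ?thesis using q by (simp add: schur_def[abs_def])
next
  case False
  show ?thesis unfolding psd_kernel_def
  proof (intro conjI allI)
    show "schur q s i j = schur q s j i" for i j
      using psd_kernel_sym[OF q, of i j] by (simp add: schur_def)
    fix n and x :: "nat \<Rightarrow> real"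
    \<comment> \<open>Position \<open>n\<close> is an additional slot for \<open>s\<close>, with the
      coefficient \<open>- c\<close> that minimizes the quadratic form. That \<open>s\<close> may
      also occur among the first \<open>n\<close> indices is harmless, since a reindexed kernel may
      repeat indices.\<close>
    define f where "f i = (if i < n then i else s)" for i
    define c where "c = (\<Sum>i<n. x i * q i s) / q s s"
    define y where "y i = (if i < n then x i else - c)" for i
    let ?X = "\<Sum>i<n. x i * q i s"
    have "0 \<le> (\<Sum>i<Suc n. \<Sum>j<Suc n. y i * y j * q (f i) (f j))"
      by (rule psd_kernelD[OF psd_kernel_reindex[OF q, of f]])
    also have "\<dots> = (\<Sum>i<n. \<Sum>j<n. x i * x j * q i j) - (\<Sum>i<n. x i * c * q i s) - (\<Sum>j<n. c * x j * q s j) + c * c * q s s"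
      by (simp add: y_def f_def sum.distrib sum_negf sum_subtractf)
    also have "(\<Sum>i<n. x i * c * q i s) = c * ?X" by (simp add: sum_distrib_left ac_simps)
    also have "(\<Sum>j<n. c * x j * q s j) = c * ?X" by (simp add: sum_distrib_left psd_kernel_sym[OF q, of s] ac_simps)
    also have "(\<Sum>i<n. \<Sum>j<n. x i * x j * q i j) - c * ?X - c * ?X + c * c * q s s =
        (\<Sum>i<n. \<Sum>j<n. x i * x j * q i j) - ?X * ?X / q s s"
      using False by (simp add: c_def field_simps)
    also have "?X * ?X / q s s = (\<Sum>i<n. \<Sum>j<n. x i * x j * (q i s * q j s / q s s))"
      by (simp add: sum_product sum_divide_distrib ac_simps)
    also have "(\<Sum>i<n. \<Sum>j<n. x i * x j * q i j) - \<dots> = (\<Sum>i<n. \<Sum>j<n. x i * x j * schur q s i j)"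
      by (simp add: schur_def right_diff_distrib sum_subtractf)
    finally show "0 \<le> (\<Sum>i<n. \<Sum>j<n. x i * x j * schur q s i j)" .
  qed
qed

text \<open>Gram-Schmidt on the odd-indexed vectors, carried out on Gram matrices: after
  \<open>K\<close> steps the vectors 1, 3, ..., 2K - 1 have been projected off.\<close>

primrec residual :: "(nat \<Rightarrow> nat \<Rightarrow> real) \<Rightarrow> nat \<Rightarrow> nat \<Rightarrow> nat \<Rightarrow> real" where
  "residual q 0 = q"
| "residual q (Suc K) = schur (residual q K) (2 * K + 1)"

text \<open>The coordinate of vector \<open>i\<close> along the \<open>K\<close>-th orthonormalized
  odd vector, a Cholesky coefficient. If that direction is degenerate, division by zero makes it
  0.\<close>

definition gram_coeff :: "(nat \<Rightarrow> nat \<Rightarrow> real) \<Rightarrow> nat \<Rightarrow> nat \<Rightarrow> real" where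
  "gram_coeff q K i = residual q K i (2 * K + 1) / sqrt (residual q K (2 * K + 1) (2 * K + 1))"

lemma psd_kernel_residual: "psd_kernel q \<Longrightarrow> psd_kernel (residual q K)"
  by (induction K) (simp_all add: psd_kernel_schur)

lemma residual_Suc:
  assumes "psd_kernel q"
  shows "residual q (Suc K) i j = residual q K i j - gram_coeff q K i * gram_coeff q K j"
  using psd_kernel_diag[OF psd_kernel_residual[OF assms], of K "2 * K + 1"]
  by (simp add: gram_coeff_def schur_def)

lemma residual_eq:
  assumes "psd_kernel q"
  shows "residual q K i j = q i j - (\<Sum>k<K. gram_coeff q k i * gram_coeff q k j)"
  by (induction K) (simp_all add: residual_Suc[OF assms] del: residual.simps(2))

lemma residual_bounds:
  assumes q: "q \<in> rost_matrices"
  shows "0 \<le> residual q K i i" "residual q K i i \<le> 1" "(residual q K i j)\<^sup>2 \<le> 1"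
proof -
  have p: "psd_kernel q" using q by (simp add: rost_matrices_iff)
  have d: "0 \<le> residual q K i i" "residual q K i i \<le> 1" for i
  proof -
    show "0 \<le> residual q K i i" by (rule psd_kernel_diag[OF psd_kernel_residual[OF p]])
    have "0 \<le> (\<Sum>k<K. gram_coeff q k i * gram_coeff q k i)" by (intro sum_nonneg) simp
    then show "residual q K i i \<le> 1" using q by (simp add: residual_eq[OF p] rost_matrices_iff)
  qed
  then show "0 \<le> residual q K i i" "residual q K i i \<le> 1" by auto
  have "(residual q K i j)\<^sup>2 \<le> residual q K i i * residual q K j j"
    by (rule psd_kernel_cauchy_schwarz[OF psd_kernel_residual[OF p]])
  also have "\<dots> \<le> 1" using d by (intro mult_le_one) auto
  finally show "(residual q K i j)\<^sup>2 \<le> 1" .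
qed

text \<open>The first \<open>K\<close> steps look only at the odd indices below
  \<open>2 * K\<close>, besides the two indices asked for.\<close>

lemma residual_permute:
  assumes "\<And>k. k < K \<Longrightarrow> \<tau> (2 * k + 1) = 2 * k + 1"
  shows "residual (\<lambda>i j. q (\<tau> i) (\<tau> j)) K i j = residual q K (\<tau> i) (\<tau> j)"
  using assms
proof (induction K arbitrary: i j)
  case (Suc K)
  have "\<tau> (2 * K + 1) = 2 * K + 1" by (rule Suc.prems) simp
  then show ?case using Suc by (simp add: schur_def)
qed simp

lemma measurable_residual [measurable]: "(\<lambda>q. residual q K i j) \<in> borel_measurable rost_algebra"
proof (induction K arbitrary: i j)
  case 0
  show ?case unfolding rost_algebra_def
    by (intro measurable_restrict_space1) (simp add: borel_measurable_continuous_onI continuous_matrix_entry)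
next
  case (Suc K)
  then show ?case by (simp add: schur_def)
qed

lemma measurable_gram_coeff [measurable]: "(\<lambda>q. gram_coeff q K i) \<in> borel_measurable rost_algebra"
  unfolding gram_coeff_def by measurable

section \<open>Decay of the residuals under exchangeability\<close>

locale rost_law = prob_space P for P :: "(nat \<Rightarrow> nat \<Rightarrow> real) measure" +
  assumes sets_P [measurable_cong]: "sets P = sets rost_algebra"
    and permute: "\<And>\<tau>. bij \<tau> \<Longrightarrow> finite {i. \<tau> i \<noteq> i} \<Longrightarrow> distr P rost_algebra (\<lambda>q i j. q (\<tau> i) (\<tau> j)) = P"
begin

lemma space_P: "space P = rost_matrices"
  using sets_eq_imp_space_eq[OF sets_P] by (simp add: space_rost_algebra)

lemma measurable_reindex: "(\<lambda>q i j. q (\<tau> i) (\<tau> j)) \<in> P \<rightarrow>\<^sub>M rost_algebra"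
proof (rule measurable_into_rost)
  show "(\<lambda>q. q (\<tau> i) (\<tau> j)) \<in> borel_measurable P" for i j
    using measurable_residual[of 0 "\<tau> i" "\<tau> j"] by (simp cong: measurable_cong_sets add: sets_P)
qed (simp add: space_P rost_matrices_reindex)

lemma integral_permute:
  fixes g :: "_ \<Rightarrow> real"
  assumes "bij \<tau>" "finite {i. \<tau> i \<noteq> i}" "g \<in> borel_measurable rost_algebra"
  shows "(\<integral>q. g (\<lambda>i j. q (\<tau> i) (\<tau> j)) \<partial>P) = (\<integral>q. g q \<partial>P)"
  using integral_distr[OF measurable_reindex[where \<tau> = \<tau>] assms(3)] by (simp only: permute[OF assms(1,2)])

text \<open>Projecting off the vector \<open>2 * K + 1\<close> lowers the mean squared residual norm
  of vector \<open>2 * a\<close> by \<open>E K - E (Suc K)\<close>. By exchangeability vector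
  \<open>2 * b\<close> could have been projected off instead, and that drop dominates the squared
  residual inner product. The drops of a decreasing nonnegative sequence tend to 0.\<close>

lemma residual_tendsto_zero:
  assumes ab: "a \<noteq> b"
  shows "(\<lambda>K. \<integral>q. (residual q K (2 * a) (2 * b))\<^sup>2 \<partial>P) \<longlonglongrightarrow> 0"
proof -
  let ?i = "2 * a" and ?j = "2 * b"
  define E where "E K = (\<integral>q. residual q K ?i ?i \<partial>P)" for K
  have int: "integrable P (\<lambda>q. residual q K ?i ?i)" for K
    using residual_bounds by (intro integrable_const_bound[of _ 1]) (auto simp: space_P)
  have int2: "integrable P (\<lambda>q. (residual q K ?i j)\<^sup>2)" for K j
    using residual_bounds by (intro integrable_const_bound[of _ 1]) (auto simp: space_P)
  define D where "D K q = (residual q K ?i (2 * K + 1))\<^sup>2 / residual q K (2 * K + 1) (2 * K + 1)" for K q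
  have D_eq: "D K q = residual q K ?i ?i - residual q (Suc K) ?i ?i" for K q
    by (simp add: D_def schur_def power2_eq_square)
  have le: "(\<integral>q. (residual q K ?i ?j)\<^sup>2 \<partial>P) \<le> E K - E (Suc K)" for K
  proof -
    \<comment> \<open>The swap fixes the odd indices used so far and \<open>2 * a\<close>, so it
      acts on the drop only by replacing \<open>2 * K + 1\<close> with \<open>2 * b\<close>.\<close>
    let ?\<tau> = "Transposition.transpose ?j (2 * K + 1)"
    have fix1: "?\<tau> (2 * k + 1) = 2 * k + 1" if "k < K" for k
    proof -
      have "2 * k + 1 \<noteq> ?j" by presburger
      then show ?thesis using that by (simp add: Transposition.transpose_def)
    qed
    have "?i \<noteq> 2 * K + 1" by presburger
    then have fix2: "?\<tau> ?i = ?i" using ab by (simp add: Transposition.transpose_def)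
    have Dp: "D K (\<lambda>i j. q (?\<tau> i) (?\<tau> j)) = (residual q K ?i ?j)\<^sup>2 / residual q K ?j ?j" for q
    proof -
      have "residual (\<lambda>i j. q (?\<tau> i) (?\<tau> j)) K i j = residual q K (?\<tau> i) (?\<tau> j)" for i j
        by (rule residual_permute) (rule fix1)
      then show ?thesis unfolding D_def by (simp only: fix2 transpose_apply_second)
    qed
    have Dm: "D K \<in> borel_measurable rost_algebra" unfolding D_def by measurable
    have fin: "finite {i. ?\<tau> i \<noteq> i}"
      by (rule finite_subset[of _ "{?j, 2 * K + 1}"]) (auto simp: Transposition.transpose_def)
    have "(\<integral>q. (residual q K ?i ?j)\<^sup>2 \<partial>P) \<le> (\<integral>q. D K (\<lambda>i j. q (?\<tau> i) (?\<tau> j)) \<partial>P)"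
    proof (rule integral_mono[OF int2])
      show "integrable P (\<lambda>q. D K (\<lambda>i j. q (?\<tau> i) (?\<tau> j)))"
      proof (rule integrable_const_bound[of _ 1])
        show "AE q in P. norm (D K (\<lambda>i j. q (?\<tau> i) (?\<tau> j))) \<le> 1"
        proof (rule AE_I2)
          fix q assume "q \<in> space P"
          then have q': "(\<lambda>i j. q (?\<tau> i) (?\<tau> j)) \<in> rost_matrices" by (simp add: space_P rost_matrices_reindex)
          have "0 \<le> D K (\<lambda>i j. q (?\<tau> i) (?\<tau> j))" unfolding D_def using residual_bounds[OF q'] by simp
          moreover have "D K (\<lambda>i j. q (?\<tau> i) (?\<tau> j)) \<le> 1"
            unfolding D_eq using residual_bounds(2)[OF q', of K ?i] residual_bounds(1)[OF q', of "Suc K" ?i] by linarith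
          ultimately show "norm (D K (\<lambda>i j. q (?\<tau> i) (?\<tau> j))) \<le> 1" by simp
        qed
        show "(\<lambda>q. D K (\<lambda>i j. q (?\<tau> i) (?\<tau> j))) \<in> borel_measurable P"
          by (rule measurable_compose[OF measurable_reindex Dm])
      qed
      fix q assume "q \<in> space P"
      then have q: "q \<in> rost_matrices" by (simp add: space_P)
      have cs: "(residual q K ?i ?j)\<^sup>2 \<le> residual q K ?i ?i * residual q K ?j ?j"
        using q by (intro psd_kernel_cauchy_schwarz psd_kernel_residual) (simp add: rost_matrices_iff)
      \<comment> \<open>Dividing by a squared residual norm at most 1 only increases; if it is 0,
        Cauchy-Schwarz makes the numerator vanish.\<close>
      show "(residual q K ?i ?j)\<^sup>2 \<le> D K (\<lambda>i j. q (?\<tau> i) (?\<tau> j))"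
      proof (cases "residual q K ?j ?j = 0")
        case False
        then have "0 < residual q K ?j ?j" using residual_bounds(1)[OF q, of K ?j] by simp
        then show ?thesis unfolding Dp using residual_bounds(2)[OF q, of K ?j]
          by (simp add: le_divide_eq mult_left_le)
      next
        case True
        then show ?thesis unfolding Dp using cs by simp
      qed
    qed
    also have "\<dots> = (\<integral>q. D K q \<partial>P)" by (rule integral_permute[OF _ fin Dm]) simp
    also have "\<dots> = E K - E (Suc K)" unfolding D_eq E_def using int[of K] int[of "Suc K"]
      by (simp del: residual.simps)
    finally show ?thesis .
  qed
  have "decseq E"
  proof (rule decseq_SucI)
    fix K
    have "0 \<le> (\<integral>q. (residual q K ?i ?j)\<^sup>2 \<partial>P)" by simp
    then show "E (Suc K) \<le> E K" using le[of K] by linarith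
  qed
  moreover have "0 \<le> E K" for K unfolding E_def
    using residual_bounds(1) by (intro integral_nonneg_AE AE_I2) (auto simp: space_P)
  ultimately obtain L where L: "E \<longlonglongrightarrow> L" using decseq_convergent by blast
  have "(\<lambda>K. E K - E (Suc K)) \<longlonglongrightarrow> L - L" using L LIMSEQ_Suc[OF L] by (rule tendsto_diff)
  then have "(\<lambda>K. E K - E (Suc K)) \<longlonglongrightarrow> 0" by simp
  then show ?thesis
    by (rule Lim_null_comparison[OF always_eventually, rotated]) (use le in simp)
qed

end

section \<open>Realization of the overlaps by vectors of the Hilbert space\<close>

context
  fixes e :: "nat \<Rightarrow> 'h :: {real_inner, polish_space}"
  assumes e: "orthonormal_basis e"
begin

lemma ee: "e i \<bullet> e j = (if i = j then 1 else 0)"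
  using e by (simp add: orthonormal_basis_def)

definition gram_partial :: "nat \<Rightarrow> (nat \<Rightarrow> nat \<Rightarrow> real) \<Rightarrow> nat \<Rightarrow> 'h" where
  "gram_partial n q i = (\<Sum>k<n. gram_coeff q k i *\<^sub>R e k)"

text \<open>For an overlap matrix, a copy of the projection of vector \<open>i\<close> onto the
  closed span of the odd-indexed ones, with the \<open>k\<close>-th orthonormalized direction placed
  at \<open>e k\<close>. For other matrices it is 0, hence it always lies in the ball.\<close>

definition gram_vector :: "(nat \<Rightarrow> nat \<Rightarrow> real) \<Rightarrow> nat \<Rightarrow> 'h" where
  "gram_vector q i = (if q \<in> rost_matrices then lim (\<lambda>n. gram_partial n q i) else 0)"

lemma inner_gram_partial:
  assumes "q \<in> rost_matrices"
  shows "gram_partial n q i \<bullet> gram_partial n q j = q i j - residual q n i j"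
proof -
  have p: "psd_kernel q" using assms by (simp add: rost_matrices_iff)
  have "gram_partial n q i \<bullet> gram_partial n q j = (\<Sum>k<n. gram_coeff q k i * gram_coeff q k j)"
    by (simp add: gram_partial_def inner_sum_left inner_sum_right ee if_distrib[of "\<lambda>y. _ * y"] cong: if_cong)
       (simp add: mult.commute)
  then show ?thesis by (simp add: residual_eq[OF p])
qed

text \<open>Squared distances of the partial sums are increments of a monotone sequence, which is
  bounded since the residual diagonal stays nonnegative.\<close>

lemma gram_partial_tendsto:
  assumes q: "q \<in> rost_matrices"
  shows "(\<lambda>n. gram_partial n q i) \<longlonglongrightarrow> gram_vector q i"
proof -
  have p: "psd_kernel q" using q by (simp add: rost_matrices_iff)
  define S where "S n = (\<Sum>k<n. (gram_coeff q k i)\<^sup>2)" for n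
  have S: "S n = q i i - residual q n i i" for n
    by (simp add: S_def residual_eq[OF p] power2_eq_square)
  have "incseq S" unfolding S_def by (intro incseq_SucI) simp
  moreover have "S n \<le> 1" for n using S[of n] residual_bounds(1)[OF q, of n i] q by (simp add: rost_matrices_iff)
  ultimately obtain L where "S \<longlonglongrightarrow> L" using incseq_convergent[of S 1] by blast
  then have "convergent S" by (rule convergentI)
  then have CS: "Cauchy S" by (rule convergent_Cauchy)
  have dist: "(dist (gram_partial m q i) (gram_partial n q i))\<^sup>2 = S m - S n" if "n \<le> m" for m n
  proof -
    have "gram_partial m q i - gram_partial n q i = (\<Sum>k\<in>{n..<m}. gram_coeff q k i *\<^sub>R e k)"
      unfolding gram_partial_def lessThan_atLeast0 using that by (simp add: sum_diff_nat_ivl)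
    then have "(dist (gram_partial m q i) (gram_partial n q i))\<^sup>2 = (\<Sum>k\<in>{n..<m}. (gram_coeff q k i)\<^sup>2)"
      by (simp add: dist_norm power2_norm_eq_inner inner_sum_left inner_sum_right ee if_distrib[of "\<lambda>y. _ * y"]
          cong: if_cong) (simp add: power2_eq_square)
    also have "\<dots> = S m - S n" unfolding S_def lessThan_atLeast0 using that by (simp add: sum_diff_nat_ivl)
    finally show ?thesis .
  qed
  have "Cauchy (\<lambda>n. gram_partial n q i)"
  proof (rule metric_CauchyI)
    fix r :: real assume r: "0 < r"
    then obtain N where N: "\<And>m n. N \<le> m \<Longrightarrow> N \<le> n \<Longrightarrow> dist (S m) (S n) < r\<^sup>2"
      using metric_CauchyD[OF CS, of "r\<^sup>2"] by auto
    have *: "dist (gram_partial m q i) (gram_partial n q i) < r" if "N \<le> n" "n \<le> m" for m n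
    proof -
      have "(dist (gram_partial m q i) (gram_partial n q i))\<^sup>2 < r\<^sup>2"
        using dist[OF that(2)] N[of m n] that by (auto simp: dist_real_def)
      then show ?thesis using r by (simp add: power_less_imp_less_base)
    qed
    show "\<exists>M. \<forall>m\<ge>M. \<forall>n\<ge>M. dist (gram_partial m q i) (gram_partial n q i) < r"
    proof (intro exI[of _ N] allI impI)
      fix m n assume "N \<le> m" "N \<le> n"
      then show "dist (gram_partial m q i) (gram_partial n q i) < r"
        using *[of n m] *[of m n] by (cases "n \<le> m") (auto simp: dist_commute)
    qed
  qed
  then have "convergent (\<lambda>n. gram_partial n q i)" by (simp add: Cauchy_convergent_iff)
  then show ?thesis using q by (simp add: gram_vector_def convergent_LIMSEQ_iff)
qed

lemma gram_vector_ball: "gram_vector q i \<in> cball 0 1"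
proof (cases "q \<in> rost_matrices")
  case True
  have "norm (gram_partial n q i) \<le> 1" for n
  proof -
    have "(norm (gram_partial n q i))\<^sup>2 \<le> 1\<^sup>2"
      using inner_gram_partial[OF True, of n i i] residual_bounds(1)[OF True, of n i] True
      by (simp add: power2_norm_eq_inner rost_matrices_iff)
    then show ?thesis by (rule power2_le_imp_le) simp
  qed
  then have "norm (gram_vector q i) \<le> 1"
    by (intro LIMSEQ_le_const2[OF tendsto_norm[OF gram_partial_tendsto[OF True]]]) auto
  then show ?thesis by simp
qed (simp add: gram_vector_def)

lemma measurable_gram_vector: "(\<lambda>q. gram_vector q i) \<in> borel_measurable rost_algebra"
proof (rule borel_measurable_LIMSEQ_metric)
  show "(\<lambda>q. gram_partial n q i) \<in> borel_measurable rost_algebra" for n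
    unfolding gram_partial_def by measurable
  show "(\<lambda>n. gram_partial n q i) \<longlonglongrightarrow> gram_vector q i" if "q \<in> space rost_algebra" for q
    using that by (intro gram_partial_tendsto) (simp add: space_rost_algebra)
qed

context
  fixes P assumes P: "rost_law P"
begin

interpretation rost_law P by (rule P)

text \<open>For each overlap matrix the residual entries converge to the difference of the two
  sides; by exchangeability they also tend to 0 in mean square.\<close>

lemma AE_gram_vector_inner:
  assumes ab: "a \<noteq> b"
  shows "AE q in P. q (2 * a) (2 * b) = gram_vector q (2 * a) \<bullet> gram_vector q (2 * b)"
proof -
  let ?d = "\<lambda>q. q (2 * a) (2 * b) - gram_vector q (2 * a) \<bullet> gram_vector q (2 * b)"
  have qm: "(\<lambda>q. q (2 * a) (2 * b)) \<in> borel_measurable rost_algebra"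
    using measurable_residual[of 0 "2 * a" "2 * b"] by simp
  have dm: "(\<lambda>q. (?d q)\<^sup>2) \<in> borel_measurable P"
    using qm measurable_gram_vector
    by (simp cong: measurable_cong_sets add: sets_P)
  have lim: "(\<lambda>n. (residual q n (2 * a) (2 * b))\<^sup>2) \<longlonglongrightarrow> (?d q)\<^sup>2" if q: "q \<in> rost_matrices" for q
  proof -
    have "residual q n (2 * a) (2 * b) = q (2 * a) (2 * b) - gram_partial n q (2 * a) \<bullet> gram_partial n q (2 * b)" for n
      using inner_gram_partial[OF q] by simp
    then show ?thesis
      by (simp only:) (intro tendsto_intros gram_partial_tendsto q)
  qed
  have "(\<lambda>n. \<integral>q. (residual q n (2 * a) (2 * b))\<^sup>2 \<partial>P) \<longlonglongrightarrow> (\<integral>q. (?d q)\<^sup>2 \<partial>P)"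
  proof (rule integral_dominated_convergence[where w = "\<lambda>_. 1", OF dm])
    show "AE q in P. (\<lambda>n. (residual q n (2 * a) (2 * b))\<^sup>2) \<longlonglongrightarrow> (?d q)\<^sup>2"
      using lim by (intro AE_I2) (simp add: space_P)
    show "AE q in P. norm ((residual q n (2 * a) (2 * b))\<^sup>2) \<le> 1" for n
      using residual_bounds(3) by (intro AE_I2) (simp add: space_P)
  qed auto
  then have zero: "(\<integral>q. (?d q)\<^sup>2 \<partial>P) = 0" using residual_tendsto_zero[OF ab] LIMSEQ_unique by blast
  have "integrable P (\<lambda>q. (?d q)\<^sup>2)"
  proof (rule integrable_const_bound[of _ 1])
    show "AE q in P. norm ((?d q)\<^sup>2) \<le> 1"
    proof (rule AE_I2)
      fix q assume "q \<in> space P"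
      then have q: "q \<in> rost_matrices" by (simp add: space_P)
      show "norm ((?d q)\<^sup>2) \<le> 1"
        using LIMSEQ_le_const2[OF lim[OF q]] residual_bounds(3)[OF q] by simp
    qed
  qed (rule dm)
  then have "AE q in P. (?d q)\<^sup>2 = 0" using zero by (simp add: integral_nonneg_eq_0_iff_AE)
  then show ?thesis by eventually_elim simp
qed

text \<open>The directions come from the odd-indexed vectors, so a permutation acting on the even
  indices alone moves the vectors and leaves the directions fixed.\<close>

lemma gram_vector_exchangeable:
  assumes \<tau>: "bij \<tau>" "finite {i. \<tau> i \<noteq> i}"
  shows "distr P (\<Pi>\<^sub>M i\<in>UNIV. borel) (\<lambda>q i. gram_vector q (2 * \<tau> i)) = distr P (\<Pi>\<^sub>M i\<in>UNIV. borel) (\<lambda>q i. gram_vector q (2 * i))"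
proof -
  let ?H = "\<Pi>\<^sub>M i\<in>(UNIV :: nat set). (borel :: 'h measure)"
  define \<pi> where "\<pi> i = (if even i then 2 * \<tau> (i div 2) else i)" for i
  have "bij \<pi>"
  proof (rule bijI)
    show "inj \<pi>"
    proof (rule injI)
      fix i j assume ij: "\<pi> i = \<pi> j"
      have par: "even (\<pi> i) = even i" for i by (simp add: \<pi>_def)
      then have "even i = even j" using ij by metis
      then show "i = j" using ij \<tau>(1) unfolding \<pi>_def bij_def inj_def
        by (cases "even i") (auto elim!: evenE)
    qed
    show "surj \<pi>"
    proof (rule surjI)
      show "\<pi> (if even j then 2 * inv \<tau> (j div 2) else j) = j" for j
        using \<tau>(1) by (simp add: \<pi>_def surj_f_inv_f bij_is_surj)
    qed
  qed
  moreover have "finite {i. \<pi> i \<noteq> i}"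
  proof (rule finite_subset)
    show "{i. \<pi> i \<noteq> i} \<subseteq> (*) 2 ` {i. \<tau> i \<noteq> i}"
      by (auto simp: \<pi>_def split: if_splits elim!: evenE)
  qed (use \<tau>(2) in simp)
  ultimately have perm: "distr P rost_algebra (\<lambda>q i j. q (\<pi> i) (\<pi> j)) = P" by (rule permute)
  have c: "gram_coeff (\<lambda>i j. q (\<pi> i) (\<pi> j)) k i = gram_coeff q k (\<pi> i)" for q k i
  proof -
    have odd: "\<pi> (2 * k + 1) = 2 * k + 1" for k by (simp add: \<pi>_def)
    show ?thesis unfolding gram_coeff_def residual_permute[where K = k and \<tau> = \<pi> and q = q, OF odd] by (simp only: odd)
  qed
  have v: "gram_vector (\<lambda>i j. q (\<pi> i) (\<pi> j)) (2 * i) = gram_vector q (2 * \<tau> i)" if "q \<in> rost_matrices" for q i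
    using that by (simp add: gram_vector_def gram_partial_def c rost_matrices_reindex) (simp add: \<pi>_def)
  have Ym: "(\<lambda>q i. gram_vector q (2 * i)) \<in> rost_algebra \<rightarrow>\<^sub>M ?H"
    by (rule measurable_PiM_single') (auto simp: space_PiM measurable_gram_vector)
  have "distr P ?H (\<lambda>q i. gram_vector q (2 * i)) = distr (distr P rost_algebra (\<lambda>q i j. q (\<pi> i) (\<pi> j))) ?H (\<lambda>q i. gram_vector q (2 * i))"
    by (simp only: perm)
  also have "\<dots> = distr P ?H (\<lambda>q i. gram_vector (\<lambda>i j. q (\<pi> i) (\<pi> j)) (2 * i))"
    by (simp add: distr_distr[OF Ym measurable_reindex] comp_def)
  also have "\<dots> = distr P ?H (\<lambda>q i. gram_vector q (2 * \<tau> i))"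
    by (rule distr_cong) (simp_all add: v space_P)
  finally show ?thesis by simp
qed

text \<open>The vectors with even index are exchangeable and reproduce the overlaps between distinct
  even indices, so their de Finetti measure is a sampling measure for that submatrix; by
  exchangeability the submatrix has the law of the whole matrix.\<close>

theorem ex_sampling_law: "\<exists>D. is_sampling_law (D :: 'h measure measure) P"
proof -
  let ?B = "\<Pi>\<^sub>M i\<in>(UNIV :: nat set). (unit_ball_algebra :: 'h measure)"
  have gm: "(\<lambda>q. gram_vector q i) \<in> borel_measurable P" for i
    using measurable_gram_vector by (simp cong: measurable_cong_sets add: sets_P)
  obtain \<mu> where \<mu>: "\<mu> \<in> P \<rightarrow>\<^sub>M prob_algebra (unit_ball_algebra :: 'h measure)"
    and law: "distr P ?B (\<lambda>q i. gram_vector q (2 * i)) = P \<bind> (\<lambda>q. \<Pi>\<^sub>M i\<in>UNIV. \<mu> q)"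
    using de_Finetti_unit_ball[OF prob_space_axioms, of "\<lambda>i q. gram_vector q (2 * i)", OF gm gram_vector_ball gram_vector_exchangeable]
    by blast
  define D where "D = distr P (prob_algebra unit_ball_algebra) \<mu>"
  have D: "D \<in> random_measure_laws"
    unfolding D_def random_measure_laws_def space_prob_algebra using prob_space_distr[OF \<mu>] by simp
  let ?ov = "replica_overlap ((\<bullet>) :: 'h \<Rightarrow> _)"
  have ovm: "?ov \<in> ?B \<rightarrow>\<^sub>M rost_algebra"
  proof -
    interpret cavity_model gaussian_sequence "unit_ball_algebra :: 'h measure" "(\<bullet>)" "cavity_weight 1 e"
        "ball_weight e 1 (\<lambda>_. 1) (\<lambda>_. 0)" 1 "\<lambda>_. 1" "\<lambda>_. 0" 1 "exp (1\<^sup>2)"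
        "\<integral>x. \<bar>Re (trig_poly 1 (\<lambda>_. 1) (\<lambda>_. 0) x) - gauss_weight 1 x\<bar> \<partial>std_normal_distribution"
      by (rule cavity_model_ball[OF e]) (auto simp: trig_poly_def)
    show ?thesis by (rule measurable_replica_overlap)
  qed
  have om: "overlap_law \<in> prob_algebra (unit_ball_algebra :: 'h measure) \<rightarrow>\<^sub>M prob_algebra rost_algebra"
    unfolding overlap_law_alt[OF e, abs_def]
    by (rule measurable_compose[OF measurable_PiM_kernel measurable_distr_prob_space[OF ovm]])
  have k: "(\<lambda>q. \<Pi>\<^sub>M i\<in>UNIV. \<mu> q) \<in> P \<rightarrow>\<^sub>M prob_algebra ?B"
    by (rule measurable_compose[OF \<mu> measurable_PiM_kernel])
  have Ym: "(\<lambda>q i. gram_vector q (2 * i)) \<in> P \<rightarrow>\<^sub>M ?B"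
  proof (rule measurable_PiM_single')
    show "(\<lambda>q. gram_vector q (2 * i)) \<in> P \<rightarrow>\<^sub>M unit_ball_algebra" for i
      unfolding unit_ball_algebra_def by (rule measurable_restrict_space2[OF _ gm]) (auto intro: gram_vector_ball simp del: mem_cball)
  qed (auto simp: space_PiM unit_ball_algebra_def space_restrict_space PiE_iff intro: gram_vector_ball simp del: mem_cball)
  have "sampled_rost_law D = P \<bind> (\<lambda>q. overlap_law (\<mu> q))"
    unfolding sampled_rost_law_def D_def
    by (rule bind_distr[OF \<mu> measurable_prob_algebraD[OF om]]) (use measurable_space[OF \<mu>] not_empty in auto)
  also have "\<dots> = distr (P \<bind> (\<lambda>q. \<Pi>\<^sub>M i\<in>UNIV. \<mu> q)) rost_algebra ?ov"
    unfolding overlap_law_alt[OF e] by (rule distr_bind[OF measurable_prob_algebraD[OF k] not_empty ovm, symmetric])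
  also have "\<dots> = distr P rost_algebra (\<lambda>q. ?ov (\<lambda>i. gram_vector q (2 * i)))"
    unfolding law[symmetric] by (simp add: distr_distr[OF ovm Ym] comp_def)
  finally have samp: "sampled_rost_law D = distr P rost_algebra (\<lambda>q. ?ov (\<lambda>i. gram_vector q (2 * i)))" .
  have ovY: "(\<lambda>q. ?ov (\<lambda>i. gram_vector q (2 * i))) \<in> P \<rightarrow>\<^sub>M rost_algebra"
    by (rule measurable_compose[OF Ym ovm])
  have "sampled_rost_law D = P"
  proof (rule rost_law_eqI)
    show "sampled_rost_law D \<in> space (prob_algebra rost_algebra)" by (rule sampled_rost_law_in[OF e D])
    show "P \<in> space (prob_algebra rost_algebra)" by (simp add: space_prob_algebra sets_P prob_space_axioms)
    fix n F assume F: "block_test n F"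
    have Fm: "F \<in> borel_measurable rost_algebra" by (rule block_test_rost_measurable[OF F])
    have AE_all: "AE q in P. \<forall>a b. a \<noteq> b \<longrightarrow> q (2 * a) (2 * b) = gram_vector q (2 * a) \<bullet> gram_vector q (2 * b)"
      using AE_gram_vector_inner by (simp add: AE_all_countable)
    \<comment> \<open>Only the first \<open>n\<close> indices matter to \<open>F\<close>, so the
      doubling of indices, which is not a finitary permutation, can be replaced by one.\<close>
    obtain \<tau> where \<tau>: "bij \<tau>" "finite {i. \<tau> i \<noteq> i}" "\<And>i. i < n \<Longrightarrow> \<tau> i = 2 * i"
      using ex_finite_permutation_extending[of "\<lambda>i. 2 * i" n] by (auto simp: inj_on_def)
    have "(\<integral>q. F q \<partial>sampled_rost_law D) = (\<integral>q. F (?ov (\<lambda>i. gram_vector q (2 * i))) \<partial>P)"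
      unfolding samp by (rule integral_distr[OF ovY Fm])
    also have "\<dots> = (\<integral>q. F (\<lambda>i j. q (\<tau> i) (\<tau> j)) \<partial>P)"
    proof (rule integral_cong_AE)
      show "(\<lambda>q. F (?ov (\<lambda>i. gram_vector q (2 * i)))) \<in> borel_measurable P" by (rule measurable_compose[OF ovY Fm])
      show "(\<lambda>q. F (\<lambda>i j. q (\<tau> i) (\<tau> j))) \<in> borel_measurable P" by (rule measurable_compose[OF measurable_reindex Fm])
      show "AE q in P. F (?ov (\<lambda>i. gram_vector q (2 * i))) = F (\<lambda>i j. q (\<tau> i) (\<tau> j))"
        using AE_all AE_space
      proof eventually_elim
        case (elim q)
        have "?ov (\<lambda>i. gram_vector q (2 * i)) i j = q (\<tau> i) (\<tau> j)" if "i < n" "j < n" for i j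
          using elim \<tau>(3) that by (simp add: replica_overlap_def space_P rost_matrices_iff)
        then show ?case using F by (auto simp: block_test_def)
      qed
    qed
    also have "\<dots> = (\<integral>q. F q \<partial>P)" by (rule integral_permute[OF \<tau>(1,2) Fm])
    finally show "(\<integral>q. F q \<partial>sampled_rost_law D) = (\<integral>q. F q \<partial>P)" .
  qed
  then show ?thesis using D unfolding is_sampling_law_def by blast
qed

end

end

section \<open>Gaussian fields on finite sets\<close>

lemma normal_law_char:
  assumes M: "prob_space M" and Y [measurable]: "Y \<in> borel_measurable M" and s: "0 \<le> s"
    and law: "distr M borel Y = (if s = 0 then return borel 0 else density lborel (normal_density 0 s))"
  shows "(\<integral>\<omega>. cis (u * Y \<omega>) \<partial>M) = complex_of_real (exp (- (u * s)\<^sup>2 / 2))"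
proof (cases "s = 0")
  case True
  have cm: "(\<lambda>y. cis (u * y)) \<in> borel_measurable borel" unfolding cis_conv_exp by measurable
  have "(\<integral>\<omega>. cis (u * Y \<omega>) \<partial>M) = (\<integral>y. cis (u * y) \<partial>distr M borel Y)"
    by (rule integral_distr[OF Y cm, symmetric])
  also have "\<dots> = (\<integral>y. cis (u * y) \<partial>return borel 0)" using law True by simp
  also have "\<dots> = cis (u * 0)" by (rule integral_return) (use cm in auto)
  finally show ?thesis using True by simp
next
  case False
  then have s: "0 < s" using s by simp
  interpret prob_space M by fact
  have cm: "(\<lambda>y. cis (u * y)) \<in> borel_measurable borel" for u unfolding cis_conv_exp by measurable
  have "distr M lborel Y = density lborel (normal_density 0 s)"
    using law False by (simp cong: distr_cong)
  then have "distributed M lborel Y (normal_density 0 s)"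
    by (simp add: distributed_def)
  then have "distributed M lborel (\<lambda>\<omega>. (Y \<omega> - 0) / s) std_normal_density"
    using normal_standard_normal_convert[OF s, of Y 0] by simp
  then have d: "distr M lborel (\<lambda>\<omega>. Y \<omega> / s) = std_normal_distribution" by (simp add: distributed_def)
  have "(\<integral>\<omega>. cis (u * Y \<omega>) \<partial>M) = (\<integral>\<omega>. cis (u * s * (Y \<omega> / s)) \<partial>M)" using s by simp
  also have "\<dots> = (\<integral>y. cis (u * s * y) \<partial>distr M lborel (\<lambda>\<omega>. Y \<omega> / s))"
    by (rule integral_distr[symmetric]) (use cm[of "u * s"] in auto)
  also have "\<dots> = complex_of_real (exp (- (u * s)\<^sup>2 / 2))" by (simp only: d integral_std_normal_cis)
  finally show ?thesis .
qed

text \<open>The definition of a Gaussian vector gives each linear combination some variance;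
  comparing second moments identifies it as the quadratic form of the covariance
  \<open>C\<close>.\<close>

lemma
  fixes X :: "'i \<Rightarrow> 'w \<Rightarrow> real"
  assumes M: "prob_space M" and I: "finite I" and X: "centered_gaussian_vector M I X"
    and cov: "\<And>i j. i \<in> I \<Longrightarrow> j \<in> I \<Longrightarrow> (\<integral>\<omega>. X i \<omega> * X j \<omega> \<partial>M) = C i j"
  shows gaussian_vector_char: "(\<integral>\<omega>. cis (\<Sum>i\<in>I. a i * X i \<omega>) \<partial>M) =
      complex_of_real (exp (- (\<Sum>i\<in>I. \<Sum>j\<in>I. a i * a j * C i j) / 2))"
    and gaussian_vector_integrable: "i \<in> I \<Longrightarrow> integrable M (X i)"
proof -
  interpret prob_space M by fact
  have Xm [measurable]: "i \<in> I \<Longrightarrow> X i \<in> borel_measurable M" for i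
    using X by (simp add: centered_gaussian_vector_def)
  have lin: "\<exists>s\<ge>0. (\<forall>u. (\<integral>\<omega>. cis (u * (\<Sum>i\<in>I. a i * X i \<omega>)) \<partial>M) = complex_of_real (exp (- (u * s)\<^sup>2 / 2)))
      \<and> (\<integral>\<omega>. (\<Sum>i\<in>I. a i * X i \<omega>)\<^sup>2 \<partial>M) = s\<^sup>2 \<and> integrable M (\<lambda>\<omega>. (\<Sum>i\<in>I. a i * X i \<omega>)\<^sup>2)" for a
  proof -
    have m: "(\<lambda>\<omega>. \<Sum>i\<in>I. a i * X i \<omega>) \<in> borel_measurable M" by measurable
    obtain s where s: "0 \<le> s" "distr M borel (\<lambda>\<omega>. \<Sum>i\<in>I. a i * X i \<omega>) =
        (if s = 0 then return borel 0 else density lborel (normal_density 0 s))"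
      using X unfolding centered_gaussian_vector_def by blast
    note c = normal_law_char[OF M m s]
    show ?thesis
      using s(1) c integral_square_of_char[OF M m c] integrable_square_of_char[OF M m c] by blast
  qed
  have sq: "integrable M (\<lambda>\<omega>. (X i \<omega>)\<^sup>2)" if "i \<in> I" for i
  proof -
    obtain s where "integrable M (\<lambda>\<omega>. (\<Sum>j\<in>I. (if j = i then 1 else 0) * X j \<omega>)\<^sup>2)"
      using lin[of "\<lambda>j. if j = i then 1 else 0"] by blast
    then show ?thesis using that I by (simp add: if_distrib[of "\<lambda>y. y * _"] sum.delta cong: if_cong)
  qed
  have prod: "integrable M (\<lambda>\<omega>. X i \<omega> * X j \<omega>)" if "i \<in> I" "j \<in> I" for i j
  proof (rule Bochner_Integration.integrable_bound)
    show "integrable M (\<lambda>\<omega>. (X i \<omega>)\<^sup>2 + (X j \<omega>)\<^sup>2)" using sq that by auto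
    have "\<bar>x * y\<bar> \<le> x\<^sup>2 + y\<^sup>2" for x y :: real
    proof -
      have "0 \<le> (\<bar>x\<bar> - \<bar>y\<bar>)\<^sup>2" by simp
      then have "2 * (\<bar>x\<bar> * \<bar>y\<bar>) \<le> x\<^sup>2 + y\<^sup>2" by (simp add: power2_diff)
      moreover have "0 \<le> \<bar>x\<bar> * \<bar>y\<bar>" by simp
      ultimately show ?thesis unfolding abs_mult by linarith
    qed
    then show "AE \<omega> in M. norm (X i \<omega> * X j \<omega>) \<le> norm ((X i \<omega>)\<^sup>2 + (X j \<omega>)\<^sup>2)"
      by (intro AE_I2) simp
  qed (use that in measurable)
  show "integrable M (X i)" if "i \<in> I"
  proof (rule Bochner_Integration.integrable_bound)
    show "integrable M (\<lambda>\<omega>. 1 + (X i \<omega>)\<^sup>2)" using sq[OF that] by auto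
    have "\<bar>x\<bar> \<le> 1 + x\<^sup>2" for x :: real
    proof -
      have "0 \<le> (\<bar>x\<bar> - 1)\<^sup>2" by simp
      then have "2 * \<bar>x\<bar> \<le> 1 + x\<^sup>2" by (simp add: power2_diff)
      then show ?thesis by linarith
    qed
    then show "AE \<omega> in M. norm (X i \<omega>) \<le> norm (1 + (X i \<omega>)\<^sup>2)" by (intro AE_I2) simp
  qed (use that in measurable)
  obtain s where s: "\<And>u. (\<integral>\<omega>. cis (u * (\<Sum>i\<in>I. a i * X i \<omega>)) \<partial>M) = complex_of_real (exp (- (u * s)\<^sup>2 / 2))"
    and s2: "(\<integral>\<omega>. (\<Sum>i\<in>I. a i * X i \<omega>)\<^sup>2 \<partial>M) = s\<^sup>2" using lin[of a] by blast
  have "(\<integral>\<omega>. (\<Sum>i\<in>I. a i * X i \<omega>)\<^sup>2 \<partial>M) = (\<integral>\<omega>. (\<Sum>i\<in>I. \<Sum>j\<in>I. a i * a j * (X i \<omega> * X j \<omega>)) \<partial>M)"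
    by (simp add: power2_eq_square sum_product ac_simps)
  also have "\<dots> = (\<Sum>i\<in>I. \<Sum>j\<in>I. a i * a j * C i j)"
    using prod by (simp add: cov)
  finally show "(\<integral>\<omega>. cis (\<Sum>i\<in>I. a i * X i \<omega>) \<partial>M) =
      complex_of_real (exp (- (\<Sum>i\<in>I. \<Sum>j\<in>I. a i * a j * C i j) / 2))"
    using s[of 1] s2 by simp
qed

text \<open>The unit diagonal makes every field value standard normal, so here the polynomial itself
  serves as \<open>T\<close> and no smoothing enters.\<close>

lemma cavity_model_finite:
  fixes \<kappa> :: "'i \<Rightarrow> 'l \<Rightarrow> real"
  assumes L: "prob_space L" and S: "finite S" and \<kappa>: "\<And>a. a \<in> S \<Longrightarrow> \<kappa> a \<in> borel_measurable L"
    and char: "\<And>s. (\<integral>l. cis (\<Sum>a\<in>S. s a * \<kappa> a l) \<partial>L) = complex_of_real (exp (- (\<Sum>a\<in>S. \<Sum>b\<in>S. s a * s b * r a b) / 2))"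
    and sym: "\<And>a b. a \<in> S \<Longrightarrow> b \<in> S \<Longrightarrow> r a b = r b a" and diag: "\<And>a. a \<in> S \<Longrightarrow> r a a = 1"
    and psd: "\<And>x. 0 \<le> (\<Sum>a\<in>S. \<Sum>b\<in>S. x a * x b * r a b)"
    and T: "\<And>x. Im (trig_poly d c t x) = 0" "\<And>x. 0 \<le> Re (trig_poly d c t x)" "\<And>x. Re (trig_poly d c t x) \<le> B"
  shows "cavity_model L (count_space S) r (\<lambda>l a. gauss_weight lam (\<kappa> a l)) (\<lambda>l a. Re (trig_poly d c t (\<kappa> a l))) d c t B (exp (lam\<^sup>2))
     (\<integral>x. \<bar>Re (trig_poly d c t x) - gauss_weight lam x\<bar> \<partial>std_normal_distribution)"
proof -
  interpret prob_space L by fact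
  have Tm: "(\<lambda>x. Re (trig_poly d c t x)) \<in> borel_measurable borel"
    unfolding trig_poly_def cis_conv_exp by measurable
  have law: "distr L borel (\<kappa> a) = std_normal_distribution" if a: "a \<in> S" for a
  proof -
    have "distr L borel (\<kappa> a) = distr std_normal_distribution borel (\<lambda>x. 1 * x)"
    proof (rule distr_scaled_normalI[OF L \<kappa>[OF a]])
      fix u :: real
      have "(\<integral>l. cis (u * \<kappa> a l) \<partial>L) = (\<integral>l. cis (\<Sum>b\<in>S. (if b = a then u else 0) * \<kappa> b l) \<partial>L)"
        using S a by (simp add: if_distrib[of "\<lambda>y. y * _"] sum.delta cong: if_cong)
      also have "\<dots> = complex_of_real (exp (- (\<Sum>x\<in>S. \<Sum>b\<in>S. (if x = a then u else 0) * (if b = a then u else 0) * r x b) / 2))"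
        by (rule char)
      also have "(\<Sum>x\<in>S. \<Sum>b\<in>S. (if x = a then u else 0) * (if b = a then u else 0) * r x b) =
          (\<Sum>x\<in>S. if x = a then (\<Sum>b\<in>S. if b = a then u * u * r a a else 0) else 0)"
        by (intro sum.cong refl) (auto intro!: sum.cong)
      also have "\<dots> = (u * 1)\<^sup>2" using S a by (simp add: sum.delta diag power2_eq_square)
      finally show "(\<integral>l. cis (u * \<kappa> a l) \<partial>L) = complex_of_real (exp (- (u * 1)\<^sup>2 / 2))" .
    qed
    then show ?thesis by (simp add: distr_id2)
  qed
  have I: "integrable L (\<lambda>l. h (\<kappa> a l)) \<longleftrightarrow> integrable std_normal_distribution h"
    and J: "(\<integral>l. h (\<kappa> a l) \<partial>L) = (\<integral>x. h x \<partial>std_normal_distribution)"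
    if a: "a \<in> S" and h: "h \<in> borel_measurable borel" for a and h :: "real \<Rightarrow> real"
    using integrable_distr_eq[OF \<kappa>[OF a] h] integral_distr[OF \<kappa>[OF a] h] unfolding law[OF a] by simp_all
  have pair: "(\<lambda>(l, a). h (\<kappa> a l)) \<in> borel_measurable (L \<Otimes>\<^sub>M count_space S)"
    if h: "h \<in> borel_measurable borel" for h :: "real \<Rightarrow> real"
    using S measurable_compose[OF \<kappa> h] unfolding measurable_pair_swap_iff[of _ L]
    by (intro measurable_pair_measure_countable1 countable_finite) auto
  have inv: "1 / gauss_weight lam x = exp (lam\<^sup>2 / 2) * exp (- lam * x)" for x
  proof -
    have "1 / exp a = exp (- a)" for a :: real by (simp add: exp_minus inverse_eq_divide)
    then show ?thesis unfolding gauss_weight_def exp_add[symmetric] by (simp only:) simp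
  qed
  have invm: "(\<lambda>x. 1 / gauss_weight lam x) \<in> borel_measurable borel" by measurable
  show ?thesis
  proof
    show "(\<lambda>(l, a). gauss_weight lam (\<kappa> a l)) \<in> borel_measurable (L \<Otimes>\<^sub>M count_space S)"
      by (rule pair) measurable
    show "(\<lambda>(l, a). Re (trig_poly d c t (\<kappa> a l))) \<in> borel_measurable (L \<Otimes>\<^sub>M count_space S)"
      by (rule pair[OF Tm])
    show "(\<lambda>(a, b). r a b) \<in> borel_measurable (count_space S \<Otimes>\<^sub>M count_space S)"
      by (simp add: pair_measure_countable countable_finite[OF S])
    show "0 < gauss_weight lam (\<kappa> a l)" for a l by (simp add: gauss_weight_def)
    show "0 \<le> Re (trig_poly d c t (\<kappa> a l))" "Re (trig_poly d c t (\<kappa> a l)) \<le> B" for a l by (rule T)+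
    fix a assume "a \<in> space (count_space S)"
    then have a: "a \<in> S" by simp
    show "integrable L (\<lambda>l. gauss_weight lam (\<kappa> a l))"
      using integrable_gauss_weight by (simp add: I[OF a gauss_weight_measurable])
    have "(\<integral>l. gauss_weight lam (\<kappa> a l) \<partial>L) = 1"
      unfolding J[OF a gauss_weight_measurable] unfolding gauss_weight_alt
      by (simp only: integral_mult_right_zero integral_std_normal_exp) (simp flip: exp_add)
    then show "(\<integral>l. gauss_weight lam (\<kappa> a l) \<partial>L) \<le> exp (lam\<^sup>2)" by simp
    show "integrable L (\<lambda>l. 1 / gauss_weight lam (\<kappa> a l))"
      unfolding I[OF a invm] unfolding inv by (intro integrable_mult_right integrable_std_normal_exp)
    have "(\<integral>l. 1 / gauss_weight lam (\<kappa> a l) \<partial>L) = exp (lam\<^sup>2)"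
      unfolding J[OF a invm] unfolding inv
      by (simp only: integral_mult_right_zero integral_std_normal_exp) (simp flip: exp_add)
    then show "(\<integral>l. 1 / gauss_weight lam (\<kappa> a l) \<partial>L) \<le> exp (lam\<^sup>2)" by simp
    have "(\<lambda>x. \<bar>Re (trig_poly d c t x) - gauss_weight lam x\<bar>) \<in> borel_measurable borel" using Tm by measurable
    from J[OF a this] show "(\<integral>l. \<bar>Re (trig_poly d c t (\<kappa> a l)) - gauss_weight lam (\<kappa> a l)\<bar> \<partial>L)
       \<le> (\<integral>x. \<bar>Re (trig_poly d c t x) - gauss_weight lam x\<bar> \<partial>std_normal_distribution)" by simp
  next
    fix v :: "nat \<Rightarrow> 'i" assume "\<And>i. v i \<in> space (count_space S)"
    then have v: "v i \<in> S" for i by simp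
    have "replica_overlap r v = (\<lambda>i j. r (v i) (v j))"
      using v by (auto simp: replica_overlap_def diag fun_eq_iff)
    moreover have "0 \<le> (\<Sum>i<n. \<Sum>j<n. x i * x j * r (v i) (v j))" for n and x :: "nat \<Rightarrow> real"
      by (rule quadratic_form_reindex[OF S v psd])
    ultimately show "replica_overlap r v \<in> rost_matrices"
      using v sym diag by (simp add: rost_matrices_def)
  next
    fix k and v :: "nat \<Rightarrow> 'i" assume "\<And>i. i < k \<Longrightarrow> v i \<in> space (count_space S)"
    then have v: "i < k \<Longrightarrow> v i \<in> S" for i by simp
    \<comment> \<open>\<open>v i\<close> is known to lie in \<open>S\<close> only for
      \<open>i < k\<close>, whereas measurability is required for all indices; zero fills the
      rest.\<close>
    define \<kappa>' where "\<kappa>' i = (if i < k then \<kappa> (v i) else (\<lambda>_. 0))" for i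
    have "(\<integral>l. (\<Prod>i<k. Re (trig_poly d c t (\<kappa>' i l))) \<partial>L) = overlap_char d c t k (\<lambda>i j. r (v i) (v j))"
    proof (rule integral_prod_trig[where g = "\<lambda>_ _. 1" and \<kappa> = \<kappa>' and T = "\<lambda>i l. Re (trig_poly d c t (\<kappa>' i l))"
          and v = "\<lambda>s. \<Sum>i<k. \<Sum>j<k. s i * s j * r (v i) (v j)", OF L])
      show "\<kappa>' i \<in> borel_measurable L" for i unfolding \<kappa>'_def using v \<kappa> by simp
      fix s :: "nat \<Rightarrow> real"
      let ?s = "\<lambda>a. \<Sum>i<k. if v i = a then s i else 0"
      have "(\<Sum>i<k. s i * \<kappa>' i l) = (\<Sum>a\<in>S. ?s a * \<kappa> a l)" for l
        using weighted_sum_reindex[where f = v and n = k and x = s and g = "\<lambda>a. \<kappa> a l", OF S v] by (simp add: \<kappa>'_def)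
      then show "(\<integral>l. cis (\<Sum>i<k. s i * \<kappa>' i l) \<partial>L) =
          complex_of_real (exp (- (\<Sum>i<k. \<Sum>j<k. s i * s j * r (v i) (v j)) / 2))"
        using quadratic_form_reindex_eq[where f = v and n = k and x = s and q = r, OF S v] by (simp only: char)
      show "complex_of_real (Re (trig_poly d c t (\<kappa>' i l))) = (\<Sum>j<d. c j * complex_of_real 1 * cis (t j * \<kappa>' i l))" for i l
      proof -
        have "complex_of_real (Re (trig_poly d c t (\<kappa>' i l))) = trig_poly d c t (\<kappa>' i l)"
          using T(1)[of "\<kappa>' i l"] by (simp add: complex_eq_iff)
        then show ?thesis by (simp add: trig_poly_def)
      qed
    qed simp
    moreover have "overlap_char d c t k (\<lambda>i j. r (v i) (v j)) = overlap_char d c t k (replica_overlap r v)"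
      by (rule overlap_char_cong) (auto simp: replica_overlap_def diag v)
    ultimately show "(\<integral>l. (\<Prod>i<k. Re (trig_poly d c t (\<kappa> (v i) l))) \<partial>L) = overlap_char d c t k (replica_overlap r v)"
      by (simp add: \<kappa>'_def)
  qed
qed

section \<open>Finite Gibbs measures\<close>

definition gibbs_prob :: "'i set \<Rightarrow> ('i \<Rightarrow> real) \<Rightarrow> 'i \<Rightarrow> real" where
  "gibbs_prob S y a = exp (y a) / (\<Sum>b\<in>S. exp (y b))"

definition finite_gibbs :: "'i set \<Rightarrow> ('i \<Rightarrow> real) \<Rightarrow> 'i measure" where
  "finite_gibbs S y = point_measure S (\<lambda>a. ennreal (gibbs_prob S y a))"

context
  fixes S :: "'i set"
  assumes S: "finite S" "S \<noteq> {}"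
begin

lemma gibbs_sum_pos: "0 < (\<Sum>b\<in>S. exp (y b :: real))"
  using S by (intro sum_pos) auto

lemma gibbs_prob_pos: "0 < gibbs_prob S y a"
  using gibbs_sum_pos by (simp add: gibbs_prob_def)

lemma sum_gibbs_prob: "(\<Sum>a\<in>S. gibbs_prob S y a) = 1"
  using gibbs_sum_pos[of y] by (simp add: gibbs_prob_def sum_divide_distrib[symmetric])

lemma sets_finite_gibbs [measurable_cong]: "sets (finite_gibbs S y) = sets (count_space S)"
  by (simp add: finite_gibbs_def sets_point_measure)

lemma space_finite_gibbs: "space (finite_gibbs S y) = S"
  by (simp add: finite_gibbs_def space_point_measure)

lemma prob_space_finite_gibbs: "prob_space (finite_gibbs S y)"
proof
  have "emeasure (finite_gibbs S y) S = (\<Sum>a\<in>S. ennreal (gibbs_prob S y a))"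
    unfolding finite_gibbs_def using S by (intro emeasure_point_measure_finite) auto
  also have "\<dots> = ennreal (\<Sum>a\<in>S. gibbs_prob S y a)"
    using gibbs_prob_pos by (intro sum_ennreal) (auto intro: less_imp_le)
  finally show "emeasure (finite_gibbs S y) (space (finite_gibbs S y)) = 1"
    by (simp add: space_finite_gibbs sum_gibbs_prob)
qed

lemma finite_gibbs_in: "finite_gibbs S y \<in> space (prob_algebra (count_space S))"
  by (simp add: space_prob_algebra sets_finite_gibbs prob_space_finite_gibbs)

lemma integral_finite_gibbs: "(\<integral>a. f a \<partial>finite_gibbs S y) = (\<Sum>a\<in>S. gibbs_prob S y a * (f a :: real))"
  unfolding finite_gibbs_def using S gibbs_prob_pos
  by (subst lebesgue_integral_point_measure_finite) (auto intro: less_imp_le)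

lemma integrable_finite_gibbs: "integrable (finite_gibbs S y) (f :: 'i \<Rightarrow> real)"
  unfolding finite_gibbs_def using S by (rule_tac integrable_point_measure_finite) auto

text \<open>The constant \<open>C\<close> disappears in the normalization; it stands for the factor
  \<open>exp (- lam\<^sup>2 / 2)\<close> of \<open>gauss_weight\<close>.\<close>

lemma tilt_finite_gibbs:
  assumes C: "0 < C"
  shows "tilt (finite_gibbs S y) (\<lambda>a. C * exp (z a)) = finite_gibbs S (\<lambda>a. y a + z a)"
proof -
  let ?w = "\<lambda>a. C * exp (z a)"
  let ?Z = "\<integral>a. ?w a \<partial>finite_gibbs S y"
  have Z: "?Z = C * (\<Sum>b\<in>S. exp (y b + z b)) / (\<Sum>b\<in>S. exp (y b))"
    by (simp add: integral_finite_gibbs gibbs_prob_def sum_distrib_left sum_divide_distrib exp_add ac_simps)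
  have Zpos: "0 < ?Z" unfolding Z using C gibbs_sum_pos[of y] gibbs_sum_pos[of "\<lambda>b. y b + z b"] by simp
  have t: "tilt (finite_gibbs S y) ?w = density (finite_gibbs S y) (\<lambda>a. ennreal (?w a / ?Z))"
    using C Zpos by (intro tilt_eq_density integrable_finite_gibbs) auto
  show ?thesis unfolding t
  proof (rule measure_eqI_finite)
    show "sets (density (finite_gibbs S y) (\<lambda>a. ennreal (?w a / ?Z))) = Pow S" by (simp add: sets_finite_gibbs)
    show "sets (finite_gibbs S (\<lambda>a. y a + z a)) = Pow S" by (simp add: sets_finite_gibbs)
    fix a assume a: "a \<in> S"
    have "emeasure (density (finite_gibbs S y) (\<lambda>a. ennreal (?w a / ?Z))) {a} =
        (\<integral>\<^sup>+ b. ennreal (?w b / ?Z) * indicator {a} b \<partial>finite_gibbs S y)"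
    proof (rule emeasure_density)
      have "(\<lambda>a. ?w a / ?Z) \<in> borel_measurable (finite_gibbs S y)"
        by (rule borel_measurable_integrable[OF integrable_finite_gibbs])
      then show "(\<lambda>a. ennreal (?w a / ?Z)) \<in> borel_measurable (finite_gibbs S y)"
        by (rule measurable_compose[OF _ measurable_ennreal])
    qed (use a in \<open>simp add: sets_finite_gibbs\<close>)
    also have "\<dots> = ennreal (?w a / ?Z) * emeasure (finite_gibbs S y) {a}"
    proof -
      have "(\<integral>\<^sup>+ b. ennreal (?w b / ?Z) * indicator {a} b \<partial>finite_gibbs S y) =
          (\<integral>\<^sup>+ b. ennreal (?w a / ?Z) * indicator {a} b \<partial>finite_gibbs S y)"
        by (intro nn_integral_cong) (auto simp: indicator_def)
      also have "\<dots> = ennreal (?w a / ?Z) * emeasure (finite_gibbs S y) {a}"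
        using a by (intro nn_integral_cmult_indicator) (simp add: sets_finite_gibbs)
      finally show ?thesis .
    qed
    also have "emeasure (finite_gibbs S y) {a} = ennreal (gibbs_prob S y a)"
      unfolding finite_gibbs_def using S a by (subst emeasure_point_measure_finite) auto
    also have "ennreal (?w a / ?Z) * ennreal (gibbs_prob S y a) = ennreal (?w a / ?Z * gibbs_prob S y a)"
      using gibbs_prob_pos[of y a] by (intro ennreal_mult''[symmetric]) simp
    also have "?w a / ?Z * gibbs_prob S y a = gibbs_prob S (\<lambda>a. y a + z a) a"
      unfolding Z gibbs_prob_def using C gibbs_sum_pos[of y] gibbs_sum_pos[of "\<lambda>b. y b + z b"]
      by (simp add: exp_add field_simps)
    also have "ennreal \<dots> = emeasure (finite_gibbs S (\<lambda>a. y a + z a)) {a}"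
      unfolding finite_gibbs_def using S a by (subst emeasure_point_measure_finite) auto
    finally show "emeasure (density (finite_gibbs S y) (\<lambda>a. ennreal (?w a / ?Z))) {a} =
      emeasure (finite_gibbs S (\<lambda>a. y a + z a)) {a}" .
  qed (use S in auto)
qed

lemma measurable_finite_gibbs:
  assumes Y: "\<And>a. a \<in> S \<Longrightarrow> (\<lambda>\<omega>. Y \<omega> a) \<in> borel_measurable M"
  shows "(\<lambda>\<omega>. finite_gibbs S (Y \<omega>)) \<in> M \<rightarrow>\<^sub>M prob_algebra (count_space S)"
proof (rule measurable_prob_algebra_generated[OF sets.sigma_sets_eq[symmetric] sets.Int_stable sets.space_closed])
  show "prob_space (finite_gibbs S (Y \<omega>))" "sets (finite_gibbs S (Y \<omega>)) = sets (count_space S)" for \<omega>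
    by (rule prob_space_finite_gibbs sets_finite_gibbs)+
  fix A assume "A \<in> sets (count_space S)"
  then have A: "A \<subseteq> S" by simp
  have "emeasure (finite_gibbs S (Y \<omega>)) A = (\<Sum>a\<in>A. ennreal (gibbs_prob S (Y \<omega>) a))" for \<omega>
    unfolding finite_gibbs_def using S A by (intro emeasure_point_measure_finite) auto
  moreover have "(\<lambda>\<omega>. \<Sum>a\<in>A. ennreal (gibbs_prob S (Y \<omega>) a)) \<in> borel_measurable M"
    unfolding gibbs_prob_def using Y A
    by (intro borel_measurable_sum measurable_compose[OF _ measurable_ennreal] borel_measurable_divide
        borel_measurable_exp[THEN measurable_compose[rotated]]) (auto intro!: borel_measurable_sum borel_measurable_exp[THEN measurable_compose[rotated]])
  ultimately show "(\<lambda>\<omega>. emeasure (finite_gibbs S (Y \<omega>)) A) \<in> borel_measurable M" by simp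
qed

text \<open>Pinsker's inequality, for the symmetrized relative entropy.\<close>

lemma gibbs_prob_l1_le:
  "(\<Sum>a\<in>S. \<bar>gibbs_prob S y a - gibbs_prob S z a\<bar>)\<^sup>2 \<le>
     (\<Sum>a\<in>S. (gibbs_prob S y a - gibbs_prob S z a) * (y a - z a))"
proof -
  let ?p = "gibbs_prob S y" and ?q = "gibbs_prob S z"
  \<comment> \<open>The difference of the logarithmic normalizations; it drops out at the end since
    both probabilities sum to 1.\<close>
  define K where "K = ln (\<Sum>b\<in>S. exp (y b)) - ln (\<Sum>b\<in>S. exp (z b))"
  have lnp: "ln (gibbs_prob S x a) = x a - ln (\<Sum>b\<in>S. exp (x b))" for x a
    unfolding gibbs_prob_def using gibbs_sum_pos[of x] by (simp add: ln_div)
  have log_ratio: "y a - z a = ln (?p a) - ln (?q a) + K" for a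
    by (simp add: lnp K_def)
  have pq: "0 < ?p a" "0 < ?q a" for a by (rule gibbs_prob_pos)+
  have elem: "2 * (p - q)\<^sup>2 / (p + q) \<le> (p - q) * (ln p - ln q)" if "0 < p" "0 < q" for p q :: real
  proof -
    have half: "2 * (p - q)\<^sup>2 / (p + q) \<le> (p - q) * (ln p - ln q)" if "0 < q" "q \<le> p" for p q :: real
    proof -
      \<comment> \<open>The classical lower bound of the logarithm; taken at
        \<open>x = p / q\<close> and multiplied by \<open>p - q\<close> it is the termwise
        inequality.\<close>
      have "2 * (x - 1) / (x + 1) \<le> ln x" if x: "1 \<le> x" for x :: real
      proof -
        define f where "f x = ln x - 2 * (x - 1) / (x + 1)" for x :: real
        have "f 1 \<le> f x"
        proof (rule DERIV_nonneg_imp_nondecreasing[OF x])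
          fix u assume u: "1 \<le> u" "u \<le> x"
          have "(f has_real_derivative 1 / u - (2 * (u + 1) - 2 * (u - 1)) / (u + 1)\<^sup>2) (at u)"
            unfolding f_def using u by (auto intro!: derivative_eq_intros simp: power2_eq_square)
          moreover have "1 / u - (2 * (u + 1) - 2 * (u - 1)) / (u + 1)\<^sup>2 = (u - 1)\<^sup>2 / (u * (u + 1)\<^sup>2)"
          proof -
            have "1 / u - (2 * (u + 1) - 2 * (u - 1)) / (u + 1)\<^sup>2 = (1 * (u + 1)\<^sup>2 - (2 * (u + 1) - 2 * (u - 1)) * u) / (u * (u + 1)\<^sup>2)"
              using u by (subst diff_frac_eq) auto
            also have "1 * (u + 1)\<^sup>2 - (2 * (u + 1) - 2 * (u - 1)) * u = (u - 1)\<^sup>2"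
              by (simp add: power2_eq_square algebra_simps)
            finally show ?thesis .
          qed
          moreover have "0 \<le> (u - 1)\<^sup>2 / (u * (u + 1)\<^sup>2)" using u by simp
          ultimately show "\<exists>y. (f has_real_derivative y) (at u) \<and> 0 \<le> y" by metis
        qed
        then show ?thesis by (simp add: f_def)
      qed
      from this[of "p / q"] have "2 * (p / q - 1) / (p / q + 1) \<le> ln p - ln q"
        using that by (simp add: ln_div)
      moreover have "2 * (p / q - 1) / (p / q + 1) = 2 * (p - q) / (p + q)"
      proof -
        have "p / q - 1 = (p - q) / q" "p / q + 1 = (p + q) / q"
          using that by (simp_all add: diff_divide_distrib add_divide_distrib)
        then show ?thesis using that by (simp only:) simp
      qed
      ultimately have "(p - q) * (2 * (p - q) / (p + q)) \<le> (p - q) * (ln p - ln q)"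
        using that by (intro mult_left_mono) auto
      then show ?thesis by (simp add: power2_eq_square ac_simps)
    qed
    show ?thesis
    proof (cases "q \<le> p")
      case True
      then show ?thesis using half[OF \<open>0 < q\<close>] by simp
    next
      case False
      then have "2 * (q - p)\<^sup>2 / (q + p) \<le> (q - p) * (ln q - ln p)" using half[OF \<open>0 < p\<close>] by simp
      then show ?thesis by (simp add: power2_commute[of q p] add.commute[of q p] algebra_simps)
    qed
  qed
  \<comment> \<open>Cauchy-Schwarz with the weights \<open>?p a + ?q a\<close>, of total mass
    2.\<close>
  have cs: "(\<Sum>a\<in>S. \<bar>?p a - ?q a\<bar>)\<^sup>2 \<le> 2 * (\<Sum>a\<in>S. (?p a - ?q a)\<^sup>2 / (?p a + ?q a))"
  proof -
    have "(\<Sum>a\<in>S. \<bar>?p a - ?q a\<bar>)\<^sup>2 = (\<Sum>a\<in>S. (\<bar>?p a - ?q a\<bar> / sqrt (?p a + ?q a)) * sqrt (?p a + ?q a))\<^sup>2"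
    proof (rule arg_cong[where f = "\<lambda>x. x\<^sup>2"], intro sum.cong refl)
      fix a
      have "sqrt (?p a + ?q a) \<noteq> 0" using pq[of a] by simp
      then show "\<bar>?p a - ?q a\<bar> = \<bar>?p a - ?q a\<bar> / sqrt (?p a + ?q a) * sqrt (?p a + ?q a)" by simp
    qed
    also have "\<dots> \<le> (\<Sum>a\<in>S. (\<bar>?p a - ?q a\<bar> / sqrt (?p a + ?q a))\<^sup>2) * (\<Sum>a\<in>S. (sqrt (?p a + ?q a))\<^sup>2)"
      by (rule Cauchy_Schwarz_ineq_sum)
    also have "(\<Sum>a\<in>S. (sqrt (?p a + ?q a))\<^sup>2) = 2"
    proof -
      have "(sqrt (?p a + ?q a))\<^sup>2 = ?p a + ?q a" for a using pq[of a] by simp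
      then show ?thesis by (simp add: sum.distrib sum_gibbs_prob)
    qed
    also have "(\<Sum>a\<in>S. (\<bar>?p a - ?q a\<bar> / sqrt (?p a + ?q a))\<^sup>2) = (\<Sum>a\<in>S. (?p a - ?q a)\<^sup>2 / (?p a + ?q a))"
    proof (intro sum.cong refl)
      fix a show "(\<bar>?p a - ?q a\<bar> / sqrt (?p a + ?q a))\<^sup>2 = (?p a - ?q a)\<^sup>2 / (?p a + ?q a)"
        using pq[of a] by (simp add: power_divide)
    qed
    finally show ?thesis by simp
  qed
  also have "2 * (\<Sum>a\<in>S. (?p a - ?q a)\<^sup>2 / (?p a + ?q a)) \<le> (\<Sum>a\<in>S. (?p a - ?q a) * (ln (?p a) - ln (?q a)))"
    unfolding sum_distrib_left
  proof (rule sum_mono)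
    fix a show "2 * ((?p a - ?q a)\<^sup>2 / (?p a + ?q a)) \<le> (?p a - ?q a) * (ln (?p a) - ln (?q a))"
      using elem[OF pq[of a]] by simp
  qed
  also have "\<dots> = (\<Sum>a\<in>S. (?p a - ?q a) * (y a - z a)) - (\<Sum>a\<in>S. (?p a - ?q a) * K)"
    unfolding sum_subtractf[symmetric] by (intro sum.cong refl) (simp add: log_ratio algebra_simps)
  also have "(\<Sum>a\<in>S. (?p a - ?q a) * K) = 0"
    by (simp add: sum_distrib_right[symmetric] sum_subtractf sum_gibbs_prob)
  finally show ?thesis by simp
qed

text \<open>The logarithm of the partition function lies above its tangent at \<open>b\<close>,
  whose slope is the Gibbs mean of \<open>h\<close>. Centering at that mean reduces this to
  \<open>1 + x \<le> exp x\<close>; \<open>t\<close> may have either sign.\<close>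

lemma ln_partition_convex:
  "ln (\<Sum>a\<in>S. exp (b * h a)) + t * (\<Sum>a\<in>S. gibbs_prob S (\<lambda>a. b * h a) a * h a) \<le> ln (\<Sum>a\<in>S. exp ((b + t) * h a))"
proof -
  let ?p = "gibbs_prob S (\<lambda>a. b * h a)" and ?Z = "\<Sum>a\<in>S. exp (b * h a)"
  define m where "m = (\<Sum>a\<in>S. ?p a * h a)"
  have Z: "0 < ?Z" by (rule gibbs_sum_pos)
  have "exp (t * m) = exp (t * m) * (\<Sum>a\<in>S. ?p a * (1 + t * (h a - m)))"
  proof -
    have "(\<Sum>a\<in>S. ?p a * (1 + t * (h a - m))) = (\<Sum>a\<in>S. ?p a) + t * (\<Sum>a\<in>S. ?p a * h a) - t * m * (\<Sum>a\<in>S. ?p a)"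
      by (simp add: sum_distrib_left algebra_simps sum.distrib sum_subtractf)
    then show ?thesis by (simp add: sum_gibbs_prob flip: m_def)
  qed
  also have "\<dots> \<le> exp (t * m) * (\<Sum>a\<in>S. ?p a * exp (t * (h a - m)))"
    using gibbs_prob_pos by (intro mult_left_mono sum_mono exp_ge_add_one_self) (auto intro: less_imp_le)
  also have "\<dots> = (\<Sum>a\<in>S. exp ((b + t) * h a)) / ?Z"
    by (simp add: gibbs_prob_def sum_distrib_left sum_divide_distrib exp_add[symmetric] algebra_simps)
  finally have "?Z * exp (t * m) \<le> (\<Sum>a\<in>S. exp ((b + t) * h a))"
    using Z by (simp add: field_simps)
  then have "ln (?Z * exp (t * m)) \<le> ln (\<Sum>a\<in>S. exp ((b + t) * h a))"
    using Z by (subst ln_le_cancel_iff) (auto intro: gibbs_sum_pos)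
  then show ?thesis using Z by (simp add: ln_mult m_def)
qed

text \<open>Both Gibbs measures are tilts of the uniform measure on \<open>S\<close>, so the
  exchange of factors one by one applies to their densities, whose L1 distance is that of the
  probabilities.\<close>

lemma integral_finite_gibbs_replicas_le:
  fixes F :: "(nat \<Rightarrow> 'i) \<Rightarrow> real"
  assumes F: "F \<in> borel_measurable (\<Pi>\<^sub>M i\<in>{..<n}. count_space S)" "\<And>x. \<bar>F x\<bar> \<le> 1"
    and dep: "\<And>x x'. (\<And>i. i < n \<Longrightarrow> x i = x' i) \<Longrightarrow> F x = F x'"
  shows "\<bar>(\<integral>x. F x \<partial>(\<Pi>\<^sub>M i\<in>UNIV. finite_gibbs S y)) - (\<integral>x. F x \<partial>(\<Pi>\<^sub>M i\<in>UNIV. finite_gibbs S z))\<bar>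
     \<le> n * (\<Sum>a\<in>S. \<bar>gibbs_prob S y a - gibbs_prob S z a\<bar>)"
proof -
  define u where "u = finite_gibbs S (\<lambda>_. 0)"
  have pu: "prob_space u" unfolding u_def by (rule prob_space_finite_gibbs)
  let ?P = "\<Pi>\<^sub>M i\<in>{..<n}. u"
  interpret P: prob_space ?P using pu by (intro prob_space_PiM)
  define g where "g x a = exp (x a) / (\<integral>a. exp (x a) \<partial>u)" for x :: "'i \<Rightarrow> real" and a
  have Fu: "F \<in> borel_measurable ?P"
    using F(1) by (simp add: u_def cong: measurable_cong_sets sets_PiM_cong sets_finite_gibbs)
  have ip: "0 < (\<integral>a. exp (x a) \<partial>u)" for x :: "'i \<Rightarrow> real"
    unfolding u_def by (intro integral_weight_pos prob_space_finite_gibbs integrable_finite_gibbs) simp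
  have gi: "integrable u (g x)" for x unfolding u_def by (rule integrable_finite_gibbs)
  have g0: "0 \<le> g x a" for x a unfolding g_def using ip[of x] by simp
  have g1: "(\<integral>a. g x a \<partial>u) = 1" for x unfolding g_def using ip[of x] by simp
  have rep: "(\<integral>v. F v \<partial>(\<Pi>\<^sub>M i\<in>UNIV. finite_gibbs S x)) = (\<integral>v. F v * (\<Prod>i<n. g x (v i)) \<partial>?P)" for x
  proof -
    have t: "tilt u (\<lambda>a. exp (x a)) = finite_gibbs S x"
      unfolding u_def using tilt_finite_gibbs[of 1 "\<lambda>_. 0" x] by simp
    have "(\<integral>v. F v \<partial>(\<Pi>\<^sub>M i\<in>UNIV. finite_gibbs S x)) = (\<integral>v. F v \<partial>(\<Pi>\<^sub>M i\<in>{..<n}. finite_gibbs S x))"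
      using F(1) by (intro integral_PiM_UNIV_restrict prob_space_finite_gibbs dep)
        (simp_all cong: measurable_cong_sets sets_PiM_cong sets_finite_gibbs)
    also have "\<dots> = (\<integral>v. F v * (\<Prod>i<n. g x (v i)) \<partial>?P)"
      unfolding t[symmetric] g_def
      by (rule integral_PiM_tilt[OF pu _ _ Fu]) (auto simp: u_def intro: integrable_finite_gibbs)
    finally show ?thesis .
  qed
  have Fg: "integrable ?P (\<lambda>v. F v * (\<Prod>i<n. g x (v i)))" for x
  proof (rule Bochner_Integration.integrable_bound[OF integrable_PiM_prod[OF pu gi, of n x]])
    show "(\<lambda>v. F v * (\<Prod>i<n. g x (v i))) \<in> borel_measurable ?P"
      using Fu borel_measurable_integrable[OF integrable_PiM_prod[OF pu gi, of n x]] by simp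
  qed (use F(2) in \<open>auto simp: abs_mult intro!: mult_left_le_one_le\<close>)
  have "\<bar>(\<integral>v. F v * (\<Prod>i<n. g y (v i)) \<partial>?P) - (\<integral>v. F v * (\<Prod>i<n. g z (v i)) \<partial>?P)\<bar> =
      \<bar>\<integral>v. F v * (\<Prod>i<n. g y (v i)) - F v * (\<Prod>i<n. g z (v i)) \<partial>?P\<bar>"
    using Fg[of y] Fg[of z] by simp
  also have "\<dots> \<le> (\<integral>v. \<bar>F v * (\<Prod>i<n. g y (v i)) - F v * (\<Prod>i<n. g z (v i))\<bar> \<partial>?P)"
    by (rule integral_abs_bound)
  also have "\<dots> \<le> (\<integral>v. \<bar>(\<Prod>i<n. g y (v i)) - (\<Prod>i<n. g z (v i))\<bar> \<partial>?P)"
  proof (rule integral_mono')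
    show "\<bar>F v * (\<Prod>i<n. g y (v i)) - F v * (\<Prod>i<n. g z (v i))\<bar> \<le> \<bar>(\<Prod>i<n. g y (v i)) - (\<Prod>i<n. g z (v i))\<bar>" for v
      using F(2)[of v] by (simp only: right_diff_distrib[symmetric] abs_mult) (simp add: mult_left_le_one_le)
  qed (auto intro!: integrable_PiM_prod pu gi)
  also have "\<dots> \<le> n * (\<integral>a. \<bar>g y a - g z a\<bar> \<partial>u)"
    by (rule integral_PiM_prod_diff_le[OF pu gi gi g0 g0 g1 g1])
  also have "(\<integral>a. \<bar>g y a - g z a\<bar> \<partial>u) = (\<Sum>a\<in>S. \<bar>gibbs_prob S y a - gibbs_prob S z a\<bar>)"
  proof -
    have c: "0 < real (card S)" using S by (simp add: card_gt_0_iff)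
    have gp: "g x a = card S * gibbs_prob S x a" for x a
      using c by (simp add: g_def u_def integral_finite_gibbs gibbs_prob_def sum_divide_distrib[symmetric])
    have "\<bar>g y a - g z a\<bar> = card S * \<bar>gibbs_prob S y a - gibbs_prob S z a\<bar>" for a
      unfolding gp right_diff_distrib[symmetric] abs_mult by simp
    then show ?thesis using c by (simp add: u_def integral_finite_gibbs gibbs_prob_def[of S "\<lambda>_. 0"] flip: sum_divide_distrib)
  qed
  finally show ?thesis unfolding rep .
qed

end

lemma (in cavity_model) tilted_integral_approx_kernel:
  fixes M' :: "'m measure"
  assumes M': "prob_space M'" and \<mu>: "\<mu> \<in> M' \<rightarrow>\<^sub>M prob_algebra X" and F: "block_test n F" and \<delta>: "0 < \<delta>"
    and p: "\<And>z. 0 \<le> z \<Longrightarrow> z \<le> B \<Longrightarrow> \<bar>(\<Sum>k\<le>D. p k * z ^ k) - 1 / max z \<delta> ^ n\<bar> \<le> \<eta>"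
  shows "\<bar>(\<integral>\<omega>. \<integral>l. \<integral>v. F (replica_overlap Q v) \<partial>(\<Pi>\<^sub>M i\<in>UNIV. tilt (\<mu> \<omega>) (w l)) \<partial>L \<partial>M') -
      (\<integral>\<omega>. \<integral>v. cavity_test F n D p d c t (replica_overlap Q v) \<partial>(\<Pi>\<^sub>M i\<in>UNIV. \<mu> \<omega>) \<partial>M')\<bar>
    \<le> (2 * real n + 2) / \<delta> * E + 4 * \<delta> * C + B ^ n * \<eta>"
proof -
  interpret M': prob_space M' by fact
  define D' where "D' = distr M' (prob_algebra X) \<mu>"
  have D': "D' \<in> space (prob_algebra (prob_algebra X))"
    unfolding D'_def space_prob_algebra using M'.prob_space_distr[OF \<mu>] by simp
  let ?R = "\<lambda>m. \<integral>l. \<integral>v. F (replica_overlap Q v) \<partial>(\<Pi>\<^sub>M i\<in>UNIV. tilt m (w l)) \<partial>L"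
  let ?S = "\<lambda>m. \<integral>v. cavity_test F n D p d c t (replica_overlap Q v) \<partial>(\<Pi>\<^sub>M i\<in>UNIV. m)"
  have Rm: "?R \<in> borel_measurable (prob_algebra X)"
    using measurable_tilted_integral[OF F \<delta> p]
    by (intro borel_measurable_lebesgue_integral) (simp add: split_beta')
  have Sm: "?S \<in> borel_measurable (prob_algebra X)"
    by (intro measurable_compose[OF measurable_PiM_kernel[THEN measurable_prob_algebraD] integral_measurable_subprob_algebra]
        measurable_compose[OF measurable_replica_overlap cavity_test_measurable[OF F]])
  have "(\<integral>\<omega>. ?R (\<mu> \<omega>) \<partial>M') = (\<integral>m. ?R m \<partial>D')" "(\<integral>\<omega>. ?S (\<mu> \<omega>) \<partial>M') = (\<integral>m. ?S m \<partial>D')"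
    unfolding D'_def by (rule integral_distr[OF \<mu> Rm, symmetric], rule integral_distr[OF \<mu> Sm, symmetric])
  then show ?thesis using tilted_integral_approx[OF F \<delta> p D'] by simp
qed

section \<open>Spin glasses\<close>

locale spin_glass_volume = prob_space M for M :: "'w measure" +
  fixes S :: "'i set" and r :: "'i \<Rightarrow> 'i \<Rightarrow> real" and H :: "'i \<Rightarrow> 'w \<Rightarrow> real" and N :: nat
  assumes S: "finite S" "S \<noteq> {}" and N: "1 \<le> N"
    and sym: "\<And>a b. a \<in> S \<Longrightarrow> b \<in> S \<Longrightarrow> r a b = r b a" and diag: "\<And>a. a \<in> S \<Longrightarrow> r a a = 1"
    and psd: "\<And>x. 0 \<le> (\<Sum>a\<in>S. \<Sum>b\<in>S. x a * x b * r a b)"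
    and gaussian: "centered_gaussian_vector M S H"
    and cov: "\<And>a b. a \<in> S \<Longrightarrow> b \<in> S \<Longrightarrow> (\<integral>\<omega>. H a \<omega> * H b \<omega> \<partial>M) = real N * r a b"
begin

lemma H_measurable: "a \<in> S \<Longrightarrow> H a \<in> borel_measurable M"
  using gaussian by (simp add: centered_gaussian_vector_def)

lemma H_char: "(\<integral>\<omega>. cis (\<Sum>a\<in>S. s a * H a \<omega>) \<partial>M) = complex_of_real (exp (- (real N * (\<Sum>a\<in>S. \<Sum>b\<in>S. s a * s b * r a b)) / 2))"
proof -
  have "(\<Sum>a\<in>S. \<Sum>b\<in>S. s a * s b * (real N * r a b)) = real N * (\<Sum>a\<in>S. \<Sum>b\<in>S. s a * s b * r a b)"
    by (simp add: sum_distrib_left ac_simps)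
  then show ?thesis using gaussian_vector_char[OF prob_space_axioms S(1) gaussian cov, of s] by simp
qed

lemma quadratic_scale: "(\<Sum>a\<in>S. \<Sum>b\<in>S. (k * s a) * (k * s b) * r a b) = k\<^sup>2 * (\<Sum>a\<in>S. \<Sum>b\<in>S. s a * s b * r a b)"
  by (simp add: sum_distrib_left power2_eq_square ac_simps)

context
  fixes d c t B
  assumes T: "\<And>x. Im (trig_poly d c t x) = 0" "\<And>x. 0 \<le> Re (trig_poly d c t x)" "\<And>x. Re (trig_poly d c t x) \<le> B"
begin

abbreviation "trig_error lam \<equiv> \<integral>x. \<bar>Re (trig_poly d c t x) - gauss_weight lam x\<bar> \<partial>std_normal_distribution"

lemma cavity_model_single:
  "cavity_model M (count_space S) r (\<lambda>\<omega> a. gauss_weight lam (H a \<omega> / sqrt N))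
     (\<lambda>\<omega> a. Re (trig_poly d c t (H a \<omega> / sqrt N))) d c t B (exp (lam\<^sup>2)) (trig_error lam)"
proof (rule cavity_model_finite[OF prob_space_axioms S(1) _ _ sym diag psd T, where \<kappa> = "\<lambda>a \<omega>. H a \<omega> / sqrt N"])
  show "(\<lambda>\<omega>. H a \<omega> / sqrt N) \<in> borel_measurable M" if "a \<in> S" for a
    using H_measurable[OF that] by measurable
  fix s
  have "(\<Sum>a\<in>S. s a * (H a \<omega> / sqrt N)) = (\<Sum>a\<in>S. (1 / sqrt N * s a) * H a \<omega>)" for \<omega>
    by (intro sum.cong refl) simp
  then have "(\<integral>\<omega>. cis (\<Sum>a\<in>S. s a * (H a \<omega> / sqrt N)) \<partial>M) =
      complex_of_real (exp (- (real N * ((1 / sqrt N)\<^sup>2 * (\<Sum>a\<in>S. \<Sum>b\<in>S. s a * s b * r a b))) / 2))"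
    by (simp only: H_char quadratic_scale)
  then show "(\<integral>\<omega>. cis (\<Sum>a\<in>S. s a * (H a \<omega> / sqrt N)) \<partial>M) =
      complex_of_real (exp (- (\<Sum>a\<in>S. \<Sum>b\<in>S. s a * s b * r a b) / 2))"
    using N by (simp add: power_divide)
qed

text \<open>The combined field has covariance \<open>\<beta>\<^sup>2 * N + lam\<^sup>2\<close> times
  \<open>r\<close>, so dividing by \<Lambda> normalizes it. Its data \<open>d\<close>,
  \<open>c\<close>, \<open>t\<close>, \<open>B\<close> and its error at parameter \<Lambda> are
  those of the single field, which is what makes the two comparable.\<close>

lemma cavity_model_double:
  fixes \<beta> lam \<Lambda> :: real
  assumes \<Lambda>: "0 < \<Lambda>" "\<Lambda>\<^sup>2 = \<beta>\<^sup>2 * N + lam\<^sup>2"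
  shows "cavity_model (M \<Otimes>\<^sub>M M) (count_space S) r
     (\<lambda>z a. gauss_weight \<Lambda> ((\<beta> * H a (fst z) + lam * (H a (snd z) / sqrt N)) / \<Lambda>))
     (\<lambda>z a. Re (trig_poly d c t ((\<beta> * H a (fst z) + lam * (H a (snd z) / sqrt N)) / \<Lambda>))) d c t B (exp (\<Lambda>\<^sup>2)) (trig_error \<Lambda>)"
proof -
  interpret MM: pair_prob_space M M ..
  let ?\<kappa> = "\<lambda>a z. (\<beta> * H a (fst z) + lam * (H a (snd z) / sqrt N)) / \<Lambda>"
  show ?thesis
  proof (rule cavity_model_finite[OF MM.prob_space_axioms S(1) _ _ sym diag psd T, where \<kappa> = ?\<kappa>])
    show m: "?\<kappa> a \<in> borel_measurable (M \<Otimes>\<^sub>M M)" if "a \<in> S" for a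
      using measurable_compose[OF measurable_fst H_measurable[OF that], of M]
        measurable_compose[OF measurable_snd H_measurable[OF that], of M] by measurable
    fix s
    let ?Q = "\<Sum>a\<in>S. \<Sum>b\<in>S. s a * s b * r a b"
    let ?x = "\<lambda>\<omega>. \<Sum>a\<in>S. (\<beta> / \<Lambda> * s a) * H a \<omega>" and ?y = "\<lambda>\<omega>. \<Sum>a\<in>S. (lam / (sqrt N * \<Lambda>) * s a) * H a \<omega>"
    have split: "cis (\<Sum>a\<in>S. s a * ?\<kappa> a z) = cis (?x (fst z)) * cis (?y (snd z))" for z
    proof -
      have "(\<Sum>a\<in>S. s a * ?\<kappa> a z) = ?x (fst z) + ?y (snd z)"
        unfolding sum.distrib[symmetric] by (intro sum.cong refl) (simp add: add_divide_distrib distrib_left ac_simps)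
      then show ?thesis by (simp add: cis_mult)
    qed
    have sm: "(\<lambda>z. \<Sum>a\<in>S. s a * ?\<kappa> a z) \<in> borel_measurable (M \<Otimes>\<^sub>M M)"
      using m by (intro borel_measurable_sum borel_measurable_times) auto
    have int: "integrable (M \<Otimes>\<^sub>M M) (\<lambda>z. cis (\<Sum>a\<in>S. s a * ?\<kappa> a z))"
    proof (rule MM.integrable_const_bound[of _ 1])
      have "cis \<in> borel_measurable borel" unfolding cis_conv_exp by measurable
      from measurable_compose[OF sm this] show "(\<lambda>z. cis (\<Sum>a\<in>S. s a * ?\<kappa> a z)) \<in> borel_measurable (M \<Otimes>\<^sub>M M)" .
    qed auto
    have "(\<integral>z. cis (\<Sum>a\<in>S. s a * ?\<kappa> a z) \<partial>(M \<Otimes>\<^sub>M M)) = (\<integral>\<omega>. \<integral>\<omega>'. cis (?x \<omega>) * cis (?y \<omega>') \<partial>M \<partial>M)"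
      using MM.integral_fst'[OF int[unfolded split]] by (simp only: split fst_conv snd_conv)
    also have "\<dots> = complex_of_real (exp (- (real N * ((\<beta> / \<Lambda>)\<^sup>2 * ?Q)) / 2)) *
        complex_of_real (exp (- (real N * ((lam / (sqrt N * \<Lambda>))\<^sup>2 * ?Q)) / 2))"
      by (simp only: integral_mult_right_zero integral_mult_left_zero H_char quadratic_scale)
    also have "\<dots> = complex_of_real (exp (- ((real N * (\<beta> / \<Lambda>)\<^sup>2 + real N * (lam / (sqrt N * \<Lambda>))\<^sup>2) * ?Q) / 2))"
      unfolding of_real_mult[symmetric] exp_add[symmetric] by (simp add: algebra_simps add_divide_distrib)
    also have "real N * (\<beta> / \<Lambda>)\<^sup>2 + real N * (lam / (sqrt N * \<Lambda>))\<^sup>2 = (\<beta>\<^sup>2 * N + lam\<^sup>2) / \<Lambda>\<^sup>2"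
      using N by (simp add: power_divide power_mult_distrib add_divide_distrib)
    also have "\<dots> = 1" using \<Lambda> by (simp only: \<Lambda>(2)[symmetric]) simp
    finally show "(\<integral>z. cis (\<Sum>a\<in>S. s a * ?\<kappa> a z) \<partial>(M \<Otimes>\<^sub>M M)) = complex_of_real (exp (- ?Q / 2))" by simp
  qed
qed

end

definition gibbs_overlap :: "((nat \<Rightarrow> nat \<Rightarrow> real) \<Rightarrow> real) \<Rightarrow> ('i \<Rightarrow> real) \<Rightarrow> real" where
  "gibbs_overlap F y = (\<integral>v. F (replica_overlap r v) \<partial>(\<Pi>\<^sub>M i\<in>UNIV. finite_gibbs S y))"

lemma trivial_trig: "Im (trig_poly 1 (\<lambda>_. 1) (\<lambda>_. 0) x) = 0" "0 \<le> Re (trig_poly 1 (\<lambda>_. 1) (\<lambda>_. 0) x)" "Re (trig_poly 1 (\<lambda>_. 1) (\<lambda>_. 0) x) \<le> 1"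
  by (auto simp: trig_poly_def)

lemma overlap_measurable: "replica_overlap r \<in> (\<Pi>\<^sub>M i\<in>UNIV. count_space S) \<rightarrow>\<^sub>M rost_algebra"
proof -
  interpret cavity_model M "count_space S" r "\<lambda>\<omega> a. gauss_weight 0 (H a \<omega> / sqrt N)"
    "\<lambda>\<omega> a. Re (trig_poly 1 (\<lambda>_. 1) (\<lambda>_. 0) (H a \<omega> / sqrt N))" 1 "\<lambda>_. 1" "\<lambda>_. 0" 1 "exp (0\<^sup>2)"
    "\<integral>x. \<bar>Re (trig_poly 1 (\<lambda>_. 1) (\<lambda>_. 0) x) - gauss_weight 0 x\<bar> \<partial>std_normal_distribution"
    by (rule cavity_model_single[OF trivial_trig])
  show ?thesis by (rule measurable_replica_overlap)
qed

lemma gibbs_overlap_bound: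
  assumes F: "block_test n F"
  shows "\<bar>gibbs_overlap F y\<bar> \<le> 1"
proof -
  interpret U: prob_space "\<Pi>\<^sub>M i\<in>(UNIV :: nat set). finite_gibbs S y"
    by (intro prob_space_PiM prob_space_finite_gibbs S)
  have "\<bar>gibbs_overlap F y\<bar> \<le> (\<integral>v. 1 \<partial>(\<Pi>\<^sub>M i\<in>(UNIV :: nat set). finite_gibbs S y))"
    unfolding gibbs_overlap_def by (rule order.trans[OF integral_abs_bound integral_mono']) (use F in \<open>auto simp: block_test_def\<close>)
  then show ?thesis by (simp add: U.prob_space)
qed

lemma measurable_gibbs_overlap:
  assumes F: "block_test n F" and Y: "\<And>a. a \<in> S \<Longrightarrow> (\<lambda>\<omega>. Y \<omega> a) \<in> borel_measurable M'"
  shows "(\<lambda>\<omega>. gibbs_overlap F (Y \<omega>)) \<in> borel_measurable M'"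
proof -
  have "(\<lambda>\<omega>. \<Pi>\<^sub>M i\<in>UNIV. finite_gibbs S (Y \<omega>)) \<in> M' \<rightarrow>\<^sub>M prob_algebra (\<Pi>\<^sub>M i\<in>(UNIV :: nat set). count_space S)"
    by (rule measurable_compose[OF measurable_finite_gibbs[OF S Y] measurable_PiM_kernel])
  moreover have "(\<lambda>v. F (replica_overlap r v)) \<in> borel_measurable (\<Pi>\<^sub>M i\<in>UNIV. count_space S)"
    by (rule measurable_compose[OF overlap_measurable block_test_rost_measurable[OF F]])
  ultimately show ?thesis unfolding gibbs_overlap_def
    by (rule measurable_compose[OF measurable_prob_algebraD integral_measurable_subprob_algebra])
qed

lemma tilt_gauss_weight:
  "tilt (finite_gibbs S y) (\<lambda>a. gauss_weight lam (x a)) = finite_gibbs S (\<lambda>a. y a + lam * x a)"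
  unfolding gauss_weight_alt by (rule tilt_finite_gibbs[OF S]) simp

text \<open>Adding an independent field to the Hamiltonian is a change of the inverse temperature, because
  the sum of two independent Gaussian vectors with proportional covariances is of the same kind.\<close>

lemma expectation_gibbs_overlap_shift:
  fixes n :: nat and \<beta> lam :: real
  assumes F: "block_test n F" and \<beta>: "0 < \<beta>" and lam: "0 < lam"
  defines "\<beta>' \<equiv> sqrt (\<beta>\<^sup>2 + lam\<^sup>2 / N)"
  shows "(\<integral>\<omega>. \<integral>\<omega>'. gibbs_overlap F (\<lambda>a. \<beta> * H a \<omega> + lam * (H a \<omega>' / sqrt N)) \<partial>M \<partial>M) =
    (\<integral>\<omega>. gibbs_overlap F (\<lambda>a. \<beta>' * H a \<omega>) \<partial>M)" (is "?A = ?B")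
proof -
  interpret MM: pair_prob_space M M ..
  \<comment> \<open>With this choice \<open>\<Lambda> * (H a \<omega> / sqrt N)\<close> is
    \<open>\<beta>' * H a \<omega>\<close>, while the square of \<Lambda> is also the variance of
    the combined field. Hence both sides are tilts at the same parameter.\<close>
  define \<Lambda> where "\<Lambda> = \<beta>' * sqrt N"
  have N0: "0 < real N" using N by simp
  have b': "0 < \<beta>'" "\<beta>'\<^sup>2 = \<beta>\<^sup>2 + lam\<^sup>2 / N" unfolding \<beta>'_def using \<beta> by (auto intro: add_pos_nonneg)
  have \<Lambda>: "0 < \<Lambda>" "\<Lambda>\<^sup>2 = \<beta>\<^sup>2 * N + lam\<^sup>2"
    using b' N0 by (simp_all add: \<Lambda>_def power_mult_distrib field_simps)
  let ?f = "\<lambda>z. gibbs_overlap F (\<lambda>a. \<beta> * H a (fst z) + lam * (H a (snd z) / sqrt N))"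
  have fm: "?f \<in> borel_measurable (M \<Otimes>\<^sub>M M)"
  proof (rule measurable_gibbs_overlap[OF F])
    fix a assume "a \<in> S"
    from measurable_compose[OF measurable_fst H_measurable[OF this], of M] measurable_compose[OF measurable_snd H_measurable[OF this], of M]
    show "(\<lambda>z. \<beta> * H a (fst z) + lam * (H a (snd z) / sqrt N)) \<in> borel_measurable (M \<Otimes>\<^sub>M M)" by measurable
  qed
  have "integrable (M \<Otimes>\<^sub>M M) ?f"
    using gibbs_overlap_bound[OF F] fm by (intro MM.integrable_const_bound[of _ 1]) auto
  from MM.integral_fst'[OF this] have pair: "?A = (\<integral>z. ?f z \<partial>(M \<Otimes>\<^sub>M M))" by simp
  have "\<bar>?A - ?B\<bar> \<le> e" if e: "0 < e" for e :: real
  proof -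
    obtain d c t B D p \<delta> \<eta> where
      T: "\<And>x. Im (trig_poly d c t x) = 0" "\<And>x. 0 \<le> Re (trig_poly d c t x)" "\<And>x. Re (trig_poly d c t x) \<le> B"
      and \<delta>: "0 < \<delta>" and p: "\<And>z. 0 \<le> z \<Longrightarrow> z \<le> B \<Longrightarrow> \<bar>(\<Sum>k\<le>D. p k * z ^ k) - 1 / max z \<delta> ^ n\<bar> \<le> \<eta>"
      and err: "(2 * real n + 2) / \<delta> * (\<integral>x. \<bar>Re (trig_poly d c t x) - gauss_weight \<Lambda> x\<bar> \<partial>std_normal_distribution)
         + 4 * \<delta> * exp (\<Lambda>\<^sup>2) + B ^ n * \<eta> \<le> e / 2"
      by (rule cavity_parameters[of "e / 2" "exp (\<Lambda>\<^sup>2)" n \<Lambda>, OF half_gt_zero[OF e] exp_gt_zero]) (rule that)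
    \<comment> \<open>Both Gibbs measures are tilts of the uniform measure, so both averages are
      close to the same number \<open>X\<close>, in which the fields enter only through their common
      covariance \<open>r\<close>.\<close>
    let ?u = "finite_gibbs S (\<lambda>_. 0)"
    have um: "(\<lambda>\<omega>. ?u) \<in> M \<rightarrow>\<^sub>M prob_algebra (count_space S)"
      using finite_gibbs_in[OF S] by simp
    define X where "X = (\<integral>v. cavity_test F n D p d c t (replica_overlap r v) \<partial>(\<Pi>\<^sub>M i\<in>UNIV. ?u))"
    interpret m1: cavity_model "M \<Otimes>\<^sub>M M" "count_space S" r
      "\<lambda>z a. gauss_weight \<Lambda> ((\<beta> * H a (fst z) + lam * (H a (snd z) / sqrt N)) / \<Lambda>)"
      "\<lambda>z a. Re (trig_poly d c t ((\<beta> * H a (fst z) + lam * (H a (snd z) / sqrt N)) / \<Lambda>))" d c t B "exp (\<Lambda>\<^sup>2)"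
      "\<integral>x. \<bar>Re (trig_poly d c t x) - gauss_weight \<Lambda> x\<bar> \<partial>std_normal_distribution"
      by (rule cavity_model_double[OF T \<Lambda>])
    interpret m2: cavity_model M "count_space S" r
      "\<lambda>\<omega> a. gauss_weight \<Lambda> (H a \<omega> / sqrt N)" "\<lambda>\<omega> a. Re (trig_poly d c t (H a \<omega> / sqrt N))" d c t B "exp (\<Lambda>\<^sup>2)"
      "\<integral>x. \<bar>Re (trig_poly d c t x) - gauss_weight \<Lambda> x\<bar> \<partial>std_normal_distribution"
      by (rule cavity_model_single[OF T])
    have "\<bar>(\<integral>z. ?f z \<partial>(M \<Otimes>\<^sub>M M)) - X\<bar> \<le> e / 2"
      using m1.tilted_integral_approx_kernel[OF prob_space_axioms um F \<delta> p] err \<Lambda>(1)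
      by (simp add: tilt_gauss_weight prob_space gibbs_overlap_def X_def)
    moreover have "\<bar>?B - X\<bar> \<le> e / 2"
    proof -
      have "\<Lambda> * (H a \<omega> / sqrt N) = \<beta>' * H a \<omega>" for a \<omega> using N0 by (simp add: \<Lambda>_def)
      then show ?thesis
        using m2.tilted_integral_approx_kernel[OF prob_space_axioms um F \<delta> p] err
        by (simp add: tilt_gauss_weight prob_space gibbs_overlap_def X_def)
    qed
    ultimately show ?thesis unfolding pair by linarith
  qed
  from dense_eq0_I[OF this] show ?thesis by simp
qed

text \<open>The counterpart of \<open>cavity_sampled_approx\<close> for a finite volume, with the
  same \<open>cavity_test\<close> and the same error; the two are joined by weak-*
  convergence.\<close>

lemma spin_cavity_approx:
  fixes n :: nat and \<beta> lam :: real
  assumes F: "block_test n F"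
    and T: "\<And>x. Im (trig_poly d c t x) = 0" "\<And>x. 0 \<le> Re (trig_poly d c t x)" "\<And>x. Re (trig_poly d c t x) \<le> B"
    and \<delta>: "0 < \<delta>" and p: "\<And>z. 0 \<le> z \<Longrightarrow> z \<le> B \<Longrightarrow> \<bar>(\<Sum>k\<le>D. p k * z ^ k) - 1 / max z \<delta> ^ n\<bar> \<le> \<eta>"
  shows "\<bar>(\<integral>\<omega>. \<integral>\<omega>'. gibbs_overlap F (\<lambda>a. \<beta> * H a \<omega> + lam * (H a \<omega>' / sqrt N)) \<partial>M \<partial>M) -
      (\<integral>\<omega>. \<integral>v. cavity_test F n D p d c t (replica_overlap r v) \<partial>(\<Pi>\<^sub>M i\<in>UNIV. finite_gibbs S (\<lambda>a. \<beta> * H a \<omega>)) \<partial>M)\<bar>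
    \<le> (2 * real n + 2) / \<delta> * (\<integral>x. \<bar>Re (trig_poly d c t x) - gauss_weight lam x\<bar> \<partial>std_normal_distribution)
       + 4 * \<delta> * exp (lam\<^sup>2) + B ^ n * \<eta>"
proof -
  interpret m: cavity_model M "count_space S" r
    "\<lambda>\<omega> a. gauss_weight lam (H a \<omega> / sqrt N)" "\<lambda>\<omega> a. Re (trig_poly d c t (H a \<omega> / sqrt N))" d c t B "exp (lam\<^sup>2)"
    "\<integral>x. \<bar>Re (trig_poly d c t x) - gauss_weight lam x\<bar> \<partial>std_normal_distribution"
    by (rule cavity_model_single[OF T])
  have \<mu>: "(\<lambda>\<omega>. finite_gibbs S (\<lambda>a. \<beta> * H a \<omega>)) \<in> M \<rightarrow>\<^sub>M prob_algebra (count_space S)"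
    by (rule measurable_finite_gibbs[OF S]) (intro borel_measurable_times borel_measurable_const H_measurable)
  show ?thesis
    using m.tilted_integral_approx_kernel[OF prob_space_axioms \<mu> F \<delta> p]
    unfolding tilt_gauss_weight gibbs_overlap_def .
qed

section \<open>Free energy and dependence on the temperature\<close>

lemma integrable_ln_partition: "integrable M (\<lambda>\<omega>. ln (\<Sum>a\<in>S. exp (b * H a \<omega>)))"
proof (rule Bochner_Integration.integrable_bound)
  have Hi: "integrable M (H a)" if "a \<in> S" for a
    using gaussian_vector_integrable[OF prob_space_axioms S(1) gaussian cov that] .
  show "integrable M (\<lambda>\<omega>. ln (card S) + \<bar>b\<bar> * (\<Sum>a\<in>S. \<bar>H a \<omega>\<bar>))"
    using Hi by (intro Bochner_Integration.integrable_add integrable_mult_right Bochner_Integration.integrable_sum integrable_abs) auto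
  show "(\<lambda>\<omega>. ln (\<Sum>a\<in>S. exp (b * H a \<omega>))) \<in> borel_measurable M"
  proof -
    have [measurable]: "a \<in> S \<Longrightarrow> H a \<in> borel_measurable M" for a by (rule H_measurable)
    show ?thesis by measurable
  qed
  have "\<bar>ln (\<Sum>a\<in>S. exp (b * h a))\<bar> \<le> ln (card S) + \<bar>b\<bar> * (\<Sum>a\<in>S. \<bar>h a\<bar>)" for h :: "'i \<Rightarrow> real"
  proof -
    let ?K = "\<bar>b\<bar> * (\<Sum>a\<in>S. \<bar>h a\<bar>)"
    have K: "\<bar>b * h a\<bar> \<le> ?K" if "a \<in> S" for a
      unfolding abs_mult using that S by (intro mult_left_mono member_le_sum) auto
    have c: "1 \<le> real (card S)" using S by (simp add: Suc_le_eq card_gt_0_iff)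
    obtain a0 where a0: "a0 \<in> S" using S by blast
    have "(\<Sum>a\<in>S. exp (b * h a)) \<le> (\<Sum>a\<in>S. exp ?K)"
      using K by (intro sum_mono) (simp add: abs_le_iff)
    then have "ln (\<Sum>a\<in>S. exp (b * h a)) \<le> ln (card S * exp ?K)"
      using gibbs_sum_pos[OF S, of "\<lambda>a. b * h a"] c by (subst ln_le_cancel_iff) auto
    also have "\<dots> = ln (card S) + ?K" using c by (subst ln_mult) auto
    finally have up: "ln (\<Sum>a\<in>S. exp (b * h a)) \<le> ln (card S) + ?K" .
    have "exp (b * h a0) \<le> (\<Sum>a\<in>S. exp (b * h a))" using S a0 by (intro member_le_sum) auto
    then have "b * h a0 \<le> ln (\<Sum>a\<in>S. exp (b * h a))"
      using gibbs_sum_pos[OF S, of "\<lambda>a. b * h a"] by (simp add: ln_ge_iff)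
    then have "- ?K \<le> ln (\<Sum>a\<in>S. exp (b * h a))" using K[OF a0] by (simp add: abs_le_iff)
    moreover have "0 \<le> ln (card S)" using c by simp
    ultimately show ?thesis using up by (simp add: abs_le_iff)
  qed
  from order.trans[OF this abs_ge_self] show "AE \<omega> in M. norm (ln (\<Sum>a\<in>S. exp (b * H a \<omega>))) \<le> norm (ln (card S) + \<bar>b\<bar> * (\<Sum>a\<in>S. \<bar>H a \<omega>\<bar>))"
    by (intro AE_I2) (simp only: real_norm_def)
qed

definition pressure :: "real \<Rightarrow> real" where
  "pressure b = 1 / real N * (\<integral>\<omega>. ln (\<Sum>a\<in>S. exp (b * H a \<omega>)) \<partial>M)"

text \<open>Pinsker bounds the squared distance by \<open>\<beta>' - \<beta>\<close> times the
  increment of the Gibbs mean of \<open>H\<close>. That mean is increasing in the inverse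
  temperature, so the increment may be taken up to \<open>\<beta> + t\<close>, where convexity
  bounds it by difference quotients of the log partition function over steps of length
  \<open>t\<close>. The factor \<open>N\<close> between that function and the pressure is absorbed
  by \<open>(\<beta>' - \<beta>) * N \<le> K\<close>.\<close>

lemma gibbs_overlap_temperature:
  fixes n :: nat and \<beta> \<beta>' t K v :: real
  assumes F: "block_test n F" and \<beta>: "0 < \<beta>" and t: "0 < t"
    and \<beta>': "\<beta> \<le> \<beta>'" "\<beta>' \<le> \<beta> + t" "(\<beta>' - \<beta>) * N \<le> K"
    and v: "K * ((pressure (\<beta> + 2 * t) - pressure (\<beta> + t) - pressure \<beta> + pressure (\<beta> - t)) / t) \<le> v" "0 < v"
  shows "\<bar>(\<integral>\<omega>. gibbs_overlap F (\<lambda>a. \<beta>' * H a \<omega>) \<partial>M) - (\<integral>\<omega>. gibbs_overlap F (\<lambda>a. \<beta> * H a \<omega>) \<partial>M)\<bar> \<le> n * sqrt v"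
proof -
  have [measurable]: "a \<in> S \<Longrightarrow> H a \<in> borel_measurable M" for a by (rule H_measurable)
  define G where "G b \<omega> = gibbs_prob S (\<lambda>a. b * H a \<omega>)" for b \<omega>
  define h where "h b \<omega> = (\<Sum>a\<in>S. G b \<omega> a * H a \<omega>)" for b \<omega>
  define Z where "Z b \<omega> = ln (\<Sum>a\<in>S. exp (b * H a \<omega>))" for b \<omega>
  define X where "X \<omega> = (\<Sum>a\<in>S. \<bar>G \<beta>' \<omega> a - G \<beta> \<omega> a\<bar>)" for \<omega>
  have Zi: "integrable M (Z b)" for b unfolding Z_def by (rule integrable_ln_partition)
  have EZ: "expectation (Z b) = N * pressure b" for b
    using N by (simp add: pressure_def Z_def[abs_def])
  have l1: "(\<Sum>a\<in>S. \<bar>G b' \<omega> a - G b \<omega> a\<bar>)\<^sup>2 \<le> (b' - b) * (h b' \<omega> - h b \<omega>)" for b b' \<omega>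
  proof -
    have "(\<Sum>a\<in>S. \<bar>G b' \<omega> a - G b \<omega> a\<bar>)\<^sup>2 \<le> (\<Sum>a\<in>S. (G b' \<omega> a - G b \<omega> a) * (b' * H a \<omega> - b * H a \<omega>))"
      unfolding G_def by (rule gibbs_prob_l1_le[OF S])
    also have "\<dots> = (\<Sum>a\<in>S. (b' - b) * (G b' \<omega> a * H a \<omega> - G b \<omega> a * H a \<omega>))"
      by (intro sum.cong refl) (simp add: algebra_simps)
    also have "\<dots> = (b' - b) * (h b' \<omega> - h b \<omega>)"
      by (simp add: h_def sum_distrib_left[symmetric] sum_subtractf)
    finally show ?thesis .
  qed
  have mono: "h b \<omega> \<le> h b' \<omega>" if "b \<le> b'" for b b' \<omega>
  proof (cases "b = b'")
    case False
    have "0 \<le> (b' - b) * (h b' \<omega> - h b \<omega>)" using l1[of b' \<omega> b] by (rule order.trans[OF zero_le_power2])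
    then show ?thesis using False that by (simp add: zero_le_mult_iff)
  qed simp
  have conv: "Z b \<omega> + s * h b \<omega> \<le> Z (b + s) \<omega>" for b s \<omega>
    unfolding Z_def h_def G_def by (rule ln_partition_convex[OF S])
  have X2: "(X \<omega>)\<^sup>2 \<le> (\<beta>' - \<beta>) * ((Z (\<beta> + 2 * t) \<omega> - Z (\<beta> + t) \<omega> - Z \<beta> \<omega> + Z (\<beta> - t) \<omega>) / t)" for \<omega>
  proof -
    have "t * (h \<beta>' \<omega> - h \<beta> \<omega>) \<le> t * (h (\<beta> + t) \<omega> - h \<beta> \<omega>)"
      using mono[OF \<beta>'(2), of \<omega>] t by (intro mult_left_mono) auto
    \<comment> \<open>Tangents at \<open>\<beta> + t\<close> with step \<open>t\<close> and at
      \<beta> with step \<open>- t\<close>.\<close>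
    also have "\<dots> \<le> Z (\<beta> + 2 * t) \<omega> - Z (\<beta> + t) \<omega> - Z \<beta> \<omega> + Z (\<beta> - t) \<omega>"
      using conv[of "\<beta> + t" \<omega> t] conv[of \<beta> \<omega> "- t"] by (simp add: algebra_simps)
    finally have "h \<beta>' \<omega> - h \<beta> \<omega> \<le> (Z (\<beta> + 2 * t) \<omega> - Z (\<beta> + t) \<omega> - Z \<beta> \<omega> + Z (\<beta> - t) \<omega>) / t"
      using t by (simp add: le_divide_eq mult.commute)
    then show ?thesis
      unfolding X_def using \<beta>'(1) by (intro order.trans[OF l1 mult_left_mono]) auto
  qed
  have Xm: "X \<in> borel_measurable M"
    unfolding X_def G_def gibbs_prob_def by measurable
  have Gp: "0 \<le> G b \<omega> a" for b \<omega> a unfolding G_def using gibbs_prob_pos[OF S] by (rule less_imp_le)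
  have Xb: "\<bar>X \<omega>\<bar> \<le> 2" for \<omega>
  proof -
    have "X \<omega> \<le> (\<Sum>a\<in>S. G \<beta>' \<omega> a + G \<beta> \<omega> a)"
      unfolding X_def
    proof (rule sum_mono)
      fix a show "\<bar>G \<beta>' \<omega> a - G \<beta> \<omega> a\<bar> \<le> G \<beta>' \<omega> a + G \<beta> \<omega> a" using Gp[of \<beta>' \<omega> a] Gp[of \<beta> \<omega> a] by linarith
    qed
    also have "\<dots> = 2" by (simp add: sum.distrib G_def sum_gibbs_prob[OF S])
    finally show ?thesis by (simp add: X_def sum_nonneg)
  qed
  have "expectation (\<lambda>\<omega>. (X \<omega>)\<^sup>2) \<le>
      expectation (\<lambda>\<omega>. (\<beta>' - \<beta>) * ((Z (\<beta> + 2 * t) \<omega> - Z (\<beta> + t) \<omega> - Z \<beta> \<omega> + Z (\<beta> - t) \<omega>) / t))"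
    using X2 Zi by (intro integral_mono') (auto intro: order.trans[OF zero_le_power2])
  also have "\<dots> = (\<beta>' - \<beta>) * N * ((pressure (\<beta> + 2 * t) - pressure (\<beta> + t) - pressure \<beta> + pressure (\<beta> - t)) / t)"
    using Zi by (simp add: EZ right_diff_distrib distrib_left)
  also have "\<dots> \<le> v"
  proof -
    let ?y = "(pressure (\<beta> + 2 * t) - pressure (\<beta> + t) - pressure \<beta> + pressure (\<beta> - t)) / t"
    \<comment> \<open>Nonnegativity of the quotient allows \<open>(\<beta>' - \<beta>) * N\<close>
      to be enlarged to \<open>K\<close>.\<close>
    have "0 \<le> ?y"
    proof -
      have "0 \<le> Z (\<beta> + 2 * t) \<omega> - Z (\<beta> + t) \<omega> - Z \<beta> \<omega> + Z (\<beta> - t) \<omega>" for \<omega>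
      proof -
        have "0 \<le> t * (h (\<beta> + t) \<omega> - h \<beta> \<omega>)" using mono[of \<beta> "\<beta> + t" \<omega>] t by simp
        also have "\<dots> \<le> Z (\<beta> + 2 * t) \<omega> - Z (\<beta> + t) \<omega> - Z \<beta> \<omega> + Z (\<beta> - t) \<omega>"
          using conv[of "\<beta> + t" \<omega> t] conv[of \<beta> \<omega> "- t"] by (simp add: algebra_simps)
        finally show ?thesis .
      qed
      then have "0 \<le> expectation (\<lambda>\<omega>. Z (\<beta> + 2 * t) \<omega> - Z (\<beta> + t) \<omega> - Z \<beta> \<omega> + Z (\<beta> - t) \<omega>)" by simp
      also have "\<dots> = N * (pressure (\<beta> + 2 * t) - pressure (\<beta> + t) - pressure \<beta> + pressure (\<beta> - t))"
        using Zi by (simp add: EZ right_diff_distrib distrib_left)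
      finally show ?thesis using t N by (simp add: zero_le_mult_iff)
    qed
    then have "(\<beta>' - \<beta>) * N * ?y \<le> K * ?y" using \<beta>'(3) by (intro mult_right_mono)
    then show ?thesis using v(1) by linarith
  qed
  finally have EX: "expectation (\<lambda>\<omega>. \<bar>X \<omega>\<bar>) \<le> sqrt v"
    using expectation_abs_le_sqrt[OF Xm Xb _ v(2)] by simp
  have gm: "(\<lambda>\<omega>. gibbs_overlap F (\<lambda>a. b * H a \<omega>)) \<in> borel_measurable M" for b
    by (rule measurable_gibbs_overlap[OF F]) measurable
  have gi: "integrable M (\<lambda>\<omega>. gibbs_overlap F (\<lambda>a. b * H a \<omega>))" for b
    using gibbs_overlap_bound[OF F] gm by (intro integrable_const_bound[of _ 1]) auto
  have ptw: "\<bar>gibbs_overlap F (\<lambda>a. \<beta>' * H a \<omega>) - gibbs_overlap F (\<lambda>a. \<beta> * H a \<omega>)\<bar> \<le> n * X \<omega>" for \<omega>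
  proof -
    interpret m: cavity_model M "count_space S" r "\<lambda>\<omega> a. gauss_weight 0 (H a \<omega> / sqrt N)"
      "\<lambda>\<omega> a. Re (trig_poly 1 (\<lambda>_. 1) (\<lambda>_. 0) (H a \<omega> / sqrt N))" 1 "\<lambda>_. 1" "\<lambda>_. 0" 1 "exp (0\<^sup>2)"
      "\<integral>x. \<bar>Re (trig_poly 1 (\<lambda>_. 1) (\<lambda>_. 0) x) - gauss_weight 0 x\<bar> \<partial>std_normal_distribution"
      by (rule cavity_model_single[OF trivial_trig])
    have Fd: "F q = F q'" if "\<And>i j. i < n \<Longrightarrow> j < n \<Longrightarrow> q i j = q' i j" for q q'
      using F that by (auto simp: block_test_def)
    have Fc: "continuous_on UNIV F" using F by (simp add: block_test_def)
    show ?thesis unfolding gibbs_overlap_def X_def G_def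
    proof (rule integral_finite_gibbs_replicas_le[OF S])
      show "(\<lambda>v. F (replica_overlap r v)) \<in> borel_measurable (\<Pi>\<^sub>M i\<in>{..<n}. count_space S)"
        by (rule m.measurable_block_overlap[OF Fc Fd]) auto
      show "\<bar>F (replica_overlap r v)\<bar> \<le> 1" for v using F by (simp add: block_test_def)
      show "F (replica_overlap r x) = F (replica_overlap r x')" if "\<And>i. i < n \<Longrightarrow> x i = x' i" for x x'
        by (rule m.replica_overlap_dep[where k = n, OF that Fd]) auto
    qed
  qed
  have "\<bar>(\<integral>\<omega>. gibbs_overlap F (\<lambda>a. \<beta>' * H a \<omega>) \<partial>M) - (\<integral>\<omega>. gibbs_overlap F (\<lambda>a. \<beta> * H a \<omega>) \<partial>M)\<bar> =
      \<bar>\<integral>\<omega>. gibbs_overlap F (\<lambda>a. \<beta>' * H a \<omega>) - gibbs_overlap F (\<lambda>a. \<beta> * H a \<omega>) \<partial>M\<bar>"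
    using gi by simp
  also have "\<dots> \<le> (\<integral>\<omega>. \<bar>gibbs_overlap F (\<lambda>a. \<beta>' * H a \<omega>) - gibbs_overlap F (\<lambda>a. \<beta> * H a \<omega>)\<bar> \<partial>M)"
    by (rule integral_abs_bound)
  also have "\<dots> \<le> (\<integral>\<omega>. n * \<bar>X \<omega>\<bar> \<partial>M)"
  proof (rule integral_mono')
    have "integrable M X" using Xb Xm by (intro integrable_const_bound[of _ 2]) auto
    then show "integrable M (\<lambda>\<omega>. n * \<bar>X \<omega>\<bar>)" by auto
    show "\<bar>gibbs_overlap F (\<lambda>a. \<beta>' * H a \<omega>) - gibbs_overlap F (\<lambda>a. \<beta> * H a \<omega>)\<bar> \<le> n * \<bar>X \<omega>\<bar>" for \<omega>
      using ptw[of \<omega>] by (simp add: X_def sum_nonneg)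
  qed auto
  also have "\<dots> \<le> n * sqrt v" using EX by (simp add: mult_left_mono)
  finally show ?thesis .
qed

section \<open>The overlap law as a mixture over the disorder\<close>

lemma replica_matrix_eq:
  assumes "v \<in> space (\<Pi>\<^sub>M i\<in>(UNIV :: nat set). count_space S)"
  shows "(\<lambda>i j. r (v i) (v j)) = replica_overlap r v"
proof -
  have "v i \<in> S" for i using assms by (auto simp: space_PiM)
  then show ?thesis by (auto simp: replica_overlap_def diag intro!: ext)
qed

lemma measurable_replica_matrix:
  "(\<lambda>v i j. r (v i) (v j)) \<in> (\<Pi>\<^sub>M i\<in>(UNIV :: nat set). count_space S) \<rightarrow>\<^sub>M rost_algebra"
  using overlap_measurable by (simp add: replica_matrix_eq cong: measurable_cong)

lemma integral_replica_matrix_law: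
  fixes b :: real and G :: "(nat \<Rightarrow> nat \<Rightarrow> real) \<Rightarrow> real"
  defines "R \<equiv> M \<bind> (\<lambda>\<omega>. distr (\<Pi>\<^sub>M i\<in>UNIV. finite_gibbs S (\<lambda>a. b * H a \<omega>)) rost_algebra (\<lambda>v i j. r (v i) (v j)))"
  assumes G: "G \<in> borel_measurable rost_algebra" and K: "\<And>q. q \<in> rost_matrices \<Longrightarrow> \<bar>G q\<bar> \<le> K"
  shows "(\<integral>q. G q \<partial>R) = (\<integral>\<omega>. \<integral>v. G (replica_overlap r v) \<partial>(\<Pi>\<^sub>M i\<in>UNIV. finite_gibbs S (\<lambda>a. b * H a \<omega>)) \<partial>M)"
proof -
  have m: "(\<lambda>\<omega>. finite_gibbs S (\<lambda>a. b * H a \<omega>)) \<in> M \<rightarrow>\<^sub>M prob_algebra (count_space S)"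
    by (rule measurable_finite_gibbs[OF S]) (intro borel_measurable_times borel_measurable_const H_measurable)
  have "(\<integral>q. G q \<partial>R) =
      (\<integral>\<omega>. \<integral>v. G (\<lambda>i j. r (v i) (v j)) \<partial>(\<Pi>\<^sub>M i\<in>UNIV. finite_gibbs S (\<lambda>a. b * H a \<omega>)) \<partial>M)"
    unfolding R_def by (rule integral_replica_bind[OF prob_space_axioms m measurable_replica_matrix G K])
  also have "\<dots> = (\<integral>\<omega>. \<integral>v. G (replica_overlap r v) \<partial>(\<Pi>\<^sub>M i\<in>UNIV. finite_gibbs S (\<lambda>a. b * H a \<omega>)) \<partial>M)"
  proof (intro Bochner_Integration.integral_cong refl arg_cong[of _ _ G] replica_matrix_eq)
    fix \<omega> v assume "v \<in> space (\<Pi>\<^sub>M i\<in>(UNIV :: nat set). finite_gibbs S (\<lambda>a. b * H a \<omega>))"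
    also have "space (\<Pi>\<^sub>M i\<in>(UNIV :: nat set). finite_gibbs S (\<lambda>a. b * H a \<omega>)) = space (\<Pi>\<^sub>M i\<in>(UNIV :: nat set). count_space S)"
      by (intro sets_eq_imp_space_eq sets_PiM_cong refl sets_finite_gibbs[OF S])
    finally show "v \<in> space (\<Pi>\<^sub>M i\<in>(UNIV :: nat set). count_space S)" .
  qed
  finally show ?thesis .
qed

end

text \<open>Written with difference quotients at \<beta>, the expression tends to
  \<open>2 * L - L - L\<close>. Two-sided differentiability enters here: the quotient with step
  \<open>- t\<close> must tend to the same \<open>L\<close>.\<close>

lemma second_difference_tendsto:
  fixes p :: "real \<Rightarrow> real"
  assumes "p differentiable (at \<beta>)"
  shows "((\<lambda>t. (p (\<beta> + 2 * t) - p (\<beta> + t) - p \<beta> + p (\<beta> - t)) / t) \<longlongrightarrow> 0) (at_right 0)"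
proof -
  obtain L where "(p has_real_derivative L) (at \<beta>)" using assms by (auto simp: real_differentiable_def)
  then have q: "((\<lambda>h. (p (\<beta> + h) - p \<beta>) / h) \<longlongrightarrow> L) (at 0)" by (simp add: DERIV_def)
  have lim: "((\<lambda>t. (p (\<beta> + c * t) - p \<beta>) / (c * t)) \<longlongrightarrow> L) (at_right 0)" if "c \<noteq> 0" for c :: real
  proof (rule filterlim_compose[OF q])
    show "filterlim ((*) c) (at 0) (at_right 0)"
    proof (rule filterlim_atI)
      show "((*) c \<longlongrightarrow> 0) (at_right 0)" by (rule tendsto_eq_intros | simp)+
      show "\<forall>\<^sub>F t in at_right 0. c * t \<noteq> 0" using that by (auto simp: eventually_at_filter)
    qed
  qed
  have "((\<lambda>t. 2 * ((p (\<beta> + 2 * t) - p \<beta>) / (2 * t)) - (p (\<beta> + 1 * t) - p \<beta>) / (1 * t)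
      - (p (\<beta> + (- 1) * t) - p \<beta>) / ((- 1) * t)) \<longlongrightarrow> 2 * L - L - L) (at_right 0)"
    by (intro tendsto_diff tendsto_mult tendsto_const lim) auto
  then have "((\<lambda>t. 2 * ((p (\<beta> + 2 * t) - p \<beta>) / (2 * t)) - (p (\<beta> + 1 * t) - p \<beta>) / (1 * t)
      - (p (\<beta> + (- 1) * t) - p \<beta>) / ((- 1) * t)) \<longlongrightarrow> 0) (at_right 0)" by simp
  then show ?thesis
    by (rule Lim_transform_eventually) (auto simp: eventually_at_filter field_simps)
qed

section \<open>Spin glasses as families of finite volumes\<close>

lemma spin_configs_finite: "finite (spin_configs N)" "spin_configs N \<noteq> {}"
  by (auto simp: spin_configs_def finite_PiE PiE_eq_empty_iff)

lemma gaussian_spin_glass_volume: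
  assumes "gaussian_spin_glass M r H" "1 \<le> N"
  shows "spin_glass_volume (M N) (spin_configs N) (r N) (H N) N"
  using assms spin_configs_finite unfolding gaussian_spin_glass_def spin_glass_volume_def spin_glass_volume_axioms_def
  by simp

lemma free_energy_eq_pressure:
  assumes "gaussian_spin_glass M r H" "1 \<le> N"
  shows "free_energy M H N = spin_glass_volume.pressure (M N) (spin_configs N) (H N) N"
  by (simp add: fun_eq_iff free_energy_def partition_function_def spin_glass_volume.pressure_def[OF gaussian_spin_glass_volume[OF assms]])

lemma spin_glass_rost_law_eq:
  "spin_glass_rost_law M r H \<beta> N = M N \<bind> (\<lambda>\<omega>.
     distr (\<Pi>\<^sub>M i\<in>UNIV. finite_gibbs (spin_configs N) (\<lambda>a. \<beta> * H N a \<omega>)) rost_algebra (\<lambda>v i j. r N (v i) (v j)))"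
  by (simp add: spin_glass_rost_law_def gibbs_measure_def finite_gibbs_def gibbs_prob_def[abs_def] partition_function_def)

text \<open>The difference of the two inverse temperatures times their sum is
  \<open>lam\<^sup>2 / N\<close>, and the sum is at least \<open>2 * \<beta>\<close>.\<close>

lemma cavity_temperature:
  fixes \<beta> lam :: real and N :: nat
  assumes \<beta>: "0 < \<beta>" and N: "1 \<le> N"
  shows "\<beta> \<le> sqrt (\<beta>\<^sup>2 + lam\<^sup>2 / N)" "(sqrt (\<beta>\<^sup>2 + lam\<^sup>2 / N) - \<beta>) * N \<le> lam\<^sup>2 / (2 * \<beta>)"
proof -
  let ?b = "sqrt (\<beta>\<^sup>2 + lam\<^sup>2 / N)"
  show le: "\<beta> \<le> ?b" using \<beta> by (intro real_le_rsqrt) simp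
  have "(?b - \<beta>) * (2 * \<beta>) \<le> (?b - \<beta>) * (?b + \<beta>)" using le by (intro mult_left_mono) auto
  also have "\<dots> = ?b\<^sup>2 - \<beta>\<^sup>2" by (simp add: power2_eq_square algebra_simps del: real_sqrt_mult_self)
  also have "\<dots> = lam\<^sup>2 / N" by simp
  finally show "(?b - \<beta>) * N \<le> lam\<^sup>2 / (2 * \<beta>)" using \<beta> N by (simp add: field_simps)
qed

text \<open>The expected Gibbs average changes little because the free energies are convex functions of the
  inverse temperature whose limit has equal one-sided derivatives.\<close>

lemma gibbs_overlap_temperature_tendsto:
  fixes \<beta> lam :: real and n :: nat
  assumes G: "gaussian_spin_glass M r H" and \<beta>: "0 < \<beta>" and F: "block_test n F"
    and conv: "\<forall>\<^sub>F b in nhds \<beta>. convergent (\<lambda>N. free_energy M H N b)"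
    and diff: "(\<lambda>b. lim (\<lambda>N. free_energy M H N b)) differentiable (at \<beta>)"
  defines "E \<equiv> \<lambda>b N. \<integral>\<omega>. spin_glass_volume.gibbs_overlap (spin_configs N) (r N) F (\<lambda>a. b * H N a \<omega>) \<partial>M N"
  shows "(\<lambda>N. E (sqrt (\<beta>\<^sup>2 + lam\<^sup>2 / N)) N - E \<beta> N) \<longlonglongrightarrow> 0"
proof (rule LIMSEQ_I)
  fix \<epsilon> :: real assume \<epsilon>: "0 < \<epsilon>"
  define p where "p b = lim (\<lambda>N. free_energy M H N b)" for b
  define sd where "sd f t = (f (\<beta> + 2 * t) - f (\<beta> + t) - f \<beta> + f (\<beta> - t)) / t" for f :: "real \<Rightarrow> real" and t
  define K where "K = lam\<^sup>2 / (2 * \<beta>)"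
  \<comment> \<open>The summand 1 keeps the quotient meaningful for \<open>n = 0\<close> and makes
    \<open>real n * sqrt v\<close> strictly smaller than \<epsilon>.\<close>
  define v where "v = (\<epsilon> / (2 * (real n + 1)))\<^sup>2"
  have v: "0 < v" using \<epsilon> by (simp add: v_def)
  have "real n * sqrt v = \<epsilon> * (real n / (2 * (real n + 1)))" using \<epsilon> by (simp add: v_def)
  also have "\<dots> < \<epsilon> * 1" using \<epsilon> by (intro mult_strict_left_mono) (auto simp: divide_less_eq)
  finally have nv: "real n * sqrt v < \<epsilon>" by simp
  from conv obtain d where d: "0 < d" "\<And>b. dist b \<beta> < d \<Longrightarrow> convergent (\<lambda>N. free_energy M H N b)"
    unfolding eventually_nhds_metric by blast
  have lim: "(\<lambda>N. free_energy M H N b) \<longlonglongrightarrow> p b" if "dist b \<beta> < d" for b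
    using d(2)[OF that] by (simp add: convergent_LIMSEQ_iff p_def)
  have "((\<lambda>t. K * sd p t) \<longlongrightarrow> K * 0) (at_right 0)"
    unfolding sd_def p_def by (intro tendsto_mult tendsto_const second_difference_tendsto diff)
  then have "\<forall>\<^sub>F t in at_right 0. K * sd p t < v" using v by (intro order_tendstoD) auto
  moreover have "\<forall>\<^sub>F t in at_right 0. t < d / 2"
    using d(1) by (intro order_tendstoD[OF tendsto_ident_at]) simp
  moreover have "\<forall>\<^sub>F t :: real in at_right 0. 0 < t" by (simp add: eventually_at_filter)
  ultimately have "\<forall>\<^sub>F t in at_right 0. K * sd p t < v \<and> t < d / 2 \<and> 0 < t" by eventually_elim auto
  then obtain t where t: "K * sd p t < v" "t < d / 2" "0 < t"
    using eventually_happens'[OF trivial_limit_at_right_real] by blast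
  \<comment> \<open>The step \<open>t\<close> is fixed before \<open>N\<close> grows. As
    \<open>t < d / 2\<close>, the points \<open>\<beta> + 2 * t\<close>, \<open>\<beta> + t\<close>,
    \<beta> and \<open>\<beta> - t\<close> lie where the free energies converge.\<close>
  have "(\<lambda>N. K * sd (free_energy M H N) t) \<longlonglongrightarrow> K * sd p t"
    unfolding sd_def using t d(1) by (intro tendsto_intros lim) (auto simp: dist_real_def)
  then have ev1: "\<forall>\<^sub>F N in sequentially. K * sd (free_energy M H N) t < v"
    using t(1) by (rule order_tendstoD)
  have "(\<lambda>N. sqrt (\<beta>\<^sup>2 + lam\<^sup>2 / real N)) \<longlonglongrightarrow> sqrt (\<beta>\<^sup>2 + 0)"
    by (intro tendsto_intros lim_const_over_n)
  then have ev2: "\<forall>\<^sub>F N in sequentially. sqrt (\<beta>\<^sup>2 + lam\<^sup>2 / real N) < \<beta> + t"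
    using \<beta> t(3) by (intro order_tendstoD) auto
  have "\<forall>\<^sub>F N in sequentially. norm (E (sqrt (\<beta>\<^sup>2 + lam\<^sup>2 / real N)) N - E \<beta> N - 0) < \<epsilon>"
    using ev1 ev2 eventually_ge_at_top[of 1]
  proof eventually_elim
    case (elim N)
    interpret spin_glass_volume "M N" "spin_configs N" "r N" "H N" N
      by (rule gaussian_spin_glass_volume[OF G elim(3)])
    have "\<bar>E (sqrt (\<beta>\<^sup>2 + lam\<^sup>2 / real N)) N - E \<beta> N\<bar> \<le> n * sqrt v"
      unfolding E_def
    proof (rule gibbs_overlap_temperature[OF F \<beta> t(3)])
      show "\<beta> \<le> sqrt (\<beta>\<^sup>2 + lam\<^sup>2 / real N)" "(sqrt (\<beta>\<^sup>2 + lam\<^sup>2 / real N) - \<beta>) * N \<le> K"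
        using cavity_temperature[OF \<beta> elim(3)] by (simp_all add: K_def)
      show "sqrt (\<beta>\<^sup>2 + lam\<^sup>2 / real N) \<le> \<beta> + t" using elim(2) by simp
      show "K * ((pressure (\<beta> + 2 * t) - pressure (\<beta> + t) - pressure \<beta> + pressure (\<beta> - t)) / t) \<le> v"
        using elim(1) by (simp add: sd_def free_energy_eq_pressure[OF G elim(3)])
    qed (rule v)
    then show ?case using nv by simp
  qed
  then show "\<exists>N0. \<forall>N\<ge>N0. norm (E (sqrt (\<beta>\<^sup>2 + lam\<^sup>2 / real N)) N - E \<beta> N - 0) < \<epsilon>"
    by (simp add: eventually_sequentially)
qed

text \<open>The topology is pulled back from a product of real lines indexed by the test functions,
  so a limit is a limit in every coordinate; membership in \<open>rost_laws\<close> comes from the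
  underlying set of the topology.\<close>

lemma limitin_rost_topology:
  fixes G :: "(nat \<Rightarrow> nat \<Rightarrow> real) \<Rightarrow> real"
  assumes lim: "limitin rost_topology X P \<F>" and G: "continuous_on rost_matrices G"
  shows "P \<in> rost_laws" "((\<lambda>k. \<integral>q. G q \<partial>X k) \<longlongrightarrow> (\<integral>q. G q \<partial>P)) \<F>"
proof -
  let ?C = "{f :: (nat \<Rightarrow> nat \<Rightarrow> real) \<Rightarrow> real. continuous_on rost_matrices f}"
  let ?I = "\<lambda>P. \<lambda>f\<in>?C. \<integral>q. f q \<partial>P"
  let ?T = "product_topology (\<lambda>_. euclideanreal) ?C"
  show "P \<in> rost_laws"
    using lim by (simp add: limitin_def rost_topology_def topspace_pullback_topology)
  have "continuous_map rost_topology ?T (id \<circ> ?I)"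
    unfolding rost_topology_def by (intro continuous_map_pullback continuous_map_id)
  from continuous_map_limit[OF this lim]
  have "limitin euclideanreal (\<lambda>k. ?I (X k) G) (?I P G) \<F>"
    using G by (simp add: limitin_componentwise)
  then show "((\<lambda>k. \<integral>q. G q \<partial>X k) \<longlongrightarrow> (\<integral>q. G q \<partial>P)) \<F>" using G by simp
qed

text \<open>For a test function \<open>F\<close>, the image of \<open>P\<close> gives nearly the
  integral of \<open>cavity_test\<close> under \<open>P\<close>, which is the limit of the same
  integral in finite volume. There it is nearly the Gibbs average at the shifted temperature, which
  differs from the integral of \<open>F\<close> by a vanishing amount, and the latter tends to the
  integral under \<open>P\<close>.\<close>

theorem corollary1p11:
  fixes M :: "nat \<Rightarrow> 'w measure"
    and r :: "nat \<Rightarrow> (nat \<Rightarrow> int) \<Rightarrow> (nat \<Rightarrow> int) \<Rightarrow> real"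
    and H :: "nat \<Rightarrow> (nat \<Rightarrow> int) \<Rightarrow> 'w \<Rightarrow> real"
    and e :: "nat \<Rightarrow> 'h :: {real_inner, polish_space}"
    and \<beta> :: real
  assumes "gaussian_spin_glass M r H"
    and "orthonormal_basis e"
    and "\<beta> > 0"
    and "\<forall>\<^sub>F b in nhds \<beta>. convergent (\<lambda>N. free_energy M H N b)"
    and "(\<lambda>b. lim (\<lambda>N. free_energy M H N b)) differentiable (at \<beta>)"
  shows "\<forall>P. rost_limit_point (spin_glass_rost_law M r H \<beta>) P \<longrightarrow> stochastically_stable e P"
  unfolding stochastically_stable_def
proof (intro allI impI)
  note G = assms(1) and e = assms(2) and \<beta> = assms(3)
  let ?Q = "spin_glass_rost_law M r H \<beta>"
  fix P and lam :: real
  assume "rost_limit_point ?Q P" and lam: "0 < lam"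
  then obtain s where s: "strict_mono s" and lim: "limitin rost_topology (?Q \<circ> s) P sequentially"
    by (auto simp: rost_limit_point_def)
  have P: "P \<in> rost_laws" by (rule limitin_rost_topology(1)[OF lim continuous_on_const])
  then have Pp: "P \<in> space (prob_algebra rost_algebra)" by (simp add: rost_laws_def)
  have "rost_law P"
    using P by (auto simp: rost_laws_def space_prob_algebra rost_law_def rost_law_axioms_def)
  \<comment> \<open>The very sampling law selected in \<open>cavity_map\<close>; its existence is
    the Dovbysh-Sudakov theorem.\<close>
  define D where "D = (SOME D :: 'h measure measure. is_sampling_law D P)"
  have "is_sampling_law D P"
    unfolding D_def by (rule someI_ex[OF ex_sampling_law[OF e \<open>rost_law P\<close>]])
  then have D: "D \<in> random_measure_laws" and DP: "sampled_rost_law D = P" by (simp_all add: is_sampling_law_def)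
  have s1: "\<forall>\<^sub>F k in sequentially. 1 \<le> s k"
    using filterlim_subseq[OF s] by (auto simp: filterlim_at_top)
  have "cavity_map lam e P = sampled_rost_law (cavity_sampling_law lam e D)"
    by (simp add: cavity_map_def D_def)
  also have "\<dots> = P"
  proof (rule rost_law_eqI[OF sampled_rost_law_in[OF e cavity_sampling_law_in[OF e D]] Pp])
    fix n F assume F: "block_test n F"
    let ?A = "\<integral>q. F q \<partial>sampled_rost_law (cavity_sampling_law lam e D)" and ?Y = "\<integral>q. F q \<partial>P"
    define E where "E b N = (\<integral>\<omega>. spin_glass_volume.gibbs_overlap (spin_configs N) (r N) F (\<lambda>a. b * H N a \<omega>) \<partial>M N)" for b N
    have "(\<lambda>N. E (sqrt (\<beta>\<^sup>2 + lam\<^sup>2 / N)) N - E \<beta> N) \<longlonglongrightarrow> 0"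
      unfolding E_def by (rule gibbs_overlap_temperature_tendsto[OF G \<beta> F assms(4,5)])
    from LIMSEQ_subseq_LIMSEQ[OF this s]
    have E0: "(\<lambda>k. E (sqrt (\<beta>\<^sup>2 + lam\<^sup>2 / s k)) (s k) - E \<beta> (s k)) \<longlonglongrightarrow> 0" by (simp add: o_def)
    have Fc: "continuous_on rost_matrices F"
      using F by (auto simp: block_test_def intro: continuous_on_subset)
    have "\<bar>?A - ?Y\<bar> \<le> \<epsilon>" if \<epsilon>: "0 < \<epsilon>" for \<epsilon> :: real
    proof -
      \<comment> \<open>The parameters depend on \<epsilon>, \<open>n\<close> and \<open>lam\<close>
        but not on the volume, so one continuous function \<open>?g\<close> serves all volumes and
        the limit.\<close>
      obtain d c t B m p \<delta> \<eta> where
        T: "\<And>x. Im (trig_poly d c t x) = 0" "\<And>x. 0 \<le> Re (trig_poly d c t x)" "\<And>x. Re (trig_poly d c t x) \<le> B"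
        and \<delta>: "0 < \<delta>" and p: "\<And>z. 0 \<le> z \<Longrightarrow> z \<le> B \<Longrightarrow> \<bar>(\<Sum>k\<le>m. p k * z ^ k) - 1 / max z \<delta> ^ n\<bar> \<le> \<eta>"
        and err: "(2 * real n + 2) / \<delta> * (\<integral>x. \<bar>Re (trig_poly d c t x) - gauss_weight lam x\<bar> \<partial>std_normal_distribution)
           + 4 * \<delta> * exp (lam\<^sup>2) + B ^ n * \<eta> \<le> \<epsilon> / 2"
        by (rule cavity_parameters[of "\<epsilon> / 2" "exp (lam\<^sup>2)" n lam, OF half_gt_zero[OF \<epsilon>] exp_gt_zero]) (rule that)
      let ?g = "cavity_test F n m p d c t"
      let ?X = "\<integral>q. ?g q \<partial>P"
      have AX: "\<bar>?A - ?X\<bar> \<le> \<epsilon> / 2"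
        using cavity_sampled_approx[OF e D F T \<delta> p, where lam = lam] err by (simp add: DP)
      \<comment> \<open>The first two terms add up to the average at the shifted temperature, the
        form in which \<open>spin_cavity_approx\<close> bounds the difference.\<close>
      have "(\<lambda>k. (\<integral>q. F q \<partial>?Q (s k)) + (E (sqrt (\<beta>\<^sup>2 + lam\<^sup>2 / s k)) (s k) - E \<beta> (s k)) - (\<integral>q. ?g q \<partial>?Q (s k)))
          \<longlonglongrightarrow> ?Y + 0 - ?X"
        using limitin_rost_topology(2)[OF lim Fc] limitin_rost_topology(2)[OF lim continuous_cavity_test[OF F]]
        by (intro tendsto_diff tendsto_add E0) (simp_all add: o_def)
      then have "(\<lambda>k. \<bar>(\<integral>q. F q \<partial>?Q (s k)) + (E (sqrt (\<beta>\<^sup>2 + lam\<^sup>2 / s k)) (s k) - E \<beta> (s k)) - (\<integral>q. ?g q \<partial>?Q (s k))\<bar>)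
          \<longlonglongrightarrow> \<bar>?Y + 0 - ?X\<bar>" by (rule tendsto_rabs)
      moreover have "\<forall>\<^sub>F k in sequentially.
          \<bar>(\<integral>q. F q \<partial>?Q (s k)) + (E (sqrt (\<beta>\<^sup>2 + lam\<^sup>2 / s k)) (s k) - E \<beta> (s k)) - (\<integral>q. ?g q \<partial>?Q (s k))\<bar> \<le> \<epsilon> / 2"
        using s1
      proof eventually_elim
        case (elim k)
        interpret spin_glass_volume "M (s k)" "spin_configs (s k)" "r (s k)" "H (s k)" "s k"
          by (rule gaussian_spin_glass_volume[OF G elim])
        obtain K where K: "\<And>q. q \<in> rost_matrices \<Longrightarrow> \<bar>?g q\<bar> \<le> K" using cavity_test_bounded[OF F] by blast
        have F1: "\<bar>F q\<bar> \<le> 1" for q using F by (simp add: block_test_def)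
        have "(\<integral>q. F q \<partial>?Q (s k)) = E \<beta> (s k)"
          unfolding spin_glass_rost_law_eq E_def gibbs_overlap_def
          by (rule integral_replica_matrix_law[OF block_test_rost_measurable[OF F] F1])
        moreover have "(\<integral>q. ?g q \<partial>?Q (s k)) = (\<integral>\<omega>. \<integral>v. ?g (replica_overlap (r (s k)) v)
            \<partial>(\<Pi>\<^sub>M i\<in>UNIV. finite_gibbs (spin_configs (s k)) (\<lambda>a. \<beta> * H (s k) a \<omega>)) \<partial>M (s k))"
          unfolding spin_glass_rost_law_eq by (rule integral_replica_matrix_law[OF cavity_test_measurable[OF F] K])
        ultimately show ?case
          using spin_cavity_approx[OF F T \<delta> p, where \<beta> = \<beta> and lam = lam] err
          unfolding E_def expectation_gibbs_overlap_shift[OF F \<beta> lam] by simp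
      qed
      ultimately have "\<bar>?Y + 0 - ?X\<bar> \<le> \<epsilon> / 2"
        by (intro tendsto_upperbound[where F = sequentially]) auto
      with AX show ?thesis by linarith
    qed
    from dense_eq0_I[OF this] show "?A = ?Y" by simp
  qed
  finally show "cavity_map lam e P = P" .
qed

end
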